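(* Let $n\ge 4$. The $\mathbb{Z}[\delta]$-algebra homomorphism $\phi:\widehat{TL}(D_n)\to\mathbb{D}\widehat{TL}(D_n)$ determined by $\phi(\hat b_i)=\hat d_i$ for $i\in\{\overline{1},1,\dots,n-1\}$ is an isomorphism. Moreover, $\phi$ maps the monomial basis $\{\hat b_w : w\in FC(D_n),\ H(w)\text{ is of type II}\}$ of $\widehat{TL}(D_n)$ bijectively onto the set of images in $\mathbb{D}\widehat{TL}(D_n)$ of the $D$-admissible diagrams of type II.
   Context: **Coxeter group and heaps.** $W(D_n)$ is the Coxeter group with generators $s_{\overline{1}},s_1,\dots,s_{n-1}$ whose Coxeter graph has edges joining $s_{\overline 1}$ to $s_2$ and $s_i$ to $s_{i+1}$ for $1\le i\le n-2$ (connected generators have product of order $3$, distinct non-connected ones commute). $FC(D_n)$ is the set of fully commutative elements: those $w$ any two of whose reduced expressions are related by commutations of commuting generators. For $w\in FC(D_n)$, $H(w)$ denotes its heap: for any reduced expression $s_{x_1}\cdots s_{x_k}$ of $w$, the labeled poset on $\{1,\dots,k\}$, with $i$ labeled $s_{x_i}$, obtained as the transitive closure of $j\lessdot i$ whenever $i<j$ and $s_{x_i},s_{x_j}$ do not commute or are equal (independent of the expression up to labeled isomorphism). $H(w)$ is of type I if some reduced expression for $w$ contains $s_{\overline 1}s_1$ as a consecutive subword, and of type II otherwise. **Algebraic side.** $TL(D_n)$ is the unital $\mathbb{Z}[\delta]$-algebra generated by $b_{\overline{1}},b_1,\dots,b_{n-1}$ with relations $b_i^2=\delta b_i$; $b_ib_j=b_jb_i$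 if $s_i\ne s_j$ are not connected in the Coxeter graph; $b_ib_jb_i=b_i$ if $s_i,s_j$ are connected. For $w\in FC(D_n)$ with reduced expression $s_{x_1}\cdots s_{x_k}$, $b_w=b_{x_1}\cdots b_{x_k}$. $\widehat{TL}(D_n)$ is the quotient of $TL(D_n)$ by the additional relation $b_1b_{\overline 1}=0$; $\hat b_i,\hat b_w$ are the images of $b_i,b_w$. **Diagrams.** The standard $n$-box is a rectangle with nodes $1,\dots,n$ (left to right) on the north face and $1',\dots,n'$ on the south face. A concrete pseudo $n$-diagram is a finite collection of disjoint planar curves (edges) in the box such that every node is the endpoint of exactly one edge, and all other edges are closed curves (loops) disjoint from the box. Propagating edges join a north node to a south node; $\mathbf{a}(d)$ is the number of non-propagating edges in the north face. Edges may carry finitely many decorations $\bullet$ (decorations adjacent along an edge may be conjoined into one block), subject to: if $\mathbf{a}(d)=0$ then all edges are undecorated; and all decorated edges can be simultaneously deformed so as to take the decorations to the left wall of the box without crossing any other edges. Such diagrams up to isotopy (through diagrams of the same kind) are L-decorated pseudo $n$-diagrams and form a basis of the $\mathbb{Z}[\delta]$-algebra $\mathcal{P}_n^L(\bullet)$, where $d'd$ is obtained by stacking $d'$ on top of $d$. $\widehat{\mathcal{P}}_n^L(\bullet)$ is the quotient by the local relations: an undecorated loop is replaced by the factor $\delta$; two adjacent decorations on an edge cancel; a decorated edge loses its decoration in the presence of a (different) loop carrying one decoration. For $1\le i\le n-1$, $d_i$ is the undecorated diagram with edges $\{i,i+1\}$, $\{i',(i+1)'\}$ and vertical edges $\{j,j'\}$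 for $j\neq i,i+1$; $d_{\overline{1}}$ is $d_1$ with one decoration on each of its two non-propagating edges. $\mathbb{D}TL(D_n)$ is the unital $\mathbb{Z}[\delta]$-subalgebra of $\widehat{\mathcal{P}}_n^L(\bullet)$ generated by $d_{\overline{1}},d_1,\dots,d_{n-1}$, and $\mathbb{D}\widehat{TL}(D_n)$ is its quotient by the additional relation that a decorated loop equals $0$ (any diagram containing a decorated loop is $0$); $\hat d_i$ is the image of $d_i$. A $D$-admissible diagram of type II is an L-decorated diagram to which none of the relations of $\widehat{\mathcal{P}}_n^L(\bullet)$ apply, containing no loops and having an even total number of decorations; these lie in $\mathbb{D}TL(D_n)$. *)

theory Defs
  imports
    "HOL-Computational_Algebra.Polynomial"
    "HOL-Library.Poly_Mapping"
    "HOL-Library.Multiset"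
    "HOL-Library.Sublist"
    "HOL-Algebra.QuotRing"
    "HOL-Algebra.Subrings"
    "HOL-Algebra.Module"
begin

section \<open>Algebras over \<open>\<int>[\<delta>]\<close>\<close>

text \<open>
  The ring \<open>\<int>[\<delta>]\<close> is the type \<^typ>\<open>int poly\<close>. A (not necessarily commutative) unital algebra over it
  is a record of type \<open>(int poly, 'a) module\<close>, which carries both the ring operations and
  the scalar multiplication.
\<close>

type_synonym 'a zd_algebra = "(int poly, 'a) module"

abbreviation delta :: "int poly" where
  "delta \<equiv> [:0, 1:]"

definition monoid_algebra :: "('a, 'm) monoid_scheme \<Rightarrow> ('a \<Rightarrow>\<^sub>0 int poly) zd_algebra" where
  "monoid_algebra M =
    \<lparr>carrier = {f. Poly_Mapping.keys f \<subseteq> carrier M},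
     mult = (\<lambda>f g. \<Sum>x\<in>Poly_Mapping.keys f. \<Sum>y\<in>Poly_Mapping.keys g.
               Poly_Mapping.single (x \<otimes>\<^bsub>M\<^esub> y) (Poly_Mapping.lookup f x * Poly_Mapping.lookup g y)),
     one = Poly_Mapping.single \<one>\<^bsub>M\<^esub> 1,
     zero = 0,
     add = (+),
     smult = (\<lambda>c f. Poly_Mapping.map ((*) c) f)\<rparr>"

text \<open>
  \<open>quotient_algebra A S\<close> is the quotient of \<open>A\<close> by the two-sided ideal generated by \<open>S\<close>, and
  \<open>quotient_map A S\<close> the canonical projection. As \<open>A\<close> is unital, this ideal is automatically
  closed under scalar multiplication.
\<close>

definition quotient_map :: "'a zd_algebra \<Rightarrow> 'a set \<Rightarrow> 'a \<Rightarrow> 'a set" where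
  "quotient_map A S x = (Idl\<^bsub>A\<^esub> S) +>\<^bsub>A\<^esub> x"

definition quotient_algebra :: "'a zd_algebra \<Rightarrow> 'a set \<Rightarrow> 'a set zd_algebra" where
  "quotient_algebra A S =
    ring.extend (A Quot (Idl\<^bsub>A\<^esub> S))
      (module.fields (\<lambda>c X. \<Union>x\<in>X. quotient_map A S (c \<odot>\<^bsub>A\<^esub> x)))"

definition generated_subalgebra :: "'a zd_algebra \<Rightarrow> 'a set \<Rightarrow> 'a zd_algebra" where
  "generated_subalgebra A S =
    A\<lparr>carrier := \<Inter>{B. subring B A \<and> (\<forall>c. \<forall>x\<in>B. c \<odot>\<^bsub>A\<^esub> x \<in> B) \<and> S \<subseteq> B}\<rparr>"

definition alg_hom :: "'a zd_algebra \<Rightarrow> 'b zd_algebra \<Rightarrow> ('a \<Rightarrow> 'b) set" where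
  "alg_hom A B =
    {\<phi> \<in> ring_hom A B. \<forall>c. \<forall>x\<in>carrier A. \<phi> (c \<odot>\<^bsub>A\<^esub> x) = c \<odot>\<^bsub>B\<^esub> \<phi> x}"

definition alg_iso :: "'a zd_algebra \<Rightarrow> 'b zd_algebra \<Rightarrow> ('a \<Rightarrow> 'b) set" where
  "alg_iso A B = {\<phi> \<in> alg_hom A B. bij_betw \<phi> (carrier A) (carrier B)}"

definition is_basis :: "'a zd_algebra \<Rightarrow> 'a set \<Rightarrow> bool" where
  "is_basis A B \<longleftrightarrow> B \<subseteq> carrier A \<and>
    (\<forall>x\<in>carrier A. \<exists>!c :: 'a \<Rightarrow>\<^sub>0 int poly.
       Poly_Mapping.keys c \<subseteq> B \<and> x = (\<Oplus>\<^bsub>A\<^esub>b\<in>Poly_Mapping.keys c. Poly_Mapping.lookup c b \<odot>\<^bsub>A\<^esub> b))"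


section \<open>The Coxeter group of type \<open>D\<^sub>n\<close> and its fully commutative elements\<close>

text \<open>\<^term>\<open>Bar1\<close> is the index of the extra generator attached to the generator with index 2.\<close>

datatype gen = Bar1 | Gen nat

definition gens :: "nat \<Rightarrow> gen set" where
  "gens n = insert Bar1 (Gen ` {1..n-1})"

fun connected_gens :: "gen \<Rightarrow> gen \<Rightarrow> bool" where
  "connected_gens (Gen i) (Gen j) \<longleftrightarrow> j = Suc i \<or> i = Suc j"
| "connected_gens Bar1 (Gen j) \<longleftrightarrow> j = 2"
| "connected_gens (Gen i) Bar1 \<longleftrightarrow> i = 2"
| "connected_gens Bar1 Bar1 \<longleftrightarrow> False"

definition cox_m :: "gen \<Rightarrow> gen \<Rightarrow> nat" where
  "cox_m s t = (if s = t then 1 else if connected_gens s t then 3 else 2)"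

text \<open>
  Words over the generators modulo the relations \<open>(s t)^m(s,t) = 1\<close>. Since \<open>m(s,s) = 1\<close> makes
  every generator an involution, the monoid with this presentation is already the Coxeter group.
  An element of the group is an equivalence class of words.
\<close>

inductive cox_eq :: "nat \<Rightarrow> gen list \<Rightarrow> gen list \<Rightarrow> bool" for n where
  relator: "\<lbrakk>s \<in> gens n; t \<in> gens n; us \<in> lists (gens n); vs \<in> lists (gens n)\<rbrakk>
     \<Longrightarrow> cox_eq n (us @ concat (replicate (cox_m s t) [s, t]) @ vs) (us @ vs)"
| refl: "xs \<in> lists (gens n) \<Longrightarrow> cox_eq n xs xs"
| sym: "cox_eq n xs ys \<Longrightarrow> cox_eq n ys xs"
| trans: "\<lbrakk>cox_eq n xs ys; cox_eq n ys zs\<rbrakk> \<Longrightarrow> cox_eq n xs zs"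

definition W_D :: "nat \<Rightarrow> gen list set set" where
  "W_D n = lists (gens n) // {(xs, ys). cox_eq n xs ys}"

definition reduced_expr :: "gen list set \<Rightarrow> gen list \<Rightarrow> bool" where
  "reduced_expr w xs \<longleftrightarrow> xs \<in> w \<and> (\<forall>ys\<in>w. length xs \<le> length ys)"

inductive commutation :: "gen list \<Rightarrow> gen list \<Rightarrow> bool" where
  "\<lbrakk>s \<noteq> t; \<not> connected_gens s t\<rbrakk> \<Longrightarrow> commutation (us @ [s, t] @ vs) (us @ [t, s] @ vs)"

definition FC :: "nat \<Rightarrow> gen list set set" where
  "FC n = {w \<in> W_D n. \<forall>xs ys. reduced_expr w xs \<and> reduced_expr w ys \<longrightarrow> commutation\<^sup>*\<^sup>* xs ys}"

text \<open>The type of the heap of \<open>w\<close>.\<close>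

definition heap_type_I :: "gen list set \<Rightarrow> bool" where
  "heap_type_I w \<longleftrightarrow> (\<exists>xs. reduced_expr w xs \<and> sublist [Bar1, Gen 1] xs)"

abbreviation heap_type_II :: "gen list set \<Rightarrow> bool" where
  "heap_type_II w \<equiv> \<not> heap_type_I w"


section \<open>The Temperley--Lieb algebra of type \<open>D\<^sub>n\<close> and its quotient\<close>

definition free_monoid :: "nat \<Rightarrow> gen list monoid" where
  "free_monoid n = \<lparr>carrier = lists (gens n), mult = (@), one = []\<rparr>"

abbreviation free_algebra :: "nat \<Rightarrow> (gen list \<Rightarrow>\<^sub>0 int poly) zd_algebra" where
  "free_algebra n \<equiv> monoid_algebra (free_monoid n)"

abbreviation monom_word :: "int poly \<Rightarrow> gen list \<Rightarrow> gen list \<Rightarrow>\<^sub>0 int poly" where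
  "monom_word c xs \<equiv> Poly_Mapping.single xs c"

definition TL_relators :: "nat \<Rightarrow> (gen list \<Rightarrow>\<^sub>0 int poly) set" where
  "TL_relators n =
     {monom_word 1 [s, s] - monom_word delta [s] | s. s \<in> gens n}
   \<union> {monom_word 1 [s, t] - monom_word 1 [t, s] | s t.
        s \<in> gens n \<and> t \<in> gens n \<and> s \<noteq> t \<and> \<not> connected_gens s t}
   \<union> {monom_word 1 [s, t, s] - monom_word 1 [s] | s t.
        s \<in> gens n \<and> t \<in> gens n \<and> connected_gens s t}"

definition TL :: "nat \<Rightarrow> (gen list \<Rightarrow>\<^sub>0 int poly) set zd_algebra" where
  "TL n = quotient_algebra (free_algebra n) (TL_relators n)"

definition b_gen :: "nat \<Rightarrow> gen \<Rightarrow> (gen list \<Rightarrow>\<^sub>0 int poly) set" where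
  "b_gen n s = quotient_map (free_algebra n) (TL_relators n) (monom_word 1 [s])"

text \<open>For fully commutative \<open>w\<close> the value of \<open>b_elem n w\<close> does not depend on the chosen
  reduced expression.\<close>

definition b_elem :: "nat \<Rightarrow> gen list set \<Rightarrow> (gen list \<Rightarrow>\<^sub>0 int poly) set" where
  "b_elem n w = foldr (\<lambda>s x. b_gen n s \<otimes>\<^bsub>TL n\<^esub> x) (SOME xs. reduced_expr w xs) \<one>\<^bsub>TL n\<^esub>"

definition TL_hat :: "nat \<Rightarrow> (gen list \<Rightarrow>\<^sub>0 int poly) set set zd_algebra" where
  "TL_hat n = quotient_algebra (TL n) {b_gen n (Gen 1) \<otimes>\<^bsub>TL n\<^esub> b_gen n Bar1}"

definition TL_proj :: "nat \<Rightarrow> (gen list \<Rightarrow>\<^sub>0 int poly) set \<Rightarrow> (gen list \<Rightarrow>\<^sub>0 int poly) set set" where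
  "TL_proj n = quotient_map (TL n) {b_gen n (Gen 1) \<otimes>\<^bsub>TL n\<^esub> b_gen n Bar1}"

definition b_hat :: "nat \<Rightarrow> gen \<Rightarrow> (gen list \<Rightarrow>\<^sub>0 int poly) set set" where
  "b_hat n s = TL_proj n (b_gen n s)"

definition b_hat_elem :: "nat \<Rightarrow> gen list set \<Rightarrow> (gen list \<Rightarrow>\<^sub>0 int poly) set set" where
  "b_hat_elem n w = TL_proj n (b_elem n w)"

definition monomial_basis_II :: "nat \<Rightarrow> (gen list \<Rightarrow>\<^sub>0 int poly) set set set" where
  "monomial_basis_II n = {b_hat_elem n w | w. w \<in> FC n \<and> heap_type_II w}"


section \<open>L-decorated pseudo diagrams\<close>

text \<open>
  \<open>North i\<close> and \<open>South i\<close> are the nodes \<open>i\<close> and \<open>i'\<close> of the box. An isotopy class of diagrams is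
  recorded by the set of its non-loop edges (each given by its two end points), the number of
  decorations on each of these edges (0 on everything else, so that equal diagrams are
  equal records), and the multiset of the numbers of decorations on its loops.

  The position of the loops is not recorded. A decorated loop has to reach the left wall, so it
  can only lie in the face adjacent to that wall; and the position of undecorated loops
  is lost once they are replaced by the factor \<open>\<delta>\<close>.
\<close>

datatype node = North nat | South nat

record diagram =
  edges :: "node set set"
  dec :: "node set \<Rightarrow> nat"
  loops :: "nat multiset"

definition nodes :: "nat \<Rightarrow> node set" where
  "nodes n = North ` {1..n} \<union> South ` {1..n}"

text \<open>The order in which the nodes are met on the boundary of the box, clockwise from the
  left wall.\<close>

fun pos :: "nat \<Rightarrow> node \<Rightarrow> nat" where
  "pos n (North i) = i"
| "pos n (South i) = 2 * n + 1 - i"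

definition perfect_matching :: "nat \<Rightarrow> node set set \<Rightarrow> bool" where
  "perfect_matching n E \<longleftrightarrow>
    (\<forall>e\<in>E. e \<subseteq> nodes n \<and> card e = 2) \<and> (\<forall>x\<in>nodes n. \<exists>!e. e \<in> E \<and> x \<in> e)"

text \<open>Disjoint planar curves realising a matching exist iff no two edges interlace on the
  boundary, and they are then unique up to isotopy.\<close>

definition planar :: "nat \<Rightarrow> node set set \<Rightarrow> bool" where
  "planar n E \<longleftrightarrow>
    \<not> (\<exists>x y z t. {x, z} \<in> E \<and> {y, t} \<in> E \<and>
         pos n x < pos n y \<and> pos n y < pos n z \<and> pos n z < pos n t)"

text \<open>An edge can be deformed to the left wall without crossing other edges iff no other edge
  separates it from that wall, that is, encloses it in the order \<^const>\<open>pos\<close>. All such edges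
  border the same face, so they can be deformed simultaneously.\<close>

definition left_exposed :: "nat \<Rightarrow> node set set \<Rightarrow> node set \<Rightarrow> bool" where
  "left_exposed n E e \<longleftrightarrow>
    \<not> (\<exists>x y. {x, y} \<in> E \<and> (\<forall>z\<in>e. pos n x < pos n z \<and> pos n z < pos n y))"

text \<open>The number \<open>a(d)\<close> of non-propagating edges in the north face.\<close>

definition num_caps :: "diagram \<Rightarrow> nat" where
  "num_caps d = card {e \<in> edges d. e \<subseteq> range North}"

definition diagrams :: "nat \<Rightarrow> diagram set" where
  "diagrams n = {d.
     perfect_matching n (edges d) \<and> planar n (edges d) \<and>
     (\<forall>e. e \<notin> edges d \<longrightarrow> dec d e = 0) \<and>
     (\<forall>e\<in>edges d. dec d e > 0 \<longrightarrow> left_exposed n (edges d) e) \<and>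
     (num_caps d = 0 \<longrightarrow> (\<forall>e\<in>edges d. dec d e = 0) \<and> (\<forall>k\<in>#loops d. k = 0))}"


subsection \<open>Stacking\<close>

text \<open>
  In \<open>stack n d' d\<close> the diagram \<open>d'\<close> is placed on top of \<open>d\<close>. The nodes of the stacked picture
  are the north nodes of \<open>d'\<close> (\<open>Top\<close>), the south nodes of \<open>d'\<close> identified with the north nodes
  of \<open>d\<close> (\<open>Mid\<close>), and the south nodes of \<open>d\<close> (\<open>Bot\<close>). Its connected components are the edges of the
  product, or new loops if they only contain middle nodes; the decorations along each component
  are added up.
\<close>

datatype stack_node = Top nat | Mid nat | Bot nat

fun upper :: "node \<Rightarrow> stack_node" where
  "upper (North i) = Top i"
| "upper (South i) = Mid i"

fun lower :: "node \<Rightarrow> stack_node" where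
  "lower (North i) = Mid i"
| "lower (South i) = Bot i"

fun outer :: "node \<Rightarrow> stack_node" where
  "outer (North i) = Top i"
| "outer (South i) = Bot i"

definition stack_adj :: "diagram \<Rightarrow> diagram \<Rightarrow> (stack_node \<times> stack_node) set" where
  "stack_adj d' d =
     {(upper x, upper y) | x y. {x, y} \<in> edges d'} \<union> {(lower x, lower y) | x y. {x, y} \<in> edges d}"

definition stack_components :: "nat \<Rightarrow> diagram \<Rightarrow> diagram \<Rightarrow> stack_node set set" where
  "stack_components n d' d =
     (\<lambda>v. (stack_adj d' d)\<^sup>* `` {v}) ` (upper ` nodes n \<union> lower ` nodes n)"

definition component_dec :: "diagram \<Rightarrow> diagram \<Rightarrow> stack_node set \<Rightarrow> nat" where
  "component_dec d' d C =
     (\<Sum>e\<in>{e \<in> edges d'. upper ` e \<subseteq> C}. dec d' e) + (\<Sum>e\<in>{e \<in> edges d. lower ` e \<subseteq> C}. dec d e)"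

definition stack :: "nat \<Rightarrow> diagram \<Rightarrow> diagram \<Rightarrow> diagram" where
  "stack n d' d =
    (let comps = stack_components n d' d;
         E = {outer -` C | C. C \<in> comps \<and> outer -` C \<noteq> {}}
     in \<lparr>edges = E,
         dec = (\<lambda>e. if e \<in> E then component_dec d' d ((stack_adj d' d)\<^sup>* `` (outer ` e)) else 0),
         loops = loops d' + loops d +
           image_mset (component_dec d' d) (mset_set {C \<in> comps. outer -` C = {}})\<rparr>)"

definition id_diagram :: "nat \<Rightarrow> diagram" where
  "id_diagram n = \<lparr>edges = {{North j, South j} | j. j \<in> {1..n}}, dec = (\<lambda>_. 0), loops = {#}\<rparr>"

definition diagram_monoid :: "nat \<Rightarrow> diagram monoid" where
  "diagram_monoid n = \<lparr>carrier = diagrams n, mult = stack n, one = id_diagram n\<rparr>"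

definition PL :: "nat \<Rightarrow> (diagram \<Rightarrow>\<^sub>0 int poly) zd_algebra" where
  "PL n = monoid_algebra (diagram_monoid n)"


subsection \<open>The local relations\<close>

text \<open>\<open>local_rel d c d'\<close>: one of the local relations replaces the diagram \<open>d\<close> by \<open>c\<close> times \<open>d'\<close>.\<close>

inductive local_rel :: "diagram \<Rightarrow> int poly \<Rightarrow> diagram \<Rightarrow> bool" where
  undecorated_loop:
    "loops d = add_mset 0 L \<Longrightarrow> local_rel d delta (d\<lparr>loops := L\<rparr>)"
| cancel_edge:
    "\<lbrakk>e \<in> edges d; dec d e = k + 2\<rbrakk> \<Longrightarrow> local_rel d 1 (d\<lparr>dec := (dec d)(e := k)\<rparr>)"
| cancel_loop:
    "loops d = add_mset (k + 2) L \<Longrightarrow> local_rel d 1 (d\<lparr>loops := add_mset k L\<rparr>)"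
| absorb_edge:
    "\<lbrakk>1 \<in># loops d; e \<in> edges d; dec d e = k + 1\<rbrakk> \<Longrightarrow> local_rel d 1 (d\<lparr>dec := (dec d)(e := k)\<rparr>)"
| absorb_loop:
    "loops d = add_mset 1 (add_mset (k + 1) L) \<Longrightarrow>
       local_rel d 1 (d\<lparr>loops := add_mset 1 (add_mset k L)\<rparr>)"

definition P_relators :: "nat \<Rightarrow> (diagram \<Rightarrow>\<^sub>0 int poly) set" where
  "P_relators n = {Poly_Mapping.single d 1 - Poly_Mapping.single d' c | d c d'.
                     d \<in> diagrams n \<and> local_rel d c d'}"

definition P_hat :: "nat \<Rightarrow> (diagram \<Rightarrow>\<^sub>0 int poly) set zd_algebra" where
  "P_hat n = quotient_algebra (PL n) (P_relators n)"

definition diag_class :: "nat \<Rightarrow> diagram \<Rightarrow> (diagram \<Rightarrow>\<^sub>0 int poly) set" where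
  "diag_class n d = quotient_map (PL n) (P_relators n) (Poly_Mapping.single d 1)"


section \<open>The diagram algebras of type \<open>D\<^sub>n\<close>\<close>

definition simple_edges :: "nat \<Rightarrow> nat \<Rightarrow> node set set" where
  "simple_edges n i =
     {{North i, North (i + 1)}, {South i, South (i + 1)}} \<union>
     {{North j, South j} | j. j \<in> {1..n} - {i, i + 1}}"

fun simple_diagram :: "nat \<Rightarrow> gen \<Rightarrow> diagram" where
  "simple_diagram n (Gen i) = \<lparr>edges = simple_edges n i, dec = (\<lambda>_. 0), loops = {#}\<rparr>"
| "simple_diagram n Bar1 =
     \<lparr>edges = simple_edges n 1,
      dec = (\<lambda>e. if e \<in> {{North 1, North 2}, {South 1, South 2}} then 1 else 0),
      loops = {#}\<rparr>"

definition DTL :: "nat \<Rightarrow> (diagram \<Rightarrow>\<^sub>0 int poly) set zd_algebra" where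
  "DTL n = generated_subalgebra (P_hat n) ((\<lambda>s. diag_class n (simple_diagram n s)) ` gens n)"

definition decorated_loop_classes :: "nat \<Rightarrow> (diagram \<Rightarrow>\<^sub>0 int poly) set set" where
  "decorated_loop_classes n =
     {diag_class n d | d. d \<in> diagrams n \<and> 1 \<in># loops d \<and> diag_class n d \<in> carrier (DTL n)}"

definition DTL_hat :: "nat \<Rightarrow> (diagram \<Rightarrow>\<^sub>0 int poly) set set zd_algebra" where
  "DTL_hat n = quotient_algebra (DTL n) (decorated_loop_classes n)"

definition diag_hat :: "nat \<Rightarrow> diagram \<Rightarrow> (diagram \<Rightarrow>\<^sub>0 int poly) set set" where
  "diag_hat n d = quotient_map (DTL n) (decorated_loop_classes n) (diag_class n d)"

definition d_hat :: "nat \<Rightarrow> gen \<Rightarrow> (diagram \<Rightarrow>\<^sub>0 int poly) set set" where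
  "d_hat n s = diag_hat n (simple_diagram n s)"

definition admissible_II :: "nat \<Rightarrow> diagram set" where
  "admissible_II n =
     {d \<in> diagrams n. (\<nexists>c d'. local_rel d c d') \<and> loops d = {#} \<and> even (\<Sum>e\<in>edges d. dec d e)}"

end

theory Submission imports Defs begin

text \<open>
  Stacking \<open>d\<^sub>i\<close> on top of a diagram joins the edges at the north nodes \<open>i\<close>, \<open>i + 1\<close> and adds a new edge
  \<open>{i, i + 1}\<close> (\<open>hook i\<close>); stacking the extra generator is \<open>dot \<circ> hook 1 \<circ> dot\<close>, where \<open>dot\<close> puts
  a decoration on the edge at the north node 1. A word in the generators thus has a diagram. The value of a
  diagram is 0 if some loop has odd decoration, and otherwise \<open>\<delta>\<close> to the number of loops times the
  loop-free diagram with all decorations reduced modulo 2. The value respects all relations on both sides.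

  Call a word good if no word obtained from it by commutations has a factor \<open>ss\<close>, \<open>sts\<close> with \<open>s\<close>, \<open>t\<close>
  connected, or a factor consisting of the two letters of column 1. Modulo the relations of the
  Temperley--Lieb quotient every word is 0 or \<open>\<delta>\<^sup>k\<close> times a good word. The diagram of a good word is
  admissible, and it determines the word up to commutations: for each \<open>k\<close> the first letter of the word
  in the columns \<open>k - 1\<close>, \<open>k\<close> tells whether the edge at the north node \<open>k\<close> goes left, right or
  straight down, so a letter that can be moved to the front can be recognised from the diagram.
  Hence the value separates the classes of good words, and the kernels of the maps from the free algebra
  to the two quotients both agree with the kernel of the value.

  A loop-free planar diagram is a product of hooks and dots, which gives surjectivity onto the admissible
  diagrams. That the good words are the reduced words of the fully commutative elements of type II is seen at
  \<open>\<delta> = 2\<close>, where \<open>s \<mapsto> b\<^sub>s - 1\<close> represents the Coxeter group: the diagram of a good word occurs in the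
  product of the \<open>b\<^sub>s - 1\<close> with coefficient 1, and it can only come from words of at least that length.
\<close>

section \<open>Diagrams as decorated matchings\<close>

text \<open>Stacking two arbitrary planar pictures is never analysed. Stacking commutes with
  \<open>hook\<close> and \<open>dot\<close> in its upper argument, and every loop-free diagram is
  built from the identity by these two, so closure, associativity and the units of stacking follow
  by induction on the upper factor. The real geometric effort is to take a diagram apart
  (\<open>unhook\<close>). The intermediate diagrams force a class larger than
  \<open>diagrams\<close>: \<open>dot\<close> of the identity is decorated but has no cap. Pushing
  \<open>dot\<close> through a generator exchanges the two letters of column 1, so all dots of a
  factorisation can be collected at the identity, where an even number of them cancels. This is
  where the parity condition on admissible diagrams enters. The value \<delta> = 2 comes from (b_s -
  1)^2 = 1 + (\<delta> - 2) b_s; the two sides of the braid relation for the b_s - 1 differ by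
  (\<delta> - 2)(b_t - b_s). The two kernels are compared by a cycle: zero in the diagram quotient
  gives value 0, value 0 gives zero in the Temperley--Lieb quotient, and this gives zero in the
  diagram quotient.\<close>

definition edge_at :: "diagram \<Rightarrow> node \<Rightarrow> node set" where
  "edge_at d x = (THE e. e \<in> edges d \<and> x \<in> e)"

definition matching_diagram :: "nat \<Rightarrow> diagram \<Rightarrow> bool" where
  "matching_diagram n d \<longleftrightarrow> perfect_matching n (edges d) \<and> (\<forall>e. e \<notin> edges d \<longrightarrow> dec d e = 0)"

text \<open>When both nodes lie on one edge, that edge is \<open>{North i, North (Suc i)}\<close>
  itself. It closes up to a loop, and since the new cap is the same set of nodes, the edge set stays
  and only the decoration count is reset to 0.\<close>

definition hook :: "nat \<Rightarrow> diagram \<Rightarrow> diagram" where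
  "hook i d =
    (let a = edge_at d (North i); b = edge_at d (North (Suc i));
         c = {North i, North (Suc i)}; r = (a \<union> b) - c
     in if a = b then d\<lparr>dec := (dec d)(a := 0), loops := add_mset (dec d a) (loops d)\<rparr>
        else \<lparr>edges = insert c (insert r (edges d - {a, b})),
              dec = (dec d)(a := 0, b := 0, r := dec d a + dec d b, c := 0),
              loops = loops d\<rparr>)"

text \<open>The edge at the north node 1 borders the left wall in every diagram, so this is a place
  where a decoration may always be added.\<close>

definition dot :: "diagram \<Rightarrow> diagram" where
  "dot d = d\<lparr>dec := (dec d)(edge_at d (North 1) := Suc (dec d (edge_at d (North 1))))\<rparr>"

definition add_loops :: "nat multiset \<Rightarrow> diagram \<Rightarrow> diagram" where
  "add_loops L d = d\<lparr>loops := L + loops d\<rparr>"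

lemma North_in_nodes [simp]: "North i \<in> nodes n \<longleftrightarrow> 1 \<le> i \<and> i \<le> n"
  by (auto simp: nodes_def)

lemma South_in_nodes [simp]: "South i \<in> nodes n \<longleftrightarrow> 1 \<le> i \<and> i \<le> n"
  by (auto simp: nodes_def)

lemma finite_nodes [simp]: "finite (nodes n)"
  by (simp add: nodes_def)

text \<open>Edges become unordered pairs with a functional partner relation, the form in which case
  analyses over explicit doubletons can be carried out.\<close>

lemma perfect_matching_iff:
  "perfect_matching n E \<longleftrightarrow>
    (\<forall>e\<in>E. \<exists>x y. e = {x, y}) \<and>
    (\<forall>x y. {x, y} \<in> E \<longrightarrow> x \<noteq> y \<and> x \<in> nodes n \<and> y \<in> nodes n) \<and>
    (\<forall>x y z. {x, y} \<in> E \<longrightarrow> {x, z} \<in> E \<longrightarrow> y = z) \<and>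
    (\<forall>x\<in>nodes n. \<exists>y. {x, y} \<in> E)" (is "?L \<longleftrightarrow> ?A \<and> ?B \<and> ?C \<and> ?D")
proof
  assume L: ?L
  have L1: "e \<subseteq> nodes n \<and> card e = 2" if "e \<in> E" for e
    using L that unfolding perfect_matching_def by (elim conjE) (erule bspec)
  have A: ?A using L1 unfolding card_2_iff by blast
  have B: ?B
  proof (intro allI impI)
    fix x y assume "{x, y} \<in> E"
    hence "{x, y} \<subseteq> nodes n" "card {x, y} = 2" using L1 by blast+
    thus "x \<noteq> y \<and> x \<in> nodes n \<and> y \<in> nodes n" by (cases "x = y") auto
  qed
  have C: ?C
  proof (intro allI impI)
    fix x y z assume 1: "{x, y} \<in> E" "{x, z} \<in> E"
    hence "x \<in> nodes n" using B by blast
    then have "\<exists>!e. e \<in> E \<and> x \<in> e" using L unfolding perfect_matching_def by blast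
    with 1 have "{x, y} = {x, z}" by blast
    thus "y = z" by (auto simp: doubleton_eq_iff)
  qed
  have D: ?D
  proof
    fix x assume "x \<in> nodes n"
    then obtain e where e: "e \<in> E" "x \<in> e" using L unfolding perfect_matching_def by blast
    then obtain u v where "e = {u, v}" using A by blast
    thus "\<exists>y. {x, y} \<in> E" using e by (auto simp: insert_commute)
  qed
  show "?A \<and> ?B \<and> ?C \<and> ?D" using A B C D by blast
next
  assume R: "?A \<and> ?B \<and> ?C \<and> ?D"
  show ?L unfolding perfect_matching_def
  proof (intro conjI ballI)
    fix e assume e: "e \<in> E"
    then obtain u v where uv: "e = {u, v}" using R by blast
    thus "e \<subseteq> nodes n" "card e = 2" using R e by (auto simp: card_2_iff)
  next
    fix x assume "x \<in> nodes n"
    then obtain y where y: "{x, y} \<in> E" using R by blast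
    show "\<exists>!e. e \<in> E \<and> x \<in> e"
    proof (rule ex1I[of _ "{x, y}"])
      show "{x, y} \<in> E \<and> x \<in> {x, y}" using y by simp
      fix e assume e: "e \<in> E \<and> x \<in> e"
      then obtain z where z: "e = {x, z}" using R by (metis insert_commute insert_iff singletonD)
      hence "y = z" using R y e by blast
      thus "e = {x, y}" using z by simp
    qed
  qed
qed

lemma pm_pair: "perfect_matching n E \<Longrightarrow> e \<in> E \<Longrightarrow> \<exists>x y. e = {x, y}"
  and pm_ends: "perfect_matching n E \<Longrightarrow> {x, y} \<in> E \<Longrightarrow> x \<noteq> y \<and> x \<in> nodes n \<and> y \<in> nodes n"
  and pm_unique: "perfect_matching n E \<Longrightarrow> {x, y} \<in> E \<Longrightarrow> {x, z} \<in> E \<Longrightarrow> y = z"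
  and pm_partner: "perfect_matching n E \<Longrightarrow> x \<in> nodes n \<Longrightarrow> \<exists>y. {x, y} \<in> E"
  unfolding perfect_matching_iff by blast+

lemma pm_disjoint:
  assumes "perfect_matching n E" "e \<in> E" "f \<in> E" "x \<in> e" "x \<in> f"
  shows "e = f"
proof -
  have "x \<in> nodes n" using assms unfolding perfect_matching_def by blast
  thus ?thesis using assms unfolding perfect_matching_def by blast
qed

lemma finite_matching: "perfect_matching n E \<Longrightarrow> finite E"
  by (rule finite_subset[of _ "Pow (nodes n)"]) (auto simp: perfect_matching_def)

lemma matching_diagramD:
  "matching_diagram n d \<Longrightarrow> perfect_matching n (edges d)"
  "matching_diagram n d \<Longrightarrow> e \<notin> edges d \<Longrightarrow> dec d e = 0"
  by (auto simp: matching_diagram_def)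

lemma edge_at_eq:
  assumes "matching_diagram n d" "e \<in> edges d" "x \<in> e"
  shows "edge_at d x = e"
  unfolding edge_at_def
proof (rule the_equality)
  fix f assume "f \<in> edges d \<and> x \<in> f"
  thus "f = e" using pm_disjoint[OF matching_diagramD(1)[OF assms(1)], of f e x] assms by simp
qed (use assms in simp)

lemma edge_at_in:
  assumes "matching_diagram n d" "x \<in> nodes n"
  shows "edge_at d x \<in> edges d" "x \<in> edge_at d x"
proof -
  obtain y where y: "{x, y} \<in> edges d" using pm_partner matching_diagramD assms by blast
  have "edge_at d x = {x, y}" by (rule edge_at_eq[OF assms(1) y]) simp
  with y show "edge_at d x \<in> edges d" "x \<in> edge_at d x" by auto
qed

lemma edge_at_pair:
  assumes "matching_diagram n d" "x \<in> nodes n"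
  obtains y where "edge_at d x = {x, y}" "{x, y} \<in> edges d" "x \<noteq> y" "y \<in> nodes n"
proof -
  obtain y where y: "{x, y} \<in> edges d" using pm_partner matching_diagramD assms by blast
  have "edge_at d x = {x, y}" by (rule edge_at_eq[OF assms(1) y]) simp
  thus ?thesis using that y pm_ends[OF matching_diagramD(1)[OF assms(1)] y] by blast
qed

lemma hook_same:
  assumes m: "matching_diagram n d" and e: "{North i, North (Suc i)} \<in> edges d"
  shows "hook i d = d\<lparr>dec := (dec d)({North i, North (Suc i)} := 0),
      loops := add_mset (dec d {North i, North (Suc i)}) (loops d)\<rparr>"
proof -
  have "edge_at d (North i) = {North i, North (Suc i)}" "edge_at d (North (Suc i)) = {North i, North (Suc i)}"
    using edge_at_eq[OF m e] by auto
  thus ?thesis unfolding hook_def Let_def by simp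
qed

text \<open>The inequalities recorded with the formula say that the two old edges, the joined edge
  and the cap are four different sets, so the function updates on \<open>dec\<close> do not
  interfere.\<close>

lemma hook_diff:
  assumes m: "matching_diagram n d" and a: "{North i, p} \<in> edges d" and b: "{North (Suc i), q} \<in> edges d"
    and ne: "p \<noteq> North (Suc i)"
  shows "hook i d = \<lparr>edges = insert {North i, North (Suc i)} (insert {p, q} (edges d - {{North i, p}, {North (Suc i), q}})),
      dec = (dec d)({North i, p} := 0, {North (Suc i), q} := 0, {p, q} := dec d {North i, p} + dec d {North (Suc i), q}, 
        {North i, North (Suc i)} := 0),
      loops = loops d\<rparr>"
    and "q \<noteq> North i" "p \<noteq> q" "p \<noteq> North i" "q \<noteq> North (Suc i)" "p \<in> nodes n" "q \<in> nodes n"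
    "{p, q} \<notin> edges d" "{North i, North (Suc i)} \<notin> edges d"
proof -
  note pm = matching_diagramD(1)[OF m]
  show q: "q \<noteq> North i" using pm_unique[OF pm] a b ne by (metis insert_commute)
  show pq: "p \<noteq> q" using pm_unique[OF pm, of p "North i" "North (Suc i)"] a b by (auto simp: insert_commute)
  show pi: "p \<noteq> North i" and qi: "q \<noteq> North (Suc i)" and "p \<in> nodes n" "q \<in> nodes n"
    using pm_ends[OF pm] a b by blast+
  show "{p, q} \<notin> edges d" using pm_unique[OF pm, of p "North i" q] a q by (auto simp: insert_commute)
  show "{North i, North (Suc i)} \<notin> edges d" using pm_unique[OF pm] a ne by blast
  have ea: "edge_at d (North i) = {North i, p}" "edge_at d (North (Suc i)) = {North (Suc i), q}"
    using edge_at_eq[OF m a] edge_at_eq[OF m b] by auto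
  have ab: "{North i, p} \<noteq> {North (Suc i), q}" using ne by (auto simp: doubleton_eq_iff)
  have r: "({North i, p} \<union> {North (Suc i), q}) - {North i, North (Suc i)} = {p, q}"
    using ne q pi qi by auto
  show "hook i d = \<lparr>edges = insert {North i, North (Suc i)} (insert {p, q} (edges d - {{North i, p}, {North (Suc i), q}})),
      dec = (dec d)({North i, p} := 0, {North (Suc i), q} := 0, {p, q} := dec d {North i, p} + dec d {North (Suc i), q}, 
        {North i, North (Suc i)} := 0),
      loops = loops d\<rparr>"
    unfolding hook_def Let_def ea r using ab by simp
qed

lemma matching_hook:
  assumes m: "matching_diagram n d" and i: "1 \<le> i" "Suc i \<le> n"
  shows "matching_diagram n (hook i d)"
proof -
  note pm = matching_diagramD(1)[OF m]
  obtain p where p: "{North i, p} \<in> edges d" using pm_partner[OF pm] i by force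
  obtain q where q: "{North (Suc i), q} \<in> edges d" using pm_partner[OF pm] i by force
  show ?thesis
  proof (cases "p = North (Suc i)")
    case True
    thus ?thesis using m p hook_same[OF m] by (auto simp: matching_diagram_def)
  next
    case False
    note h = hook_diff[OF m p q False]
    let ?E = "insert {North i, North (Suc i)} (insert {p, q} (edges d - {{North i, p}, {North (Suc i), q}}))"
    have off: "x \<notin> {North i, North (Suc i), p, q}"
      if "{x, y} \<in> edges d" "{x, y} \<noteq> {North i, p}" "{x, y} \<noteq> {North (Suc i), q}" for x y
    proof
      assume "x \<in> {North i, North (Suc i), p, q}"
      then consider "x \<in> {North i, p}" | "x \<in> {North (Suc i), q}" by blast
      thus False using pm_disjoint[OF pm that(1), of _ x] p q that(2,3) by cases blast+
    qed
    have iff: "{x, y} \<in> ?E \<longleftrightarrow> ({x,y} = {North i, North (Suc i)} \<or> {x,y} = {p,q} \<or>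
       ({x,y} \<in> edges d \<and> x \<notin> {North i, North (Suc i), p, q} \<and> y \<notin> {North i, North (Suc i), p, q}))" for x y
    proof -
      have "{x, y} \<in> edges d - {{North i, p}, {North (Suc i), q}} \<longleftrightarrow>
        {x,y} \<in> edges d \<and> x \<notin> {North i, North (Suc i), p, q} \<and> y \<notin> {North i, North (Suc i), p, q}"
        (is "?X \<longleftrightarrow> ?Y")
      proof
        assume ?X
        moreover have "{y, x} = {x, y}" by blast
        ultimately show ?Y using off[of x y] off[of y x] by simp
      next
        assume ?Y
        thus ?X by (auto simp: doubleton_eq_iff)
      qed
      thus ?thesis by (simp only: insert_iff)
    qed
    have "perfect_matching n ?E" unfolding perfect_matching_iff
    proof (intro conjI ballI allI impI)
      fix e assume "e \<in> ?E" thus "\<exists>x y. e = {x, y}" using pm_pair[OF pm] by blast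
    next
      fix x y assume "{x, y} \<in> ?E"
      then consider "{x,y} = {North i, North (Suc i)}" | "{x,y} = {p, q}" | "{x, y} \<in> edges d" by blast
      then have "x \<noteq> y \<and> x \<in> nodes n \<and> y \<in> nodes n"
        by cases (use h i pm_ends[OF pm] in \<open>auto simp: doubleton_eq_iff\<close>)
      thus "x \<noteq> y" "x \<in> nodes n" "y \<in> nodes n" by auto
    next
      fix x y z assume "{x, y} \<in> ?E" "{x, z} \<in> ?E"
      thus "y = z" unfolding iff using h pm_unique[OF pm, of x y z] False by (auto simp: doubleton_eq_iff)
    next
      fix x assume x: "x \<in> nodes n"
      then obtain y where y: "{x, y} \<in> edges d" using pm_partner[OF pm] by blast
      show "\<exists>y. {x, y} \<in> ?E"
      proof (cases "x \<in> {North i, North (Suc i), p, q}")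
        case True
        thus ?thesis by (auto simp: insert_commute)
      next
        case False
        have yx: "{y, x} \<in> edges d" using y by (simp only: insert_commute)
        have "{y, x} \<noteq> {North i, p}" "{y, x} \<noteq> {North (Suc i), q}" using False by (auto simp: doubleton_eq_iff)
        hence "y \<notin> {North i, North (Suc i), p, q}" using off[OF yx] by simp
        hence "{x, y} \<in> ?E" unfolding iff using False y by simp
        thus ?thesis ..
      qed
    qed
    moreover have "e \<notin> ?E \<Longrightarrow> dec (hook i d) e = 0" for e
      using h matching_diagramD(2)[OF m, of e] by (auto simp: h(1))
    ultimately show ?thesis by (simp add: matching_diagram_def h(1))
  qed
qed

lemma matching_dot: "matching_diagram n d \<Longrightarrow> 1 \<le> n \<Longrightarrow> matching_diagram n (dot d)"
  using edge_at_in(1)[of n d "North 1"] by (auto simp: matching_diagram_def dot_def)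

lemma matching_id: "matching_diagram n (id_diagram n)"
  unfolding matching_diagram_def id_diagram_def perfect_matching_iff
  by (auto simp: doubleton_eq_iff nodes_def)


section \<open>Connected components of a symmetric relation\<close>

definition component :: "('a \<times> 'a) set \<Rightarrow> 'a \<Rightarrow> 'a set" where
  "component R v = R\<^sup>* `` {v}"

lemma component_self [simp]: "v \<in> component R v"
  by (simp add: component_def)

lemma component_iff: "w \<in> component R v \<longleftrightarrow> (v, w) \<in> R\<^sup>*"
  by (simp add: component_def)

lemma component_eq:
  assumes "sym R" "w \<in> component R v"
  shows "component R w = component R v"
  using assms unfolding component_def by (auto intro: rtrancl_trans dest: symD[OF sym_rtrancl])

lemma component_meet:
  assumes "sym R" "x \<in> component R v" "x \<in> component R w"
  shows "component R v = component R w"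
  using component_eq[OF assms(1)] assms by metis

lemma sym_stack_adj: "sym (stack_adj a b)"
  unfolding sym_def stack_adj_def by (auto simp: insert_commute) (metis insert_commute)+

section \<open>Stacking and the action of the generators\<close>

lemma outer_inj [simp]: "outer x = outer y \<longleftrightarrow> x = y"
  by (cases x; cases y) auto

lemma upper_inj [simp]: "upper x = upper y \<longleftrightarrow> x = y"
  by (cases x; cases y) auto

lemma lower_inj [simp]: "lower x = lower y \<longleftrightarrow> x = y"
  by (cases x; cases y) auto

abbreviation stack_nodes :: "nat \<Rightarrow> stack_node set" where
  "stack_nodes n \<equiv> upper ` nodes n \<union> lower ` nodes n"

lemma outer_in_stack_nodes [simp]: "outer x \<in> stack_nodes n \<longleftrightarrow> x \<in> nodes n"
proof
  assume "outer x \<in> stack_nodes n"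
  then obtain y where y: "y \<in> nodes n" "outer x = upper y \<or> outer x = lower y" by auto
  thus "x \<in> nodes n" by (cases x; cases y) auto
next
  assume "x \<in> nodes n"
  moreover have "outer x = upper x \<or> outer x = lower x" by (cases x) auto
  ultimately show "outer x \<in> stack_nodes n" by auto
qed

lemma stack_adj_nodes:
  assumes "matching_diagram n a" "matching_diagram n b" "(v, w) \<in> stack_adj a b"
  shows "w \<in> stack_nodes n"
  using assms(3) pm_ends[OF matching_diagramD(1)[OF assms(1)]] pm_ends[OF matching_diagramD(1)[OF assms(2)]]
  unfolding stack_adj_def by auto

lemma component_stack_nodes:
  assumes "matching_diagram n a" "matching_diagram n b" "v \<in> stack_nodes n"
  shows "component (stack_adj a b) v \<subseteq> stack_nodes n"
proof
  fix w assume "w \<in> component (stack_adj a b) v"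
  hence "(v, w) \<in> (stack_adj a b)\<^sup>*" by (simp add: component_iff)
  thus "w \<in> stack_nodes n" by (induction) (use assms stack_adj_nodes in blast)+
qed

lemma component_comm:
  "sym R \<Longrightarrow> w \<in> component R v \<longleftrightarrow> v \<in> component R w"
  using component_eq[of R v w] component_eq[of R w v] component_self by metis

text \<open>Every component that counts as an edge can be started at one of its outer nodes, so
  edges are indexed by \<open>nodes n\<close> instead of by all nodes of the stacked
  picture.\<close>

lemma edges_stack:
  assumes "matching_diagram n a" "matching_diagram n b"
  shows "edges (stack n a b) = (\<lambda>x. outer -` component (stack_adj a b) (outer x)) ` nodes n"
proof -
  let ?R = "stack_adj a b"
  have "edges (stack n a b) = {outer -` C | C. C \<in> component ?R ` stack_nodes n \<and> outer -` C \<noteq> {}}"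
    by (simp add: stack_def Let_def stack_components_def component_def)
  also have "\<dots> = (\<lambda>x. outer -` component ?R (outer x)) ` nodes n"
  proof (rule Set.set_eqI)
    fix e
    show "e \<in> {outer -` C | C. C \<in> component ?R ` stack_nodes n \<and> outer -` C \<noteq> {}}
       \<longleftrightarrow> e \<in> (\<lambda>x. outer -` component ?R (outer x)) ` nodes n"
    proof
      assume "e \<in> {outer -` C | C. C \<in> component ?R ` stack_nodes n \<and> outer -` C \<noteq> {}}"
      then obtain v x where v: "v \<in> stack_nodes n" "e = outer -` component ?R v" "x \<in> outer -` component ?R v"
        by blast
      hence x: "outer x \<in> component ?R v" by simp
      hence "outer x \<in> stack_nodes n" using component_stack_nodes[OF assms v(1)] by blast
      hence "x \<in> nodes n" by (simp only: outer_in_stack_nodes)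
      moreover have "component ?R (outer x) = component ?R v"
        by (rule component_eq[OF sym_stack_adj x])
      ultimately show "e \<in> (\<lambda>x. outer -` component ?R (outer x)) ` nodes n" using v(2) by auto
    next
      assume "e \<in> (\<lambda>x. outer -` component ?R (outer x)) ` nodes n"
      then obtain x where x: "x \<in> nodes n" "e = outer -` component ?R (outer x)" by blast
      have "x \<in> outer -` component ?R (outer x)" by simp
      hence ne: "outer -` component ?R (outer x) \<noteq> {}" by blast
      have "outer x \<in> stack_nodes n" using x(1) by (simp only: outer_in_stack_nodes)
      thus "e \<in> {outer -` C | C. C \<in> component ?R ` stack_nodes n \<and> outer -` C \<noteq> {}}"
        using x(2) ne by blast
    qed
  qed
  finally show ?thesis .
qed

lemma dec_stack_if:
  "dec (stack n a b) e = (if e \<in> edges (stack n a b) then component_dec a b ((stack_adj a b)\<^sup>* `` (outer ` e)) else 0)"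
  by (simp add: stack_def Let_def)

text \<open>The definition of \<open>stack\<close> recovers a component from the outer nodes in it;
  for a component with an outer node this returns the component itself.\<close>

lemma Image_outer_component:
  "sym R \<Longrightarrow> R\<^sup>* `` (outer ` (outer -` component R (outer x))) = component R (outer x)"
proof -
  assume s: "sym R"
  have "R\<^sup>* `` (outer ` (outer -` component R (outer x))) = (\<Union>y\<in>outer -` component R (outer x). component R (outer y))"
    unfolding component_def by blast
  also have "\<dots> = (\<Union>y\<in>outer -` component R (outer x). component R (outer x))"
    using component_eq[OF s] by auto
  also have "\<dots> = component R (outer x)"
  proof -
    have "x \<in> outer -` component R (outer x)" by simp
    thus ?thesis by blast
  qed
  finally show ?thesis .
qed

lemma dec_stack:
  assumes "matching_diagram n a" "matching_diagram n b" "x \<in> nodes n"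
  shows "dec (stack n a b) (outer -` component (stack_adj a b) (outer x)) = component_dec a b (component (stack_adj a b) (outer x))"
proof -
  have "outer -` component (stack_adj a b) (outer x) \<in> edges (stack n a b)"
    using edges_stack[OF assms(1,2)] assms(3) by blast
  thus ?thesis by (simp only: dec_stack_if Image_outer_component[OF sym_stack_adj] if_True)
qed

lemma dec_stack_0: "e \<notin> edges (stack n a b) \<Longrightarrow> dec (stack n a b) e = 0"
  by (simp only: dec_stack_if if_False)

lemma loops_stack:
  "loops (stack n a b) = loops a + loops b +
     image_mset (component_dec a b) (mset_set {C \<in> component (stack_adj a b) ` stack_nodes n. outer -` C = {}})"
  by (simp add: stack_def Let_def stack_components_def component_def)

lemma edge_at_stack:
  assumes "matching_diagram n a" "matching_diagram n b" "matching_diagram n (stack n a b)" "x \<in> nodes n"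
  shows "edge_at (stack n a b) x = outer -` component (stack_adj a b) (outer x)"
  by (rule edge_at_eq[OF assms(3)]) (use edges_stack[OF assms(1,2)] assms(4) in auto)

text \<open>Diagrams are compared edge by edge; outside the edges both decoration functions have the
  default value 0, which makes the records equal.\<close>

lemma diagram_eqI:
  fixes d d' :: diagram
  assumes "edges d = edges d'" "loops d = loops d'"
    "\<And>e. e \<in> edges d \<Longrightarrow> dec d e = dec d' e"
    "\<And>e. e \<notin> edges d \<Longrightarrow> dec d e = 0" "\<And>e. e \<notin> edges d' \<Longrightarrow> dec d' e = 0"
  shows "d = d'"
proof -
  have "dec d e = dec d' e" for e
    using assms by (cases "e \<in> edges d") auto
  thus ?thesis using assms(1,2) by (intro diagram.equality) auto
qed

lemma stack_loops_update:
  "stack_adj (a\<lparr>loops := L\<rparr>) b = stack_adj a b" "stack_adj a (b\<lparr>loops := L\<rparr>) = stack_adj a b"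
  "component_dec (a\<lparr>loops := L\<rparr>) b = component_dec a b" "component_dec a (b\<lparr>loops := L\<rparr>) = component_dec a b"
  by (auto simp: stack_adj_def component_dec_def fun_eq_iff)

lemma stack_add_loops_left: "stack n (add_loops L a) b = add_loops L (stack n a b)"
  by (rule diagram.equality)
    (simp_all add: stack_def Let_def stack_components_def add_loops_def stack_loops_update add_ac cong: if_cong)

lemma stack_add_loops_right: "stack n a (add_loops L b) = add_loops L (stack n a b)"
  by (rule diagram.equality)
    (simp_all add: stack_def Let_def stack_components_def add_loops_def stack_loops_update add_ac cong: if_cong)

text \<open>An edge never straddles two components, so a single end decides.\<close>

lemma edge_in_component_upper:
  assumes "matching_diagram n a" "e \<in> edges a" "x \<in> e"
  shows "upper ` e \<subseteq> component (stack_adj a b) v \<longleftrightarrow> upper x \<in> component (stack_adj a b) v"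
proof -
  obtain y z where e: "e = {y, z}" using pm_pair[OF matching_diagramD(1)[OF assms(1)] assms(2)] by blast
  have "(upper y, upper z) \<in> stack_adj a b" "(upper z, upper y) \<in> stack_adj a b"
    using assms(2) e unfolding stack_adj_def by (auto simp: insert_commute)
  hence "upper y \<in> component (stack_adj a b) v \<longleftrightarrow> upper z \<in> component (stack_adj a b) v"
    unfolding component_iff by (meson rtrancl.rtrancl_into_rtrancl)
  thus ?thesis using e assms(3) by auto
qed

lemma edge_in_component_lower:
  assumes "matching_diagram n b" "e \<in> edges b" "x \<in> e"
  shows "lower ` e \<subseteq> component (stack_adj a b) v \<longleftrightarrow> lower x \<in> component (stack_adj a b) v"
proof -
  obtain y z where e: "e = {y, z}" using pm_pair[OF matching_diagramD(1)[OF assms(1)] assms(2)] by blast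
  have "(lower y, lower z) \<in> stack_adj a b" "(lower z, lower y) \<in> stack_adj a b"
    using assms(2) e unfolding stack_adj_def by (auto simp: insert_commute)
  hence "lower y \<in> component (stack_adj a b) v \<longleftrightarrow> lower z \<in> component (stack_adj a b) v"
    unfolding component_iff by (meson rtrancl.rtrancl_into_rtrancl)
  thus ?thesis using e assms(3) by auto
qed

text \<open>\<open>T\<close> and \<open>U\<close> are leaves hanging on \<open>P\<close> and
  \<open>Q\<close>, as two north nodes of the upper diagram are in a stacked picture. The rewiring
  joins the leaves to each other and their neighbours to each other, so \<open>{T, U}\<close> splits
  off and the remains of the two components merge.\<close>

lemma component_hook:
  fixes R R' :: "('a \<times> 'a) set"
  assumes R: "sym R"
    and T: "\<And>z. (T, z) \<in> R \<longleftrightarrow> z = P" and U: "\<And>z. (U, z) \<in> R \<longleftrightarrow> z = Q"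
    and ne: "T \<noteq> U" "P \<noteq> U" "Q \<noteq> T" "P \<noteq> T" "Q \<noteq> U"
    and R': "\<And>x y. (x, y) \<in> R' \<longleftrightarrow> (x, y) \<in> {(T, U), (U, T), (P, Q), (Q, P)} \<or>
                 (x, y) \<in> R \<and> x \<notin> {T, U} \<and> y \<notin> {T, U}"
  shows "component R' T = {T, U}" "component R' U = {T, U}"
    and "x \<notin> {T, U} \<Longrightarrow> component R' x =
      (if x \<in> component R T \<union> component R U then (component R T \<union> component R U) - {T, U} else component R x)"
proof -
  have symR': "sym R'" using R unfolding sym_def R' by auto
  have "y \<in> {T, U}" if "(T, y) \<in> R'\<^sup>*" for y
    using that by induction (use R' ne in auto)
  moreover have "(T, U) \<in> R'" using R' by blast
  ultimately show cT: "component R' T = {T, U}" unfolding component_def by blast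
  have "U \<in> component R' T" using cT by blast
  thus "component R' U = {T, U}" using component_eq[OF symR'] cT by blast
  let ?W = "component R T \<union> component R U"
  have inW: "y \<in> ?W \<longleftrightarrow> z \<in> ?W" if "(y, z) \<in> R" for y z
    using that symD[OF R that] unfolding Un_iff component_iff by (meson rtrancl.rtrancl_into_rtrancl)
  have PQ: "P \<in> ?W" "Q \<in> ?W" using T[of P] U[of Q] by (auto simp: component_iff)
  \<comment> \<open>Contracting each leaf to its neighbour turns every step of \<open>R\<close> into
    a step of \<open>R'\<close> or a standstill.\<close>
  define g where "g y = (if y = T then P else if y = U then Q else y)" for y
  have up: "(x, g y) \<in> R'\<^sup>*" if "(x, y) \<in> R\<^sup>*" "x \<notin> {T, U}" for x y
    using that(1)
  proof induction
    case base thus ?case using that(2) by (simp add: g_def)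
  next
    case (step y z)
    have "(g y, g z) \<in> R' \<or> g y = g z"
    proof (cases "y \<in> {T, U}")
      case True
      thus ?thesis using step(2) T U ne by (auto simp: g_def)
    next
      case F: False
      show ?thesis
      proof (cases "z \<in> {T, U}")
        case True
        thus ?thesis using symD[OF R step(2)] T U ne F by (auto simp: g_def)
      next
        case False
        thus ?thesis using F step(2) by (auto simp: g_def R')
      qed
    qed
    thus ?case using step(3) by (metis rtrancl.rtrancl_into_rtrancl)
  qed
  assume x: "x \<notin> {T, U}"
  have down: "y \<notin> {T, U} \<and> (x \<in> ?W \<longleftrightarrow> y \<in> ?W) \<and> (x \<in> ?W \<or> (x, y) \<in> R\<^sup>*)" if "(x, y) \<in> R'\<^sup>*" for y
    using that
  proof induction
    case base thus ?case using x by simp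
  next
    case (step y z)
    from step(2) have "z \<notin> {T, U}" using step(3) ne unfolding R' by auto
    moreover from step(2) have "(y \<in> ?W \<and> z \<in> ?W) \<or> (y, z) \<in> R"
      using step(3) PQ unfolding R' by auto
    ultimately show ?case using step(3) inW by (meson rtrancl.rtrancl_into_rtrancl)
  qed
  show "component R' x =
      (if x \<in> ?W then ?W - {T, U} else component R x)"
  proof (cases "x \<in> ?W")
    case False
    have "y \<in> component R x \<longleftrightarrow> y \<in> component R' x" for y
    proof
      assume y: "y \<in> component R x"
      have "y \<notin> ?W"
      proof
        assume "y \<in> ?W"
        hence "component R T = component R x \<or> component R U = component R x"
          using component_meet[OF R _ y] by blast
        thus False using False component_self[of x R] by blast
      qed
      hence "y \<notin> {T, U}" using component_self[of T R] component_self[of U R] by blast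
      hence "g y = y" by (simp add: g_def)
      thus "y \<in> component R' x" using up[of x y] x y by (simp add: component_iff)
    next
      assume "y \<in> component R' x"
      hence "(x, y) \<in> R'\<^sup>*" by (simp only: component_iff)
      hence "(x, y) \<in> R\<^sup>*" using down[of y] False by blast
      thus "y \<in> component R x" by (simp only: component_iff)
    qed
    thus ?thesis using False by auto
  next
    case True
    have toP: "(z, P) \<in> R'\<^sup>*" if "z \<in> ?W" "z \<notin> {T, U}" for z
    proof -
      have "(z, T) \<in> R\<^sup>* \<or> (z, U) \<in> R\<^sup>*" using that(1) component_comm[OF R] by (auto simp: component_iff)
      hence "(z, P) \<in> R'\<^sup>* \<or> (z, Q) \<in> R'\<^sup>*" using up[of z T] up[of z U] that(2) ne by (auto simp: g_def)
      moreover have "(Q, P) \<in> R'" using R' by blast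
      ultimately show ?thesis by (meson rtrancl.rtrancl_into_rtrancl)
    qed
    have "component R' x = ?W - {T, U}"
    proof (rule Set.set_eqI)
      fix y show "y \<in> component R' x \<longleftrightarrow> y \<in> ?W - {T, U}"
      proof
        assume "y \<in> component R' x"
        thus "y \<in> ?W - {T, U}" using down True by (auto simp: component_iff)
      next
        assume y: "y \<in> ?W - {T, U}"
        have "(x, P) \<in> R'\<^sup>*" "(y, P) \<in> R'\<^sup>*" using toP x y True by blast+
        hence "(x, y) \<in> R'\<^sup>*" using symD[OF sym_rtrancl[OF symR']] by (meson rtrancl_trans)
        thus "y \<in> component R' x" by (simp add: component_iff)
      qed
    qed
    thus ?thesis using True by simp
  qed
qed


lemma Top_adj:
  assumes "matching_diagram n a" "{North i, p} \<in> edges a"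
  shows "(Top i, z) \<in> stack_adj a b \<longleftrightarrow> z = upper p"
proof
  assume "(Top i, z) \<in> stack_adj a b"
  then consider x y where "Top i = upper x" "z = upper y" "{x, y} \<in> edges a" 
    | x y where "Top i = lower x" "z = lower y"
    unfolding stack_adj_def by blast
  thus "z = upper p"
  proof cases
    case 1
    hence "x = North i" by (cases x) auto
    thus ?thesis using 1 pm_unique[OF matching_diagramD(1)[OF assms(1)]] assms(2) by blast
  next
    case 2
    thus ?thesis by (cases x) auto
  qed
next
  assume "z = upper p"
  moreover have "(upper (North i), upper p) \<in> stack_adj a b" using assms(2) unfolding stack_adj_def by blast
  ultimately show "(Top i, z) \<in> stack_adj a b" by simp
qed

lemma component_dec_Top_pair:
  assumes "matching_diagram n b" "perfect_matching n (edges a)" "{North i, North j} \<in> edges a"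
  shows "component_dec a b {Top i, Top j} = dec a {North i, North j}"
proof -
  have "{e \<in> edges a. upper ` e \<subseteq> {Top i, Top j}} = {{North i, North j}}"
  proof (intro equalityI subsetI)
    fix e assume "e \<in> {e \<in> edges a. upper ` e \<subseteq> {Top i, Top j}}"
    hence e: "e \<in> edges a" "upper ` e \<subseteq> {Top i, Top j}" by auto
    obtain x y where xy: "e = {x, y}" using pm_pair[OF assms(2) e(1)] by blast
    hence "upper x \<in> {Top i, Top j}" using e(2) by blast
    hence "x = North i \<or> x = North j" by (cases x) auto
    hence "e = {North i, North j}" using pm_disjoint[OF assms(2) e(1) assms(3), of x] xy by blast
    thus "e \<in> {{North i, North j}}" by simp
  qed (use assms(3) in auto)
  moreover have "{e \<in> edges b. lower ` e \<subseteq> {Top i, Top j}} = {}"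
  proof -
    have "\<not> lower ` e \<subseteq> {Top i, Top j}" if eb: "e \<in> edges b" for e
    proof -
      obtain x y where "e = {x, y}" using pm_pair[OF matching_diagramD(1)[OF assms(1)] eb] by blast
      thus ?thesis by (cases x) auto
    qed
    thus ?thesis by blast
  qed
  ultimately show ?thesis by (simp only: component_dec_def) simp
qed

text \<open>A cap at the top of \<open>a\<close> is a component of the stacked picture by itself, so
  on both sides the only effect is to turn its decorations into a loop and to leave an undecorated
  cap.\<close>

lemma stack_hook_same:
  assumes a: "matching_diagram n a" and b: "matching_diagram n b" and s: "matching_diagram n (stack n a b)"
    and i: "1 \<le> i" "Suc i \<le> n" and e: "{North i, North (Suc i)} \<in> edges a"
  shows "stack n (hook i a) b = hook i (stack n a b)"
proof -
  let ?e = "{North i, North (Suc i)}" and ?R = "stack_adj a b"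
  have e': "{North (Suc i), North i} \<in> edges a" using e by (simp add: insert_commute)
  note h = hook_same[OF a e]
  have R: "stack_adj (hook i a) b = ?R" by (simp add: h stack_adj_def)
  have "y \<in> {Top i, Top (Suc i)}" if "(Top i, y) \<in> ?R\<^sup>*" for y
    using that by induction (use Top_adj[OF a e] Top_adj[OF a e'] in auto)
  moreover have "(Top i, Top (Suc i)) \<in> ?R" using Top_adj[OF a e] by simp
  ultimately have c: "component ?R (Top i) = {Top i, Top (Suc i)}" unfolding component_def by blast
  have oi: "outer -` {Top i, Top (Suc i)} = ?e"
  proof -
    have "outer x \<in> {Top i, Top (Suc i)} \<longleftrightarrow> x \<in> ?e" for x by (cases x) auto
    thus ?thesis by blast
  qed
  have Ni: "North i \<in> nodes n" using i by simp
  have es: "?e \<in> edges (stack n a b)" unfolding edges_stack[OF a b]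
    by (rule image_eqI[of _ _ "North i"]) (use c oi Ni in auto)
  have ds: "dec (stack n a b) ?e = dec a ?e"
    using dec_stack[OF a b Ni] c oi component_dec_Top_pair[OF b matching_diagramD(1)[OF a] e] by simp
  have dc: "component_dec (hook i a) b C = component_dec a b C" if "Top i \<notin> C" for C
  proof -
    have "(\<Sum>f\<in>{f \<in> edges a. upper ` f \<subseteq> C}. dec (hook i a) f) = (\<Sum>f\<in>{f \<in> edges a. upper ` f \<subseteq> C}. dec a f)"
      by (rule sum.cong) (use that h in auto)
    thus ?thesis unfolding component_dec_def by (simp add: h)
  qed
  have ha: "matching_diagram n (hook i a)" by (rule matching_hook[OF a i])
  have dc0: "component_dec (hook i a) b {Top i, Top (Suc i)} = 0"
    using component_dec_Top_pair[OF b matching_diagramD(1)[OF ha], of i "Suc i"] e by (simp add: h)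
  have E: "edges (stack n (hook i a) b) = edges (stack n a b)"
    unfolding edges_stack[OF ha b] edges_stack[OF a b] R ..
  show ?thesis
  proof (rule diagram_eqI)
    show "edges (stack n (hook i a) b) = edges (hook i (stack n a b))"
      unfolding E hook_same[OF s es] by simp
    have "image_mset (component_dec (hook i a) b) (mset_set {C \<in> component ?R ` stack_nodes n. outer -` C = {}})
        = image_mset (component_dec a b) (mset_set {C \<in> component ?R ` stack_nodes n. outer -` C = {}})"
    proof (rule image_mset_cong)
      fix C assume "C \<in># mset_set {C \<in> component ?R ` stack_nodes n. outer -` C = {}}"
      hence "outer -` C = {}" by simp
      hence "North i \<notin> outer -` C" by blast
      thus "component_dec (hook i a) b C = component_dec a b C" using dc by simp
    qed
    thus "loops (stack n (hook i a) b) = loops (hook i (stack n a b))"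
      unfolding hook_same[OF s es] loops_stack R by (simp add: h ds)
  next
    fix f assume "f \<in> edges (stack n (hook i a) b)"
    then obtain x where x: "x \<in> nodes n" "f = outer -` component ?R (outer x)" unfolding E edges_stack[OF a b] by blast
    have 1: "dec (stack n (hook i a) b) f = component_dec (hook i a) b (component ?R (outer x))"
      using dec_stack[OF ha b x(1)] x(2) R by simp
    show "dec (stack n (hook i a) b) f = dec (hook i (stack n a b)) f"
    proof (cases "f = ?e")
      case True
      have "x \<in> f" unfolding x(2) by simp
      hence "outer x \<in> component ?R (Top i)" unfolding c True by auto
      hence "component ?R (outer x) = {Top i, Top (Suc i)}" using component_eq[OF sym_stack_adj] c by blast
      thus ?thesis using 1 dc0 True by (simp add: hook_same[OF s es])
    next
      case False
      have "Top i \<notin> component ?R (outer x)"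
      proof
        assume "Top i \<in> component ?R (outer x)"
        hence "component ?R (outer x) = {Top i, Top (Suc i)}" using component_eq[OF sym_stack_adj] c by blast
        thus False using False x oi by simp
      qed
      hence "component_dec (hook i a) b (component ?R (outer x)) = component_dec a b (component ?R (outer x))"
        by (rule dc)
      thus ?thesis using 1 False dec_stack[OF a b x(1)] x(2) by (simp add: hook_same[OF s es])
    qed
  qed (erule dec_stack_0 matching_diagramD(2)[OF matching_hook[OF s i]])+
qed

text \<open>Only the components of \<open>Top i\<close> and \<open>Top (Suc i)\<close> change. If
  they are the same component, what remains of it has no outer node and is the loop that
  \<open>hook\<close> records on the right-hand side; otherwise the two remains merge to the joined
  edge.\<close>

lemma stack_hook_diff:
  assumes a: "matching_diagram n a" and b: "matching_diagram n b" and s: "matching_diagram n (stack n a b)"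
    and i: "1 \<le> i" "Suc i \<le> n" and e: "{North i, North (Suc i)} \<notin> edges a"
  shows "stack n (hook i a) b = hook i (stack n a b)"
proof -
  define R where "R = stack_adj a b"
  define R' where "R' = stack_adj (hook i a) b"
  have symR: "sym R" unfolding R_def by (rule sym_stack_adj)
  have symR': "sym R'" unfolding R'_def by (rule sym_stack_adj)
  define T where "T = Top i"
  define U where "U = Top (Suc i)"
  note pma = matching_diagramD(1)[OF a] and pmb = matching_diagramD(1)[OF b] and pms = matching_diagramD(1)[OF s]
  obtain p where p: "{North i, p} \<in> edges a" using pm_partner[OF pma] i by force
  obtain q where q: "{North (Suc i), q} \<in> edges a" using pm_partner[OF pma] i by force
  have pj: "p \<noteq> North (Suc i)" using p e by blast
  note h = hook_diff[OF a p q pj]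
  have ha: "matching_diagram n (hook i a)" by (rule matching_hook[OF a i])
  have hp: "{p, q} \<in> edges (hook i a)" "{North i, North (Suc i)} \<in> edges (hook i a)" unfolding h(1) by auto
  have off: "x \<notin> {North i, North (Suc i), p, q}"
    if "f \<in> edges a" "f \<noteq> {North i, p}" "f \<noteq> {North (Suc i), q}" "x \<in> f" for x f
  proof
    assume "x \<in> {North i, North (Suc i), p, q}"
    then consider "x \<in> {North i, p}" | "x \<in> {North (Suc i), q}" by blast
    thus False using pm_disjoint[OF pma that(1) _ that(4)] p q that(2,3) by cases blast+
  qed
  have adjT: "(T, z) \<in> R \<longleftrightarrow> z = upper p" for z unfolding T_def R_def by (rule Top_adj[OF a p])
  have adjU: "(U, z) \<in> R \<longleftrightarrow> z = upper q" for z unfolding U_def R_def by (rule Top_adj[OF a q])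
  have TU: "T = upper (North i)" "U = upper (North (Suc i))" "T = outer (North i)" "U = outer (North (Suc i))"
    by (auto simp: T_def U_def)
  have upT: "upper u = T \<longleftrightarrow> u = North i" "upper u = U \<longleftrightarrow> u = North (Suc i)" for u
    by (cases u; simp add: T_def U_def)+
  have lowT: "lower x \<noteq> T" "lower x \<noteq> U" for x by (cases x; simp add: T_def U_def)+
  have adj': "(x, y) \<in> R' \<longleftrightarrow> (x, y) \<in> {(T, U), (U, T), (upper p, upper q), (upper q, upper p)} \<or>
                 (x, y) \<in> R \<and> x \<notin> {T, U} \<and> y \<notin> {T, U}" for x y
  proof -
    let ?L = "\<exists>u v. x = lower u \<and> y = lower v \<and> {u, v} \<in> edges b"
    have 1: "(x, y) \<in> R' \<longleftrightarrow> (\<exists>u v. x = upper u \<and> y = upper v \<and> {u, v} \<in> edges (hook i a)) \<or> ?L"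
      unfolding R'_def stack_adj_def h(1) by auto
    have 2: "(x, y) \<in> R \<longleftrightarrow> (\<exists>u v. x = upper u \<and> y = upper v \<and> {u, v} \<in> edges a) \<or> ?L"
      unfolding R_def stack_adj_def by auto
    have 3: "?L \<Longrightarrow> x \<notin> {T, U} \<and> y \<notin> {T, U}" using lowT by auto
    have 4: "{u, v} \<in> edges (hook i a) \<longleftrightarrow>
        {u, v} = {North i, North (Suc i)} \<or> {u, v} = {p, q} \<or>
        ({u, v} \<in> edges a \<and> u \<notin> {North i, North (Suc i)} \<and> v \<notin> {North i, North (Suc i)})" for u v
    proof -
      have "{u, v} \<in> edges a - {{North i, p}, {North (Suc i), q}} \<longleftrightarrow>
        {u, v} \<in> edges a \<and> u \<notin> {North i, North (Suc i)} \<and> v \<notin> {North i, North (Suc i)}" (is "?X \<longleftrightarrow> ?Y")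
      proof
        assume ?X
        thus ?Y using off[of "{u, v}" u] off[of "{u, v}" v] by simp
      next
        assume ?Y
        thus ?X by (auto simp: doubleton_eq_iff)
      qed
      thus ?thesis unfolding h(1) by (simp only: insert_iff diagram.simps)
    qed
    have 5: "(\<exists>u v. x = upper u \<and> y = upper v \<and> {u, v} \<in> edges (hook i a)) \<longleftrightarrow>
        (x, y) \<in> {(T, U), (U, T), (upper p, upper q), (upper q, upper p)} \<or>
        ((\<exists>u v. x = upper u \<and> y = upper v \<and> {u, v} \<in> edges a) \<and> x \<notin> {T, U} \<and> y \<notin> {T, U})"
      (is "?A \<longleftrightarrow> ?B")
    proof
      assume ?A
      then obtain u v where uv: "x = upper u" "y = upper v" "{u, v} \<in> edges (hook i a)" by blast
      from uv(3)[unfolded 4] show ?B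
        unfolding uv(1,2) by (auto simp: doubleton_eq_iff upT)
    next
      assume ?B
      thus ?A
      proof
        assume "(x, y) \<in> {(T, U), (U, T), (upper p, upper q), (upper q, upper p)}"
        then consider "x = T" "y = U" | "x = U" "y = T" | "x = upper p" "y = upper q" | "x = upper q" "y = upper p" by blast
        thus ?A using hp unfolding TU(1,2) by cases (metis insert_commute)+
      next
        assume "(\<exists>u v. x = upper u \<and> y = upper v \<and> {u, v} \<in> edges a) \<and> x \<notin> {T, U} \<and> y \<notin> {T, U}"
        then obtain u v where "x = upper u" "y = upper v" "{u, v} \<in> edges a" "u \<notin> {North i, North (Suc i)}" "v \<notin> {North i, North (Suc i)}"
          by (auto simp: upT)
        thus ?A unfolding 4 by blast
      qed
    qed
    show ?thesis unfolding 1 2 5 using 3 by blast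
  qed
  have ne: "T \<noteq> U" "upper p \<noteq> U" "upper q \<noteq> T" "upper p \<noteq> T" "upper q \<noteq> U"
    using pj h(2,4,5) upT by (auto simp: T_def U_def)
  note ch = component_hook[OF symR adjT adjU ne adj']
  define CT where "CT = component R T"
  define CU where "CU = component R U"
  define W where "W = (CT \<union> CU) - {T, U}"
  let ?V = "stack_nodes n"
  have TV: "T \<in> ?V" "U \<in> ?V" using i unfolding TU(3,4) by (simp_all only: outer_in_stack_nodes) auto
  have PV: "upper p \<in> ?V" using h(6) by auto
  have inC: "T \<in> CT" "U \<in> CU" "upper p \<in> CT" "upper q \<in> CU"
    using adjT adjU by (auto simp: CT_def CU_def component_iff)
  have PW: "upper p \<in> W" using inC ne by (auto simp: W_def)
  have comp_inter: "component R v = CT" if "component R v \<inter> CT \<noteq> {}" for v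
    using that component_meet[OF symR] unfolding CT_def by blast
  have comp_inter': "component R v = CU" if "component R v \<inter> CU \<noteq> {}" for v
    using that component_meet[OF symR] unfolding CU_def by blast
  have cR': "component R' v = (if v \<in> {T, U} then {T, U} else if v \<in> CT \<union> CU then W else component R v)" for v
    using ch(1,2) ch(3)[of v] unfolding CT_def CU_def W_def by auto
  have comps': "component R' ` ?V = insert {T, U} (insert W (component R ` ?V - {CT, CU}))"
  proof (intro equalityI subsetI)
    fix C assume "C \<in> component R' ` ?V"
    then obtain v where v: "v \<in> ?V" "C = component R' v" by blast
    show "C \<in> insert {T, U} (insert W (component R ` ?V - {CT, CU}))"
    proof (cases "v \<in> CT \<union> CU")
      case True
      thus ?thesis using v cR'[of v] by (cases "v \<in> {T, U}") auto
    next
      case False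
      hence "v \<notin> {T, U}" using inC by blast
      hence "C = component R v" using v cR'[of v] False by simp
      moreover from this have "C \<noteq> CT \<and> C \<noteq> CU" using False component_self[of v R] by blast
      ultimately show ?thesis using v by blast
    qed
  next
    fix C assume "C \<in> insert {T, U} (insert W (component R ` ?V - {CT, CU}))"
    then consider "C = {T, U}" | "C = W" | v where "v \<in> ?V" "C = component R v" "C \<noteq> CT" "C \<noteq> CU" by blast
    thus "C \<in> component R' ` ?V"
    proof cases
      case 1
      thus ?thesis using TV ch(1) by blast
    next
      case 2
      have "component R' (upper p) = W" using cR'[of "upper p"] ne inC by auto
      thus ?thesis using 2 PV by blast
    next
      case 3
      have "v \<notin> CT \<union> CU" using 3 comp_inter[of v] comp_inter'[of v] component_self[of v R] by blast
      moreover from this have "v \<notin> {T, U}" using inC by blast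
      ultimately have "component R' v = component R v" using cR'[of v] by simp
      thus ?thesis using 3 by blast
    qed
  qed
  define \<epsilon> where "\<epsilon> = outer -` CT"
  define \<eta> where "\<eta> = outer -` CU"
  let ?c = "{North i, North (Suc i)}"
  have Nn: "North i \<in> nodes n" "North (Suc i) \<in> nodes n" using i by auto
  have eat: "edge_at (stack n a b) (North i) = \<epsilon>" "edge_at (stack n a b) (North (Suc i)) = \<eta>"
    using edge_at_stack[OF a b s] Nn unfolding \<epsilon>_def \<eta>_def CT_def CU_def R_def T_def U_def by (simp_all del: vimage_insert)
  have es: "\<epsilon> \<in> edges (stack n a b)" "\<eta> \<in> edges (stack n a b)" "North i \<in> \<epsilon>" "North (Suc i) \<in> \<eta>"
    using edge_at_in[OF s Nn(1)] edge_at_in[OF s Nn(2)] unfolding eat by auto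
  have dCT: "dec (stack n a b) \<epsilon> = component_dec a b CT" and dCU: "dec (stack n a b) \<eta> = component_dec a b CU"
    using dec_stack[OF a b Nn(1)] dec_stack[OF a b Nn(2)]
    unfolding \<epsilon>_def \<eta>_def CT_def CU_def R_def TU(3,4) by auto
  have oTU: "outer -` {T, U} = ?c"
  proof -
    have "outer x \<in> {T, U} \<longleftrightarrow> x \<in> ?c" for x by (cases x) (auto simp: T_def U_def)
    thus ?thesis by blast
  qed
  have oW: "outer -` W = (\<epsilon> \<union> \<eta>) - ?c" unfolding W_def \<epsilon>_def \<eta>_def vimage_Diff oTU vimage_Un ..
  have CTU: "\<epsilon> = \<eta> \<longleftrightarrow> CT = CU"
  proof
    assume "\<epsilon> = \<eta>"
    hence "outer (North i) \<in> CU" using es(3) unfolding \<eta>_def by blast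
    hence "T \<in> CT \<inter> CU" using inC TU(3) by simp
    thus "CT = CU" using comp_inter'[of T] unfolding CT_def[symmetric] by blast
  qed (simp add: \<epsilon>_def \<eta>_def)
  \<comment> \<open>A component other than the two affected ones contains none of the four edges
    involved in the rewiring, hence keeps its decorations.\<close>
  have old: "component_dec (hook i a) b C = component_dec a b C" if hC: "C \<in> component R ` ?V" "C \<noteq> CT" "C \<noteq> CU" for C
  proof -
    obtain v where v: "C = component R v" using hC(1) by blast
    have disj: "C \<inter> CT = {}" "C \<inter> CU = {}" using hC v comp_inter[of v] comp_inter'[of v] by blast+
    hence nin: "T \<notin> C" "U \<notin> C" "upper p \<notin> C" "upper q \<notin> C" using inC by blast+
    have "{f \<in> edges (hook i a). upper ` f \<subseteq> C} = {f \<in> edges a. upper ` f \<subseteq> C}"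
      unfolding h(1) using nin TU(1,2) by auto
    moreover have "(\<Sum>f\<in>{f \<in> edges a. upper ` f \<subseteq> C}. dec (hook i a) f) = (\<Sum>f\<in>{f \<in> edges a. upper ` f \<subseteq> C}. dec a f)"
    proof (rule sum.cong[OF HOL.refl])
      fix f assume f: "f \<in> {f \<in> edges a. upper ` f \<subseteq> C}"
      hence "f \<noteq> {North i, p}" "f \<noteq> {North (Suc i), q}" "f \<noteq> {p, q}" "f \<noteq> ?c" using nin TU(1,2) by auto
      thus "dec (hook i a) f = dec a f" unfolding h(1) by simp
    qed
    ultimately show ?thesis unfolding component_dec_def by simp
  qed
  have dTU: "component_dec (hook i a) b {T, U} = 0"
  proof -
    have "component_dec (hook i a) b {T, U} = dec (hook i a) ?c"
      using component_dec_Top_pair[OF b matching_diagramD(1)[OF ha] hp(2)] unfolding T_def U_def .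
    thus ?thesis unfolding h(1) by simp
  qed
  have upC: "upper ` f \<subseteq> component R v \<longleftrightarrow> upper x \<in> component R v" if "f \<in> edges a" "x \<in> f" for f x v
    unfolding R_def by (rule edge_in_component_upper[OF a that])
  have loC: "lower ` f \<subseteq> component R v \<longleftrightarrow> lower x \<in> component R v" if "f \<in> edges b" "x \<in> f" for f x v
    unfolding R_def by (rule edge_in_component_lower[OF b that])
  define SA where "SA X = {f \<in> edges a. upper ` f \<subseteq> X}" for X
  define SB where "SB X = {f \<in> edges b. lower ` f \<subseteq> X}" for X
  have cdec: "component_dec a b X = (\<Sum>f\<in>SA X. dec a f) + (\<Sum>f\<in>SB X. dec b f)" for X
    unfolding component_dec_def SA_def SB_def ..
  have fin: "finite (SA X)" "finite (SB X)" for X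
    unfolding SA_def SB_def using finite_matching[OF pma] finite_matching[OF pmb] by auto
  have SAun: "SA (CT \<union> CU) = SA CT \<union> SA CU"
  proof (intro equalityI subsetI)
    fix f assume "f \<in> SA (CT \<union> CU)"
    hence f: "f \<in> edges a" "upper ` f \<subseteq> CT \<union> CU" unfolding SA_def by auto
    obtain x y where "f = {x, y}" using pm_pair[OF pma f(1)] by blast
    hence x: "x \<in> f" by simp
    hence "upper x \<in> CT \<or> upper x \<in> CU" using f(2) by blast
    thus "f \<in> SA CT \<union> SA CU" using upC[OF f(1) x] f(1) unfolding SA_def CT_def CU_def by blast
  qed (auto simp: SA_def)
  have SBW: "SB W = SB CT \<union> SB CU"
  proof (intro equalityI subsetI)
    fix f assume "f \<in> SB W"
    hence f: "f \<in> edges b" "lower ` f \<subseteq> CT \<union> CU" unfolding SB_def W_def by auto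
    obtain x y where "f = {x, y}" using pm_pair[OF pmb f(1)] by blast
    hence x: "x \<in> f" by simp
    hence "lower x \<in> CT \<or> lower x \<in> CU" using f(2) by blast
    thus "f \<in> SB CT \<union> SB CU" using loC[OF f(1) x] f(1) unfolding SB_def CT_def CU_def by blast
  next
    fix f assume "f \<in> SB CT \<union> SB CU"
    thus "f \<in> SB W" unfolding SB_def W_def using lowT by auto
  qed
  have apq: "{North i, p} \<in> SA CT" "{North (Suc i), q} \<in> SA CU"
    unfolding SA_def using p q inC TU(1,2) by auto
  have apq_ne: "{North i, p} \<noteq> {North (Suc i), q}" using pj by (auto simp: doubleton_eq_iff)
  have SAW: "{f \<in> edges (hook i a). upper ` f \<subseteq> W} = insert {p, q} (SA (CT \<union> CU) - {{North i, p}, {North (Suc i), q}})"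
  proof (intro equalityI subsetI)
    fix f assume f: "f \<in> {f \<in> edges (hook i a). upper ` f \<subseteq> W}"
    hence "f \<noteq> ?c" using TU(1) unfolding W_def by auto
    thus "f \<in> insert {p, q} (SA (CT \<union> CU) - {{North i, p}, {North (Suc i), q}})"
      using f unfolding h(1) SA_def W_def by auto
  next
    fix f assume "f \<in> insert {p, q} (SA (CT \<union> CU) - {{North i, p}, {North (Suc i), q}})"
    thus "f \<in> {f \<in> edges (hook i a). upper ` f \<subseteq> W}"
    proof
      assume "f = {p, q}"
      thus ?thesis using hp(1) inC ne unfolding W_def by auto
    next
      assume f: "f \<in> SA (CT \<union> CU) - {{North i, p}, {North (Suc i), q}}"
      hence "\<forall>x\<in>f. x \<notin> {North i, North (Suc i), p, q}" using off unfolding SA_def by blast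
      hence "\<forall>x\<in>f. upper x \<notin> {T, U}" by (simp add: upT)
      hence "upper ` f \<subseteq> W" using f unfolding SA_def W_def by blast
      thus ?thesis using f unfolding h(1) SA_def by simp
    qed
  qed
  have pqS: "{p, q} \<notin> SA (CT \<union> CU) - {{North i, p}, {North (Suc i), q}}" using h(8) unfolding SA_def by blast
  have decpq: "dec (hook i a) {p, q} = dec a {North i, p} + dec a {North (Suc i), q}"
    unfolding h(1) using h(2-5) pj by (auto simp: doubleton_eq_iff)
  \<comment> \<open>\<open>{p, q}\<close> carries the decorations of both edges that it replaces, so
    the total over the two old components is unchanged.\<close>
  have dW0: "component_dec (hook i a) b W = (\<Sum>f\<in>SA (CT \<union> CU). dec a f) + (\<Sum>f\<in>SB CT \<union> SB CU. dec b f)"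
  proof -
    let ?S = "SA (CT \<union> CU)"
    have "(\<Sum>f\<in>?S - {{North i, p}, {North (Suc i), q}}. dec (hook i a) f) = (\<Sum>f\<in>?S - {{North i, p}, {North (Suc i), q}}. dec a f)"
    proof (rule sum.cong[OF HOL.refl])
      fix f assume f: "f \<in> ?S - {{North i, p}, {North (Suc i), q}}"
      hence "f \<noteq> {p, q}" "f \<noteq> ?c" using h(8,9) unfolding SA_def by blast+
      thus "dec (hook i a) f = dec a f" using f unfolding h(1) by simp
    qed
    moreover have "(\<Sum>f\<in>?S. dec a f) = dec a {North i, p} + (dec a {North (Suc i), q} + (\<Sum>f\<in>?S - {{North i, p}, {North (Suc i), q}}. dec a f))"
    proof -
      have "(\<Sum>f\<in>?S. dec a f) = dec a {North i, p} + (\<Sum>f\<in>?S - {{North i, p}}. dec a f)"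
        by (rule sum.remove) (use fin apq SAun in auto)
      also have "(\<Sum>f\<in>?S - {{North i, p}}. dec a f) = dec a {North (Suc i), q} + (\<Sum>f\<in>?S - {{North i, p}} - {{North (Suc i), q}}. dec a f)"
        by (rule sum.remove) (use fin apq SAun apq_ne in auto)
      also have "?S - {{North i, p}} - {{North (Suc i), q}} = ?S - {{North i, p}, {North (Suc i), q}}" by blast
      finally show ?thesis .
    qed
    ultimately show ?thesis
      unfolding component_dec_def SAW SB_def[symmetric] SBW using fin pqS decpq by simp
  qed
  have hs: "matching_diagram n (hook i (stack n a b))" by (rule matching_hook[OF s i])
  \<comment> \<open>When a loop closes, the set of loop components must grow by exactly one; so
    \<open>W\<close> must not have been a component before.\<close>
  have Wdisj: "W \<notin> component R ` ?V \<or> W \<in> {CT, CU}"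
  proof (rule disjCI)
    assume nW: "W \<notin> {CT, CU}"
    show "W \<notin> component R ` ?V"
    proof
      assume "W \<in> component R ` ?V"
      then obtain v where "W = component R v" by blast
      hence "W = CT" using comp_inter[of v] PW inC by blast
      thus False using nW by blast
    qed
  qed
  have W_ne: "W \<noteq> CT" "W \<noteq> CU" using inC unfolding W_def by blast+
  have E': "edges (stack n (hook i a) b) = {outer -` C | C. C \<in> component R' ` ?V \<and> outer -` C \<noteq> {}}"
    by (simp add: stack_def Let_def stack_components_def component_def R'_def)
  have E: "edges (stack n a b) = {outer -` C | C. C \<in> component R ` ?V \<and> outer -` C \<noteq> {}}"
    by (simp add: stack_def Let_def stack_components_def component_def R_def)
  have dec': "dec (stack n (hook i a) b) (outer -` C) = component_dec (hook i a) b C"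
    if hC: "C \<in> component R' ` ?V" "outer -` C \<noteq> {}" for C
  proof -
    obtain x where x: "outer x \<in> C" using hC(2) by blast
    obtain v where v: "v \<in> ?V" "C = component R' v" using hC(1) by blast
    have C: "C = component R' (outer x)" using component_eq[OF symR'] x v(2) by blast
    have "C \<subseteq> ?V" using v component_stack_nodes[OF ha b] unfolding R'_def by blast
    hence "outer x \<in> ?V" using x by blast
    hence "x \<in> nodes n" by (simp only: outer_in_stack_nodes)
    thus ?thesis using dec_stack[OF ha b] unfolding C R'_def by blast
  qed
  have decR: "dec (stack n a b) (outer -` C) = component_dec a b C"
    if hC: "C \<in> component R ` ?V" "outer -` C \<noteq> {}" for C
  proof -
    obtain x where x: "outer x \<in> C" using hC(2) by blast
    obtain v where v: "v \<in> ?V" "C = component R v" using hC(1) by blast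
    have C: "C = component R (outer x)" using component_eq[OF symR] x v(2) by blast
    have "C \<subseteq> ?V" using v component_stack_nodes[OF a b] unfolding R_def by blast
    hence "outer x \<in> ?V" using x by blast
    hence "x \<in> nodes n" by (simp only: outer_in_stack_nodes)
    thus ?thesis using dec_stack[OF a b] unfolding C R_def by blast
  qed
  have rest: "{outer -` C | C. C \<in> component R ` ?V - {CT, CU} \<and> outer -` C \<noteq> {}} = edges (stack n a b) - {\<epsilon>, \<eta>}"
  proof (intro equalityI subsetI)
    fix f assume "f \<in> {outer -` C | C. C \<in> component R ` ?V - {CT, CU} \<and> outer -` C \<noteq> {}}"
    then obtain v x where v: "v \<in> ?V" "f = outer -` component R v" "component R v \<noteq> CT" "component R v \<noteq> CU" "x \<in> f" by blast
    have "f \<noteq> \<epsilon>" using comp_inter[of v] v unfolding \<epsilon>_def by blast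
    moreover have "f \<noteq> \<eta>" using comp_inter'[of v] v unfolding \<eta>_def by blast
    ultimately show "f \<in> edges (stack n a b) - {\<epsilon>, \<eta>}" unfolding E using v by blast
  next
    fix f assume "f \<in> edges (stack n a b) - {\<epsilon>, \<eta>}"
    thus "f \<in> {outer -` C | C. C \<in> component R ` ?V - {CT, CU} \<and> outer -` C \<noteq> {}}"
      unfolding E \<epsilon>_def \<eta>_def by blast
  qed
  have loopset: "{C \<in> component R ` ?V. outer -` C = {}} = {C \<in> component R ` ?V - {CT, CU}. outer -` C = {}}"
    using es(3,4) unfolding \<epsilon>_def \<eta>_def by blast
  have finV: "finite (component R ` ?V)" by simp
  have oldimg: "image_mset (component_dec (hook i a) b) (mset_set {C \<in> component R ` ?V - {CT, CU}. outer -` C = {}})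
      = image_mset (component_dec a b) (mset_set {C \<in> component R ` ?V - {CT, CU}. outer -` C = {}})"
    by (rule image_mset_cong) (use old finV in auto)
  have lh: "loops (hook i a) = loops a" unfolding h(1) by simp
  have Eset: "edges (stack n (hook i a) b) = insert ?c ({f. f = (\<epsilon> \<union> \<eta>) - ?c \<and> f \<noteq> {}} \<union> (edges (stack n a b) - {\<epsilon>, \<eta>}))"
  proof -
    have 1: "{outer -` C | C. C \<in> insert A (insert B X) \<and> outer -` C \<noteq> {}} =
      {f. f = outer -` A \<and> f \<noteq> {}} \<union> ({f. f = outer -` B \<and> f \<noteq> {}} \<union> {outer -` C | C. C \<in> X \<and> outer -` C \<noteq> {}})"
      for A B X by blast
    have 2: "{f. f = ?c \<and> f \<noteq> {}} = {?c}" by blast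
    show ?thesis unfolding E' comps' rest[symmetric] 1 oTU oW 2 by (rule insert_is_Un[symmetric])
  qed
  have hookdef: "hook i (stack n a b) = (if \<epsilon> = \<eta> then (stack n a b)\<lparr>dec := (dec (stack n a b))(\<epsilon> := 0), loops := add_mset (dec (stack n a b) \<epsilon>) (loops (stack n a b))\<rparr>
     else \<lparr>edges = insert ?c (insert ((\<epsilon> \<union> \<eta>) - ?c) (edges (stack n a b) - {\<epsilon>, \<eta>})),
              dec = (dec (stack n a b))(\<epsilon> := 0, \<eta> := 0, (\<epsilon> \<union> \<eta>) - ?c := dec (stack n a b) \<epsilon> + dec (stack n a b) \<eta>, ?c := 0),
              loops = loops (stack n a b)\<rparr>)"
    unfolding hook_def Let_def eat ..
  have deccases: "dec (stack n (hook i a) b) f = dec (stack n a b) f" if hf: "f \<in> edges (stack n a b) - {\<epsilon>, \<eta>}" for f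
  proof -
    obtain C where C: "f = outer -` C" "C \<in> component R ` ?V - {CT, CU}" "outer -` C \<noteq> {}"
      using hf unfolding rest[symmetric] by blast
    have "C \<in> component R' ` ?V" using C(2) unfolding comps' by blast
    hence "dec (stack n (hook i a) b) f = component_dec (hook i a) b C" using dec' C by blast
    also have "\<dots> = component_dec a b C" using old C(2) by blast
    also have "\<dots> = dec (stack n a b) f" using decR[of C] C by simp
    finally show ?thesis .
  qed
  have decc: "dec (stack n (hook i a) b) ?c = 0"
    using dec'[of "{T, U}"] oTU dTU unfolding comps' by simp
  show ?thesis
  proof (cases "CT = CU")
    case True
    hence eq: "\<epsilon> = \<eta>" using CTU by blast
    obtain x y where xy: "\<epsilon> = {x, y}" using pm_pair[OF pms es(1)] by blast
    have ec: "\<epsilon> = ?c" using es(3,4) xy unfolding eq[symmetric] by auto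
    have oW0: "outer -` W = {}" unfolding oW using ec eq by blast
    have dW: "component_dec (hook i a) b W = dec (stack n a b) \<epsilon>"
      unfolding dW0 dCT cdec using True by simp
    show ?thesis
    proof (rule diagram_eqI)
      have "edges (stack n (hook i a) b) = edges (stack n a b)"
        unfolding Eset using ec eq es(1) by auto
      thus "edges (stack n (hook i a) b) = edges (hook i (stack n a b))" unfolding hookdef using eq by simp
      have "{C \<in> component R' ` ?V. outer -` C = {}} = insert W {C \<in> component R ` ?V - {CT, CU}. outer -` C = {}}"
      proof -
        have 1: "{C. C \<in> insert A (insert B X) \<and> outer -` C = {}} = insert B {C \<in> X. outer -` C = {}}"
          if "outer -` A \<noteq> {}" "outer -` B = {}" for A B X using that by blast
        show ?thesis unfolding comps' by (rule 1) (simp_all only: oTU oW0, blast+)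
      qed
      moreover have "W \<notin> {C \<in> component R ` ?V - {CT, CU}. outer -` C = {}}" using Wdisj W_ne by blast
      ultimately have "image_mset (component_dec (hook i a) b) (mset_set {C \<in> component R' ` ?V. outer -` C = {}})
        = add_mset (dec (stack n a b) \<epsilon>) (image_mset (component_dec a b) (mset_set {C \<in> component R ` ?V. outer -` C = {}}))"
        unfolding loopset oldimg[symmetric] using finV by (simp add: dW)
      thus "loops (stack n (hook i a) b) = loops (hook i (stack n a b))"
        unfolding hookdef if_P[OF eq] loops_stack R'_def R_def lh by simp
    next
      fix f assume "f \<in> edges (stack n (hook i a) b)"
      hence "f = ?c \<or> f \<in> edges (stack n a b) - {\<epsilon>, \<eta>}" unfolding Eset using ec eq by auto
      thus "dec (stack n (hook i a) b) f = dec (hook i (stack n a b)) f"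
      proof
        assume "f = ?c" thus ?thesis unfolding hookdef if_P[OF eq] ec using decc by simp
      next
        assume f: "f \<in> edges (stack n a b) - {\<epsilon>, \<eta>}"
        thus ?thesis unfolding hookdef if_P[OF eq] deccases[OF f] by simp
      qed
    qed (erule dec_stack_0 matching_diagramD(2)[OF hs])+
  next
    case False
    hence neq: "\<epsilon> \<noteq> \<eta>" using CTU by blast
    let ?r = "(\<epsilon> \<union> \<eta>) - ?c"
    obtain x where x: "\<epsilon> = {North i, x}" "x \<noteq> North i"
      using edge_at_pair[OF s Nn(1)] unfolding eat by metis
    have "x \<noteq> North (Suc i)" using pm_disjoint[OF pms es(1,2), of "North (Suc i)"] neq es(4) x by blast
    hence xr: "x \<in> ?r" using x by auto
    hence rne: "?r \<noteq> {}" by blast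
    have SAdis: "SA CT \<inter> SA CU = {}" and SBdis: "SB CT \<inter> SB CU = {}"
    proof -
      have dis: "CT \<inter> CU = {}" using comp_inter'[of T] False unfolding CT_def[symmetric] by blast
      have *: "\<not> (g ` f \<subseteq> CT \<and> g ` f \<subseteq> CU)" if "f \<noteq> {}" for g :: "node \<Rightarrow> stack_node" and f
      proof -
        from that obtain x where "x \<in> f" by blast
        thus ?thesis using dis by blast
      qed
      have nea: "f \<noteq> {}" if "f \<in> edges a" for f using pm_pair[OF pma that] by blast
      have neb: "f \<noteq> {}" if "f \<in> edges b" for f using pm_pair[OF pmb that] by blast
      show "SA CT \<inter> SA CU = {}" using *[OF nea, of _ upper] unfolding SA_def by blast
      show "SB CT \<inter> SB CU = {}" using *[OF neb, of _ lower] unfolding SB_def by blast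
    qed
    have dW: "component_dec (hook i a) b W = dec (stack n a b) \<epsilon> + dec (stack n a b) \<eta>"
      unfolding dW0 dCT dCU cdec SAun using SAdis SBdis fin by (simp add: sum.union_disjoint)
    show ?thesis
    proof (rule diagram_eqI)
      show "edges (stack n (hook i a) b) = edges (hook i (stack n a b))"
      proof -
        have "{f. f = ?r \<and> f \<noteq> {}} = {?r}" using rne by blast
        thus ?thesis unfolding Eset hookdef if_not_P[OF neq] by simp
      qed
      have "{C \<in> component R' ` ?V. outer -` C = {}} = {C \<in> component R ` ?V - {CT, CU}. outer -` C = {}}"
      proof -
        have 1: "{C. C \<in> insert A (insert B X) \<and> outer -` C = {}} = {C \<in> X. outer -` C = {}}"
          if "outer -` A \<noteq> {}" "outer -` B \<noteq> {}" for A B X using that by blast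
        show ?thesis unfolding comps' by (rule 1) (simp_all only: oTU oW rne, blast+)
      qed
      thus "loops (stack n (hook i a) b) = loops (hook i (stack n a b))"
        unfolding hookdef if_not_P[OF neq] loops_stack R'_def[symmetric] R_def[symmetric] lh loopset
        using oldimg by simp
    next
      fix f assume "f \<in> edges (stack n (hook i a) b)"
      then consider "f = ?c" | "f = ?r" | "f \<in> edges (stack n a b) - {\<epsilon>, \<eta>}" unfolding Eset by blast
      thus "dec (stack n (hook i a) b) f = dec (hook i (stack n a b)) f"
      proof cases
        case 1
        thus ?thesis unfolding hookdef if_not_P[OF neq] using decc by simp
      next
        case 2
        have "f \<noteq> ?c" using xr x unfolding 2 by blast
        moreover have "dec (stack n (hook i a) b) f = component_dec (hook i a) b W"
          using dec'[of W] oW rne unfolding comps' 2 by simp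
        ultimately show ?thesis unfolding hookdef if_not_P[OF neq] using 2 dW by simp
      next
        case 3
        have "f \<noteq> ?r"
        proof
          assume "f = ?r"
          hence "x \<in> f" using xr by simp
          hence "f = \<epsilon>" using pm_disjoint[OF pms _ es(1), of f x] 3 x by blast
          thus False using 3 by blast
        qed
        moreover have "f \<noteq> ?c" using pm_disjoint[OF pms _ es(1), of f "North i"] 3 es(3) by blast
        ultimately show ?thesis unfolding hookdef if_not_P[OF neq] deccases[OF 3] using 3 by simp
      qed
    qed (erule dec_stack_0 matching_diagramD(2)[OF hs])+
  qed
qed

lemma stack_hook:
  assumes "matching_diagram n a" "matching_diagram n b" "matching_diagram n (stack n a b)" "1 \<le> i" "Suc i \<le> n"
  shows "stack n (hook i a) b = hook i (stack n a b)"
  using stack_hook_same[OF assms] stack_hook_diff[OF assms] by blast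

lemma dec_dot: "dec (dot d) f = dec d f + (if f = edge_at d (North 1) then 1 else 0)"
  by (simp add: dot_def)

text \<open>The added decoration lies on the component of \<open>Top 1\<close>, which contains an
  outer node, so no loop is affected.\<close>

lemma stack_dot:
  assumes a: "matching_diagram n a" and b: "matching_diagram n b" and s: "matching_diagram n (stack n a b)" and n: "1 \<le> n"
  shows "stack n (dot a) b = dot (stack n a b)"
proof -
  define e where "e = edge_at a (North 1)"
  let ?R = "stack_adj a b"
  have N1: "North 1 \<in> nodes n" using n by simp
  have e: "e \<in> edges a" "North 1 \<in> e" using edge_at_in[OF a N1] unfolding e_def by auto
  have da: "matching_diagram n (dot a)" by (rule matching_dot[OF a n])
  have ds: "matching_diagram n (dot (stack n a b))" by (rule matching_dot[OF s n])
  have R: "stack_adj (dot a) b = ?R" by (simp add: dot_def stack_adj_def)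
  have eat: "edge_at (stack n a b) (North 1) = outer -` component ?R (Top 1)"
    using edge_at_stack[OF a b s N1] by (simp only: outer.simps)
  have dc: "component_dec (dot a) b (component ?R v) = component_dec a b (component ?R v) + (if Top 1 \<in> component ?R v then 1 else 0)" for v
  proof -
    let ?S = "{f \<in> edges a. upper ` f \<subseteq> component ?R v}"
    have "finite ?S" using finite_matching[OF matching_diagramD(1)[OF a]] by simp
    hence "(\<Sum>f\<in>?S. dec (dot a) f) = (\<Sum>f\<in>?S. dec a f) + (if e \<in> ?S then 1 else 0)"
    proof -
      have "dec (dot a) f = dec a f + (if f = e then 1 else 0)" for f
        by (simp add: dot_def e_def)
      thus ?thesis using \<open>finite ?S\<close> by (simp add: sum.distrib sum.delta)
    qed
    moreover have "e \<in> ?S \<longleftrightarrow> Top 1 \<in> component ?R v"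
      using edge_in_component_upper[OF a e, of b v] e(1) by simp
    moreover have "edges (dot a) = edges a" by (simp add: dot_def)
    ultimately show ?thesis unfolding component_dec_def by simp
  qed
  have E: "edges (stack n (dot a) b) = edges (stack n a b)"
    unfolding edges_stack[OF da b] edges_stack[OF a b] R ..
  show ?thesis
  proof (rule diagram_eqI)
    show "edges (stack n (dot a) b) = edges (dot (stack n a b))" unfolding E by (simp add: dot_def)
    have "image_mset (component_dec (dot a) b) (mset_set {C \<in> component ?R ` stack_nodes n. outer -` C = {}})
        = image_mset (component_dec a b) (mset_set {C \<in> component ?R ` stack_nodes n. outer -` C = {}})"
    proof (rule image_mset_cong)
      fix C assume "C \<in># mset_set {C \<in> component ?R ` stack_nodes n. outer -` C = {}}"
      hence C: "C \<in> component ?R ` stack_nodes n" "outer -` C = {}" by auto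
      hence "North 1 \<notin> outer -` C" by blast
      thus "component_dec (dot a) b C = component_dec a b C" using dc C(1) by auto
    qed
    thus "loops (stack n (dot a) b) = loops (dot (stack n a b))"
      unfolding loops_stack R by (simp add: dot_def loops_stack)
  next
    fix f assume "f \<in> edges (stack n (dot a) b)"
    then obtain x where x: "x \<in> nodes n" "f = outer -` component ?R (outer x)" unfolding E edges_stack[OF a b] by blast
    have 1: "dec (stack n (dot a) b) f = component_dec (dot a) b (component ?R (outer x))"
      using dec_stack[OF da b x(1)] x(2) R by simp
    have 2: "dec (stack n a b) f = component_dec a b (component ?R (outer x))"
      using dec_stack[OF a b x(1)] x(2) by simp
    have "Top 1 \<in> component ?R (outer x) \<longleftrightarrow> f = outer -` component ?R (Top 1)"
    proof
      assume "Top 1 \<in> component ?R (outer x)"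
      thus "f = outer -` component ?R (Top 1)" using component_eq[OF sym_stack_adj] x(2) by metis
    next
      assume "f = outer -` component ?R (Top 1)"
      moreover have "North 1 \<in> outer -` component ?R (Top 1)" by simp
      ultimately have "North 1 \<in> outer -` component ?R (outer x)" using x(2) by blast
      thus "Top 1 \<in> component ?R (outer x)" by simp
    qed
    thus "dec (stack n (dot a) b) f = dec (dot (stack n a b)) f"
      by (simp only: 1 dc dec_dot eat 2)
  qed (erule dec_stack_0 matching_diagramD(2)[OF ds])+
qed

text \<open>An edge \<open>e\<close> of \<open>b\<close> becomes the component made of its copy in
  the lower diagram and of the vertical strands above its north ends; this is the set
  \<open>K e\<close>.\<close>

lemma stack_id_left:
  assumes b: "matching_diagram n b"
  shows "stack n (id_diagram n) b = b"
proof -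
  let ?R = "stack_adj (id_diagram n) b"
  note pmb = matching_diagramD(1)[OF b]
  have R: "(v, w) \<in> ?R \<longleftrightarrow> (\<exists>k\<in>{1..n}. {v, w} = {Top k, Mid k}) \<or> (\<exists>x y. v = lower x \<and> w = lower y \<and> {x, y} \<in> edges b)" for v w
  proof -
    have "(\<exists>x y. v = upper x \<and> w = upper y \<and> {x, y} \<in> edges (id_diagram n)) \<longleftrightarrow> (\<exists>k\<in>{1..n}. {v, w} = {Top k, Mid k})"
    proof
      assume "\<exists>x y. v = upper x \<and> w = upper y \<and> {x, y} \<in> edges (id_diagram n)"
      then obtain x y k where "v = upper x" "w = upper y" "{x, y} = {North k, South k}" "k \<in> {1..n}"
        by (auto simp: id_diagram_def)
      thus "\<exists>k\<in>{1..n}. {v, w} = {Top k, Mid k}" by (auto simp: doubleton_eq_iff)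
    next
      assume "\<exists>k\<in>{1..n}. {v, w} = {Top k, Mid k}"
      then obtain k where k: "k \<in> {1..n}" "v = upper (North k) \<and> w = upper (South k) \<or> v = upper (South k) \<and> w = upper (North k)"
        by (auto simp: doubleton_eq_iff)
      have "{North k, South k} \<in> edges (id_diagram n)" "{South k, North k} \<in> edges (id_diagram n)"
        using k(1) by (auto simp: id_diagram_def)
      thus "\<exists>x y. v = upper x \<and> w = upper y \<and> {x, y} \<in> edges (id_diagram n)" using k(2) by blast
    qed
    thus ?thesis unfolding stack_adj_def by blast
  qed
  define K where "K e = lower ` e \<union> outer ` e" for e :: "node set"
  have outlow: "outer x = lower x \<or> (\<exists>k. x = North k \<and> outer x = Top k \<and> lower x = Mid k)" for x
    by (cases x) auto
  have step: "w \<in> K e" if e: "e \<in> edges b" and v: "v \<in> K e" and vw: "(v, w) \<in> ?R" for e v w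
  proof -
    obtain x where x: "x \<in> e" "v = lower x \<or> v = outer x" using v unfolding K_def by blast
    from vw consider k where "{v, w} = {Top k, Mid k}" | x' y' where "v = lower x'" "w = lower y'" "{x', y'} \<in> edges b"
      unfolding R by blast
    thus ?thesis
    proof cases
      case 1
      hence "x = North k" "w = lower x \<or> w = outer x" using x(2) by (cases x; auto simp: doubleton_eq_iff)+
      thus ?thesis using x(1) unfolding K_def by blast
    next
      case 2
      have "lower x' = lower x"
      proof -
        have "lower x' = outer x \<Longrightarrow> lower x' = lower x" by (cases x; cases x') auto
        thus ?thesis using x(2) 2(1) by auto
      qed
      hence "x' = x" by simp
      hence "e = {x', y'}" using pm_disjoint[OF pmb e 2(3)] x(1) by blast
      thus ?thesis using 2(2) unfolding K_def by blast
    qed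
  qed
  have low_out: "lower x \<in> component ?R (outer x)" if "x \<in> nodes n" for x
  proof (cases x)
    case (North k)
    hence "(outer x, lower x) \<in> ?R" using that unfolding R by auto
    thus ?thesis by (auto simp: component_iff)
  qed (simp add: component_iff)
  have comp: "component ?R (outer x) = K e" if e: "e \<in> edges b" and x: "x \<in> e" for e x
  proof
    show "component ?R (outer x) \<subseteq> K e"
    proof
      fix w assume "w \<in> component ?R (outer x)"
      hence "(outer x, w) \<in> ?R\<^sup>*" by (simp only: component_iff)
      thus "w \<in> K e" by induction (use x step[OF e] in \<open>auto simp: K_def\<close>)
    qed
  next
    obtain u v where uv: "e = {u, v}" using pm_pair[OF pmb e] by blast
    have en: "y \<in> nodes n" if "y \<in> e" for y using pm_ends[OF pmb] e uv that by blast
    have sym: "sym ?R" by (rule sym_stack_adj)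
    have "component ?R (outer y) = component ?R (outer x)" if "y \<in> e" for y
    proof -
      have lo: "component ?R (lower z) = component ?R (outer z)" if "z \<in> e" for z
        using component_eq[OF sym low_out] en that by blast
      have "lower y \<in> component ?R (lower x)"
        using edge_in_component_lower[OF b e that, of "id_diagram n" "lower x"]
          edge_in_component_lower[OF b e x, of "id_diagram n" "lower x"] by simp
      thus ?thesis using component_eq[OF sym] lo that x by metis
    qed
    hence "lower y \<in> component ?R (outer x)" "outer y \<in> component ?R (outer x)" if "y \<in> e" for y
      using low_out[OF en[OF that]] that component_self[of "outer y" ?R] by simp_all
    thus "K e \<subseteq> component ?R (outer x)" unfolding K_def by (intro Un_least image_subsetI)
  qed
  have oK: "outer -` K e = e" if "e \<in> edges b" for e
  proof -
    have ol: "outer x = lower y \<Longrightarrow> x = y" for x y by (cases x; cases y) auto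
    have "outer x \<in> K e \<longleftrightarrow> x \<in> e" for x unfolding K_def by (auto dest: ol)
    thus ?thesis by (intro Set.set_eqI) (simp only: vimage_eq)
  qed
  note mi = matching_id[of n]
  have E: "edges (stack n (id_diagram n) b) = edges b"
  proof -
    have eat: "outer -` component ?R (outer x) = edge_at b x" if "x \<in> nodes n" for x
      using comp[OF edge_at_in[OF b that]] oK[OF edge_at_in(1)[OF b that]] by simp
    have "edges (stack n (id_diagram n) b) = edge_at b ` nodes n" unfolding edges_stack[OF mi b] using eat by auto
    also have "\<dots> = edges b"
    proof (intro equalityI subsetI)
      fix e assume "e \<in> edge_at b ` nodes n" thus "e \<in> edges b" using edge_at_in(1)[OF b] by blast
    next
      fix e assume e: "e \<in> edges b"
      then obtain x y where xy: "e = {x, y}" using pm_pair[OF pmb] by blast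
      hence "x \<in> nodes n" "edge_at b x = e" using pm_ends[OF pmb] e edge_at_eq[OF b e] by auto
      thus "e \<in> edge_at b ` nodes n" by blast
    qed
    finally show ?thesis .
  qed
  have comp_v: "\<exists>x\<in>nodes n. component ?R v = component ?R (outer x)" if "v \<in> stack_nodes n" for v
  proof -
    have sym: "sym ?R" by (rule sym_stack_adj)
    have lo: "component ?R (lower x) = component ?R (outer x)" if "x \<in> nodes n" for x
      using component_eq[OF sym low_out[OF that]] .
    from that consider x where "x \<in> nodes n" "v = upper x" | x where "x \<in> nodes n" "v = lower x" by blast
    thus ?thesis
    proof cases
      case (1 x)
      show ?thesis
      proof (cases x)
        case (North k)
        thus ?thesis using 1 by (intro bexI[of _ x]) simp_all
      next
        case (South k)
        hence "North k \<in> nodes n" "v = lower (North k)" using 1 by auto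
        thus ?thesis using lo by blast
      qed
    next
      case 2
      thus ?thesis using lo by blast
    qed
  qed
  have nol: "{C \<in> component ?R ` stack_nodes n. outer -` C = {}} = {}"
  proof -
    have "outer -` component ?R v \<noteq> {}" if v: "v \<in> stack_nodes n" for v
    proof -
      obtain x where "component ?R v = component ?R (outer x)" using comp_v[OF v] by blast
      hence "x \<in> outer -` component ?R v" by simp
      thus ?thesis by blast
    qed
    thus ?thesis by blast
  qed
  show ?thesis
  proof (rule diagram_eqI)
    show "edges (stack n (id_diagram n) b) = edges b" by (rule E)
    show "loops (stack n (id_diagram n) b) = loops b"
      unfolding loops_stack nol by (simp add: id_diagram_def)
  next
    fix f assume "f \<in> edges (stack n (id_diagram n) b)"
    hence f: "f \<in> edges b" using E by blast
    obtain x y where xy: "f = {x, y}" using pm_pair[OF pmb f] by blast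
    have x: "x \<in> nodes n" "x \<in> f" using pm_ends[OF pmb] f xy by auto
    have "dec (stack n (id_diagram n) b) f = component_dec (id_diagram n) b (K f)"
      using dec_stack[OF mi b x(1)] unfolding comp[OF f x(2)] oK[OF f] .
    also have "{e \<in> edges b. lower ` e \<subseteq> K f} = {f}"
    proof (intro equalityI subsetI)
      fix e assume "e \<in> {e \<in> edges b. lower ` e \<subseteq> K f}"
      hence e: "e \<in> edges b" "lower ` e \<subseteq> K f" by auto
      obtain u v where uv: "e = {u, v}" using pm_pair[OF pmb e(1)] by blast
      hence "lower u \<in> K f" using e(2) by blast
      then obtain z where z: "z \<in> f" "lower u = lower z \<or> lower u = outer z" unfolding K_def by blast
      hence "u = z" by (cases u; cases z) auto
      thus "e \<in> {f}" using pm_disjoint[OF pmb e(1) f, of u] uv z(1) by blast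
    qed (use f in \<open>auto simp: K_def\<close>)
    hence "component_dec (id_diagram n) b (K f) = dec b f"
      unfolding component_dec_def by (simp add: id_diagram_def)
    finally show "dec (stack n (id_diagram n) b) f = dec b f" .
  qed (erule dec_stack_0 matching_diagramD(2)[OF b])+
qed

section \<open>Planarity\<close>

text \<open>Unordered betweenness: two chords cross iff exactly one end of the second lies between
  the ends of the first. This avoids the case distinctions on the order of the ends that
  \<open>planar\<close> would require.\<close>

definition btw :: "nat \<Rightarrow> nat \<Rightarrow> nat \<Rightarrow> bool" where
  "btw a b c \<longleftrightarrow> a < c \<and> c < b \<or> b < c \<and> c < a"

lemma btw_commute: "btw a b c = btw b a c"
  by (auto simp: btw_def)

text \<open>This is the symmetry of crossing; it lets planarity be checked with either of the two
  edges in the first place.\<close>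

lemma btw_sym:
  "distinct [a, b, c, d] \<Longrightarrow> btw a b c = btw a b d \<longleftrightarrow> btw c d a = btw c d b"
  unfolding btw_def by (simp add: not_less) (metis linorder_neq_iff nat_less_le not_less order.strict_trans)

text \<open>Modulo 2 the interval from \<open>p\<close> to \<open>q\<close> is the sum of the
  intervals from \<open>i\<close> to \<open>p\<close> and from \<open>Suc i\<close> to
  \<open>q\<close>, because no position lies between \<open>i\<close> and
  \<open>Suc i\<close>.\<close>

lemma btw_Suc:
  "y \<noteq> i \<Longrightarrow> y \<noteq> Suc i \<Longrightarrow> y \<noteq> p \<Longrightarrow> y \<noteq> q \<Longrightarrow> p \<noteq> i \<Longrightarrow> p \<noteq> Suc i \<Longrightarrow> q \<noteq> i \<Longrightarrow> q \<noteq> Suc i \<Longrightarrow>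
    btw p q y \<longleftrightarrow> (btw i p y \<noteq> btw (Suc i) q y)"
  unfolding btw_def by (cases "y < i"; cases "y < p"; cases "y < q"; simp; linarith)

lemma btw_adjacent [simp]: "\<not> btw i (Suc i) y" "\<not> btw (Suc i) i y"
  by (auto simp: btw_def)

lemma btw_Suc_right:
  "y \<noteq> i \<Longrightarrow> y \<noteq> Suc i \<Longrightarrow> t \<noteq> i \<Longrightarrow> t \<noteq> Suc i \<Longrightarrow> btw y t (Suc i) = btw y t i"
  unfolding btw_def by auto

text \<open>The eight excluded patterns are the ways in which the interlacing of
  \<open>planar\<close> can occur for two edges taken in either order, each in either
  orientation.\<close>

lemma btw_noncrossing:
  assumes "distinct [x, z, y, t]"
    "\<not> (x < y \<and> y < z \<and> z < t)" "\<not> (x < t \<and> t < z \<and> z < y)" "\<not> (z < y \<and> y < x \<and> x < t)" "\<not> (z < t \<and> t < x \<and> x < y)"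
    "\<not> (y < x \<and> x < t \<and> t < z)" "\<not> (y < z \<and> z < t \<and> t < x)" "\<not> (t < x \<and> x < y \<and> y < z)" "\<not> (t < z \<and> z < y \<and> y < x)"
  shows "btw x z y = btw x z t"
  using assms unfolding btw_def by (smt (z3) distinct_length_2_or_more linorder_less_linear)

lemma pos_inj: "x \<in> nodes n \<Longrightarrow> y \<in> nodes n \<Longrightarrow> pos n x = pos n y \<longleftrightarrow> x = y"
  by (cases x; cases y) auto

lemma pos_range: "x \<in> nodes n \<Longrightarrow> 1 \<le> pos n x \<and> pos n x \<le> 2 * n"
  by (cases x) auto

abbreviation between :: "nat \<Rightarrow> node \<Rightarrow> node \<Rightarrow> node \<Rightarrow> bool" where
  "between n x y z \<equiv> btw (pos n x) (pos n y) (pos n z)"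

lemma distinct_edges:
  assumes "perfect_matching n E" "{x, z} \<in> E" "{y, t} \<in> E" "{x, z} \<noteq> {y, t}"
  shows "distinct [pos n x, pos n z, pos n y, pos n t]"
proof -
  have "x \<notin> {y, t}" "z \<notin> {y, t}"
    using pm_disjoint[OF assms(1-3), of x] pm_disjoint[OF assms(1-3), of z] assms(4) by blast+
  moreover have "x \<noteq> z" "y \<noteq> t" using pm_ends[OF assms(1)] assms(2,3) by blast+
  ultimately have "distinct [x, z, y, t]" by auto
  moreover have "{x, z, y, t} \<subseteq> nodes n" using pm_ends[OF assms(1)] assms(2,3) by blast
  ultimately show ?thesis by (auto simp: pos_inj)
qed

lemma planar_iff:
  assumes pm: "perfect_matching n E"
  shows "planar n E \<longleftrightarrow> (\<forall>x z y t. {x, z} \<in> E \<longrightarrow> {y, t} \<in> E \<longrightarrow> {x, z} \<noteq> {y, t} \<longrightarrow>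
            between n x z y = between n x z t)" (is "_ \<longleftrightarrow> ?R")
proof
  assume P: "planar n E"
  show ?R
  proof (intro allI impI)
    fix x z y t assume h: "{x, z} \<in> E" "{y, t} \<in> E" "{x, z} \<noteq> {y, t}"
    have h': "{z, x} \<in> E" "{t, y} \<in> E" using h by (simp_all add: insert_commute)
    have nc: "\<not> (pos n x < pos n y \<and> pos n y < pos n z \<and> pos n z < pos n t)" if "{x, z} \<in> E" "{y, t} \<in> E" for x y z t
      using P that unfolding planar_def by blast
    show "between n x z y = between n x z t"
      by (rule btw_noncrossing[OF distinct_edges[OF pm h]])
        (rule nc; use h h' in simp)+
  qed
next
  assume R: ?R
  show "planar n E" unfolding planar_def
  proof clarify
    fix x y z t assume h: "{x, z} \<in> E" "{y, t} \<in> E" and lt: "pos n x < pos n y" "pos n y < pos n z" "pos n z < pos n t"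
    have "{x, z} \<noteq> {y, t}" using lt by (auto simp: doubleton_eq_iff)
    hence "between n x z y = between n x z t" using R h by blast
    thus False using lt unfolding btw_def by auto
  qed
qed

lemma planarD:
  assumes "perfect_matching n E" "planar n E" "{x, z} \<in> E" "{y, t} \<in> E" "{x, z} \<noteq> {y, t}"
  shows "between n x z y = between n x z t"
  using assms planar_iff by blast

text \<open>Meant for rewirings that keep the edges \<open>D\<close> and introduce two edges
  \<open>f\<close> and \<open>g\<close>: by the symmetry of crossing it suffices to test kept edges
  against the ends of the new ones, and the new ones against each other.\<close>

lemma planarI:
  assumes pm: "perfect_matching n E" and sub: "E \<subseteq> insert f (insert g D)"
    and fg: "f = {a, b}" "g = {c, d}" "between n a b c = between n a b d"
    and D: "\<And>x z y t. {x, z} \<in> D \<Longrightarrow> {y, t} \<in> D \<Longrightarrow> {x, z} \<noteq> {y, t} \<Longrightarrow> between n x z y = between n x z t"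
    and fD: "\<And>x z. {x, z} \<in> D \<Longrightarrow> {x, z} \<in> E \<Longrightarrow> {x, z} \<noteq> f \<Longrightarrow> between n x z a = between n x z b"
    and gD: "\<And>x z. {x, z} \<in> D \<Longrightarrow> {x, z} \<in> E \<Longrightarrow> {x, z} \<noteq> g \<Longrightarrow> between n x z c = between n x z d"
  shows "planar n E"
proof -
  have key: "between n x z y = between n x z t"
    if h: "{x, z} \<in> E" "{y, t} \<in> E" "{x, z} \<noteq> {y, t}" "{x, z} \<in> D" for x z y t
  proof -
    have "{y, t} = f \<or> {y, t} = g \<or> {y, t} \<in> D" using h(2) sub by blast
    thus ?thesis
    proof (elim disjE)
      assume "{y, t} = f"
      thus ?thesis using fD[OF h(4,1)] h(3) fg(1) by (auto simp: doubleton_eq_iff)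
    next
      assume "{y, t} = g"
      thus ?thesis using gD[OF h(4,1)] h(3) fg(2) by (auto simp: doubleton_eq_iff)
    next
      assume "{y, t} \<in> D" thus ?thesis using D h by blast
    qed
  qed
  show ?thesis unfolding planar_iff[OF pm]
  proof (intro allI impI)
    fix x z y t assume h: "{x, z} \<in> E" "{y, t} \<in> E" "{x, z} \<noteq> {y, t}"
    have sym: "between n x z y = between n x z t \<longleftrightarrow> between n y t x = between n y t z"
      by (rule btw_sym[OF distinct_edges[OF pm h]])
    consider "{x, z} \<in> D" | "{y, t} \<in> D" | "{x, z} \<in> {f, g}" "{y, t} \<in> {f, g}" using h sub by blast
    thus "between n x z y = between n x z t"
    proof cases
      case 1 thus ?thesis using key h by blast
    next
      case 2 thus ?thesis using key[of y t x z] h sym by auto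
    next
      case 3
      hence "{x, z} = f \<and> {y, t} = g \<or> {x, z} = g \<and> {y, t} = f" using h(3) by auto
      thus ?thesis
      proof
        assume "{x, z} = f \<and> {y, t} = g"
        thus ?thesis using fg by (auto simp: doubleton_eq_iff btw_commute)
      next
        assume "{x, z} = g \<and> {y, t} = f"
        hence "between n y t x = between n y t z" using fg by (auto simp: doubleton_eq_iff btw_commute)
        thus ?thesis using sym by blast
      qed
    qed
  qed
qed

lemma left_exposed_iff:
  "left_exposed n E {y, t} \<longleftrightarrow> (\<forall>u v. {u, v} \<in> E \<longrightarrow> \<not> (between n u v y \<and> between n u v t))"
proof
  assume L: "left_exposed n E {y, t}"
  show "\<forall>u v. {u, v} \<in> E \<longrightarrow> \<not> (between n u v y \<and> between n u v t)"
  proof (intro allI impI notI)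
    fix u v assume h: "{u, v} \<in> E" "between n u v y \<and> between n u v t"
    have h': "{v, u} \<in> E" using h(1) by (simp add: insert_commute)
    have "(pos n u < pos n y \<and> pos n y < pos n v \<and> pos n u < pos n t \<and> pos n t < pos n v) \<or>
          (pos n v < pos n y \<and> pos n y < pos n u \<and> pos n v < pos n t \<and> pos n t < pos n u)"
      using h(2) unfolding btw_def by linarith
    thus False using L h(1) h' unfolding left_exposed_def by blast
  qed
next
  assume R: "\<forall>u v. {u, v} \<in> E \<longrightarrow> \<not> (between n u v y \<and> between n u v t)"
  show "left_exposed n E {y, t}" unfolding left_exposed_def
  proof clarify
    fix u v assume "{u, v} \<in> E" "\<forall>z\<in>{y, t}. pos n u < pos n z \<and> pos n z < pos n v"
    thus False using R unfolding btw_def by blast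
  qed
qed

text \<open>Like \<open>diagrams\<close>, but without the rule that a diagram without caps is
  undecorated: \<open>dot\<close> of the identity breaks that rule, while this larger class is
  closed under \<open>hook\<close>, \<open>dot\<close> and stacking.\<close>

definition dplus :: "nat \<Rightarrow> diagram \<Rightarrow> bool" where
  "dplus n d \<longleftrightarrow> matching_diagram n d \<and> planar n (edges d) \<and>
     (\<forall>e\<in>edges d. dec d e > 0 \<longrightarrow> left_exposed n (edges d) e)"

lemma dplusD:
  assumes "dplus n d"
  shows "matching_diagram n d" "planar n (edges d)" "e \<in> edges d \<Longrightarrow> dec d e > 0 \<Longrightarrow> left_exposed n (edges d) e"
    "perfect_matching n (edges d)"
  using assms by (auto simp: dplus_def matching_diagram_def)

lemma insert2_cases:
  assumes "e \<in> insert a (insert b D)"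
  obtains "e = a" | "e \<noteq> a" "e = b" | "e \<noteq> a" "e \<noteq> b" "e \<in> D"
  using assms by blast

text \<open>The joined edge runs along its two parents. Whatever separates it from the left wall
  therefore separates both of them, and by \<open>btw_Suc\<close> an edge enclosed by it was
  enclosed by one of them.\<close>

lemma dplus_hook:
  assumes d: "dplus n d" and i: "1 \<le> i" "Suc i \<le> n"
  shows "dplus n (hook i d)"
proof -
  note m = dplusD(1)[OF d] and pl = dplusD(2)[OF d] and ex = dplusD(3)[OF d] and pm = dplusD(4)[OF d]
  have hm: "matching_diagram n (hook i d)" by (rule matching_hook[OF m i])
  show ?thesis
  proof (cases "{North i, North (Suc i)} \<in> edges d")
    case True
    thus ?thesis using d hm unfolding dplus_def hook_same[OF m True] by auto
  next
    case False
    obtain p where p: "{North i, p} \<in> edges d" using pm_partner[OF pm] i by force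
    obtain q where q: "{North (Suc i), q} \<in> edges d" using pm_partner[OF pm] i by force
    have pj: "p \<noteq> North (Suc i)" using p False by blast
    note h = hook_diff[OF m p q pj]
    let ?c = "{North i, North (Suc i)}" and ?a = "{North i, p}" and ?b = "{North (Suc i), q}"
    let ?D = "edges d - {?a, ?b}" and ?E = "edges (hook i d)"
    have E: "?E = insert ?c (insert {p, q} ?D)" unfolding h(1) by simp
    have ab: "?a \<noteq> ?b" using pj by (auto simp: doubleton_eq_iff)
    have off: "distinct [i, pos n p, pos n y, pos n t]" "distinct [Suc i, pos n q, pos n y, pos n t]"
      if "{y, t} \<in> ?D" for y t
      using distinct_edges[OF pm p, of y t] distinct_edges[OF pm q, of y t] that by auto
    have pp: "pos n p \<noteq> i" "pos n p \<noteq> Suc i" "pos n q \<noteq> i" "pos n q \<noteq> Suc i"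
      using distinct_edges[OF pm p q ab] by auto
    have Na: "between n y t (North (Suc i)) = between n y t (North i)" if "{y, t} \<in> ?D" for y t
      using off[OF that] btw_Suc_right[of "pos n y" i "pos n t"] by auto
    have ya: "between n y t (North i) = between n y t p" if "{y, t} \<in> ?D" for y t
      by (rule planarD[OF pm pl _ p]) (use that in auto)
    have yb: "between n y t (North (Suc i)) = between n y t q" if "{y, t} \<in> ?D" for y t
      by (rule planarD[OF pm pl _ q]) (use that in auto)
    have pl': "planar n ?E"
    proof (rule planarI[OF matching_diagramD(1)[OF hm]])
      show "?E \<subseteq> insert ?c (insert {p, q} ?D)" unfolding E by (rule subset_refl)
      show "between n (North i) (North (Suc i)) p = between n (North i) (North (Suc i)) q" by simp
      show "between n x z y = between n x z t" if "{x, z} \<in> ?D" "{y, t} \<in> ?D" "{x, z} \<noteq> {y, t}" for x z y t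
        by (rule planarD[OF pm pl _ _ that(3)]) (use that in simp_all)
      show "between n x z (North i) = between n x z (North (Suc i))" if "{x, z} \<in> ?D" for x z
        using Na[OF that] by simp
      show "between n x z p = between n x z q" if "{x, z} \<in> ?D" for x z
        using ya[OF that] yb[OF that] Na[OF that] by simp
    qed auto
    have "left_exposed n ?E e" if e: "e \<in> ?E" "dec (hook i d) e > 0" for e
    proof -
      from e(2) have nc: "e \<noteq> ?c" unfolding h(1) by auto
      consider "e = {p, q}" | "e \<in> ?D" "e \<noteq> {p, q}"
        by (rule insert2_cases[OF e(1)[unfolded E]]) (use nc in simp_all)
      thus ?thesis
      proof cases
        case 1
        hence pos: "dec d ?a > 0 \<or> dec d ?b > 0" using e(2) nc unfolding h(1) by auto
        have "\<not> (between n u v p \<and> between n u v q)" if uv: "{u, v} \<in> ?E" for u v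
        proof -
          consider "{u, v} = ?c" | "{u, v} = {p, q}" | "{u, v} \<in> ?D"
            by (rule insert2_cases[OF uv[unfolded E]]) simp_all
          thus ?thesis
          proof cases
            case 1
            thus ?thesis by (auto simp: doubleton_eq_iff)
          next
            case 2
            thus ?thesis by (auto simp: doubleton_eq_iff btw_def)
          next
            case 3
            hence uvE: "{u, v} \<in> edges d" by simp
            from pos show ?thesis
            proof
              assume "dec d ?a > 0"
              hence "\<not> (between n u v (North i) \<and> between n u v p)" using ex[OF p] uvE left_exposed_iff by blast
              thus ?thesis using ya[OF 3] by simp
            next
              assume "dec d ?b > 0"
              hence "\<not> (between n u v (North (Suc i)) \<and> between n u v q)" using ex[OF q] uvE left_exposed_iff by blast
              thus ?thesis using yb[OF 3] by simp
            qed
          qed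
        qed
        thus ?thesis unfolding 1 left_exposed_iff by blast
      next
        case 2
        have "dec d e > 0" using e(2) 2 nc unfolding h(1) by (auto split: if_splits)
        hence exe: "left_exposed n (edges d) e" using 2 ex by blast
        obtain y t where yt: "e = {y, t}" using pm_pair[OF pm] 2 by blast
        have D: "{y, t} \<in> ?D" using 2 yt by blast
        have "\<not> (between n u v y \<and> between n u v t)" if uv: "{u, v} \<in> ?E" for u v
        proof -
          have npq: "\<not> (between n p q y \<and> between n p q t)"
          proof
            assume pq: "between n p q y \<and> between n p q t"
            have neyt: "{North i, p} \<noteq> {y, t}" "{North (Suc i), q} \<noteq> {y, t}" using D by auto
            have ytE: "{y, t} \<in> edges d" using D by simp
            have "between n (North i) p y = between n (North i) p t"
              "between n (North (Suc i)) q y = between n (North (Suc i)) q t"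
              by (rule planarD[OF pm pl p ytE neyt(1)], rule planarD[OF pm pl q ytE neyt(2)])
            moreover have "between n (North i) p y \<or> between n (North (Suc i)) q y"
              using pq btw_Suc[of "pos n y" i "pos n p" "pos n q"] off[OF D] pp by auto
            moreover have "\<not> (between n (North i) p y \<and> between n (North i) p t)"
              "\<not> (between n (North (Suc i)) q y \<and> between n (North (Suc i)) q t)"
              using exe p q unfolding yt left_exposed_iff by blast+
            ultimately show False by simp
          qed
          consider "{u, v} = ?c" | "{u, v} = {p, q}" | "{u, v} \<in> ?D"
            by (rule insert2_cases[OF uv[unfolded E]]) simp_all
          then show ?thesis
          proof cases
            case 1
            thus ?thesis by (auto simp: doubleton_eq_iff)
          next
            case 2
            thus ?thesis using npq by (auto simp: doubleton_eq_iff btw_commute)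
          next
            case 3
            thus ?thesis using exe unfolding yt left_exposed_iff by blast
          qed
        qed
        thus ?thesis unfolding yt left_exposed_iff by blast
      qed
    qed
    thus ?thesis using pl' hm unfolding dplus_def by blast
  qed
qed

text \<open>An enclosing edge would need an end at a position before 1.\<close>

lemma left_exposed_North1:
  assumes pm: "perfect_matching n E" and e: "e \<in> E" "North 1 \<in> e"
  shows "left_exposed n E e"
  unfolding left_exposed_def
proof clarify
  fix x y assume "{x, y} \<in> E" "\<forall>z\<in>e. pos n x < pos n z \<and> pos n z < pos n y"
  hence "x \<in> nodes n" "pos n x < 1" using pm_ends[OF pm] e(2) by force+
  thus False using pos_range[of x n] by simp
qed

lemma dplus_dot:
  assumes d: "dplus n d" and n: "1 \<le> n"
  shows "dplus n (dot d)"
proof -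
  note m = dplusD(1)[OF d]
  have N: "North 1 \<in> nodes n" using n by simp
  have "left_exposed n (edges d) (edge_at d (North 1))"
    by (rule left_exposed_North1[OF dplusD(4)[OF d] edge_at_in[OF m N]])
  thus ?thesis using d matching_dot[OF m n] unfolding dplus_def by (auto simp: dot_def)
qed

lemma dplus_add_loops: "dplus n d \<Longrightarrow> dplus n (add_loops L d)"
  by (auto simp: dplus_def add_loops_def matching_diagram_def)

lemma dplus_id: "dplus n (id_diagram n)"
proof -
  have "planar n (edges (id_diagram n))"
    unfolding planar_def id_diagram_def by (auto simp: doubleton_eq_iff)
  thus ?thesis using matching_id unfolding dplus_def by (simp add: id_diagram_def)
qed

section \<open>Factorisation of planar diagrams\<close>

text \<open>The side condition on \<open>hook\<close> rules out new loops. Induction over this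
  predicate replaces arguments about arbitrary planar pictures, because
  \<open>dplus_loopless\<close> shows that it covers all loop-free ones.\<close>

inductive loopless :: "nat \<Rightarrow> diagram \<Rightarrow> bool" for n where
  id: "loopless n (id_diagram n)"
| dot: "loopless n d \<Longrightarrow> loopless n (dot d)"
| hook: "loopless n d \<Longrightarrow> 1 \<le> i \<Longrightarrow> Suc i \<le> n \<Longrightarrow> {North i, North (Suc i)} \<notin> edges d \<Longrightarrow> loopless n (hook i d)"

fun col :: "node \<Rightarrow> nat" where
  "col (North i) = i"
| "col (South i) = i"

text \<open>The horizontal length of an edge, where a decorated edge is imagined to run to the left
  wall at column 0 and back. Undoing a hook shortens the total.\<close>

definition edge_weight :: "diagram \<Rightarrow> node set \<Rightarrow> nat" where
  "edge_weight d e = (if dec d e > 0 then \<Sum>x\<in>e. col x else Max (col ` e) - Min (col ` e))"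

definition weight :: "diagram \<Rightarrow> nat" where
  "weight d = (\<Sum>e\<in>edges d. edge_weight d e)"

lemma edge_weight_pair:
  "x \<noteq> y \<Longrightarrow> edge_weight d {x, y} = (if dec d {x, y} > 0 then col x + col y else max (col x) (col y) - min (col x) (col y))"
  by (simp add: edge_weight_def max_def min_def)

lemma dot_funpow:
  "(dot ^^ k) d = d\<lparr>dec := (dec d)(edge_at d (North 1) := dec d (edge_at d (North 1)) + k)\<rparr>"
proof (induction k)
  case (Suc k)
  have "edge_at (d\<lparr>dec := f\<rparr>) x = edge_at d x" for f x by (simp add: edge_at_def)
  hence "dot (d\<lparr>dec := (dec d)(edge_at d (North 1) := dec d (edge_at d (North 1)) + k)\<rparr>) =
      d\<lparr>dec := (dec d)(edge_at d (North 1) := dec d (edge_at d (North 1)) + Suc k)\<rparr>"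
    by (intro diagram.equality ext) (auto simp: dot_def)
  thus ?case using Suc by (simp add: fun_upd_def)
qed simp

lemma loopless_funpow_dot: "loopless n d \<Longrightarrow> loopless n ((dot ^^ k) d)"
  by (induction k) (auto intro: loopless.dot)

text \<open>The partner of the node next to \<open>a\<close> is trapped under the cap, so descent on
  the width ends at a cap of width one.\<close>

lemma cap_between:
  assumes d: "perfect_matching n E" "planar n E"
  shows "{North a, North b} \<in> E \<Longrightarrow> a < b \<Longrightarrow> \<exists>k. a \<le> k \<and> k < b \<and> {North k, North (Suc k)} \<in> E"
proof (induction "b - a" arbitrary: a b rule: less_induct)
  case less
  have nb: "1 \<le> a" "b \<le> n" using pm_ends[OF d(1) less(2)] by auto
  show ?case
  proof (cases "b = Suc a")
    case True
    thus ?thesis using less by auto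
  next
    case False
    hence ab: "Suc a < b" using less by simp
    obtain y where y: "{North (Suc a), y} \<in> E" using pm_partner[OF d(1), of "North (Suc a)"] ab nb by auto
    have ne: "{North a, North b} \<noteq> {North (Suc a), y}" using ab by (auto simp: doubleton_eq_iff)
    have "between n (North a) (North b) (North (Suc a)) = between n (North a) (North b) y"
      by (rule planarD[OF d less(2) y ne])
    hence B: "between n (North a) (North b) y" using ab unfolding btw_def by simp
    have yn: "y \<in> nodes n" "y \<noteq> North (Suc a)" using pm_ends[OF d(1) y] by auto
    obtain c where c: "y = North c" using B nb yn ab unfolding btw_def by (cases y) auto
    have "a < c" "c < b" "c \<noteq> Suc a" using B c yn ab unfolding btw_def by auto
    hence "\<exists>k. Suc a \<le> k \<and> k < c \<and> {North k, North (Suc k)} \<in> E"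
      using less(1)[of c "Suc a"] y c ab by auto
    thus ?thesis using \<open>c < b\<close> by (meson Suc_leD order.strict_trans)
  qed
qed

text \<open>Without caps every north node goes to a south node, and planarity makes this map
  strictly increasing on \<open>{1..n}\<close>; such a map is the identity.\<close>

lemma no_caps_edges:
  assumes d: "perfect_matching n E" "planar n E" and no: "\<And>i j. {North i, North j} \<notin> E"
  shows "E = {{North j, South j} | j. j \<in> {1..n}}"
proof -
  have "\<exists>y. {North k, South y} \<in> E \<and> y \<in> {1..n}" if "k \<in> {1..n}" for k
  proof -
    obtain z where z: "{North k, z} \<in> E" using pm_partner[OF d(1), of "North k"] \<open>k \<in> {1..n}\<close> by auto
    hence "z \<in> nodes n" using pm_ends[OF d(1)] by blast
    thus ?thesis using z no by (cases z) auto
  qed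
  then obtain f where f: "\<And>k. k \<in> {1..n} \<Longrightarrow> {North k, South (f k)} \<in> E \<and> f k \<in> {1..n}" by metis
  have mono: "f k < f l" if kl: "k \<in> {1..n}" "l \<in> {1..n}" "k < l" for k l
  proof -
    have E: "{North k, South (f k)} \<in> E" "{North l, South (f l)} \<in> E" "f k \<in> {1..n}" "f l \<in> {1..n}"
      using f kl by auto
    have ne: "{North k, South (f k)} \<noteq> {North l, South (f l)}" using kl(3) by (auto simp: doubleton_eq_iff)
    have "between n (North k) (South (f k)) (North l) = between n (North k) (South (f k)) (South (f l))"
      by (rule planarD[OF d E(1,2) ne])
    moreover have "f k \<noteq> f l" using distinct_edges[OF d(1) E(1,2) ne] by auto
    ultimately show ?thesis using E(3,4) kl unfolding btw_def by auto
  qed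
  have lower: "k \<in> {1..n} \<Longrightarrow> k \<le> f k" for k
  proof (induction k)
    case (Suc k)
    show ?case
    proof (cases "k = 0")
      case True thus ?thesis using f[OF Suc(2)] by auto
    next
      case False
      hence "k \<in> {1..n}" using Suc by auto
      thus ?thesis using Suc mono[of k "Suc k"] by auto
    qed
  qed simp
  have upper: "j < n \<Longrightarrow> f (n - j) \<le> n - j" for j
  proof (induction j)
    case 0
    thus ?case using f[of n] by auto
  next
    case (Suc j)
    hence "f (n - Suc j) < f (n - j)" by (intro mono) auto
    thus ?case using Suc by auto
  qed
  have fk: "f k = k" if "k \<in> {1..n}" for k
    using lower[OF that] upper[of "n - k"] that by auto
  have ver: "{North k, South k} \<in> E" if "k \<in> {1..n}" for k using f[OF that] fk[OF that] by simp
  show ?thesis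
  proof (intro equalityI subsetI)
    fix e assume e: "e \<in> E"
    obtain x y where xy: "e = {x, y}" using pm_pair[OF d(1) e] by blast
    have x: "x \<in> nodes n" using pm_ends[OF d(1)] e xy by blast
    define k where "k = col x"
    have k: "k \<in> {1..n}" "x \<in> {North k, South k}" using x unfolding k_def by (cases x; auto)+
    have "e = {North k, South k}" by (rule pm_disjoint[OF d(1) e ver[OF k(1)] _ k(2)]) (simp add: xy)
    thus "e \<in> {{North j, South j} | j. j \<in> {1..n}}" using k(1) by blast
  next
    fix e assume "e \<in> {{North j, South j} | j. j \<in> {1..n}}"
    thus "e \<in> E" using ver by blast
  qed
qed

text \<open>A set closed under partners is a disjoint union of edges, each with two nodes.\<close>

lemma even_card_union:
  assumes pm: "perfect_matching n E" and X: "X \<subseteq> nodes n" and cl: "\<And>x y. x \<in> X \<Longrightarrow> {x, y} \<in> E \<Longrightarrow> y \<in> X"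
  shows "even (card X)"
proof -
  let ?F = "{e \<in> E. e \<subseteq> X}"
  have fin: "finite X" using X finite_nodes by (rule finite_subset)
  have U: "\<Union>?F = X"
  proof (intro equalityI subsetI)
    fix x assume x: "x \<in> X"
    then obtain y where y: "{x, y} \<in> E" using pm_partner[OF pm] X by blast
    hence "{x, y} \<subseteq> X" using cl x by blast
    thus "x \<in> \<Union>?F" using y by blast
  qed auto
  have "2 * card ?F = card (\<Union>?F)"
  proof (rule card_partition)
    show "finite ?F" using finite_matching[OF pm] by simp
    show "finite (\<Union>?F)" unfolding U by (rule fin)
    show "card c = 2" if "c \<in> ?F" for c using pm that unfolding perfect_matching_def by auto
    show "c1 \<inter> c2 = {}" if "c1 \<in> ?F" "c2 \<in> ?F" "c1 \<noteq> c2" for c1 c2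
      using pm_disjoint[OF pm] that by blast
  qed
  thus ?thesis unfolding U by (metis dvd_triv_left)
qed

text \<open>If \<open>i\<close> were larger than 1, the edge at node 1 could not enclose the
  decorated cap, so it would have to end to the left of it and thereby enclose or be a cap still
  further left.\<close>

lemma leftmost_cap_decorated:
  assumes d: "dplus n d" and cap: "{North i, North (Suc i)} \<in> edges d" "dec d {North i, North (Suc i)} > 0"
    and least: "\<And>j. {North j, North (Suc j)} \<in> edges d \<Longrightarrow> i \<le> j"
  shows "i = 1"
proof (rule ccontr)
  assume ne: "i \<noteq> 1"
  note pm = dplusD(4)[OF d] and pl = dplusD(2)[OF d]
  have i: "1 < i" "Suc i \<le> n" using pm_ends[OF pm cap(1)] ne by auto
  obtain y where y: "{North 1, y} \<in> edges d" using pm_partner[OF pm, of "North 1"] i by auto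
  have yn: "y \<in> nodes n" "y \<noteq> North 1" using pm_ends[OF pm y] by auto
  have nec: "{North 1, y} \<noteq> {North i, North (Suc i)}" using i by (auto simp: doubleton_eq_iff)
  have dist: "distinct [1, pos n y, i, Suc i]" using distinct_edges[OF pm y cap(1) nec] by simp
  have "\<not> (between n (North 1) y (North i) \<and> between n (North 1) y (North (Suc i)))"
    using dplusD(3)[OF d cap] y unfolding left_exposed_iff by blast
  hence "pos n y < i" using dist i unfolding btw_def by auto
  then obtain c where c: "y = North c" "c < i" using i yn by (cases y) auto
  hence "1 < c" using yn by auto
  then obtain k where "k < c" "{North k, North (Suc k)} \<in> edges d"
    using cap_between[OF pm pl] y c by blast
  thus False using least c by force
qed


lemma insert2_disjoint:
  assumes "A \<inter> B = {}" "\<And>g. g \<in> D \<Longrightarrow> A \<inter> g = {}" "\<And>g. g \<in> D \<Longrightarrow> B \<inter> g = {}"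
    "\<And>g h. g \<in> D \<Longrightarrow> h \<in> D \<Longrightarrow> x \<in> g \<Longrightarrow> x \<in> h \<Longrightarrow> g = h"
    "e \<in> insert A (insert B D)" "f \<in> insert A (insert B D)" "x \<in> e" "x \<in> f"
  shows "e = f"
  using assms by blast

lemma exists_exposed_edge:
  assumes pm: "perfect_matching n (edges d)" and cap: "{North i, North (Suc i)} \<in> edges d"
  shows "\<exists>x y. {x, y} \<in> edges d \<and> x \<noteq> North (Suc i) \<and> Suc i \<le> col x \<and> (col y \<le> i \<or> dec d {x, y} > 0)"
proof (rule ccontr)
  assume contra: "\<not> ?thesis"
  have i: "1 \<le> i" "Suc i \<le> n" using pm_ends[OF pm cap] by auto
  let ?X = "{x \<in> nodes n. Suc i \<le> col x} - {North (Suc i)}"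
  have "{x \<in> nodes n. Suc i \<le> col x} = North ` {Suc i..n} \<union> South ` {Suc i..n}"
    unfolding nodes_def using i by auto
  moreover have "card (North ` {Suc i..n} \<union> South ` {Suc i..n}) = (n - i) + (n - i)"
    by (subst card_Un_disjoint) (auto simp: card_image inj_on_def)
  ultimately have "card {x \<in> nodes n. Suc i \<le> col x} = 2 * (n - i)" by simp
  moreover have "North (Suc i) \<in> {x \<in> nodes n. Suc i \<le> col x}" using i by simp
  ultimately have odd: "odd (card ?X)" using i by (simp add: card_Diff_singleton)
  have "even (card ?X)"
  proof (rule even_card_union[OF pm])
    show "?X \<subseteq> nodes n" by blast
    fix x y assume x: "x \<in> ?X" and xy: "{x, y} \<in> edges d"
    have "\<not> col y \<le> i" using contra x xy by blast
    moreover have "y \<noteq> North (Suc i)"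
    proof
      assume "y = North (Suc i)"
      hence "{x, y} = {North i, North (Suc i)}" using pm_disjoint[OF pm xy cap, of y] by simp
      hence "x = North i" using x \<open>y = North (Suc i)\<close> by (auto simp: doubleton_eq_iff)
      thus False using x by simp
    qed
    ultimately show "y \<in> ?X" using pm_ends[OF pm xy] by simp
  qed
  thus False using odd by blast
qed

text \<open>The cap is undone by cutting another edge \<open>{p, q}\<close> and joining its ends to
  the two nodes of the cap. The end \<open>q\<close> is the first node, clockwise from the cap, in
  the columns beyond \<open>i\<close> whose edge is decorated or leaves these columns; so the edge
  can be reached from the cap without crossing anything. Its decorations stay on the part at
  \<open>North i\<close>, the one nearer to the left wall.\<close>

lemma unhook:
  assumes d: "dplus n d" and cap: "{North i, North (Suc i)} \<in> edges d" and und: "dec d {North i, North (Suc i)} = 0"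
  obtains d' where "dplus n d'" "hook i d' = d" "{North i, North (Suc i)} \<notin> edges d'" "loops d' = loops d" "weight d' < weight d"
proof -
  note m = dplusD(1)[OF d] and pl = dplusD(2)[OF d] and ex = dplusD(3)[OF d] and pm = dplusD(4)[OF d]
  let ?c = "{North i, North (Suc i)}"
  have i: "1 \<le> i" "Suc i \<le> n" using pm_ends[OF pm cap] by auto
  define good where "good x \<longleftrightarrow> x \<noteq> North (Suc i) \<and> Suc i \<le> col x \<and>
      (\<exists>y. {x, y} \<in> edges d \<and> (col y \<le> i \<or> dec d {x, y} > 0))" for x
  have "\<exists>x. good x" using exists_exposed_edge[OF pm cap] unfolding good_def by blast
  then obtain q where q: "good q" "\<And>x. good x \<Longrightarrow> pos n q \<le> pos n x"
    using ex_has_least_nat[of good _ "pos n"] by metis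
  then obtain p where p: "{q, p} \<in> edges d" "col p \<le> i \<or> dec d {q, p} > 0" unfolding good_def by blast
  have qj: "q \<noteq> North (Suc i)" "Suc i \<le> col q" using q(1) unfolding good_def by blast+
  have pqn: "p \<noteq> q" "p \<in> nodes n" "q \<in> nodes n" using pm_ends[OF pm p(1)] by auto
  have pq: "{p, q} \<in> edges d" "{p, q} = {q, p}" using p(1) by (simp_all add: insert_commute)
  have qi: "q \<noteq> North i" using qj by auto
  have cpq: "?c \<noteq> {p, q}" using qj qi by (auto simp: doubleton_eq_iff)
  have dist: "distinct [i, Suc i, pos n p, pos n q]"
    using distinct_edges[OF pm cap pq(1) cpq] by simp
  have pne: "p \<noteq> North i" "p \<noteq> North (Suc i)" using dist by auto
  \<comment> \<open>The columns beyond \<open>i\<close> form one interval of boundary positions,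
    from \<open>Suc i\<close> to \<open>2 * n - i\<close>.\<close>
  have right_pos: "Suc i \<le> col x \<longleftrightarrow> i < pos n x \<and> pos n x \<le> 2 * n - i" if "x \<in> nodes n" for x
    using that i by (cases x) auto
  have qpos: "Suc i < pos n q" "pos n q \<le> 2 * n - i" using right_pos[OF pqn(3)] qj(2) dist by auto
  let ?a = "{North i, p}" and ?b = "{North (Suc i), q}"
  let ?D = "edges d - {?c, {p, q}}"
  \<comment> \<open>By minimality of \<open>q\<close>, edges with an end strictly between the cap
    and \<open>q\<close> are undecorated and have their other end in the columns beyond
    \<open>i\<close>.\<close>
  have minl: "Suc i \<le> col t \<and> dec d {y, t} = 0" if "{y, t} \<in> edges d" "Suc i < pos n y" "pos n y < pos n q" for y t
  proof -
    have yn: "y \<in> nodes n" using pm_ends[OF pm that(1)] by blast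
    have "\<not> good y" using q(2)[of y] that(3) by auto
    moreover have "y \<noteq> North (Suc i)" "Suc i \<le> col y" using right_pos[OF yn] that qpos by auto
    ultimately show ?thesis using that(1) unfolding good_def by auto
  qed
  \<comment> \<open>If \<open>p\<close> were between the cap and \<open>q\<close>, it would lie in
    the columns beyond \<open>i\<close> on an undecorated edge, contrary to the choice of the
    edge.\<close>
  have ppos: "pos n p < i \<or> pos n q < pos n p"
  proof (rule ccontr)
    assume "\<not> ?thesis"
    hence "Suc i < pos n p" "pos n p < pos n q" using dist by auto
    hence h: "Suc i \<le> col q \<and> dec d {p, q} = 0" and "Suc i \<le> col p" using minl[OF pq(1)] right_pos[OF pqn(2)] qpos by auto
    thus False using p(2) pq(2) by simp
  qed
  have pright: "dec d {p, q} > 0" if "pos n p \<le> 2 * n - i" "pos n q < pos n p"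
  proof -
    have "Suc i \<le> col p" using right_pos[OF pqn(2)] that qpos by auto
    thus ?thesis using p(2) pq(2) by simp
  qed
  have off: "distinct [i, Suc i, pos n y, pos n t]" "distinct [pos n p, pos n q, pos n y, pos n t]"
    if "{y, t} \<in> ?D" for y t
    using distinct_edges[OF pm cap, of y t] distinct_edges[OF pm pq(1), of y t] that by auto
  have yt_pq: "between n y t p = between n y t q" "between n p q y = between n p q t" if "{y, t} \<in> ?D" for y t
  proof -
    have "{y, t} \<in> edges d" "{y, t} \<noteq> {p, q}" using that by auto
    thus "between n y t p = between n y t q" "between n p q y = between n p q t"
      using planarD[OF pm pl _ pq(1), of y t] planarD[OF pm pl pq(1), of y t] by metis+
  qed
  have yt_ij: "between n y t (North (Suc i)) = between n y t (North i)" if "{y, t} \<in> ?D" for y t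
    using off(1)[OF that] btw_Suc_right[of "pos n y" i "pos n t"] by auto
  have expq: "\<not> (between n u v p \<and> between n u v q)" if "dec d {p, q} > 0" "{u, v} \<in> edges d" for u v
    using ex[OF pq(1) that(1)] that(2) unfolding left_exposed_iff by blast
  \<comment> \<open>A kept edge with exactly one end between \<open>i\<close> and \<open>p\<close>
    would cross \<open>{p, q}\<close>, or leave the columns beyond \<open>i\<close> from a node
    before \<open>q\<close>, or separate a decorated \<open>{p, q}\<close> from the left
    wall.\<close>
  have half: False if yt: "{y, t} \<in> ?D" and y: "between n (North i) p y" and t: "\<not> between n (North i) p t" for y t
  proof -
    have E: "{y, t} \<in> edges d" "{t, y} \<in> edges d" using yt by (auto simp: insert_commute)
    have yn: "y \<in> nodes n" "t \<in> nodes n" using pm_ends[OF pm E(1)] by auto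
    note o = off[OF yt] and pqyt = yt_pq[OF yt]
    from ppos show False
    proof
      assume pi: "pos n p < i"
      hence y': "pos n p < pos n y" "pos n y < i" using y unfolding btw_def by auto
      hence "between n p q y" using qpos unfolding btw_def by auto
      hence "between n p q t" using pqyt by blast
      hence "Suc i < pos n t" "pos n t < pos n q" using t pi qpos o unfolding btw_def by auto
      hence "Suc i \<le> col y" using minl[OF E(2)] by blast
      thus False using right_pos[OF yn(1)] y' by auto
    next
      assume qp: "pos n q < pos n p"
      hence y': "Suc i < pos n y" "pos n y < pos n p" using y o qpos unfolding btw_def by auto
      have "pos n y \<noteq> pos n q" using o by auto
      show False
      proof (cases "pos n y < pos n q")
        case True
        hence "Suc i \<le> col t" using minl[OF E(1)] y' by blast
        hence t': "i < pos n t" "pos n t \<le> 2 * n - i" using right_pos[OF yn(2)] by auto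
        hence tp: "pos n p < pos n t" using t qp qpos o unfolding btw_def by auto
        hence "dec d {p, q} > 0" using pright t' qp by simp
        hence "\<not> (between n y t p \<and> between n y t q)" using expq E by blast
        thus False using True tp qp unfolding btw_def by auto
      next
        case False
        hence "between n p q y" using y' \<open>pos n y \<noteq> pos n q\<close> unfolding btw_def by auto
        hence "between n p q t" using pqyt by blast
        thus False using t qp qpos unfolding btw_def by auto
      qed
    qed
  qed
  have yt_ip: "between n y t (North i) = between n y t p" if yt: "{y, t} \<in> ?D" for y t
  proof -
    have ty: "{t, y} \<in> ?D" using yt by (simp add: insert_commute)
    have "between n (North i) p y = between n (North i) p t" using half[OF yt] half[OF ty] by blast
    thus ?thesis using btw_sym[of "pos n (North i)" "pos n p" "pos n y" "pos n t"] off[OF yt] dist by auto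
  qed
  define d' where "d' = \<lparr>edges = insert ?a (insert ?b ?D),
     dec = (dec d)({p, q} := 0, ?c := 0, ?b := 0, ?a := dec d {p, q}), loops = loops d\<rparr>"
  have E': "edges d' = insert ?a (insert ?b ?D)" unfolding d'_def by simp
  have ab: "?a \<noteq> ?b" "?a \<noteq> ?c" "?b \<noteq> ?c" "?a \<noteq> {p, q}" "?b \<noteq> {p, q}" using pne qj qi pqn by (auto simp: doubleton_eq_iff)
  have anot: "?a \<notin> edges d"
  proof
    assume "?a \<in> edges d"
    hence "?a = ?c" by (rule pm_disjoint[OF pm _ cap, of _ "North i"]) auto
    thus False using ab by blast
  qed
  have bnot: "?b \<notin> edges d"
  proof
    assume "?b \<in> edges d"
    hence "?b = ?c" by (rule pm_disjoint[OF pm _ cap, of _ "North (Suc i)"]) auto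
    thus False using ab by blast
  qed
  have Dn: "x \<notin> {North i, North (Suc i), p, q}" if "e \<in> ?D" "x \<in> e" for e x
  proof
    assume "x \<in> {North i, North (Suc i), p, q}"
    then consider "x \<in> ?c" | "x \<in> {p, q}" by blast
    thus False using pm_disjoint[OF pm _ cap, of e x] pm_disjoint[OF pm _ pq(1), of e x] that by cases auto
  qed
  have pm': "perfect_matching n (edges d')"
    unfolding perfect_matching_def
  proof (intro conjI ballI)
    fix e assume "e \<in> edges d'"
    then consider "e = ?a" | "e = ?b" | "e \<in> ?D" unfolding E' by (rule insert2_cases)
    thus "e \<subseteq> nodes n"
      by cases (use pqn i pm in \<open>auto simp: perfect_matching_def\<close>)
  next
    fix e assume "e \<in> edges d'"
    then consider "e = ?a" | "e = ?b" | "e \<in> ?D" unfolding E' by (rule insert2_cases)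
    thus "card e = 2"
      by cases (use pne qj pm in \<open>auto simp: perfect_matching_def\<close>)
  next
    fix x assume x: "x \<in> nodes n"
    have uniq: "e = f" if e: "e \<in> edges d'" "x \<in> e" and f: "f \<in> edges d'" "x \<in> f" for e f
    proof -
      have 1: "?a \<inter> ?b = {}" using pne qi pqn by auto
      have 2: "?a \<inter> g = {}" "?b \<inter> g = {}" if "g \<in> ?D" for g using Dn[OF that] by blast+
      have 3: "g = h" if "g \<in> ?D" "h \<in> ?D" "x \<in> g" "x \<in> h" for g h
        using pm_disjoint[OF pm _ _ that(3,4)] that(1,2) by simp
      show ?thesis
        by (rule insert2_disjoint[OF 1 2 3 e(1)[unfolded E'] f(1)[unfolded E'] e(2) f(2)])
    qed
    have "\<exists>e\<in>edges d'. x \<in> e"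
    proof (cases "x \<in> {North i, North (Suc i), p, q}")
      case True
      hence "x \<in> ?a \<or> x \<in> ?b" by blast
      thus ?thesis unfolding E' by blast
    next
      case False
      obtain y where y: "{x, y} \<in> edges d" using pm_partner[OF pm x] by blast
      have "{x, y} \<in> ?D" using False y by (auto simp: doubleton_eq_iff)
      thus ?thesis unfolding E' by blast
    qed
    thus "\<exists>!e. e \<in> edges d' \<and> x \<in> e" using uniq by blast
  qed
  have m': "matching_diagram n d'"
  proof -
    have "dec d' e = 0" if "e \<notin> edges d'" for e
      using that matching_diagramD(2)[OF m, of e] unfolding d'_def by auto
    thus ?thesis using pm' by (simp add: matching_diagram_def)
  qed
  have pl': "planar n (edges d')"
  proof (rule planarI[OF pm'])
    show "edges d' \<subseteq> insert ?a (insert ?b ?D)" unfolding E' by (rule subset_refl)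
    show "between n (North i) p (North (Suc i)) = between n (North i) p q"
      using ppos qpos unfolding btw_def by auto
    show "between n x z y = between n x z t" if "{x, z} \<in> ?D" "{y, t} \<in> ?D" "{x, z} \<noteq> {y, t}" for x z y t
      by (rule planarD[OF pm pl _ _ that(3)]) (use that in simp_all)
    show "between n x z (North i) = between n x z p" if "{x, z} \<in> ?D" for x z by (rule yt_ip[OF that])
    show "between n x z (North (Suc i)) = between n x z q" if "{x, z} \<in> ?D" for x z
      using yt_ip[OF that] yt_ij[OF that] yt_pq(1)[OF that] by simp
  qed auto
  have ex': "left_exposed n (edges d') e" if e: "e \<in> edges d'" "dec d' e > 0" for e
  proof -
    have "dec d' ?b = 0" unfolding d'_def using ab(1) by simp
    hence eb: "e \<noteq> ?b" using e(2) by (metis less_irrefl)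
    consider "e = ?a" | "e \<in> ?D" "e \<noteq> ?a" by (rule insert2_cases[OF e(1)[unfolded E']]) (use eb in simp_all)
    thus ?thesis
    proof cases
      case 1
      have dpq: "dec d {p, q} > 0" using e(2) unfolding 1 d'_def by simp
      have "\<not> (between n u v (North i) \<and> between n u v p)" if uv: "{u, v} \<in> edges d'" for u v
      proof -
        consider "{u, v} = ?a" | "{u, v} = ?b" | "{u, v} \<in> ?D" by (rule insert2_cases[OF uv[unfolded E']]) simp_all
        thus ?thesis
        proof cases
          case 1
          thus ?thesis by (auto simp: doubleton_eq_iff btw_def)
        next
          case 2
          thus ?thesis using qpos by (auto simp: doubleton_eq_iff btw_def)
        next
          case 3
          hence "{u, v} \<in> edges d" by simp
          thus ?thesis using expq[OF dpq, of u v] yt_pq(1)[OF 3] by simp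
        qed
      qed
      thus ?thesis unfolding 1 left_exposed_iff by blast
    next
      case 2
      have de: "dec d e > 0"
      proof -
        have "e \<noteq> ?c" "e \<noteq> {p, q}" using 2(1) by simp_all
        thus ?thesis using e(2) 2(2) eb unfolding d'_def by simp
      qed
      hence exe: "left_exposed n (edges d) e" using 2 ex by simp
      obtain y t where yt: "e = {y, t}" using pm_pair[OF pm] 2 by blast
      have D: "{y, t} \<in> ?D" using 2 yt by simp
      have D': "{t, y} \<in> ?D" using D by (simp add: insert_commute)
      have E: "{y, t} \<in> edges d" "{t, y} \<in> edges d" using D D' by simp_all
      have ydec: "dec d {y, t} > 0" "dec d {t, y} > 0" using de yt by (simp_all add: insert_commute)
      have nb: "\<not> (Suc i < pos n y \<and> pos n y < pos n q)" "\<not> (Suc i < pos n t \<and> pos n t < pos n q)"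
        using minl[OF E(1)] minl[OF E(2)] ydec by auto
      have npq: "\<not> (between n p q y \<and> between n p q t)"
        using exe pq(1) unfolding yt left_exposed_iff by blast
      have "\<not> (between n u v y \<and> between n u v t)" if uv: "{u, v} \<in> edges d'" for u v
      proof -
        consider "{u, v} = ?a" | "{u, v} = ?b" | "{u, v} \<in> ?D" by (rule insert2_cases[OF uv[unfolded E']]) simp_all
        thus ?thesis
        proof cases
          case 1
          \<comment> \<open>A node between \<open>i\<close> and \<open>p\<close> lies between
            \<open>p\<close> and \<open>q\<close> or in the gap between the cap and
            \<open>q\<close>, and that gap contains no end of a decorated edge.\<close>
          have imp: "btw (pos n p) (pos n q) z"
            if "btw i (pos n p) z" "\<not> (Suc i < z \<and> z < pos n q)" "z \<noteq> Suc i" "z \<noteq> pos n q" for z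
            using that ppos qpos unfolding btw_def by linarith
          have "\<not> (between n (North i) p y \<and> between n (North i) p t)"
            using imp[OF _ nb(1)] imp[OF _ nb(2)] npq off[OF D] by auto
          thus ?thesis using 1 by (auto simp: doubleton_eq_iff btw_commute)
        next
          case 2
          have "\<not> (between n (North (Suc i)) q y \<and> between n (North (Suc i)) q t)"
            using nb qpos unfolding btw_def by auto
          thus ?thesis using 2 by (auto simp: doubleton_eq_iff btw_commute)
        next
          case 3
          hence "{u, v} \<in> edges d" by simp
          thus ?thesis using exe unfolding yt left_exposed_iff by blast
        qed
      qed
      thus ?thesis unfolding yt left_exposed_iff by blast
    qed
  qed
  have dp: "dplus n d'" unfolding dplus_def using m' pl' ex' by blast
  have aE: "?a \<in> edges d'" "?b \<in> edges d'" unfolding E' by simp_all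
  note h = hook_diff[OF m' aE pne(2)]
  have hd: "hook i d' = d"
  proof (rule diagram_eqI)
    have "edges d' - {?a, ?b} = ?D" unfolding E' using anot bnot by auto
    moreover have "insert ?c (insert {p, q} ?D) = edges d" using cap pq(1) by auto
    ultimately show "edges (hook i d') = edges d" unfolding h(1) by simp
    show "loops (hook i d') = loops d" unfolding h(1) by (simp add: d'_def)
  next
    fix e assume e: "e \<in> edges (hook i d')"
    have s: "dec d' ?a = dec d {p, q}" "dec d' ?b = 0" unfolding d'_def using ab by auto
    consider "e = ?c" | "e \<noteq> ?c" "e = {p, q}" | "e \<noteq> ?c" "e \<noteq> {p, q}" by blast
    thus "dec (hook i d') e = dec d e"
    proof cases
      case 1 thus ?thesis unfolding h(1) using und by simp
    next
      case 2 thus ?thesis unfolding h(1) using s by simp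
    next
      case 3
      have "e \<in> edges d" if "e \<noteq> ?a" "e \<noteq> ?b"
        using e 3 unfolding h(1) E' by auto
      thus ?thesis using 3 matching_diagramD(2)[OF m anot] matching_diagramD(2)[OF m bnot]
        unfolding h(1) by (auto simp: d'_def)
    qed
  qed (erule matching_diagramD(2)[OF matching_hook[OF m' i]] matching_diagramD(2)[OF m])+
  have finD: "finite ?D" using finite_matching[OF pm] by simp
  have w': "weight d' = edge_weight d' ?a + (edge_weight d' ?b + (\<Sum>e\<in>?D. edge_weight d' e))"
    unfolding weight_def E' using finD anot bnot ab by simp
  have w: "weight d = edge_weight d ?c + (edge_weight d {p, q} + (\<Sum>e\<in>?D. edge_weight d e))"
  proof -
    have "edges d = insert ?c (insert {p, q} ?D)" using cap pq(1) by auto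
    hence "weight d = (\<Sum>e\<in>insert ?c (insert {p, q} ?D). edge_weight d e)" unfolding weight_def by simp
    thus ?thesis using finD cpq by simp
  qed
  have same: "(\<Sum>e\<in>?D. edge_weight d' e) = (\<Sum>e\<in>?D. edge_weight d e)"
  proof (rule sum.cong[OF HOL.refl])
    fix e assume "e \<in> ?D"
    hence "dec d' e = dec d e" using anot bnot unfolding d'_def by auto
    thus "edge_weight d' e = edge_weight d e" by (simp add: edge_weight_def)
  qed
  \<comment> \<open>In both cases the total drops by 2: by 1 for the vanished cap and by 1 for the
    step between the columns \<open>i\<close> and \<open>Suc i\<close>.\<close>
  have wlt: "edge_weight d' ?a + edge_weight d' ?b < edge_weight d ?c + edge_weight d {p, q}"
  proof -
    have wb: "edge_weight d' ?b = col q - Suc i"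
      using edge_weight_pair[of "North (Suc i)" q d'] qj ab unfolding d'_def by (auto simp: max_def min_def)
    have wc: "edge_weight d ?c = 1"
      using edge_weight_pair[of "North i" "North (Suc i)" d] und by simp
    have da: "dec d' ?a = dec d {p, q}" unfolding d'_def by simp
    have wa: "edge_weight d' ?a = (if dec d {p, q} > 0 then i + col p else max i (col p) - min i (col p))"
      using edge_weight_pair[of "North i" p d'] pne unfolding da by simp
    have wp: "edge_weight d {p, q} = (if dec d {p, q} > 0 then col p + col q else max (col p) (col q) - min (col p) (col q))"
      by (rule edge_weight_pair[OF pqn(1)])
    show ?thesis
    proof (cases "dec d {p, q} > 0")
      case True
      thus ?thesis unfolding wa wb wc wp using qj by simp
    next
      case False
      hence "col p \<le> i" using p(2) pq(2) by simp
      thus ?thesis unfolding wa wb wc wp using qj False by (simp add: max_def min_def)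
    qed
  qed
  have "?c \<notin> edges d'" unfolding E' using ab by auto
  thus ?thesis using that[OF dp hd] wlt w w' same by (simp add: d'_def)
qed

lemma dplus_update_dec:
  assumes "dplus n d" "e \<in> edges d" "k > 0 \<Longrightarrow> dec d e > 0"
  shows "dplus n (d\<lparr>dec := (dec d)(e := k)\<rparr>)"
  using assms unfolding dplus_def matching_diagram_def by auto

text \<open>The leftmost cap is stripped of its decorations and undone. Taking the leftmost one
  guarantees that stripped decorations sit on the edge at node 1, where \<open>dot\<close> can put
  them back.\<close>

lemma dplus_loopless:
  assumes n: "1 \<le> n"
  shows "dplus n d \<Longrightarrow> loops d = {#} \<Longrightarrow> loopless n d"
proof (induction "weight d" arbitrary: d rule: less_induct)
  case less
  note d = less(2) and m = dplusD(1)[OF less(2)] and pl = dplusD(2)[OF less(2)] and pm = dplusD(4)[OF less(2)]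
  show ?case
  proof (cases "\<exists>i j. {North i, North j} \<in> edges d")
    case False
    hence E: "edges d = {{North j, South j} | j. j \<in> {1..n}}" using no_caps_edges[OF pm pl] by blast
    let ?e = "{North 1, South 1}"
    have e: "?e \<in> edges d" unfolding E using n by auto
    have ei: "edge_at (id_diagram n) (North 1) = ?e"
    proof (rule edge_at_eq[OF matching_id[of n]])
      show "?e \<in> edges (id_diagram n)" using e unfolding E by (simp add: id_diagram_def)
    qed simp
    \<comment> \<open>The vertical edge in column 1 separates all the others from the left
      wall.\<close>
    have dec0: "dec d f = 0" if "f \<noteq> ?e" for f
    proof (rule ccontr)
      assume nz: "dec d f \<noteq> 0"
      hence fE: "f \<in> edges d" using matching_diagramD(2)[OF m, of f] by auto
      then obtain j where j: "f = {North j, South j}" "j \<in> {1..n}" unfolding E by blast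
      have "left_exposed n (edges d) f" using dplusD(3)[OF d fE] nz by simp
      hence "\<not> (between n (North 1) (South 1) (North j) \<and> between n (North 1) (South 1) (South j))"
        using e unfolding j left_exposed_iff by blast
      hence "j = 1" using j(2) unfolding btw_def by auto
      thus False using j that by simp
    qed
    have "d = (dot ^^ dec d ?e) (id_diagram n)"
      unfolding dot_funpow ei
    proof (intro diagram.equality)
      show "dec d = dec (id_diagram n\<lparr>dec := (dec (id_diagram n))(?e := dec (id_diagram n) ?e + dec d ?e)\<rparr>)"
        using dec0 by (intro ext) (simp add: id_diagram_def)
    qed (use E less(3) in \<open>simp_all add: id_diagram_def\<close>)
    thus ?thesis using loopless_funpow_dot[OF loopless.id] by metis
  next
    case True
    then obtain a b where ab: "{North a, North b} \<in> edges d" by blast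
    have "a \<noteq> b" using pm_ends[OF pm ab] by auto
    have ba: "{North b, North a} \<in> edges d" using ab by (simp add: insert_commute)
    have "\<exists>i. {North i, North (Suc i)} \<in> edges d"
    proof (cases "a < b")
      case True thus ?thesis using cap_between[OF pm pl ab] by blast
    next
      case False
      thus ?thesis using cap_between[OF pm pl ba] \<open>a \<noteq> b\<close> by auto
    qed
    then obtain i where i: "{North i, North (Suc i)} \<in> edges d" "\<And>j. {North j, North (Suc j)} \<in> edges d \<Longrightarrow> i \<le> j"
      using exists_least_iff[of "\<lambda>i. {North i, North (Suc i)} \<in> edges d"] by (metis not_less)
    have in1: "1 \<le> i" "Suc i \<le> n" using pm_ends[OF pm i(1)] by auto
    let ?c = "{North i, North (Suc i)}"
    define d0 where "d0 = d\<lparr>dec := (dec d)(?c := 0)\<rparr>"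
    have d0: "dplus n d0" unfolding d0_def by (rule dplus_update_dec[OF d i(1)]) simp
    have c0: "?c \<in> edges d0" "dec d0 ?c = 0" using i(1) by (simp_all add: d0_def)
    obtain d' where d': "dplus n d'" "hook i d' = d0" "?c \<notin> edges d'" "loops d' = loops d0" "weight d' < weight d0"
      using unhook[OF d0 c0] by blast
    \<comment> \<open>Stripping the cap cannot raise its weight, so the induction hypothesis applies
      to \<open>d'\<close>.\<close>
    have "weight d0 \<le> weight d"
    proof -
      have "edge_weight d0 e \<le> edge_weight d e" if "e \<in> edges d" for e
      proof (cases "e = ?c")
        case True
        have "edge_weight d0 ?c = 1" using edge_weight_pair[of "North i" "North (Suc i)" d0] c0 by simp
        moreover have "edge_weight d ?c \<ge> 1" using edge_weight_pair[of "North i" "North (Suc i)" d] by auto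
        ultimately show ?thesis using True by simp
      next
        case False
        thus ?thesis by (simp add: edge_weight_def d0_def)
      qed
      thus ?thesis unfolding weight_def by (simp add: d0_def sum_mono)
    qed
    hence "loopless n d'" using less(1)[OF _ d'(1)] d' less(3) by (simp add: d0_def)
    hence l0: "loopless n d0" using loopless.hook[OF _ in1 d'(3)] d'(2) by simp
    show ?thesis
    proof (cases "dec d ?c > 0")
      case False
      hence "d0 = d" unfolding d0_def by (simp add: fun_upd_idem)
      thus ?thesis using l0 by simp
    next
      case True
      hence "i = 1" using leftmost_cap_decorated[OF d i(1)] i(2) by blast
      have "edge_at d0 (North 1) = ?c"
        by (rule edge_at_eq[OF dplusD(1)[OF d0] c0(1)]) (simp add: \<open>i = 1\<close>)
      hence "(dot ^^ dec d ?c) d0 = d" unfolding dot_funpow by (simp add: d0_def)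
      thus ?thesis using loopless_funpow_dot[OF l0] by metis
    qed
  qed
qed

lemma loopless_dplus:
  assumes "1 \<le> n" "loopless n d"
  shows "dplus n d \<and> loops d = {#}"
  using assms(2)
proof induction
  case id
  thus ?case using dplus_id by (simp add: id_diagram_def)
next
  case (dot d)
  thus ?case using dplus_dot[OF _ assms(1)] by (simp add: dot_def)
next
  case (hook d i)
  have "edge_at d (North i) \<noteq> edge_at d (North (Suc i))"
  proof
    assume eq: "edge_at d (North i) = edge_at d (North (Suc i))"
    have m: "matching_diagram n d" using hook dplusD by blast
    have N: "North i \<in> nodes n" "North (Suc i) \<in> nodes n" using hook by auto
    obtain y where y: "edge_at d (North i) = {North i, y}" "{North i, y} \<in> edges d" using edge_at_pair[OF m N(1)] by metis
    have "North (Suc i) \<in> {North i, y}" using edge_at_in(2)[OF m N(2)] eq y by simp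
    thus False using y hook.hyps(4) by auto
  qed
  hence "loops (hook i d) = loops d" unfolding hook_def Let_def by simp
  thus ?case using dplus_hook hook by auto
qed

section \<open>Closure, associativity and units of stacking\<close>

lemma add_loops_strip: "add_loops (loops d) (d\<lparr>loops := {#}\<rparr>) = d"
  by (simp add: add_loops_def)

text \<open>Stacking passes existing loops through unchanged, so they can be split off before any
  induction over \<open>loopless\<close>.\<close>

lemma dplus_cases:
  assumes "1 \<le> n" "dplus n d"
  obtains L d0 where "d = add_loops L d0" "loopless n d0"
proof -
  have "dplus n (d\<lparr>loops := {#}\<rparr>)" using assms(2) by (simp add: dplus_def matching_diagram_def)
  hence "loopless n (d\<lparr>loops := {#}\<rparr>)" using dplus_loopless[OF assms(1)] by simp
  thus ?thesis using that add_loops_strip by metis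
qed

text \<open>Stacking a product of hooks and dots on top of \<open>b\<close> amounts to applying the
  same operations to \<open>b\<close>, and these preserve the class.\<close>

lemma dplus_stack_loopless:
  assumes n: "1 \<le> n" and b: "dplus n b"
  shows "loopless n a \<Longrightarrow> dplus n (stack n a b)"
proof (induction rule: loopless.induct)
  case id
  thus ?case using stack_id_left[OF dplusD(1)[OF b]] b by simp
next
  case (dot d)
  have d: "dplus n d" using loopless_dplus[OF n dot.hyps] by simp
  show ?case using stack_dot[OF dplusD(1)[OF d] dplusD(1)[OF b] dplusD(1)[OF dot.IH] n] dplus_dot[OF dot.IH n] by simp
next
  case (hook d i)
  have d: "dplus n d" using loopless_dplus[OF n hook.hyps(1)] by simp
  show ?case using stack_hook[OF dplusD(1)[OF d] dplusD(1)[OF b] dplusD(1)[OF hook.IH] hook.hyps(2,3)]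
      dplus_hook[OF hook.IH hook.hyps(2,3)] by simp
qed

lemma dplus_stack:
  assumes n: "1 \<le> n" and a: "dplus n a" and b: "dplus n b"
  shows "dplus n (stack n a b)"
proof -
  obtain L a0 where a0: "a = add_loops L a0" "loopless n a0" using dplus_cases[OF n a] by blast
  show ?thesis unfolding a0(1) stack_add_loops_left
    by (rule dplus_add_loops[OF dplus_stack_loopless[OF n b a0(2)]])
qed

lemma stack_hook':
  assumes "1 \<le> n" "dplus n a" "dplus n b" "1 \<le> i" "Suc i \<le> n"
  shows "stack n (hook i a) b = hook i (stack n a b)"
  using stack_hook[OF dplusD(1) dplusD(1) dplusD(1)[OF dplus_stack]] assms by blast

lemma stack_dot':
  assumes "1 \<le> n" "dplus n a" "dplus n b"
  shows "stack n (dot a) b = dot (stack n a b)"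
  using stack_dot[OF dplusD(1) dplusD(1) dplusD(1)[OF dplus_stack]] assms by blast

text \<open>Both sides apply the operations that build \<open>a\<close> to
  \<open>stack n b c\<close>.\<close>

lemma stack_assoc_loopless:
  assumes n: "1 \<le> n" and b: "dplus n b" and c: "dplus n c"
  shows "loopless n a \<Longrightarrow> stack n (stack n a b) c = stack n a (stack n b c)"
proof (induction rule: loopless.induct)
  case id
  thus ?case using stack_id_left[OF dplusD(1)] b dplus_stack[OF n b c] by simp
next
  case (dot d)
  have d: "dplus n d" using loopless_dplus[OF n dot.hyps] by simp
  show ?case using stack_dot'[OF n] d b c dplus_stack[OF n] dot by simp
next
  case (hook d i)
  have d: "dplus n d" using loopless_dplus[OF n hook.hyps(1)] by simp
  show ?case using stack_hook'[OF n] d b c dplus_stack[OF n] hook by simp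
qed

lemma stack_assoc:
  assumes n: "1 \<le> n" and a: "dplus n a" and b: "dplus n b" and c: "dplus n c"
  shows "stack n (stack n a b) c = stack n a (stack n b c)"
proof -
  obtain L a0 where a0: "a = add_loops L a0" "loopless n a0" using dplus_cases[OF n a] by blast
  show ?thesis unfolding a0(1) stack_add_loops_left stack_assoc_loopless[OF n b c a0(2)] ..
qed

lemma stack_id_right_loopless:
  assumes n: "1 \<le> n"
  shows "loopless n a \<Longrightarrow> stack n a (id_diagram n) = a"
proof (induction rule: loopless.induct)
  case id
  thus ?case using stack_id_left[OF matching_id] by simp
next
  case (dot d)
  have d: "dplus n d" using loopless_dplus[OF n dot.hyps] by simp
  show ?case using stack_dot'[OF n d dplus_id] dot by simp
next
  case (hook d i)
  have d: "dplus n d" using loopless_dplus[OF n hook.hyps(1)] by simp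
  show ?case using stack_hook'[OF n d dplus_id] hook by simp
qed

lemma stack_id_right:
  assumes n: "1 \<le> n" and a: "dplus n a"
  shows "stack n a (id_diagram n) = a"
proof -
  obtain L a0 where a0: "a = add_loops L a0" "loopless n a0" using dplus_cases[OF n a] by blast
  show ?thesis unfolding a0(1) stack_add_loops_left stack_id_right_loopless[OF n a0(2)] ..
qed

section \<open>Caps and the monoid of diagrams\<close>

lemma num_caps_eq_0_iff:
  assumes "matching_diagram n d"
  shows "num_caps d = 0 \<longleftrightarrow> (\<forall>i j. {North i, North j} \<notin> edges d)"
proof -
  have "finite {e \<in> edges d. e \<subseteq> range North}" using finite_matching[OF matching_diagramD(1)[OF assms]] by simp
  hence "num_caps d = 0 \<longleftrightarrow> {e \<in> edges d. e \<subseteq> range North} = {}" unfolding num_caps_def by simp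
  also have "\<dots> \<longleftrightarrow> (\<forall>i j. {North i, North j} \<notin> edges d)"
  proof
    assume "{e \<in> edges d. e \<subseteq> range North} = {}"
    thus "\<forall>i j. {North i, North j} \<notin> edges d" by blast
  next
    assume R: "\<forall>i j. {North i, North j} \<notin> edges d"
    have "\<not> e \<subseteq> range North" if e: "e \<in> edges d" for e
    proof
      assume s: "e \<subseteq> range North"
      obtain x y where xy: "e = {x, y}" using pm_pair[OF matching_diagramD(1)[OF assms] e] by blast
      then obtain i j where "x = North i" "y = North j" using s by blast
      thus False using R e xy by blast
    qed
    thus "{e \<in> edges d. e \<subseteq> range North} = {}" by blast
  qed
  finally show ?thesis .
qed

lemma cap_hook:
  assumes "matching_diagram n d" "1 \<le> i" "Suc i \<le> n"
  shows "{North i, North (Suc i)} \<in> edges (hook i d)"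
proof -
  obtain p where p: "{North i, p} \<in> edges d" using pm_partner[OF matching_diagramD(1)[OF assms(1)], of "North i"] assms by auto
  obtain q where q: "{North (Suc i), q} \<in> edges d"
    using pm_partner[OF matching_diagramD(1)[OF assms(1)], of "North (Suc i)"] assms by auto
  show ?thesis
    by (cases "p = North (Suc i)") (use hook_same[OF assms(1)] hook_diff(1)[OF assms(1) p q] p in auto)
qed

text \<open>The outermost hook in the construction of \<open>a\<close> is also applied to the
  product and leaves a cap there; dots do not change edges.\<close>

lemma caps_stack:
  assumes n: "1 \<le> n" and b: "dplus n b"
  shows "loopless n a \<Longrightarrow> {North i, North j} \<in> edges a \<Longrightarrow> \<exists>i j. {North i, North j} \<in> edges (stack n a b)"
proof (induction arbitrary: i j rule: loopless.induct)
  case id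
  thus ?case by (auto simp: id_diagram_def doubleton_eq_iff)
next
  case (dot d)
  have d: "dplus n d" using loopless_dplus[OF n dot.hyps] by simp
  have "edges (dot x) = edges x" for x by (simp add: dot_def)
  thus ?case using stack_dot'[OF n d b] dot by simp
next
  case (hook d k)
  have d: "dplus n d" using loopless_dplus[OF n hook.hyps(1)] by simp
  have "{North k, North (Suc k)} \<in> edges (hook k (stack n d b))"
    by (rule cap_hook[OF dplusD(1)[OF dplus_stack[OF n d b]] hook.hyps(2,3)])
  thus ?case using stack_hook'[OF n d b hook.hyps(2,3)] by auto
qed

lemma diagrams_iff:
  "d \<in> diagrams n \<longleftrightarrow> dplus n d \<and> (num_caps d = 0 \<longrightarrow> (\<forall>e\<in>edges d. dec d e = 0) \<and> (\<forall>k\<in>#loops d. k = 0))"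
  unfolding diagrams_def dplus_def matching_diagram_def by blast

lemma diagrams_dplus: "d \<in> diagrams n \<Longrightarrow> dplus n d"
  by (simp only: diagrams_iff)

lemma diagram_monoid_simps [simp]:
  "carrier (diagram_monoid n) = diagrams n" "mult (diagram_monoid n) = stack n" "one (diagram_monoid n) = id_diagram n"
  by (simp_all add: diagram_monoid_def)

text \<open>The rule on diagrams without caps is what is left after \<open>dplus_stack\<close>. A
  cap of \<open>a\<close> yields a cap of the product; without caps \<open>a\<close> is the identity
  with undecorated loops, and the product inherits the rule from \<open>b\<close>.\<close>

lemma stack_in_diagrams:
  assumes n: "1 \<le> n" and a: "a \<in> diagrams n" and b: "b \<in> diagrams n"
  shows "stack n a b \<in> diagrams n"
proof -
  have da: "dplus n a" "dplus n b" using a b by (auto simp: diagrams_iff)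
  note ds = dplus_stack[OF n da]
  obtain L a0 where a0: "a = add_loops L a0" "loopless n a0" using dplus_cases[OF n da(1)] by blast
  show ?thesis
  proof (cases "num_caps a = 0")
    case False
    then obtain i j where "{North i, North j} \<in> edges a0"
      using num_caps_eq_0_iff[OF dplusD(1)[OF da(1)]] a0(1) by (auto simp: add_loops_def)
    hence "\<exists>i j. {North i, North j} \<in> edges (stack n a b)"
      using caps_stack[OF n da(2) a0(2)] unfolding a0(1) stack_add_loops_left by (simp add: add_loops_def)
    hence "num_caps (stack n a b) \<noteq> 0" using num_caps_eq_0_iff[OF dplusD(1)[OF ds]] by blast
    thus ?thesis using ds by (simp add: diagrams_iff)
  next
    case True
    hence nd: "\<forall>e\<in>edges a. dec a e = 0" "\<forall>k\<in>#loops a. k = 0" using a by (auto simp: diagrams_iff)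
    have E: "edges a = {{North j, South j} | j. j \<in> {1..n}}"
      using no_caps_edges[OF dplusD(4)[OF da(1)] dplusD(2)[OF da(1)]] True
      num_caps_eq_0_iff[OF dplusD(1)[OF da(1)]] by blast
    have "dec a e = 0" for e using nd(1) matching_diagramD(2)[OF dplusD(1)[OF da(1)], of e] by (cases "e \<in> edges a") auto
    hence "a = add_loops (loops a) (id_diagram n)"
      by (intro diagram.equality ext) (use E in \<open>auto simp: add_loops_def id_diagram_def\<close>)
    hence s: "stack n a b = add_loops (loops a) b"
      using stack_add_loops_left stack_id_left[OF dplusD(1)[OF da(2)]] by metis
    have "num_caps (add_loops (loops a) b) = num_caps b" by (simp add: num_caps_def add_loops_def)
    thus ?thesis using b nd(2) ds unfolding s diagrams_iff by (auto simp: add_loops_def)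
  qed
qed

lemma id_in_diagrams: "id_diagram n \<in> diagrams n"
  using dplus_id by (simp add: diagrams_iff id_diagram_def)

lemma monoid_diagrams:
  assumes "1 \<le> n"
  shows "monoid (diagram_monoid n)"
proof (rule monoidI, unfold diagram_monoid_simps)
  show "stack n x y \<in> diagrams n" if "x \<in> diagrams n" "y \<in> diagrams n" for x y
    by (rule stack_in_diagrams[OF assms that])
  show "id_diagram n \<in> diagrams n" by (rule id_in_diagrams)
  show "stack n (stack n x y) z = stack n x (stack n y z)" if "x \<in> diagrams n" "y \<in> diagrams n" "z \<in> diagrams n" for x y z
    by (rule stack_assoc[OF assms that[THEN diagrams_dplus]])
  show "stack n (id_diagram n) x = x" "stack n x (id_diagram n) = x" if "x \<in> diagrams n" for x
    using stack_id_left[OF dplusD(1)[OF diagrams_dplus[OF that]]] stack_id_right[OF assms diagrams_dplus[OF that]] .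
qed

section \<open>Good words\<close>

text \<open>\<open>Bar1\<close> and \<open>Gen 1\<close> both act on the nodes 1 and 2. With this
  numbering adjacency in the Coxeter graph becomes adjacency of columns
  (\<open>connected_gens_iff\<close>), and the fork of the graph is confined to column 1.\<close>

fun gen_col :: "gen \<Rightarrow> nat" where
  "gen_col Bar1 = 1"
| "gen_col (Gen i) = i"

lemma connected_gens_sym: "connected_gens s t = connected_gens t s"
  by (cases s; cases t) auto

lemma connected_gens_iff:
  "s \<in> gens n \<Longrightarrow> t \<in> gens n \<Longrightarrow>
    connected_gens s t \<longleftrightarrow> gen_col t = Suc (gen_col s) \<or> gen_col s = Suc (gen_col t)"
  by (cases s; cases t) (auto simp: gens_def)

lemma gen_col_range: "s \<in> gens n \<Longrightarrow> 2 \<le> n \<Longrightarrow> 1 \<le> gen_col s \<and> Suc (gen_col s) \<le> n"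
  by (auto simp: gens_def)

lemma gen_col_eq_Gen: "2 \<le> gen_col s \<Longrightarrow> s = Gen (gen_col s)"
  by (cases s) auto

lemma commutation_sym: "commutation xs ys \<Longrightarrow> commutation ys xs"
proof (induction rule: commutation.induct)
  case (1 s t us vs)
  thus ?case using commutation.intros[of t s us vs] connected_gens_sym by blast
qed

lemma commutations_sym: "commutation\<^sup>*\<^sup>* xs ys \<Longrightarrow> commutation\<^sup>*\<^sup>* ys xs"
  by (induction rule: rtranclp_induct) (auto intro: converse_rtranclp_into_rtranclp commutation_sym)

lemma commutation_context: "commutation xs ys \<Longrightarrow> commutation (us @ xs @ vs) (us @ ys @ vs)"
proof (induction rule: commutation.induct)
  case (1 s t as bs)
  show ?case using commutation.intros[OF 1, of "us @ as" "bs @ vs"] by simp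
qed

lemma commutations_context: "commutation\<^sup>*\<^sup>* xs ys \<Longrightarrow> commutation\<^sup>*\<^sup>* (us @ xs @ vs) (us @ ys @ vs)"
  by (induction rule: rtranclp_induct) (auto intro: rtranclp.rtrancl_into_rtrancl commutation_context)

lemma commutations_Cons: "commutation\<^sup>*\<^sup>* xs ys \<Longrightarrow> commutation\<^sup>*\<^sup>* (x # xs) (x # ys)"
  using commutations_context[of xs ys "[x]" "[]"] by simp

lemma commutation_mset: "commutation xs ys \<Longrightarrow> mset ys = mset xs"
  by (induction rule: commutation.induct) auto

lemma commutations_mset: "commutation\<^sup>*\<^sup>* xs ys \<Longrightarrow> mset ys = mset xs"
  by (induction rule: rtranclp_induct) (auto dest: commutation_mset)

lemma commutations_set: "commutation\<^sup>*\<^sup>* xs ys \<Longrightarrow> set ys = set xs"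
  by (metis commutations_mset set_mset_mset)

lemma commutations_length: "commutation\<^sup>*\<^sup>* xs ys \<Longrightarrow> length ys = length xs"
  by (metis commutations_mset size_mset)

lemma commute_past:
  assumes "\<And>t. t \<in> set us \<Longrightarrow> t \<noteq> x \<and> \<not> connected_gens x t"
  shows "commutation\<^sup>*\<^sup>* (as @ x # us @ bs) (as @ us @ x # bs)"
  using assms
proof (induction us arbitrary: as)
  case (Cons t us)
  have "commutation (as @ [x, t] @ us @ bs) (as @ [t, x] @ us @ bs)"
    by (rule commutation.intros) (use Cons.prems[of t] in auto)
  moreover have "commutation\<^sup>*\<^sup>* ((as @ [t]) @ x # us @ bs) ((as @ [t]) @ us @ x # bs)"
    by (rule Cons.IH) (use Cons.prems in auto)
  ultimately show ?case by (simp add: converse_rtranclp_into_rtranclp)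
qed simp

definition bad_factor :: "gen list \<Rightarrow> bool" where
  "bad_factor xs \<longleftrightarrow> (\<exists>us vs.
     (\<exists>s. xs = us @ [s, s] @ vs) \<or> (\<exists>s t. connected_gens s t \<and> xs = us @ [s, t, s] @ vs) \<or>
     xs = us @ [Gen 1, Bar1] @ vs \<or> xs = us @ [Bar1, Gen 1] @ vs)"

definition good_word :: "nat \<Rightarrow> gen list \<Rightarrow> bool" where
  "good_word n xs \<longleftrightarrow> xs \<in> lists (gens n) \<and> (\<forall>ys. commutation\<^sup>*\<^sup>* xs ys \<longrightarrow> \<not> bad_factor ys)"

lemma good_wordD:
  assumes "good_word n xs"
  shows "xs \<in> lists (gens n)" "commutation\<^sup>*\<^sup>* xs ys \<Longrightarrow> \<not> bad_factor ys"
  using assms by (auto simp: good_word_def)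

lemma bad_factor_context: "bad_factor xs \<Longrightarrow> bad_factor (as @ xs @ bs)"
  unfolding bad_factor_def by (metis append.assoc)

lemma good_word_commutations:
  assumes "good_word n xs" "commutation\<^sup>*\<^sup>* xs ys"
  shows "good_word n ys"
proof -
  have "ys \<in> lists (gens n)" using commutations_set[OF assms(2)] good_wordD(1)[OF assms(1)] by (simp add: lists_eq_set)
  thus ?thesis using assms unfolding good_word_def by (meson rtranclp_trans)
qed

lemma good_word_Cons:
  assumes "good_word n (x # xs)"
  shows "good_word n xs" "x \<in> gens n"
proof -
  have "\<not> bad_factor ys" if "commutation\<^sup>*\<^sup>* xs ys" for ys
    using good_wordD(2)[OF assms commutations_Cons[OF that]] bad_factor_context[of ys "[x]" "[]"] by auto
  thus "good_word n xs" "x \<in> gens n" using good_wordD(1)[OF assms] unfolding good_word_def by auto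
qed

lemma two_in_filter:
  assumes "2 \<le> length (filter P xs)"
  obtains us s vs t ws where "xs = us @ s # vs @ t # ws" "P s" "P t" "\<forall>z\<in>set vs. \<not> P z"
proof -
  obtain s t rest where "filter P xs = s # t # rest"
    using assms by (cases "filter P xs"; cases "tl (filter P xs)") auto
  then obtain us zs where 1: "xs = us @ s # zs" "P s" "t # rest = filter P zs"
    unfolding filter_eq_Cons_iff by blast
  then obtain vs ws where "zs = vs @ t # ws" "P t" "\<forall>z\<in>set vs. \<not> P z"
    unfolding Cons_eq_filter_iff by blast
  thus ?thesis using that 1 by blast
qed

text \<open>Induction on the gap \<open>us\<close>. Two letters of one neighbouring column in the
  gap would, by induction, have a letter of the column of \<open>x\<close> between them; so each
  neighbouring column occurs at most once. With fewer than two neighbours in the gap, equal letters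
  \<open>x\<close> and \<open>y\<close> could be commuted together to a factor \<open>ss\<close> or
  \<open>sts\<close>.\<close>

lemma alternation:
  assumes "good_word n (as @ x # us @ y # bs)" "gen_col x = gen_col y" "\<And>t. t \<in> set us \<Longrightarrow> gen_col t \<noteq> gen_col x"
  shows "(\<exists>t\<in>set us. gen_col t = Suc (gen_col x)) \<and> (2 \<le> gen_col x \<longrightarrow> (\<exists>t\<in>set us. Suc (gen_col t) = gen_col x)) \<and>
    (gen_col x = 1 \<longrightarrow> x \<noteq> y)"
  using assms
proof (induction us arbitrary: as x y bs rule: length_induct)
  case (1 us)
  note good = 1(2) and xy = 1(3) and ncol = 1(4)
  let ?w = "as @ x # us @ y # bs"
  have G: "set ?w \<subseteq> gens n" using good_wordD(1)[OF good] by (simp add: lists_eq_set)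
  hence xG: "x \<in> gens n" "y \<in> gens n" and uG: "\<And>t. t \<in> set us \<Longrightarrow> t \<in> gens n" by auto
  have IH: "(\<exists>t\<in>set vs. gen_col t = Suc (gen_col s)) \<and> (2 \<le> gen_col s \<longrightarrow> (\<exists>t\<in>set vs. Suc (gen_col t) = gen_col s))"
    if "us = u1 @ s # vs @ t # u2" "gen_col s = gen_col t" "\<forall>z\<in>set vs. gen_col z \<noteq> gen_col s" for u1 s vs t u2
  proof -
    have "good_word n ((as @ x # u1) @ s # vs @ t # (u2 @ y # bs))" using good that(1) by simp
    thus ?thesis using 1(1)[rule_format, of vs "as @ x # u1" s t "u2 @ y # bs"] that by auto
  qed
  have few: "length (filter (\<lambda>t. gen_col t = c) us) \<le> 1" if c: "c = Suc (gen_col x) \<or> Suc c = gen_col x" and c1: "1 \<le> gen_col x" for c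
  proof (rule ccontr)
    assume "\<not> ?thesis"
    hence "2 \<le> length (filter (\<lambda>t. gen_col t = c) us)" by simp
    then obtain u1 s vs t u2 where s: "us = u1 @ s # vs @ t # u2" "gen_col s = c" "gen_col t = c" "\<forall>z\<in>set vs. gen_col z \<noteq> c"
      by (rule two_in_filter)
    have "\<exists>z\<in>set vs. gen_col z = gen_col x" using IH[OF s(1)] s c c1 by auto
    thus False using ncol s(1) by auto
  qed
  have x1: "1 \<le> gen_col x" using xG by (cases x) (auto simp: gens_def)
  define F where "F = filter (connected_gens x) us"
  have none: "commutation\<^sup>*\<^sup>* ?w (as @ us @ x # y # bs)" if "F = []"
  proof (rule commute_past)
    fix t assume t: "t \<in> set us"
    have "\<not> connected_gens x t" using that t unfolding F_def filter_empty_conv by blast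
    thus "t \<noteq> x \<and> \<not> connected_gens x t" using ncol[OF t] by auto
  qed
  have one: "\<exists>u1 u2. connected_gens x t \<and> commutation\<^sup>*\<^sup>* ?w (as @ u1 @ x # t # y # u2 @ bs)" if F: "F = [t]" and "x = y" for t
  proof -
    obtain u1 u2 where u: "us = u1 @ t # u2" "\<forall>z\<in>set u1. \<not> connected_gens x z" "connected_gens x t" "filter (connected_gens x) u2 = []"
      using F unfolding F_def filter_eq_Cons_iff by metis
    have nu: "z \<in> set u1 \<or> z \<in> set u2 \<Longrightarrow> z \<noteq> x \<and> \<not> connected_gens x z" for z
      using u ncol[of z] by (auto simp: filter_empty_conv)
    have "commutation\<^sup>*\<^sup>* (as @ x # u1 @ (t # u2 @ y # bs)) (as @ u1 @ x # (t # u2 @ y # bs))"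
      by (rule commute_past) (use nu in blast)
    moreover have "commutation\<^sup>*\<^sup>* ((as @ u1 @ [x, t]) @ y # u2 @ bs) ((as @ u1 @ [x, t]) @ u2 @ y # bs)"
      by (rule commute_past) (use nu \<open>x = y\<close> in blast)
    ultimately have "commutation\<^sup>*\<^sup>* (as @ x # u1 @ t # u2 @ y # bs) (as @ u1 @ x # t # y # u2 @ bs)"
      using commutations_sym by (simp, metis (no_types, lifting) rtranclp_trans)
    thus ?thesis using u(1,3) by auto
  qed
  have F2: False if eq: "x = y" and le1: "length F \<le> 1"
  proof (cases F)
    case Nil
    hence "bad_factor (as @ us @ x # y # bs)" unfolding bad_factor_def using eq by (metis append.assoc append_Cons append_Nil)
    thus False using good_wordD(2)[OF good none[OF Nil]] by blast
  next
    case (Cons t F')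
    hence "F = [t]" using le1 by simp
    then obtain u1 u2 where c: "connected_gens x t" "commutation\<^sup>*\<^sup>* ?w (as @ u1 @ x # t # y # u2 @ bs)"
      using one[OF _ eq] by blast
    have "as @ u1 @ x # t # y # u2 @ bs = (as @ u1) @ [x, t, x] @ (u2 @ bs)" using eq by simp
    hence "bad_factor (as @ u1 @ x # t # y # u2 @ bs)" unfolding bad_factor_def using c(1) by blast
    thus False using good_wordD(2)[OF good c(2)] by blast
  qed
  have Fcol: "F = filter (\<lambda>t. gen_col t = Suc (gen_col x) \<or> Suc (gen_col t) = gen_col x) us"
    unfolding F_def by (rule filter_cong) (use connected_gens_iff[OF xG(1)] uG in auto)
  show ?case
  proof (cases "2 \<le> gen_col x")
    case True
    hence "x = y" using gen_col_eq_Gen[of x] gen_col_eq_Gen[of y] xy by simp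
    have "\<exists>t\<in>set us. gen_col t = Suc (gen_col x)"
    proof (rule ccontr)
      assume "\<not> ?thesis"
      hence "F = filter (\<lambda>t. gen_col t = gen_col x - 1) us" unfolding Fcol using True by (intro filter_cong) auto
      thus False using few[of "gen_col x - 1"] F2[OF \<open>x = y\<close>] True by simp
    qed
    moreover have "\<exists>t\<in>set us. Suc (gen_col t) = gen_col x"
    proof (rule ccontr)
      assume "\<not> ?thesis"
      hence "F = filter (\<lambda>t. gen_col t = Suc (gen_col x)) us" unfolding Fcol by (intro filter_cong) auto
      thus False using few[of "Suc (gen_col x)"] F2[OF \<open>x = y\<close>] True by simp
    qed
    ultimately show ?thesis using True by simp
  next
    case False
    hence c1: "gen_col x = 1" using x1 by simp
    \<comment> \<open>Column 0 is empty, so column 2 is the only neighbour of column 1.\<close>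
    have nz: "gen_col t \<noteq> 0" if "t \<in> set us" for t using uG[OF that] by (cases t) (auto simp: gens_def)
    have F': "F = filter (\<lambda>t. gen_col t = Suc (gen_col x)) us"
      unfolding Fcol c1 by (rule filter_cong[OF HOL.refl]) (metis One_nat_def Suc_inject nz)
    have "x \<noteq> y" using F2 few[of "Suc (gen_col x)"] x1 unfolding F' by auto
    moreover have "F \<noteq> []"
    proof
      assume "F = []"
      moreover have "x = Gen 1 \<and> y = Bar1 \<or> x = Bar1 \<and> y = Gen 1"
        using \<open>x \<noteq> y\<close> c1 xy by (cases x; cases y) auto
      hence "bad_factor (as @ us @ x # y # bs)" unfolding bad_factor_def
        by (metis append.assoc append_Cons append_Nil)
      ultimately show False using good_wordD(2)[OF good none] by blast
    qed
    hence "\<exists>t\<in>set us. gen_col t = Suc (gen_col x)" unfolding F' filter_empty_conv by blast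
    ultimately show ?thesis using c1 by simp
  qed
qed

section \<open>Diagrams of words and the directions of their edges\<close>

fun act :: "gen \<Rightarrow> diagram \<Rightarrow> diagram" where
  "act (Gen i) d = hook i d"
| "act Bar1 d = dot (hook 1 (dot d))"

definition word_diagram :: "nat \<Rightarrow> gen list \<Rightarrow> diagram" where
  "word_diagram n xs = foldr act xs (id_diagram n)"

lemma word_diagram_simps [simp]:
  "word_diagram n [] = id_diagram n" "word_diagram n (x # xs) = act x (word_diagram n xs)"
  by (simp_all add: word_diagram_def)

lemma dplus_act:
  assumes "2 \<le> n" "s \<in> gens n" "dplus n d"
  shows "dplus n (act s d)"
  using assms dplus_hook dplus_dot by (auto simp: gens_def)

lemma dplus_word_diagram: "2 \<le> n \<Longrightarrow> xs \<in> lists (gens n) \<Longrightarrow> dplus n (word_diagram n xs)"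
  by (induction xs) (auto intro: dplus_act dplus_id)

definition goes_right :: "diagram \<Rightarrow> nat \<Rightarrow> bool" where
  "goes_right d k \<longleftrightarrow> (\<exists>y. {North k, y} \<in> edges d \<and> dec d {North k, y} = 0 \<and> k < col y)"

text \<open>A decorated edge counts as going left wherever its other end is, since it is deformed to
  touch the left wall.\<close>

definition goes_left :: "diagram \<Rightarrow> nat \<Rightarrow> bool" where
  "goes_left d k \<longleftrightarrow> (\<exists>y. {North k, y} \<in> edges d \<and> (dec d {North k, y} > 0 \<or> col y < k))"

definition goes_straight :: "diagram \<Rightarrow> nat \<Rightarrow> bool" where
  "goes_straight d k \<longleftrightarrow> {North k, South k} \<in> edges d \<and> dec d {North k, South k} = 0"

lemma goes_exclusive:
  assumes "matching_diagram n d"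
  shows "\<not> (goes_right d k \<and> goes_left d k)" "\<not> (goes_straight d k \<and> goes_left d k)" "\<not> (goes_straight d k \<and> goes_right d k)"
proof -
  note u = pm_unique[OF matching_diagramD(1)[OF assms], of "North k"]
  show "\<not> (goes_right d k \<and> goes_left d k)"
  proof (rule notI, elim conjE)
    assume "goes_right d k" "goes_left d k"
    then obtain y z where yz: "{North k, y} \<in> edges d" "dec d {North k, y} = 0" "k < col y"
       "{North k, z} \<in> edges d" "dec d {North k, z} > 0 \<or> col z < k" unfolding goes_right_def goes_left_def by blast
    have "y = z" by (rule u[OF yz(1,4)])
    thus False using yz by simp
  qed
  show "\<not> (goes_straight d k \<and> goes_left d k)"
  proof (rule notI, elim conjE)
    assume "goes_straight d k" "goes_left d k"
    then obtain z where yz: "{North k, South k} \<in> edges d" "dec d {North k, South k} = 0"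
       "{North k, z} \<in> edges d" "dec d {North k, z} > 0 \<or> col z < k" unfolding goes_straight_def goes_left_def by blast
    have "South k = z" by (rule u[OF yz(1,3)])
    thus False using yz by auto
  qed
  show "\<not> (goes_straight d k \<and> goes_right d k)"
  proof (rule notI, elim conjE)
    assume "goes_straight d k" "goes_right d k"
    then obtain z where yz: "{North k, South k} \<in> edges d" "{North k, z} \<in> edges d" "k < col z"
      unfolding goes_straight_def goes_right_def by blast
    have "South k = z" by (rule u[OF yz(1,2)])
    thus False using yz by auto
  qed
qed

text \<open>Under this condition \<open>hook i\<close> joins two different edges and loses no information about \<open>d\<close>; it
  holds whenever \<open>Gen i\<close> extends a good word with diagram \<open>d\<close> to a good word.\<close>

definition hookable :: "diagram \<Rightarrow> nat \<Rightarrow> bool" where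
  "hookable d i \<longleftrightarrow> \<not> goes_right d i \<and> \<not> goes_left d (Suc i)"

lemma hookableE:
  assumes m: "matching_diagram n d" and i: "1 \<le> i" "Suc i \<le> n" and ok: "hookable d i"
  obtains p q where "{North i, p} \<in> edges d" "{North (Suc i), q} \<in> edges d" "p \<noteq> North (Suc i)"
    "dec d {North i, p} > 0 \<or> col p \<le> i" "dec d {North (Suc i), q} = 0" "Suc i \<le> col q"
proof -
  note pm = matching_diagramD(1)[OF m]
  obtain p where p: "{North i, p} \<in> edges d" using pm_partner[OF pm] i by force
  obtain q where q: "{North (Suc i), q} \<in> edges d" using pm_partner[OF pm] i by force
  have 1: "dec d {North i, p} > 0 \<or> col p \<le> i"
    using ok p unfolding hookable_def goes_right_def by (meson not_gr_zero not_less)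
  have 2: "dec d {North (Suc i), q} = 0" "Suc i \<le> col q"
    using ok q unfolding hookable_def goes_left_def by (meson not_gr_zero not_less)+
  have "p \<noteq> North (Suc i)"
  proof
    assume "p = North (Suc i)"
    hence "{North (Suc i), North i} \<in> edges d" using p by (simp add: insert_commute)
    hence "q = North i" using pm_unique[OF pm q] by blast
    thus False using 2 by simp
  qed
  thus ?thesis using that p q 1 2 by blast
qed

lemma sum_dec_hook:
  assumes m: "matching_diagram n d" and i: "1 \<le> i" "Suc i \<le> n" and no: "{North i, North (Suc i)} \<notin> edges d"
  shows "(\<Sum>e\<in>edges (hook i d). dec (hook i d) e) = (\<Sum>e\<in>edges d. dec d e)"
proof -
  note pm = matching_diagramD(1)[OF m]
  obtain p where p: "{North i, p} \<in> edges d" using pm_partner[OF pm, of "North i"] i by auto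
  obtain q where q: "{North (Suc i), q} \<in> edges d" using pm_partner[OF pm, of "North (Suc i)"] i by auto
  have pj: "p \<noteq> North (Suc i)" using p no by metis
  note h = hook_diff[OF m p q pj]
  let ?c = "{North i, North (Suc i)}" and ?a = "{North i, p}" and ?b = "{North (Suc i), q}"
  let ?D = "edges d - {?a, ?b}"
  have ab: "?a \<noteq> ?b" using pj by (auto simp: doubleton_eq_iff)
  have pqc: "{p, q} \<noteq> ?c" using h(3-5) pj by (auto simp: doubleton_eq_iff)
  have fin: "finite ?D" using finite_matching[OF pm] by simp
  have E: "edges (hook i d) = insert ?c (insert {p, q} ?D)" unfolding h(1) by simp
  have decD: "dec (hook i d) e = dec d e" if "e \<in> ?D" for e
  proof -
    have "e \<noteq> {p, q}" "e \<noteq> ?c" using that h(8,9) by auto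
    thus ?thesis unfolding h(1) using that by simp
  qed
  have "(\<Sum>e\<in>edges (hook i d). dec (hook i d) e) = dec (hook i d) ?c + (dec (hook i d) {p, q} + (\<Sum>e\<in>?D. dec (hook i d) e))"
    unfolding E using fin h(8,9) pqc by simp
  also have "\<dots> = dec d ?a + (dec d ?b + (\<Sum>e\<in>?D. dec d e))" using decD pqc by (simp add: h(1))
  also have "\<dots> = (\<Sum>e\<in>insert ?a (insert ?b ?D). dec d e)" using fin ab by simp
  also have "insert ?a (insert ?b ?D) = edges d" using p q by auto
  finally show ?thesis .
qed

text \<open>The edge at \<open>i\<close> leads to the left or straight down, the one at
  \<open>Suc i\<close> to the right or straight down. Joining them prolongs both in the direction
  they already have, so the far ends keep their own directions.\<close>

lemma hook_goes:
  assumes m: "matching_diagram n d" and i: "1 \<le> i" "Suc i \<le> n" and ok: "hookable d i"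
  shows "{North i, North (Suc i)} \<notin> edges d" "loops (hook i d) = loops d"
    "goes_right (hook i d) i" "goes_left (hook i d) (Suc i)"
    "\<forall>e. dec d e \<le> 1 \<Longrightarrow> dec (hook i d) e \<le> 1"
    "k \<noteq> i \<Longrightarrow> k \<noteq> Suc i \<Longrightarrow> goes_right d k \<Longrightarrow> goes_right (hook i d) k"
    "k \<noteq> i \<Longrightarrow> k \<noteq> Suc i \<Longrightarrow> goes_left d k \<Longrightarrow> goes_left (hook i d) k"
    "k \<noteq> i \<Longrightarrow> k \<noteq> Suc i \<Longrightarrow> goes_straight d k \<Longrightarrow> goes_straight (hook i d) k"
    "dec (hook i d) {North i, North (Suc i)} = 0"
proof -
  obtain p q where p: "{North i, p} \<in> edges d" and q: "{North (Suc i), q} \<in> edges d" and pj: "p \<noteq> North (Suc i)"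
    and pc: "dec d {North i, p} > 0 \<or> col p \<le> i" and qc: "dec d {North (Suc i), q} = 0" "Suc i \<le> col q"
    using hookableE[OF m i ok] by metis
  note h = hook_diff[OF m p q pj]
  let ?c = "{North i, North (Suc i)}" and ?a = "{North i, p}" and ?b = "{North (Suc i), q}"
  have E: "edges (hook i d) = insert ?c (insert {p, q} (edges d - {?a, ?b}))" unfolding h(1) by simp
  have ab: "?a \<noteq> ?b" using pj by (auto simp: doubleton_eq_iff)
  have pqc: "{p, q} \<noteq> ?c" using h(3-5) pj by (auto simp: doubleton_eq_iff)
  have decc: "dec (hook i d) ?c = 0" unfolding h(1) by simp
  have decpq: "dec (hook i d) {p, q} = dec d ?a" unfolding h(1) using pqc qc by simp
  have decD: "dec (hook i d) e = dec d e" if "e \<in> edges d - {?a, ?b}" for e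
  proof -
    have "e \<noteq> {p, q}" "e \<noteq> ?c" using that h(8,9) by auto
    thus ?thesis unfolding h(1) using that by simp
  qed
  show "{North i, North (Suc i)} \<notin> edges d" by (rule h(9))
  show "loops (hook i d) = loops d" unfolding h(1) by simp
  have cE: "?c \<in> edges (hook i d)" unfolding E by simp
  show "goes_right (hook i d) i" unfolding goes_right_def using cE decc by (intro exI[of _ "North (Suc i)"]) simp
  have cE': "{North (Suc i), North i} \<in> edges (hook i d)" using cE by (simp only: insert_commute)
  show "goes_left (hook i d) (Suc i)" unfolding goes_left_def using cE' by (intro exI[of _ "North i"]) simp
  show "dec (hook i d) ?c = 0" by (rule decc)
  show "dec (hook i d) e \<le> 1" if "\<forall>e. dec d e \<le> 1" for e
    unfolding h(1) using that qc by simp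
  have trans: "({North k, y} \<in> edges (hook i d) \<and> dec (hook i d) {North k, y} = dec d {North k, y}) \<or>
      (North k = p \<and> y = North i) \<or> (North k = q \<and> y = North (Suc i))"
    if "k \<noteq> i" "k \<noteq> Suc i" "{North k, y} \<in> edges d" for k y
  proof (cases "{North k, y} \<in> {?a, ?b}")
    case True
    thus ?thesis using that(1,2) by (auto simp: doubleton_eq_iff)
  next
    case False
    hence "{North k, y} \<in> edges d - {?a, ?b}" using that(3) by simp
    thus ?thesis using decD unfolding E by simp
  qed
  have pqE: "{p, q} \<in> edges (hook i d)" "{q, p} \<in> edges (hook i d)" "dec (hook i d) {q, p} = dec d ?a"
    unfolding E using decpq by (auto simp: insert_commute)
  have sym: "{p, North i} = ?a" "{q, North (Suc i)} = ?b" by (simp_all add: insert_commute)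
  show "goes_right (hook i d) k" if k: "k \<noteq> i" "k \<noteq> Suc i" and g: "goes_right d k"
  proof -
    obtain y where y: "{North k, y} \<in> edges d" "dec d {North k, y} = 0" "k < col y" using g unfolding goes_right_def by blast
    from trans[OF k y(1)] show ?thesis
    proof (elim disjE conjE)
      assume "{North k, y} \<in> edges (hook i d)" "dec (hook i d) {North k, y} = dec d {North k, y}"
      thus ?thesis using y unfolding goes_right_def by metis
    next
      assume kp: "North k = p" "y = North i"
      hence "dec d ?a = 0" "k < i" using y sym by simp_all
      moreover have "{North k, q} \<in> edges (hook i d)" "dec (hook i d) {North k, q} = dec d ?a" using pqE decpq kp by simp_all
      ultimately show ?thesis using qc unfolding goes_right_def by (intro exI[of _ q]) simp
    next
      assume kq: "North k = q" "y = North (Suc i)"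
      hence "k < Suc i" using y by simp
      moreover have "Suc i \<le> k" using qc kq by (metis col.simps(1))
      ultimately show ?thesis by simp
    qed
  qed
  show "goes_left (hook i d) k" if k: "k \<noteq> i" "k \<noteq> Suc i" and g: "goes_left d k"
  proof -
    obtain y where y: "{North k, y} \<in> edges d" "dec d {North k, y} > 0 \<or> col y < k" using g unfolding goes_left_def by blast
    from trans[OF k y(1)] show ?thesis
    proof (elim disjE conjE)
      assume "{North k, y} \<in> edges (hook i d)" "dec (hook i d) {North k, y} = dec d {North k, y}"
      thus ?thesis using y unfolding goes_left_def by metis
    next
      assume kp: "North k = p" "y = North i"
      hence "dec d ?a > 0 \<or> i < k" using y sym by simp
      moreover have "dec d ?a > 0 \<or> k \<le> i" using pc kp by (metis col.simps(1))
      ultimately have "dec d ?a > 0" by auto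
      moreover have "{North k, q} \<in> edges (hook i d)" "dec (hook i d) {North k, q} = dec d ?a" using pqE decpq kp by simp_all
      ultimately show ?thesis unfolding goes_left_def by (intro exI[of _ q]) simp
    next
      assume kq: "North k = q" "y = North (Suc i)"
      have "Suc i \<le> k" using qc kq by (metis col.simps(1))
      moreover have "{North k, p} \<in> edges (hook i d)" "dec (hook i d) {North k, p} = dec d ?a" using pqE kq by simp_all
      ultimately show ?thesis using pc unfolding goes_left_def by (intro exI[of _ p]) auto
    qed
  qed
  show "goes_straight (hook i d) k" if k: "k \<noteq> i" "k \<noteq> Suc i" and g: "goes_straight d k"
    using trans[OF k, of "South k"] g unfolding goes_straight_def by auto
qed

text \<open>The joined edge has to be recognised in the result. If the two diagrams joined different
  edges, the one whose right end comes first would be enclosed, in the other diagram, by the edge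
  from \<open>Suc i\<close> to the later right end. Both its ends would then lie on the right side,
  so it would carry a decoration that cannot reach the wall.\<close>

lemma hook_inj:
  assumes d1: "dplus n d1" and d2: "dplus n d2" and i: "1 \<le> i" "Suc i \<le> n"
    and ok1: "hookable d1 i" and ok2: "hookable d2 i" and eq: "hook i d1 = hook i d2"
  shows "d1 = d2"
proof -
  note m1 = dplusD(1)[OF d1] and m2 = dplusD(1)[OF d2]
  let ?c = "{North i, North (Suc i)}"
  obtain p1 q1 where p1: "{North i, p1} \<in> edges d1" and q1: "{North (Suc i), q1} \<in> edges d1" and pj1: "p1 \<noteq> North (Suc i)"
    and pc1: "dec d1 {North i, p1} > 0 \<or> col p1 \<le> i" and qc1: "dec d1 {North (Suc i), q1} = 0" "Suc i \<le> col q1"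
    using hookableE[OF m1 i ok1] by metis
  obtain p2 q2 where p2: "{North i, p2} \<in> edges d2" and q2: "{North (Suc i), q2} \<in> edges d2" and pj2: "p2 \<noteq> North (Suc i)"
    and pc2: "dec d2 {North i, p2} > 0 \<or> col p2 \<le> i" and qc2: "dec d2 {North (Suc i), q2} = 0" "Suc i \<le> col q2"
    using hookableE[OF m2 i ok2] by metis
  note h1 = hook_diff[OF m1 p1 q1 pj1] and h2 = hook_diff[OF m2 p2 q2 pj2]
  have E1: "edges (hook i d1) = insert ?c (insert {p1, q1} (edges d1 - {{North i, p1}, {North (Suc i), q1}}))" unfolding h1(1) by simp
  have E2: "edges (hook i d1) = insert ?c (insert {p2, q2} (edges d2 - {{North i, p2}, {North (Suc i), q2}}))" unfolding eq h2(1) by simp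
  have pqc: "{p1, q1} \<noteq> ?c" "{p2, q2} \<noteq> ?c" using h1(3-5) pj1 h2(3-5) pj2 by (auto simp: doubleton_eq_iff)
  have dec1: "dec (hook i d1) {p1, q1} = dec d1 {North i, p1}" unfolding h1(1) using pqc qc1 by simp
  have dec2: "dec (hook i d1) {p2, q2} = dec d2 {North i, p2}" unfolding eq h2(1) using pqc qc2 by simp
  have cross: False
    if d: "dplus n d" "dplus n d'" and p: "{North i, p} \<in> edges d" and q: "{North (Suc i), q} \<in> edges d"
      and pc: "dec d {North i, p} > 0 \<or> col p \<le> i" and qc: "Suc i \<le> col q" and qc': "Suc i \<le> col q'"
      and p': "{North i, p'} \<in> edges d'" and q': "{North (Suc i), q'} \<in> edges d'"
      and pq: "{p, q} \<in> edges d'" "{p, q} \<noteq> {North i, p'}" "{p, q} \<noteq> {North (Suc i), q'}"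
      and dec: "dec d' {p, q} = dec d {North i, p}" and lt: "pos n q < pos n q'"
    for d d' p q p' q'
  proof -
    note pm = dplusD(4)[OF d(1)] and pm' = dplusD(4)[OF d(2)]
    have n: "p \<in> nodes n" "q \<in> nodes n" "q' \<in> nodes n" using pm_ends[OF pm] p q pm_ends[OF pm'] q' by blast+
    have right_pos: "Suc i \<le> col x \<longleftrightarrow> i < pos n x \<and> pos n x \<le> 2 * n - i" if "x \<in> nodes n" for x
      using that i by (cases x) auto
    have dist: "distinct [Suc i, pos n q', pos n p, pos n q]"
      using distinct_edges[OF pm' q' pq(1)] pq(3) by auto
    have qb: "Suc i < pos n q" "pos n q' \<le> 2 * n - i" using right_pos n qc qc' dist by auto
    hence "between n (North (Suc i)) q' q" using lt unfolding btw_def by auto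
    moreover have "between n (North (Suc i)) q' p = between n (North (Suc i)) q' q"
      by (rule planarD[OF pm' dplusD(2)[OF d(2)] q' pq(1)]) (use pq(3) in simp)
    ultimately have b: "between n (North (Suc i)) q' p" "between n (North (Suc i)) q' q" by simp_all
    hence "Suc i \<le> col p" using right_pos[OF n(1)] qb unfolding btw_def by auto
    hence "dec d' {p, q} > 0" using pc dec by auto
    hence "left_exposed n (edges d') {p, q}" using dplusD(3)[OF d(2) pq(1)] by simp
    thus False using b q' unfolding left_exposed_iff by blast
  qed
  have same: "{p1, q1} = {p2, q2}"
  proof (rule ccontr)
    assume ne: "{p1, q1} \<noteq> {p2, q2}"
    have "{p1, q1} \<in> insert ?c (insert {p2, q2} (edges d2 - {{North i, p2}, {North (Suc i), q2}}))"
      unfolding E2[symmetric] E1 by simp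
    hence in2: "{p1, q1} \<in> edges d2 - {{North i, p2}, {North (Suc i), q2}}"
      by (rule insert2_cases) (use pqc ne in simp_all)
    have "{p2, q2} \<in> insert ?c (insert {p1, q1} (edges d1 - {{North i, p1}, {North (Suc i), q1}}))"
      unfolding E1[symmetric] E2 by simp
    hence in1: "{p2, q2} \<in> edges d1 - {{North i, p1}, {North (Suc i), q1}}"
      by (rule insert2_cases) (use pqc ne in simp_all)
    have dec21: "dec d2 {p1, q1} = dec d1 {North i, p1}"
    proof -
      have "dec (hook i d2) {p1, q1} = dec d2 {p1, q1}" unfolding h2(1) using in2 pqc ne by simp
      thus ?thesis using dec1 eq by simp
    qed
    have dec12: "dec d1 {p2, q2} = dec d2 {North i, p2}"
    proof -
      have "dec (hook i d1) {p2, q2} = dec d1 {p2, q2}" unfolding h1(1) using in1 pqc ne by simp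
      thus ?thesis using dec2 by simp
    qed
    have "q1 \<noteq> q2"
    proof
      assume q12: "q1 = q2"
      have "{p1, q1} = {North (Suc i), q2}"
        by (rule pm_disjoint[OF dplusD(4)[OF d2] _ q2, of _ q1]) (use in2 q12 in simp_all)
      thus False using in2 by simp
    qed
    hence "pos n q1 \<noteq> pos n q2" using pos_inj[of q1 n q2] h1(7) h2(7) by simp
    then consider "pos n q1 < pos n q2" | "pos n q2 < pos n q1" by linarith
    thus False
    proof cases
      case 1
      show False
        by (rule cross[OF d1 d2 p1 q1 pc1 qc1(2) qc2(2) p2 q2 _ _ _ dec21 1]) (use in2 in simp_all)
    next
      case 2
      show False
        by (rule cross[OF d2 d1 p2 q2 pc2 qc2(2) qc1(2) p1 q1 _ _ _ dec12 2]) (use in1 in simp_all)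
    qed
  qed
  \<comment> \<open>The same edge with its ends exchanged would have both ends to the right of the
    cap, and the planarity of the two diagrams would demand opposite orders of these ends.\<close>
  have "p1 = p2 \<and> q1 = q2"
  proof (rule ccontr)
    assume "\<not> ?thesis"
    hence sw: "q2 = p1" "p2 = q1" using same by (auto simp: doubleton_eq_iff)
    have right_pos: "Suc i \<le> col x \<longleftrightarrow> i < pos n x \<and> pos n x \<le> 2 * n - i" if "x \<in> nodes n" for x
      using that i by (cases x) auto
    have ab1: "{North i, p1} \<noteq> {North (Suc i), q1}" using pj1 by (auto simp: doubleton_eq_iff)
    have ab2: "{North i, p2} \<noteq> {North (Suc i), q2}" using pj2 by (auto simp: doubleton_eq_iff)
    have b1: "between n (North i) p1 (North (Suc i)) = between n (North i) p1 q1"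
      by (rule planarD[OF dplusD(4,2)[OF d1] p1 q1 ab1])
    have b2: "between n (North i) p2 (North (Suc i)) = between n (North i) p2 q2"
      by (rule planarD[OF dplusD(4,2)[OF d2] p2 q2 ab2])
    have dist: "distinct [i, pos n p1, Suc i, pos n q1]"
      using distinct_edges[OF dplusD(4)[OF d1] p1 q1 ab1] by simp
    have "Suc i < pos n q1" "Suc i < pos n p1"
      using right_pos[OF h1(7)] right_pos[OF h1(6)] qc1 qc2 sw dist by auto
    thus False using b1 b2 sw dist unfolding btw_def by auto
  qed
  hence pq: "p2 = p1" "q2 = q1" by auto
  let ?a = "{North i, p1}" and ?b = "{North (Suc i), q1}"
  have Ed: "edges d1 = edges d2"
  proof -
    have "edges d1 - {?a, ?b} = edges (hook i d1) - {?c, {p1, q1}}" unfolding E1 using h1(8,9) by auto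
    moreover have "edges d2 - {?a, ?b} = edges (hook i d1) - {?c, {p1, q1}}" unfolding E2 pq using h2(8,9) pq by auto
    moreover have "edges d1 = insert ?a (insert ?b (edges d1 - {?a, ?b}))" using p1 q1 by auto
    moreover have "edges d2 = insert ?a (insert ?b (edges d2 - {?a, ?b}))" using p2 q2 pq by auto
    ultimately show ?thesis by metis
  qed
  show ?thesis
  proof (rule diagram_eqI)
    show "edges d1 = edges d2" by (rule Ed)
    have "loops (hook i d1) = loops d1" unfolding h1(1) by simp
    moreover have "loops (hook i d2) = loops d2" unfolding h2(1) by simp
    ultimately show "loops d1 = loops d2" using eq by simp
  next
    fix e assume e: "e \<in> edges d1"
    consider "e = ?a" | "e = ?b" | "e \<noteq> ?a" "e \<noteq> ?b" by blast
    thus "dec d1 e = dec d2 e"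
    proof cases
      case 1 thus ?thesis using dec1 dec2 pq by simp
    next
      case 2 thus ?thesis using qc1 qc2 pq by simp
    next
      case 3
      have "e \<noteq> ?c" "e \<noteq> {p1, q1}" using e h1(8,9) by auto
      hence "dec (hook i d1) e = dec d1 e" "dec (hook i d2) e = dec d2 e"
        unfolding h1(1) h2(1) pq using 3 by simp_all
      thus ?thesis using eq by simp
    qed
  qed (erule matching_diagramD(2)[OF m1] matching_diagramD(2)[OF m2])+
qed

lemma dot_inj:
  assumes "dot d1 = dot d2"
  shows "d1 = d2"
proof -
  have E: "edges d1 = edges d2" "loops d1 = loops d2"
    using arg_cong[OF assms, of edges] arg_cong[OF assms, of loops] by (simp_all add: dot_def)
  hence at: "edge_at d1 x = edge_at d2 x" for x by (simp add: edge_at_def)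
  have "dec d1 e = dec d2 e" for e
    using arg_cong[OF assms, of "\<lambda>d. dec d e"] unfolding dec_dot at by simp
  thus ?thesis using E by (intro diagram.equality ext) auto
qed

section \<open>Relations between the operators of the generators\<close>

lemma stack_act:
  assumes "2 \<le> n" "s \<in> gens n" "dplus n a" "dplus n b"
  shows "stack n (act s a) b = act s (stack n a b)"
proof -
  have n: "1 \<le> n" using assms(1) by simp
  show ?thesis
  proof (cases s)
    case Bar1
    have i: "1 \<le> (1::nat)" "Suc 1 \<le> n" using assms(1) by auto
    note da = dplus_dot[OF assms(3) n]
    have "stack n (dot (hook 1 (dot a))) b = dot (stack n (hook 1 (dot a)) b)"
      by (rule stack_dot'[OF n dplus_hook[OF da i] assms(4)])
    also have "stack n (hook 1 (dot a)) b = hook 1 (stack n (dot a) b)"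
      by (rule stack_hook'[OF n da assms(4) i])
    also have "stack n (dot a) b = dot (stack n a b)"
      by (rule stack_dot'[OF n assms(3,4)])
    finally show ?thesis using Bar1 by simp
  next
    case (Gen i)
    hence "1 \<le> i" "Suc i \<le> n" using assms(1,2) by (auto simp: gens_def)
    thus ?thesis using stack_hook'[OF n assms(3,4)] Gen by simp
  qed
qed

lemma stack_word_diagram:
  assumes "2 \<le> n" "xs \<in> lists (gens n)" "dplus n d"
  shows "stack n (word_diagram n xs) d = foldr act xs d"
  using assms(2)
proof (induction xs)
  case Nil
  thus ?case using stack_id_left[OF dplusD(1)[OF assms(3)]] by simp
next
  case (Cons x xs)
  thus ?case using stack_act[OF assms(1) _ dplus_word_diagram[OF assms(1)] assms(3)] by simp
qed

lemma word_diagram_append: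
  assumes "2 \<le> n" "xs \<in> lists (gens n)" "ys \<in> lists (gens n)"
  shows "word_diagram n (xs @ ys) = stack n (word_diagram n xs) (word_diagram n ys)"
  using stack_word_diagram[OF assms(1,2) dplus_word_diagram[OF assms(1,3)]] by (simp add: word_diagram_def)

lemma hook_id:
  assumes "1 \<le> i" "Suc i \<le> n"
  shows "hook i (id_diagram n) = \<lparr>edges = simple_edges n i, dec = (\<lambda>_. 0), loops = {#}\<rparr>"
proof -
  have p: "{North i, South i} \<in> edges (id_diagram n)" "{North (Suc i), South (Suc i)} \<in> edges (id_diagram n)"
    using assms by (auto simp: id_diagram_def)
  note h = hook_diff[OF matching_id p]
  have "edges (id_diagram n) - {{North i, South i}, {North (Suc i), South (Suc i)}} =
      {{North j, South j} | j. j \<in> {1..n} - {i, Suc i}}"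
    by (auto simp: id_diagram_def doubleton_eq_iff)
  thus ?thesis using h(1) by (simp add: simple_edges_def id_diagram_def fun_upd_def)
qed

lemma edge_at_id: "1 \<le> j \<Longrightarrow> j \<le> n \<Longrightarrow> edge_at (id_diagram n) (North j) = {North j, South j}"
  by (rule edge_at_eq[OF matching_id[of n]]) (auto simp: id_diagram_def)

lemma simple_diagram_eq_act:
  assumes n: "2 \<le> n" and s: "s \<in> gens n"
  shows "simple_diagram n s = act s (id_diagram n)"
proof (cases s)
  case (Gen i)
  thus ?thesis using hook_id[of i n] s n by (auto simp: gens_def)
next
  case Bar1
  let ?v = "{North 1, South 1}" and ?c = "{North 1, North 2}" and ?d = "{South 1, South 2}"
  define d1 where "d1 = dot (id_diagram n)"
  have m1: "matching_diagram n d1" unfolding d1_def by (rule matching_dot[OF matching_id]) (use n in simp)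
  have E1: "edges d1 = edges (id_diagram n)" unfolding d1_def dot_def by simp
  have at: "edge_at (id_diagram n) (North 1) = ?v" using edge_at_id[of 1 n] n by simp
  have D1: "dec d1 e = (if e = ?v then 1 else 0)" for e unfolding d1_def dec_dot at by (simp add: id_diagram_def)
  have L1: "loops d1 = {#}" unfolding d1_def dot_def id_diagram_def by simp
  have p: "{North 1, South 1} \<in> edges d1" "{North (Suc 1), South (Suc 1)} \<in> edges d1"
    unfolding E1 using n by (auto simp: id_diagram_def)
  have S: "South 1 \<noteq> North (Suc 1)" by simp
  note h = hook_diff[OF m1 p S]
  have N: "Suc 1 = (2::nat)" by simp
  have "edges d1 - {?v, {North 2, South 2}} = {{North j, South j} | j. j \<in> {1..n} - {1, 2}}"
    unfolding E1 by (auto simp: id_diagram_def doubleton_eq_iff)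
  hence E2: "edges (hook 1 d1) = simple_edges n 1"
    unfolding h(1) simple_edges_def by (simp add: numeral_2_eq_2)
  have D2: "dec (hook 1 d1) e = (if e = ?d then 1 else 0)" for e
    unfolding h(1) by (auto simp: D1 doubleton_eq_iff numeral_2_eq_2)
  have m2: "matching_diagram n (hook 1 d1)" by (rule matching_hook[OF m1]) (use n in auto)
  have at2: "edge_at (hook 1 d1) (North 1) = ?c"
    by (rule edge_at_eq[OF m2]) (use E2 in \<open>auto simp: simple_edges_def numeral_2_eq_2\<close>)
  show ?thesis
  proof (rule diagram_eqI)
    show "edges (simple_diagram n s) = edges (act s (id_diagram n))"
      using Bar1 E2 by (simp add: d1_def[symmetric]) (simp add: dot_def)
    show "loops (simple_diagram n s) = loops (act s (id_diagram n))"
      using Bar1 L1 by (simp add: d1_def[symmetric]) (simp add: dot_def h(1)[simplified])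
    have "dec (act s (id_diagram n)) e = (if e = ?d then 1 else 0) + (if e = ?c then 1 else 0)" for e
      using Bar1 D2 at2 by (simp add: d1_def[symmetric] dec_dot)
    thus "dec (simple_diagram n s) e = dec (act s (id_diagram n)) e" for e
      using Bar1 by (auto simp: doubleton_eq_iff)
    show "dec (act s (id_diagram n)) e = 0" if "e \<notin> edges (act s (id_diagram n))" for e
      using matching_diagramD(2)[OF dplusD(1)[OF dplus_act[OF n s dplus_id]] that] .
    show "dec (simple_diagram n s) e = 0" if "e \<notin> edges (simple_diagram n s)" for e
      using that Bar1 by (auto simp: simple_edges_def)
  qed
qed

lemma dot_hook:
  assumes m: "matching_diagram n d" and i: "2 \<le> i" "Suc i \<le> n"
  shows "dot (hook i d) = hook i (dot d)"
proof -
  have i1: "1 \<le> i" and n1: "1 \<le> n" using i by auto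
  note pm = matching_diagramD(1)[OF m] and md = matching_dot[OF m n1]
  have hm: "matching_diagram n (hook i d)" by (rule matching_hook[OF m i1 i(2)])
  obtain p where p: "{North i, p} \<in> edges d" using pm_partner[OF pm, of "North i"] i by auto
  obtain q where q: "{North (Suc i), q} \<in> edges d" using pm_partner[OF pm, of "North (Suc i)"] i by auto
  obtain z where z: "{North 1, z} \<in> edges d" using pm_partner[OF pm, of "North 1"] i by auto
  have at: "edge_at d (North 1) = {North 1, z}" by (rule edge_at_eq[OF m z]) simp
  have E: "edges (dot d) = edges d" by (simp add: dot_def)
  let ?c = "{North i, North (Suc i)}"
  have nc: "{North 1, z} \<noteq> ?c" using i by (auto simp: doubleton_eq_iff)
  show ?thesis
  proof (cases "p = North (Suc i)")
    case True
    have c: "?c \<in> edges d" using p True by simp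
    have at': "edge_at (hook i d) (North 1) = {North 1, z}"
      by (rule edge_at_eq[OF hm]) (use z in \<open>simp_all add: hook_same[OF m c]\<close>)
    have dc: "dec (dot d) ?c = dec d ?c" unfolding dec_dot at using nc by simp
    show ?thesis
    proof (rule diagram.equality)
      show "dec (dot (hook i d)) = dec (hook i (dot d))"
      proof (rule ext)
        fix f
        have 1: "dec (dot (hook i d)) f = dec (hook i d) f + (if f = {North 1, z} then 1 else 0)"
          unfolding dec_dot at' ..
        have 2: "dec (dot d) f = dec d f + (if f = {North 1, z} then 1 else 0)" unfolding dec_dot at ..
        show "dec (dot (hook i d)) f = dec (hook i (dot d)) f"
          unfolding 1 hook_same[OF md c[folded E]] using nc by (simp add: hook_same[OF m c] 2)
      qed
      show "loops (dot (hook i d)) = loops (hook i (dot d))"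
        unfolding hook_same[OF md c[folded E]] dc by (simp add: dot_def hook_same[OF m c])
    qed (simp_all add: hook_same[OF md c[folded E]] hook_same[OF m c], simp_all add: dot_def)
  next
    case False
    note h = hook_diff[OF m p q False] and h' = hook_diff[OF md p[folded E] q[folded E] False]
    let ?a = "{North i, p}" and ?b = "{North (Suc i), q}"
    have ab: "?a \<noteq> ?b" using False by (auto simp: doubleton_eq_iff)
    have pqc: "{p, q} \<noteq> ?c" using h(3-5) False by (auto simp: doubleton_eq_iff)
    show ?thesis
    proof (rule diagram_eqI)
      show "edges (dot (hook i d)) = edges (hook i (dot d))" unfolding h'(1) by (simp add: dot_def h(1))
      show "loops (dot (hook i d)) = loops (hook i (dot d))" unfolding h'(1) by (simp add: dot_def h(1))
      fix e assume e: "e \<in> edges (dot (hook i d))"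
      have "e \<in> insert ?c (insert {p, q} (edges d - {?a, ?b}))" using e by (simp add: dot_def h(1))
      then consider "e = ?c" | "e = {p, q}" | "e \<noteq> ?c" "e \<noteq> {p, q}" "e \<in> edges d - {?a, ?b}" by (rule insert2_cases)
      note e_cases = this
      show "dec (dot (hook i d)) e = dec (hook i (dot d)) e"
      proof (cases "{North 1, z} \<in> {?a, ?b}")
        case True
        have at': "edge_at (hook i d) (North 1) = {p, q}"
        proof (rule edge_at_eq[OF hm])
          show "{p, q} \<in> edges (hook i d)" by (simp add: h(1))
          show "North 1 \<in> {p, q}" using True i by (auto simp: doubleton_eq_iff)
        qed
        have "dec (dot d) ?a + dec (dot d) ?b = Suc (dec d ?a + dec d ?b)"
        proof -
          from True have "{North 1, z} = ?a \<or> {North 1, z} = ?b" by (simp only: insert_iff empty_iff simp_thms)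
          thus ?thesis
          proof
            assume eq: "{North 1, z} = ?a"
            show ?thesis unfolding dec_dot at eq using ab by simp
          next
            assume eq: "{North 1, z} = ?b"
            show ?thesis unfolding dec_dot at eq using ab by simp
          qed
        qed
        hence pq: "dec (hook i (dot d)) {p, q} = Suc (dec d ?a + dec d ?b)" unfolding h'(1) using pqc by simp
        from e_cases show ?thesis
        proof cases
          case 1
          thus ?thesis unfolding dec_dot at' h'(1) by (simp add: h(1) pqc[symmetric])
        next
          case 2
          thus ?thesis unfolding dec_dot at' using pq by (simp add: h(1) pqc)
        next
          case 3
          have "e \<noteq> {North 1, z}"
          proof
            assume "e = {North 1, z}"
            hence "e \<in> {?a, ?b}" using True by (simp only:)
            thus False by (rule DiffD2[OF 3(3)])
          qed
          hence "dec (dot d) e = dec d e" unfolding dec_dot at by simp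
          thus ?thesis using 3 unfolding dec_dot[of "hook i d"] at' h'(1) by (simp add: h(1))
        qed
      next
        case F: False
        have zD: "{North 1, z} \<in> edges d - {?a, ?b}" using z F by simp
        have at': "edge_at (hook i d) (North 1) = {North 1, z}"
          by (rule edge_at_eq[OF hm]) (use zD in \<open>simp_all add: h(1)\<close>)
        have zpq: "{North 1, z} \<noteq> {p, q}" using z h(8) by metis
        have "?a \<noteq> {North 1, z}" "?b \<noteq> {North 1, z}" using F by (metis insertI1 insertI2)+
        hence "dec (dot d) ?a = dec d ?a" "dec (dot d) ?b = dec d ?b"
          unfolding dec_dot at by (simp_all only: if_False add_0_right)
        hence pq: "dec (hook i (dot d)) {p, q} = dec d ?a + dec d ?b" unfolding h'(1) using pqc by simp
        from e_cases show ?thesis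
        proof cases
          case 1
          thus ?thesis unfolding dec_dot at' h'(1) using nc by (simp add: h(1))
        next
          case 2
          thus ?thesis unfolding dec_dot at' using pq zpq by (simp add: h(1) pqc)
        next
          case 3
          moreover have "dec (dot d) e = dec d e + (if e = {North 1, z} then 1 else 0)" unfolding dec_dot at ..
          ultimately show ?thesis unfolding dec_dot[of "hook i d"] at' h'(1) by (simp add: h(1))
        qed
      qed
    qed (erule matching_diagramD(2)[OF matching_dot[OF hm n1]] matching_diagramD(2)[OF matching_hook[OF md i1 i(2)]])+
  qed
qed

lemma vertical_in_simple_edges:
  "1 \<le> k \<Longrightarrow> k \<le> n \<Longrightarrow> k \<noteq> l \<Longrightarrow> k \<noteq> Suc l \<Longrightarrow> {North k, South k} \<in> simple_edges n l"
  unfolding simple_edges_def by (intro UnI2 CollectI exI[of _ k]) simp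

text \<open>On the identity all edges are explicit; \<open>hook_commute\<close> carries the equation
  to an arbitrary \<open>d\<close> by stacking.\<close>

lemma hook_commute_id:
  assumes "1 \<le> i" "Suc i < j" "Suc j \<le> n"
  shows "hook i (hook j (id_diagram n)) = hook j (hook i (id_diagram n))"
proof -
  have key: "hook k (hook l (id_diagram n)) = \<lparr>edges = insert {North k, North (Suc k)} (insert {South k, South (Suc k)}
      (insert {North l, North (Suc l)} (insert {South l, South (Suc l)} {{North j, South j} | j. j \<in> {1..n} - {l, Suc l, k, Suc k}}))),
      dec = (\<lambda>_. 0), loops = {#}\<rparr>"
    if k: "1 \<le> k" "Suc k \<le> n" "1 \<le> l" "Suc l \<le> n" "Suc k < l \<or> Suc l < k" for k l
  proof -
    have m: "matching_diagram n (hook l (id_diagram n))" by (rule matching_hook[OF matching_id k(3,4)])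
    have p: "{North k, South k} \<in> edges (hook l (id_diagram n))" "{North (Suc k), South (Suc k)} \<in> edges (hook l (id_diagram n))"
      unfolding hook_id[OF k(3,4)] diagram.simps
      by (rule vertical_in_simple_edges; use k in linarith)+
    let ?C = "{{North l, North (Suc l)}, {South l, South (Suc l)}}"
    have 1: "?C - {{North k, South k}, {North (Suc k), South (Suc k)}} = ?C"
      by (auto simp: doubleton_eq_iff)
    have 2: "{{North j, South j} | j. j \<in> {1..n} - {l, Suc l}} - {{North k, South k}, {North (Suc k), South (Suc k)}} =
        {{North j, South j} | j. j \<in> {1..n} - {l, Suc l, k, Suc k}}"
      by (auto simp: doubleton_eq_iff)
    have "edges (hook l (id_diagram n)) - {{North k, South k}, {North (Suc k), South (Suc k)}} =
       ?C \<union> ({{North j, South j} | j. j \<in> {1..n} - {l, Suc l, k, Suc k}})"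
      unfolding hook_id[OF k(3,4)] simple_edges_def diagram.simps Un_Diff 2 add.commute[of l] plus_1_eq_Suc 1 ..
    hence "hook k (hook l (id_diagram n)) = \<lparr>edges = insert {North k, North (Suc k)} (insert {South k, South (Suc k)}
        (?C \<union> ({{North j, South j} | j. j \<in> {1..n} - {l, Suc l, k, Suc k}}))), dec = (\<lambda>_. 0), loops = {#}\<rparr>"
      using hook_diff(1)[OF m p] by (simp only: hook_id[OF k(3,4)] diagram.simps fun_upd_def add_0 if_cancel) simp
    thus ?thesis by simp
  qed
  have swap: "insert a (insert b (insert c (insert d V))) = insert c (insert d (insert a (insert b V)))" for a b c d :: "node set" and V
    by blast
  have V: "{1..n} - {j, Suc j, i, Suc i} = {1..n} - {i, Suc i, j, Suc j}" by blast
  have "hook i (hook j (id_diagram n)) = \<lparr>edges = insert {North i, North (Suc i)} (insert {South i, South (Suc i)}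
      (insert {North j, North (Suc j)} (insert {South j, South (Suc j)} {{North k, South k} | k. k \<in> {1..n} - {j, Suc j, i, Suc i}}))),
      dec = (\<lambda>_. 0), loops = {#}\<rparr>"
    by (rule key) (use assms in linarith)+
  moreover have "hook j (hook i (id_diagram n)) = \<lparr>edges = insert {North j, North (Suc j)} (insert {South j, South (Suc j)}
      (insert {North i, North (Suc i)} (insert {South i, South (Suc i)} {{North k, South k} | k. k \<in> {1..n} - {i, Suc i, j, Suc j}}))),
      dec = (\<lambda>_. 0), loops = {#}\<rparr>"
    by (rule key) (use assms in linarith)+
  ultimately show ?thesis by (simp only: V swap[of "{North i, North (Suc i)}"])
qed

lemma hook_commute:
  assumes n: "2 \<le> n" and i: "1 \<le> i" "Suc i < j" "Suc j \<le> n" and d: "dplus n d"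
  shows "hook i (hook j d) = hook j (hook i d)"
proof -
  have g: "Gen i \<in> gens n" "Gen j \<in> gens n" using i by (auto simp: gens_def)
  have "hook i (hook j d) = stack n (hook i (hook j (id_diagram n))) d" 
    using stack_word_diagram[OF n _ d, of "[Gen i, Gen j]"] g by simp
  also have "\<dots> = stack n (hook j (hook i (id_diagram n))) d" using hook_commute_id[OF i] by simp
  also have "\<dots> = hook j (hook i d)"
    using stack_word_diagram[OF n _ d, of "[Gen j, Gen i]"] g by simp
  finally show ?thesis .
qed

lemma act_commute:
  assumes n: "2 \<le> n" and st: "s \<in> gens n" "t \<in> gens n" "gen_col s \<noteq> gen_col t" "\<not> connected_gens s t" and d: "dplus n d"
  shows "act s (act t d) = act t (act s d)"
proof -
  have *: "act s (act t d) = act t (act s d)"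
    if "s \<in> gens n" "t \<in> gens n" "Suc (gen_col s) < gen_col t" for s t
  proof -
    have t: "t = Gen (gen_col t)" using gen_col_eq_Gen[of t] that(3) by simp
    obtain j where j: "t = Gen j" using t by blast
    have jn: "Suc j \<le> n" "2 \<le> j" "3 \<le> j" using that gen_col_range[OF that(2) n] gen_col_range[OF that(1) n] j by auto
    show ?thesis
    proof (cases s)
      case (Gen i)
      thus ?thesis using hook_commute[OF n _ _ jn(1) d, of i] that j gen_col_range[OF that(1) n] by simp
    next
      case Bar1
      have n1: "1 \<le> n" using n by simp
      note dd = dplus_dot[OF d n1]
      have i1: "Suc 1 \<le> n" using n by simp
      have "dot (hook 1 (dot (hook j d))) = dot (hook 1 (hook j (dot d)))"
        using dot_hook[OF dplusD(1)[OF d] jn(2,1)] by simp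
      also have "\<dots> = dot (hook j (hook 1 (dot d)))"
        using hook_commute[OF n _ _ jn(1) dd, of 1] jn by simp
      also have "\<dots> = hook j (dot (hook 1 (dot d)))"
        using dot_hook[OF dplusD(1)[OF dplus_hook[OF dd _ i1]] jn(2,1)] by simp
      finally show ?thesis using j Bar1 by simp
    qed
  qed
  show ?thesis
    using *[OF st(1,2)] *[OF st(2,1)] st connected_gens_iff[OF st(1,2)] by (cases "gen_col s < gen_col t") auto
qed

text \<open>An undecorated cap at \<open>i\<close> is what the letter \<open>Gen i\<close> leaves on
  top, so this is the source of the relation b_i b_(i+1) b_i = b_i: the zigzag of the middle strand
  is pulled straight.\<close>

lemma hook_hook_up:
  assumes m: "matching_diagram n d" and i: "1 \<le> i" "Suc (Suc i) \<le> n"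
    and c: "{North i, North (Suc i)} \<in> edges d" "dec d {North i, North (Suc i)} = 0"
  shows "hook i (hook (Suc i) d) = d"
proof -
  let ?i = "North i" and ?j = "North (Suc i)" and ?k = "North (Suc (Suc i))"
  have c': "{?j, ?i} \<in> edges d" using c by (simp add: insert_commute)
  have jn: "1 \<le> Suc i" by simp
  obtain q where q: "{?k, q} \<in> edges d" using pm_partner[OF matching_diagramD(1)[OF m], of ?k] i by auto
  have ik: "?i \<noteq> ?k" by simp
  note h = hook_diff[OF m c' q ik]
  have hm: "matching_diagram n (hook (Suc i) d)" by (rule matching_hook[OF m jn i(2)])
  have a': "{?i, q} \<in> edges (hook (Suc i) d)" and b': "{?j, ?k} \<in> edges (hook (Suc i) d)"
    unfolding h(1) by simp_all
  have qj: "q \<noteq> ?j" using h(2) .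
  note h' = hook_diff[OF hm a' b' qj]
  have hm2: "matching_diagram n (hook i (hook (Suc i) d))" by (rule matching_hook[OF hm i(1)]) (use i in simp)
  have ne: "{?j, ?i} \<noteq> {?k, q}" "{?i, q} \<noteq> {?j, ?k}" "{q, ?k} = {?k, q}" "{?j, ?i} = {?i, ?j}" using qj h(5) by (auto simp: doubleton_eq_iff)
  show ?thesis
  proof (rule diagram_eqI)
    have "edges (hook (Suc i) d) - {{?i, q}, {?j, ?k}} = edges d - {{?j, ?i}, {?k, q}}"
      unfolding h(1) using h(8,9) by auto
    moreover have "insert {?i, ?j} (insert {q, ?k} (edges d - {{?j, ?i}, {?k, q}})) = edges d"
      using c(1) q unfolding ne by auto
    ultimately show "edges (hook i (hook (Suc i) d)) = edges d" unfolding h'(1) by simp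
    show "loops (hook i (hook (Suc i) d)) = loops d" unfolding h'(1) by (simp add: h(1))
    fix e assume e: "e \<in> edges (hook i (hook (Suc i) d))"
    have s: "dec (hook (Suc i) d) {?i, q} = dec d {?k, q}" "dec (hook (Suc i) d) {?j, ?k} = 0"
      unfolding h(1) ne(4) using ne(2) c(2) by simp_all
    consider "e = {?i, ?j}" | "e \<noteq> {?i, ?j}" "e = {q, ?k}" | "e \<noteq> {?i, ?j}" "e \<noteq> {q, ?k}" by blast
    thus "dec (hook i (hook (Suc i) d)) e = dec d e"
    proof cases
      case 1
      thus ?thesis unfolding h'(1) using c by simp
    next
      case 2
      thus ?thesis unfolding h'(1) using s ne by simp
    next
      case 3
      have "e \<in> edges (hook (Suc i) d) - {{?i, q}, {?j, ?k}}" using e 3 unfolding h'(1) by simp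
      thus ?thesis using 3 ne unfolding h'(1) by (simp add: h(1))
    qed
  qed (erule matching_diagramD(2)[OF hm2] matching_diagramD(2)[OF m])+
qed

lemma hook_hook_down:
  assumes m: "matching_diagram n d" and i: "1 \<le> i" "Suc (Suc i) \<le> n"
    and c: "{North (Suc i), North (Suc (Suc i))} \<in> edges d" "dec d {North (Suc i), North (Suc (Suc i))} = 0"
  shows "hook (Suc i) (hook i d) = d"
proof -
  let ?i = "North i" and ?j = "North (Suc i)" and ?k = "North (Suc (Suc i))"
  obtain p where p: "{?i, p} \<in> edges d" using pm_partner[OF matching_diagramD(1)[OF m], of ?i] i by auto
  have pj: "p \<noteq> ?j"
  proof
    assume "p = ?j"
    hence "{?i, p} = {?j, ?k}" using pm_disjoint[OF matching_diagramD(1)[OF m] p c(1), of ?j] by simp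
    thus False by (auto simp: doubleton_eq_iff)
  qed
  have i': "Suc i \<le> n" using i by simp
  note h = hook_diff[OF m p c(1) pj]
  have hm: "matching_diagram n (hook i d)" by (rule matching_hook[OF m i(1) i'])
  have a': "{?j, ?i} \<in> edges (hook i d)" and b': "{?k, p} \<in> edges (hook i d)"
    unfolding h(1) by (simp_all add: insert_commute)
  have ik: "?i \<noteq> ?k" by simp
  note h' = hook_diff[OF hm a' b' ik]
  have hm2: "matching_diagram n (hook (Suc i) (hook i d))" by (rule matching_hook[OF hm _ i(2)]) simp
  have ne: "{?i, p} \<noteq> {?j, ?k}" "{?k, p} = {p, ?k}" "{?j, ?i} = {?i, ?j}" "{?i, ?j} \<noteq> {p, ?k}" using pj h(3,4) by (auto simp: doubleton_eq_iff)
  show ?thesis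
  proof (rule diagram_eqI)
    have "edges (hook i d) - {{?j, ?i}, {?k, p}} = edges d - {{?i, p}, {?j, ?k}}"
      unfolding h(1) ne using h(8,9) by auto
    moreover have "insert {?j, ?k} (insert {?i, p} (edges d - {{?i, p}, {?j, ?k}})) = edges d"
      using c(1) p by auto
    ultimately show "edges (hook (Suc i) (hook i d)) = edges d" unfolding h'(1) by simp
    show "loops (hook (Suc i) (hook i d)) = loops d" unfolding h'(1) by (simp add: h(1))
    fix e assume e: "e \<in> edges (hook (Suc i) (hook i d))"
    have s: "dec (hook i d) {?k, p} = dec d {?i, p}" "dec (hook i d) {?j, ?i} = 0"
      unfolding ne(2,3) h(1) using ne(4) c(2) by simp_all
    consider "e = {?j, ?k}" | "e \<noteq> {?j, ?k}" "e = {?i, p}" | "e \<noteq> {?j, ?k}" "e \<noteq> {?i, p}" by blast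
    thus "dec (hook (Suc i) (hook i d)) e = dec d e"
    proof cases
      case 1
      thus ?thesis unfolding h'(1) using c by simp
    next
      case 2
      thus ?thesis unfolding h'(1) using s by simp
    next
      case 3
      have "e \<in> edges (hook i d) - {{?j, ?i}, {?k, p}}" using e 3 unfolding h'(1) by simp
      thus ?thesis using 3 unfolding h'(1) ne by (simp add: h(1))
    qed
  qed (erule matching_diagramD(2)[OF hm2] matching_diagramD(2)[OF m])+
qed

section \<open>Reading a good word off its diagram\<close>

definition first_touch :: "nat \<Rightarrow> gen list \<Rightarrow> gen option" where
  "first_touch k xs = find (\<lambda>s. gen_col s = k \<or> Suc (gen_col s) = k) xs"

lemma first_touch_Cons:
  "first_touch k (s # xs) = (if gen_col s = k \<or> Suc (gen_col s) = k then Some s else first_touch k xs)"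
  by (simp add: first_touch_def)

lemma find_SomeE:
  assumes "find P xs = Some s"
  obtains us vs where "xs = us @ s # vs" "P s" "\<forall>z\<in>set us. \<not> P z"
  using assms
proof (induction xs arbitrary: thesis)
  case (Cons x xs)
  show ?case
  proof (cases "P x")
    case True
    thus ?thesis using Cons.prems(1)[of "[]" xs] Cons.prems(2) by auto
  next
    case False
    hence "find P xs = Some s" using Cons.prems(2) by simp
    then obtain us vs where "xs = us @ s # vs" "P s" "\<forall>z\<in>set us. \<not> P z" using Cons.IH by blast
    thus ?thesis using Cons.prems(1)[of "x # us" vs] False by auto
  qed
qed simp

lemma first_touch_SomeE:
  assumes "first_touch k xs = Some s"
  obtains us vs where "xs = us @ s # vs" "gen_col s = k \<or> Suc (gen_col s) = k"
    "\<And>z. z \<in> set us \<Longrightarrow> gen_col z \<noteq> k \<and> Suc (gen_col z) \<noteq> k"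
  using find_SomeE[OF assms[unfolded first_touch_def]] by metis

text \<open>The invariant carried along a good word. The letters of the columns \<open>k - 1\<close>
  and \<open>k\<close> are those that act on the north node \<open>k\<close>. The first of them
  sends the edge there to the right if it is \<open>Gen k\<close>; otherwise it produces a cap back
  to \<open>k - 1\<close> or, for \<open>Bar1\<close> at node 1, a decorated cap, and both count as
  left.\<close>

definition profile :: "nat \<Rightarrow> diagram \<Rightarrow> gen list \<Rightarrow> bool" where
  "profile n d xs \<longleftrightarrow> dplus n d \<and> loops d = {#} \<and> (\<forall>e. dec d e \<le> 1) \<and> even (\<Sum>e\<in>edges d. dec d e) \<and>
     (\<forall>k\<in>{1..n}. case first_touch k xs of None \<Rightarrow> goes_straight d k
        | Some s \<Rightarrow> (if s = Gen k then goes_right d k else goes_left d k))"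

lemma profileD:
  assumes "profile n d xs" "1 \<le> k" "k \<le> n"
  shows "first_touch k xs = None \<Longrightarrow> goes_straight d k" "first_touch k xs = Some (Gen k) \<Longrightarrow> goes_right d k"
    "first_touch k xs = Some s \<Longrightarrow> s \<noteq> Gen k \<Longrightarrow> goes_left d k"
  using assms unfolding profile_def by (fastforce split: option.splits if_splits)+

lemma profile_right:
  assumes "profile n d xs" "1 \<le> k" "k \<le> n" "goes_right d k"
  shows "first_touch k xs = Some (Gen k)"
proof -
  have m: "matching_diagram n d" using assms(1) dplusD(1) unfolding profile_def by blast
  show ?thesis
    using profileD[OF assms(1-3)] goes_exclusive[OF m, of k] assms(4) by (cases "first_touch k xs") metis+
qed

lemma profile_left:
  assumes "profile n d xs" "1 \<le> k" "k \<le> n" "goes_left d k"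
  shows "\<exists>s. first_touch k xs = Some s \<and> s \<noteq> Gen k"
proof -
  have m: "matching_diagram n d" using assms(1) dplusD(1) unfolding profile_def by blast
  show ?thesis
    using profileD[OF assms(1-3)] goes_exclusive[OF m, of k] assms(4) by (cases "first_touch k xs") metis+
qed

text \<open>If the edge at \<open>i\<close> went right, or that at \<open>Suc i\<close> went left,
  the letter responsible for it would lie in column \<open>i\<close>, and the gap between
  \<open>s\<close> and that letter would miss a neighbouring column, against
  \<open>alternation\<close>; for \<open>i = 1\<close> in the first case the two letters would be
  equal.\<close>

lemma not_right_of_good:
  assumes n: "2 \<le> n" and good: "good_word n (s # ys)" and p: "profile n d ys" and s: "s = Gen i"
  shows "hookable d i"
  unfolding hookable_def
proof (intro conjI notI)
  have i: "1 \<le> i" "Suc i \<le> n" using good_word_Cons(2)[OF good] n s by (auto simp: gens_def)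
  {
    assume "goes_right d i"
    hence "first_touch i ys = Some (Gen i)" using profile_right[OF p] i by simp
    then obtain us vs where u: "ys = us @ Gen i # vs" "\<And>z. z \<in> set us \<Longrightarrow> gen_col z \<noteq> i \<and> Suc (gen_col z) \<noteq> i"
      by (rule first_touch_SomeE) blast
    have g: "good_word n ([] @ s # us @ Gen i # vs)" using good u by simp
    have "(2 \<le> i \<longrightarrow> (\<exists>t\<in>set us. Suc (gen_col t) = i)) \<and> (i = 1 \<longrightarrow> s \<noteq> Gen i)"
      using alternation[OF g] s u(2) by auto
    thus False using u(2) s i by (cases "2 \<le> i") auto
  }
  {
    assume "goes_left d (Suc i)"
    then obtain t where t: "first_touch (Suc i) ys = Some t" "t \<noteq> Gen (Suc i)" using profile_left[OF p, of "Suc i"] i by auto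
    from t(1) obtain us vs where u: "ys = us @ t # vs" "gen_col t = Suc i \<or> Suc (gen_col t) = Suc i"
        "\<And>z. z \<in> set us \<Longrightarrow> gen_col z \<noteq> Suc i \<and> Suc (gen_col z) \<noteq> Suc i"
      by (rule first_touch_SomeE) blast
    have "gen_col t = i" using u(2) t(2) i by (cases t) auto
    moreover have "good_word n ([] @ s # us @ t # vs)" using good u by simp
    ultimately have "\<exists>t\<in>set us. gen_col t = Suc i"
      using alternation[of n "[]" s us t vs] s u(3) by auto
    thus False using u(3) by blast
  }
qed

text \<open>An edge going left at node 1 would be due to a second \<open>Bar1\<close>, and
  \<open>alternation\<close> forbids equal consecutive letters in column 1. At node 2 the
  responsible letter would be in column 1 with no letter of column 2 in the gap.\<close>

lemma not_left_of_good:
  assumes n: "2 \<le> n" and good: "good_word n (Bar1 # ys)" and p: "profile n d ys"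
  shows "\<not> goes_left d 1" "\<not> goes_left d 2"
proof -
  show "\<not> goes_left d 1"
  proof
    assume "goes_left d 1"
    then obtain t where t: "first_touch 1 ys = Some t" "t \<noteq> Gen 1" using profile_left[OF p, of 1] n by auto
    from t(1) obtain us vs where u: "ys = us @ t # vs" "gen_col t = 1 \<or> Suc (gen_col t) = 1"
        "\<And>z. z \<in> set us \<Longrightarrow> gen_col z \<noteq> 1 \<and> Suc (gen_col z) \<noteq> 1"
      by (rule first_touch_SomeE) blast
    have "t \<in> gens n" using good_wordD(1)[OF good] u(1) by simp
    hence "t = Bar1" using u(2) t(2) by (cases t) (auto simp: gens_def)
    moreover have "good_word n ([] @ Bar1 # us @ t # vs)" using good u by simp
    ultimately show False using alternation[of n "[]" Bar1 us t vs] u(3) by auto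
  qed
  show "\<not> goes_left d 2"
  proof
    assume "goes_left d 2"
    then obtain t where t: "first_touch 2 ys = Some t" "t \<noteq> Gen 2" using profile_left[OF p, of 2] n by auto
    from t(1) obtain us vs where u: "ys = us @ t # vs" "gen_col t = 2 \<or> Suc (gen_col t) = 2"
        "\<And>z. z \<in> set us \<Longrightarrow> gen_col z \<noteq> 2 \<and> Suc (gen_col z) \<noteq> 2"
      by (rule first_touch_SomeE) blast
    have "gen_col t = 1" using u(2) t(2) by (cases t) auto
    moreover have "good_word n ([] @ Bar1 # us @ t # vs)" using good u by simp
    ultimately have "\<exists>t\<in>set us. gen_col t = Suc 1"
      using alternation[of n "[]" Bar1 us t vs] u(3) by force
    thus False using u(3) by (auto simp: numeral_2_eq_2)
  qed
qed

lemma dot_goes: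
  assumes m: "matching_diagram n d" and n: "1 \<le> n" and k: "k \<noteq> 1"
  shows "goes_left d k \<Longrightarrow> goes_left (dot d) k" "1 \<le> k \<Longrightarrow> goes_right d k \<Longrightarrow> goes_right (dot d) k"
    "goes_straight d k \<Longrightarrow> goes_straight (dot d) k"
proof -
  obtain z where z: "edge_at d (North 1) = {North 1, z}" using edge_at_pair[OF m, of "North 1"] n by auto
  have E: "edges (dot d) = edges d" by (simp add: dot_def)
  have D: "dec (dot d) {North k, y} = dec d {North k, y}" if "y \<noteq> North 1" for y
  proof -
    have "{North k, y} \<noteq> {North 1, z}" using that k by (auto simp: doubleton_eq_iff)
    thus ?thesis unfolding dec_dot z by (simp only: if_False add_0_right)
  qed
  have D': "dec d e \<le> dec (dot d) e" for e unfolding dec_dot by simp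
  show "goes_left (dot d) k" if g: "goes_left d k"
  proof -
    obtain y where y: "{North k, y} \<in> edges d" "dec d {North k, y} > 0 \<or> col y < k" using g unfolding goes_left_def by blast
    have "dec (dot d) {North k, y} > 0 \<or> col y < k" using y(2) D'[of "{North k, y}"] by auto
    thus ?thesis using y(1) unfolding goes_left_def E by blast
  qed
  show "goes_right (dot d) k" if g: "goes_right d k" and k1: "1 \<le> k"
  proof -
    obtain y where y: "{North k, y} \<in> edges d" "dec d {North k, y} = 0" "k < col y" using g unfolding goes_right_def by blast
    have "y \<noteq> North 1" using y(3) k1 by auto
    thus ?thesis using y D unfolding goes_right_def E by metis
  qed
  show "goes_straight (dot d) k" if "goes_straight d k"
    using that D[of "South k"] unfolding goes_straight_def E by simp
qed

lemma sum_dec_dot: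
  assumes "matching_diagram n d" "1 \<le> n"
  shows "(\<Sum>e\<in>edges (dot d). dec (dot d) e) = Suc (\<Sum>e\<in>edges d. dec d e)"
proof -
  have "edge_at d (North 1) \<in> edges d" using edge_at_in[OF assms(1), of "North 1"] assms(2) by simp
  moreover have "edges (dot d) = edges d" by (simp add: dot_def)
  ultimately show ?thesis
    using finite_matching[OF matching_diagramD(1)[OF assms(1)]] by (simp add: dec_dot sum.distrib)
qed

text \<open>The inner \<open>dot\<close> decorates the edge at node 1 and thus makes it count as
  going left; the edge at node 2 is a different one and keeps its direction.\<close>

lemma Bar1_hookable:
  assumes m: "matching_diagram n d" and n: "2 \<le> n" and l: "\<not> goes_left d 1" "\<not> goes_left d 2"
  shows "hookable (dot d) 1" "dec d (edge_at d (North 1)) = 0"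
proof -
  have N: "North 1 \<in> nodes n" "North 2 \<in> nodes n" using n by auto
  obtain z where z: "edge_at d (North 1) = {North 1, z}" "{North 1, z} \<in> edges d" using edge_at_pair[OF m N(1)] by metis
  have E: "edges (dot d) = edges d" by (simp add: dot_def)
  have "dec (dot d) {North 1, z} > 0" unfolding dec_dot z(1) by simp
  hence "goes_left (dot d) 1" unfolding goes_left_def E using z(2) by blast
  hence r: "\<not> goes_right (dot d) 1" using goes_exclusive[OF matching_dot[OF m]] n by auto
  have "\<not> goes_left (dot d) 2"
  proof
    assume "goes_left (dot d) 2"
    then obtain y where y: "{North 2, y} \<in> edges d" "dec (dot d) {North 2, y} > 0 \<or> col y < 2" unfolding goes_left_def E by blast
    have "\<not> (dec d {North 2, y} > 0 \<or> col y < 2)" using l(2) y(1) unfolding goes_left_def by blast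
    hence "{North 2, y} = {North 1, z}" "2 \<le> col y" using y(2) unfolding dec_dot z(1) by (auto split: if_splits)
    thus False by (auto simp: doubleton_eq_iff)
  qed
  thus "hookable (dot d) 1" using r unfolding hookable_def by (simp add: numeral_2_eq_2)
  show "dec d (edge_at d (North 1)) = 0" using l(1) z unfolding goes_left_def by (metis not_gr_zero)
qed

lemma good_profile:
  assumes n: "2 \<le> n"
  shows "good_word n xs \<Longrightarrow> profile n (word_diagram n xs) xs"
proof (induction xs)
  case Nil
  have "goes_straight (id_diagram n) k" if "k \<in> {1..n}" for k
    using that unfolding goes_straight_def by (auto simp: id_diagram_def)
  thus ?case unfolding profile_def using dplus_id by (simp add: first_touch_def) (simp add: id_diagram_def)
next
  case (Cons s ys)
  have p: "profile n (word_diagram n ys) ys" using Cons good_word_Cons by blast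
  define d where "d = word_diagram n ys"
  note p = p[folded d_def]
  have d: "dplus n d" "loops d = {#}" "\<forall>e. dec d e \<le> 1" "even (\<Sum>e\<in>edges d. dec d e)" using p unfolding profile_def by blast+
  note m = dplusD(1)[OF d(1)]
  have sG: "s \<in> gens n" using good_word_Cons(2)[OF Cons.prems] .
  have da: "dplus n (act s d)" by (rule dplus_act[OF n sG d(1)])
  show ?case
  proof (cases s)
    case (Gen i)
    hence i: "1 \<le> i" "Suc i \<le> n" using sG n by (auto simp: gens_def)
    have ok: "hookable d i" by (rule not_right_of_good[OF n Cons.prems p Gen])
    note h = hook_goes[OF m i ok]
    have a: "act s d = hook i d" using Gen by simp
    have "case first_touch k (s # ys) of None \<Rightarrow> goes_straight (act s d) k
        | Some t \<Rightarrow> (if t = Gen k then goes_right (act s d) k else goes_left (act s d) k)" if k: "k \<in> {1..n}" for k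
    proof (cases "k = i \<or> k = Suc i")
      case True
      thus ?thesis unfolding a using h(3,4) Gen by (auto simp: first_touch_Cons)
    next
      case False
      have "first_touch k (s # ys) = first_touch k ys" using False Gen by (auto simp: first_touch_Cons)
      thus ?thesis unfolding a using profileD[OF p, of k] k h(6-8)[of k] False by (auto split: option.split)
    qed
    moreover have "loops (act s d) = {#}" "\<forall>e. dec (act s d) e \<le> 1" "even (\<Sum>e\<in>edges (act s d). dec (act s d) e)"
      unfolding a using d h(2,5) sum_dec_hook[OF m i h(1)] by simp_all
    ultimately show ?thesis unfolding profile_def word_diagram_simps d_def[symmetric] using da by blast
  next
    case Bar1
    have i1: "1 \<le> (1::nat)" "Suc 1 \<le> n" and n1: "1 \<le> n" using n by auto
    note nl = not_left_of_good[OF n Cons.prems[unfolded Bar1] p]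
    note bh = Bar1_hookable[OF m n nl]
    have m1: "matching_diagram n (dot d)" by (rule matching_dot[OF m n1])
    note h = hook_goes[OF m1 i1 bh(1)]
    have m2: "matching_diagram n (hook 1 (dot d))" by (rule matching_hook[OF m1 i1])
    let ?c = "{North 1, North (Suc 1)}"
    have c: "?c \<in> edges (hook 1 (dot d))" by (rule cap_hook[OF m1 i1])
    have at: "edge_at (hook 1 (dot d)) (North 1) = ?c" by (rule edge_at_eq[OF m2 c]) simp
    have D3: "dec (dot (hook 1 (dot d))) e = dec (hook 1 (dot d)) e + (if e = ?c then 1 else 0)" for e
      unfolding dec_dot at ..
    \<comment> \<open>Both dots land on edges that are undecorated at that moment: the edge at node
      1 by \<open>not_left_of_good\<close>, and later the fresh cap of \<open>hook 1\<close>. So no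
      count exceeds 1.\<close>
    have D1: "dec (dot d) e \<le> 1" for e using d(3)[rule_format, of e] bh(2) unfolding dec_dot by simp
    hence D2: "dec (hook 1 (dot d)) e \<le> 1" for e using h(5) by blast
    have le1: "dec (dot (hook 1 (dot d))) e \<le> 1" for e unfolding D3 using D2[of e] h(9) by auto
    have sum: "even (\<Sum>e\<in>edges (dot (hook 1 (dot d))). dec (dot (hook 1 (dot d))) e)"
      unfolding sum_dec_dot[OF m2 n1] sum_dec_hook[OF m1 i1 h(1)] sum_dec_dot[OF m n1] using d(4) by simp
    have E3: "edges (dot (hook 1 (dot d))) = edges (hook 1 (dot d))" by (simp add: dot_def)
    have gl: "goes_left (dot (hook 1 (dot d))) 1" "goes_left (dot (hook 1 (dot d))) 2"
    proof -
      have "{North 1, North (Suc 1)} \<in> edges (dot (hook 1 (dot d)))" "dec (dot (hook 1 (dot d))) {North 1, North (Suc 1)} > 0"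
        unfolding E3 D3 using c by simp_all
      thus "goes_left (dot (hook 1 (dot d))) 1" unfolding goes_left_def by blast
      have "{North (Suc 1), North 1} \<in> edges (dot (hook 1 (dot d)))" unfolding E3 using c by (simp only: insert_commute)
      thus "goes_left (dot (hook 1 (dot d))) 2" unfolding goes_left_def by (intro exI[of _ "North 1"]) (simp add: numeral_2_eq_2)
    qed
    have "case first_touch k (s # ys) of None \<Rightarrow> goes_straight (act s d) k
        | Some t \<Rightarrow> (if t = Gen k then goes_right (act s d) k else goes_left (act s d) k)" if k: "k \<in> {1..n}" for k
    proof (cases "k = 1 \<or> k = 2")
      case True
      thus ?thesis using gl Bar1 by (auto simp: first_touch_Cons)
    next
      case False
      have ft: "first_touch k (s # ys) = first_touch k ys" using False Bar1 by (auto simp: first_touch_Cons)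
      have k1: "k \<noteq> 1" "k \<noteq> Suc 1" "1 \<le> k" "k \<le> n" using False k by auto
      have a: "act s d = dot (hook 1 (dot d))" using Bar1 by simp
      have "goes_straight d k \<Longrightarrow> goes_straight (act s d) k" "goes_right d k \<Longrightarrow> goes_right (act s d) k"
        "goes_left d k \<Longrightarrow> goes_left (act s d) k"
        unfolding a using dot_goes[OF m n1 k1(1)] dot_goes[OF m2 n1 k1(1)] h(6-8)[OF k1(1,2)] k1(3) by blast+
      thus ?thesis using profileD[OF p k1(3,4)] unfolding ft by (auto split: option.split)
    qed
    moreover have "loops (act s d) = {#}"
    proof -
      have "loops (act s d) = loops (hook 1 (dot d))" using Bar1 by (simp add: dot_def)
      also have "\<dots> = loops (dot d)" by (rule h(2))
      also have "\<dots> = {#}" using d(2) by (simp add: dot_def)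
      finally show ?thesis .
    qed
    moreover have "\<forall>e. dec (act s d) e \<le> 1" using le1 Bar1 by simp
    moreover have "even (\<Sum>e\<in>edges (act s d). dec (act s d) e)" using sum Bar1 by simp
    ultimately show ?thesis unfolding profile_def word_diagram_simps d_def[symmetric] using da by blast
  qed
qed

text \<open>\<open>Gen 1\<close> and \<open>Bar1\<close> commute in the group, but their operators
  do not commute on diagrams; goodness excludes exactly this exchange.\<close>

lemma word_diagram_commutation:
  assumes n: "2 \<le> n" and good: "good_word n xs" and c: "commutation xs ys"
  shows "word_diagram n xs = word_diagram n ys"
  using c
proof cases
  case (1 s t us vs)
  have G: "s \<in> gens n" "t \<in> gens n" "vs \<in> lists (gens n)" using good_wordD(1)[OF good] 1(1) by auto
  have "gen_col s \<noteq> gen_col t"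
  proof
    assume "gen_col s = gen_col t"
    hence "s = Gen 1 \<and> t = Bar1 \<or> s = Bar1 \<and> t = Gen 1" using 1(3) G by (cases s; cases t) (auto simp: gens_def)
    hence "bad_factor xs" unfolding bad_factor_def using 1(1) by blast
    thus False using good_wordD(2)[OF good] by blast
  qed
  hence "act s (act t (word_diagram n vs)) = act t (act s (word_diagram n vs))"
    using act_commute[OF n G(1,2) _ 1(4) dplus_word_diagram[OF n G(3)]] by blast
  thus ?thesis unfolding 1(1,2) word_diagram_def by simp
qed

lemma word_diagram_commutations:
  assumes n: "2 \<le> n" and good: "good_word n xs" and c: "commutation\<^sup>*\<^sup>* xs ys"
  shows "word_diagram n xs = word_diagram n ys"
  using c
proof (induction rule: rtranclp_induct)
  case (step y z)
  thus ?case using word_diagram_commutation[OF n good_word_commutations[OF good step(1)] step(2)] by simp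
qed simp

lemma cap_act:
  assumes "2 \<le> n" "s \<in> gens n" "dplus n d"
  shows "{North (gen_col s), North (Suc (gen_col s))} \<in> edges (act s d)"
proof (cases s)
  case (Gen i)
  thus ?thesis using cap_hook[OF dplusD(1)[OF assms(3)], of i] assms by (auto simp: gens_def)
next
  case Bar1
  have m1: "matching_diagram n (dot d)" using matching_dot[OF dplusD(1)[OF assms(3)]] assms(1) by simp
  have "{North 1, North (Suc 1)} \<in> edges (hook 1 (dot d))" by (rule cap_hook[OF m1]) (use assms(1) in auto)
  thus ?thesis using Bar1 by (simp add: dot_def[of "hook (Suc 0) _"])
qed

text \<open>Goodness of the two words supplies the \<open>hookable\<close> conditions under which
  \<open>hook_inj\<close> applies.\<close>

lemma act_inj_good:
  assumes n: "2 \<le> n" and g: "good_word n (s # xs)" "good_word n (s # ys)"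
    and eq: "word_diagram n (s # xs) = word_diagram n (s # ys)"
  shows "word_diagram n xs = word_diagram n ys"
proof -
  have gx: "good_word n xs" "good_word n ys" using g good_word_Cons by blast+
  note px = good_profile[OF n gx(1)] and py = good_profile[OF n gx(2)]
  have sG: "s \<in> gens n" by (rule good_word_Cons(2)[OF g(1)])
  define d1 where "d1 = word_diagram n xs"
  define d2 where "d2 = word_diagram n ys"
  have d: "dplus n d1" "dplus n d2" using px py unfolding profile_def d1_def d2_def by blast+
  have e: "act s d1 = act s d2" using eq by (simp add: d1_def d2_def)
  have "d1 = d2"
  proof (cases s)
    case (Gen i)
    hence i: "1 \<le> i" "Suc i \<le> n" using sG n by (auto simp: gens_def)
    show ?thesis
      by (rule hook_inj[OF d i]) (use not_right_of_good[OF n g(1) px Gen] not_right_of_good[OF n g(2) py Gen] e Gen in \<open>simp_all add: d1_def d2_def\<close>)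
  next
    case Bar1
    have n1: "1 \<le> n" "Suc 1 \<le> n" using n by auto
    have "dot (hook 1 (dot d1)) = dot (hook 1 (dot d2))" using e Bar1 by simp
    hence h: "hook 1 (dot d1) = hook 1 (dot d2)" by (rule dot_inj)
    have ok: "hookable (dot d1) 1" "hookable (dot d2) 1"
      using Bar1_hookable(1)[OF dplusD(1)[OF d(1)] n] Bar1_hookable(1)[OF dplusD(1)[OF d(2)] n]
        not_left_of_good[OF n g(1)[unfolded Bar1] px] not_left_of_good[OF n g(2)[unfolded Bar1] py]
      by (simp_all add: d1_def d2_def)
    have "dot d1 = dot d2"
      by (rule hook_inj[OF dplus_dot[OF d(1) n1(1)] dplus_dot[OF d(2) n1(1)] _ n1(2) ok h]) simp
    thus ?thesis by (rule dot_inj)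
  qed
  thus ?thesis by (simp add: d1_def d2_def)
qed

lemma word_diagram_inj:
  assumes n: "2 \<le> n"
  shows "good_word n xs \<Longrightarrow> good_word n ys \<Longrightarrow> word_diagram n xs = word_diagram n ys \<Longrightarrow> commutation\<^sup>*\<^sup>* xs ys"
proof (induction ys arbitrary: xs)
  case Nil
  show ?case
  proof (cases xs)
    case (Cons x xs')
    have "{North (gen_col x), North (Suc (gen_col x))} \<in> edges (act x (word_diagram n xs'))"
      using cap_act[OF n] good_word_Cons[of n x xs'] Nil.prems(1) dplus_word_diagram[OF n good_wordD(1)] Cons by blast
    moreover have "{North i, North j} \<notin> edges (id_diagram n)" for i j
      by (auto simp: id_diagram_def doubleton_eq_iff)
    ultimately show ?thesis using Nil.prems(3) Cons by simp
  qed simp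
next
  case (Cons s ys)
  note gx = Cons.prems(1) and gy = Cons.prems(2)
  define d where "d = word_diagram n xs"
  have px: "profile n d xs" unfolding d_def by (rule good_profile[OF n gx])
  have py: "profile n d (s # ys)" unfolding d_def Cons.prems(3) by (rule good_profile[OF n gy])
  have sG: "s \<in> gens n" by (rule good_word_Cons(2)[OF gy])
  define c where "c = gen_col s"
  have c: "1 \<le> c" "Suc c \<le> n" using gen_col_range[OF sG n] by (auto simp: c_def)
  have "first_touch (Suc c) (s # ys) = Some s" by (simp add: first_touch_Cons c_def)
  moreover have "s \<noteq> Gen (Suc c)" unfolding c_def by (cases s) auto
  ultimately have "goes_left d (Suc c)" using profileD(3)[OF py, of "Suc c"] c by simp
  then obtain t where t: "first_touch (Suc c) xs = Some t" "t \<noteq> Gen (Suc c)" using profile_left[OF px, of "Suc c"] c by auto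
  \<comment> \<open>The direction at node \<open>c\<close> identifies \<open>s\<close>: only
    \<open>Gen c\<close> sends the edge there to the right, and at node 1 only \<open>Bar1\<close>
    sends it to the left.\<close>
  have fc: "first_touch c xs = Some s"
  proof (cases s)
    case (Gen i)
    hence "first_touch c (s # ys) = Some (Gen c)" by (simp add: first_touch_Cons c_def)
    hence "goes_right d c" using profileD(2)[OF py] c by simp
    thus ?thesis using profile_right[OF px] c Gen by (simp add: c_def)
  next
    case Bar1
    hence c1: "c = 1" by (simp add: c_def)
    have "first_touch 1 (s # ys) = Some Bar1" using Bar1 by (simp add: first_touch_Cons)
    hence "goes_left d 1" using profileD(3)[OF py, of 1 Bar1] n by simp
    then obtain r where r: "first_touch 1 xs = Some r" "r \<noteq> Gen 1" using profile_left[OF px, of 1] n by auto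
    from r(1) obtain us vs where "xs = us @ r # vs" "gen_col r = 1 \<or> Suc (gen_col r) = 1"
      by (rule first_touch_SomeE) blast
    moreover from this have "r \<in> gens n" using good_wordD(1)[OF gx] by simp
    ultimately have "r = Bar1" using r(2) by (cases r) (auto simp: gens_def)
    thus ?thesis using r Bar1 c1 by simp
  qed
  from fc obtain us vs where u: "xs = us @ s # vs" "\<And>z. z \<in> set us \<Longrightarrow> gen_col z \<noteq> c \<and> Suc (gen_col z) \<noteq> c"
    by (rule first_touch_SomeE) blast
  from t(1) obtain us' vs' where u': "xs = us' @ t # vs'" "gen_col t = Suc c \<or> Suc (gen_col t) = Suc c"
      "\<And>z. z \<in> set us' \<Longrightarrow> gen_col z \<noteq> Suc c \<and> Suc (gen_col z) \<noteq> Suc c"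
    by (rule first_touch_SomeE) blast
  have tc: "gen_col t = c" using u'(2) t(2) c by (cases t) auto
  \<comment> \<open>The first letter of \<open>xs\<close> acting on node \<open>Suc c\<close> is
    \<open>t\<close>, of column \<open>c\<close>. Since \<open>us\<close> has no letter of that
    column, it ends before \<open>t\<close> and so contains no letter of column \<open>Suc c\<close>
    either.\<close>
  have noc: "gen_col z \<noteq> Suc c" if "z \<in> set us" for z
  proof -
    have "length us \<le> length us'"
    proof (rule ccontr)
      assume "\<not> ?thesis"
      hence lt: "length us' < length us" by simp
      have "xs ! length us' = t" using u'(1) by simp
      moreover have "xs ! length us' = us ! length us'" using u(1) lt by (simp add: nth_append)
      ultimately have "t \<in> set us" using lt nth_mem by metis
      thus False using u(2) tc by blast
    qed
    hence "us = take (length us) us'" using u(1) u'(1) by (metis append_eq_append_conv_if append_eq_conv_conj)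
    hence "set us \<subseteq> set us'" by (metis set_take_subset)
    thus ?thesis using u'(3) that by blast
  qed
  have usG: "z \<in> set us \<Longrightarrow> z \<in> gens n" for z using good_wordD(1)[OF gx] u(1) by auto
  have "commutation\<^sup>*\<^sup>* ([] @ s # us @ vs) ([] @ us @ s # vs)"
  proof (rule commute_past)
    fix z assume z: "z \<in> set us"
    show "z \<noteq> s \<and> \<not> connected_gens s z"
      using connected_gens_iff[OF sG usG[OF z]] u(2)[OF z] noc[OF z] unfolding c_def by auto
  qed
  hence com: "commutation\<^sup>*\<^sup>* xs (s # us @ vs)" using u(1) commutations_sym by simp
  have g': "good_word n (s # us @ vs)" by (rule good_word_commutations[OF gx com])
  have "word_diagram n (s # us @ vs) = word_diagram n (s # ys)"
    using word_diagram_commutations[OF n gx com] Cons.prems(3) by simp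
  hence "word_diagram n (us @ vs) = word_diagram n ys" by (rule act_inj_good[OF n g' gy])
  hence "commutation\<^sup>*\<^sup>* (us @ vs) ys" using Cons.IH good_word_Cons(1)[OF g'] good_word_Cons(1)[OF gy] by blast
  thus ?case using com commutations_Cons rtranclp_trans by metis
qed

section \<open>The value of a diagram\<close>

definition reduce :: "diagram \<Rightarrow> diagram" where
  "reduce d = \<lparr>edges = edges d, dec = (\<lambda>e. dec d e mod 2), loops = {#}\<rparr>"

definition even_loops :: "diagram \<Rightarrow> bool" where
  "even_loops d \<longleftrightarrow> (\<forall>k\<in>#loops d. even k)"

definition diagram_value :: "diagram \<Rightarrow> diagram \<Rightarrow>\<^sub>0 int poly" where
  "diagram_value d = (if even_loops d then Poly_Mapping.single (reduce d) (delta ^ size (loops d)) else 0)"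

text \<open>Equality up to cancelling pairs of decorations. It is respected by stacking,
  \<open>hook\<close> and \<open>dot\<close> and determines the value, so relations between words
  need to hold only in this sense.\<close>

definition same_parity :: "diagram \<Rightarrow> diagram \<Rightarrow> bool" where
  "same_parity a b \<longleftrightarrow> edges a = edges b \<and> (\<forall>e. dec a e mod 2 = dec b e mod 2) \<and>
     image_mset (\<lambda>k. k mod 2) (loops a) = image_mset (\<lambda>k. k mod 2) (loops b)"

lemma same_parity_refl [simp]: "same_parity a a"
  by (simp add: same_parity_def)

lemma same_parity_sym: "same_parity a b \<Longrightarrow> same_parity b a"
  by (simp add: same_parity_def)

lemma same_parity_trans [trans]: "same_parity a b \<Longrightarrow> same_parity b c \<Longrightarrow> same_parity a c"
  by (simp add: same_parity_def)

lemma even_loops_iff: "even_loops d \<longleftrightarrow> (\<forall>k\<in>#image_mset (\<lambda>k. k mod 2) (loops d). k = 0)"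
  by (auto simp: even_loops_def even_iff_mod_2_eq_zero)

lemma diagram_value_same_parity:
  assumes "same_parity a b"
  shows "diagram_value a = diagram_value b"
proof -
  have "size (loops a) = size (loops b)"
    using assms unfolding same_parity_def by (metis size_image_mset)
  moreover have "reduce a = reduce b" using assms by (simp add: reduce_def same_parity_def)
  moreover have "even_loops a = even_loops b" using assms unfolding even_loops_iff same_parity_def by simp
  ultimately show ?thesis by (simp add: diagram_value_def)
qed

lemma sum_mod_cong:
  "(\<And>x. x \<in> A \<Longrightarrow> f x mod 2 = g x mod (2::nat)) \<Longrightarrow> sum f A mod 2 = sum g A mod 2"
  by (metis (mono_tags, lifting) mod_sum_eq sum.cong)

lemma same_parity_stack:
  assumes "same_parity a a'" "same_parity b b'"
  shows "same_parity (stack n a b) (stack n a' b')"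
proof -
  have E: "edges a = edges a'" "edges b = edges b'" using assms by (simp_all add: same_parity_def)
  have R: "stack_adj a b = stack_adj a' b'" by (simp add: stack_adj_def E)
  have C: "component_dec a b C mod 2 = component_dec a' b' C mod 2" for C
    unfolding component_dec_def E
    by (rule mod_add_cong; rule sum_mod_cong) (use assms in \<open>simp_all add: same_parity_def\<close>)
  have E': "edges (stack n a b) = edges (stack n a' b')"
    by (simp add: stack_def Let_def stack_components_def R)
  have D: "dec (stack n a b) e mod 2 = dec (stack n a' b') e mod 2" for e
    unfolding dec_stack_if E' R using C by simp
  have "image_mset (\<lambda>k. k mod 2) (loops (stack n a b)) = image_mset (\<lambda>k. k mod 2) (loops (stack n a' b'))"
    using assms unfolding loops_stack R by (simp add: same_parity_def image_mset.compositionality o_def C)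
  thus ?thesis using D E' by (simp add: same_parity_def)
qed

lemma edge_at_cong: "edges a = edges b \<Longrightarrow> edge_at a x = edge_at b x"
  by (simp add: edge_at_def)

lemma same_parity_dot:
  assumes "same_parity a b"
  shows "same_parity (dot a) (dot b)"
proof -
  have E: "edge_at a (North 1) = edge_at b (North 1)"
    using assms by (intro edge_at_cong) (simp add: same_parity_def)
  have "dec (dot a) e mod 2 = dec (dot b) e mod 2" for e
    unfolding dec_dot E by (rule mod_add_cong) (use assms in \<open>simp_all add: same_parity_def\<close>)
  moreover have "edges (dot d) = edges d" "loops (dot d) = loops d" for d by (simp_all add: dot_def)
  ultimately show ?thesis using assms by (simp add: same_parity_def)
qed

lemma same_parity_dot_dot: "same_parity (dot (dot a)) a"
proof -
  have "edge_at (dot a) x = edge_at a x" for x by (rule edge_at_cong) (simp add: dot_def)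
  hence "dec (dot (dot a)) e mod 2 = dec a e mod 2" for e unfolding dec_dot by simp
  moreover have "edges (dot d) = edges d" "loops (dot d) = loops d" for d by (simp_all add: dot_def)
  ultimately show ?thesis by (simp add: same_parity_def)
qed

lemma same_parity_hook:
  assumes "same_parity a b"
  shows "same_parity (hook i a) (hook i b)"
proof -
  have E: "edges a = edges b" and D: "\<And>e. dec a e mod 2 = dec b e mod 2"
    and L: "image_mset (\<lambda>k. k mod 2) (loops a) = image_mset (\<lambda>k. k mod 2) (loops b)"
    using assms by (simp_all add: same_parity_def)
  have at: "edge_at a x = edge_at b x" for x by (rule edge_at_cong[OF E])
  have DD: "(dec a e + dec a f) mod 2 = (dec b e + dec b f) mod 2" for e f
    by (rule mod_add_cong[OF D D])
  show ?thesis
  proof (cases "edge_at b (North i) = edge_at b (North (Suc i))")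
    case True
    show ?thesis unfolding hook_def Let_def at if_P[OF True] same_parity_def by (simp add: E L D)
  next
    case False
    show ?thesis unfolding hook_def Let_def at if_not_P[OF False] same_parity_def by (simp add: E L D DD)
  qed
qed

lemma same_parity_act: "same_parity a b \<Longrightarrow> same_parity (act s a) (act s b)"
  by (cases s) (auto intro: same_parity_hook same_parity_dot)

lemma same_parity_foldr_act: "same_parity a b \<Longrightarrow> same_parity (foldr act v a) (foldr act v b)"
  by (induction v) (auto intro: same_parity_act)

section \<open>Collecting the decorations of a factorisation\<close>

fun swap_gen :: "gen \<Rightarrow> gen" where
  "swap_gen Bar1 = Gen 1"
| "swap_gen (Gen i) = (if i = 1 then Bar1 else Gen i)"

lemma swap_gen_in_gens: "2 \<le> n \<Longrightarrow> s \<in> gens n \<Longrightarrow> swap_gen s \<in> gens n"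
  by (cases s) (auto simp: gens_def)

lemma dplus_foldr_act: "2 \<le> n \<Longrightarrow> v \<in> lists (gens n) \<Longrightarrow> dplus n d \<Longrightarrow> dplus n (foldr act v d)"
  by (induction v) (auto intro: dplus_act)

text \<open>Up to parity \<open>dot\<close> is an involution, so conjugation by it exchanges
  \<open>hook 1\<close> with \<open>dot \<circ> hook 1 \<circ> dot\<close>, the operators of the two
  letters of column 1; it fixes the other hooks by \<open>dot_hook\<close>.\<close>

lemma dot_act:
  assumes n: "2 \<le> n" and s: "s \<in> gens n" and d: "dplus n d"
  shows "same_parity (dot (act s d)) (act (swap_gen s) (dot d))"
proof (cases s)
  case Bar1
  thus ?thesis using same_parity_dot_dot by simp
next
  case (Gen i)
  show ?thesis
  proof (cases "i = 1")
    case True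
    thus ?thesis using Gen same_parity_dot[OF same_parity_hook[OF same_parity_sym[OF same_parity_dot_dot]]] by simp
  next
    case False
    thus ?thesis using dot_hook[OF dplusD(1)[OF d], of i] Gen s by (auto simp: gens_def)
  qed
qed

lemma dot_foldr_act:
  assumes n: "2 \<le> n" and d: "dplus n d"
  shows "v \<in> lists (gens n) \<Longrightarrow> same_parity (dot (foldr act v d)) (foldr act (map swap_gen v) (dot d))"
proof (induction v)
  case (Cons s v)
  hence s: "s \<in> gens n" "v \<in> lists (gens n)" by auto
  have "same_parity (dot (act s (foldr act v d))) (act (swap_gen s) (dot (foldr act v d)))"
    by (rule dot_act[OF n s(1) dplus_foldr_act[OF n s(2) d]])
  also have "same_parity \<dots> (act (swap_gen s) (foldr act (map swap_gen v) (dot d)))"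
    by (rule same_parity_act[OF Cons.IH[OF s(2)]])
  finally show ?case by simp
qed simp

lemma dplus_funpow_dot: "2 \<le> n \<Longrightarrow> dplus n ((dot ^^ k) (id_diagram n))"
  by (induction k) (auto intro: dplus_dot dplus_id)

text \<open>All dots of the factorisation are pushed down to the identity. Their number is the total
  decoration of \<open>d\<close>, since a hook that closes no loop preserves this total and a dot
  raises it by one.\<close>

lemma loopless_word:
  assumes n: "2 \<le> n"
  shows "loopless n d \<Longrightarrow>
    \<exists>v\<in>lists (gens n). same_parity d (foldr act v ((dot ^^ (\<Sum>e\<in>edges d. dec d e)) (id_diagram n)))"
proof (induction rule: loopless.induct)
  case id
  have "(\<Sum>e\<in>edges (id_diagram n). dec (id_diagram n) e) = 0" by (simp add: id_diagram_def)
  thus ?case by (intro bexI[of _ "[]"]) simp_all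
next
  case (dot d)
  then obtain v where v: "v \<in> lists (gens n)" "same_parity d (foldr act v ((dot ^^ (\<Sum>e\<in>edges d. dec d e)) (id_diagram n)))"
    by blast
  have n1: "1 \<le> n" using n by simp
  have m: "matching_diagram n d" using loopless_dplus[OF n1 dot.hyps] dplusD(1) by blast
  have "same_parity (dot d) (foldr act (map swap_gen v) (dot ((dot ^^ (\<Sum>e\<in>edges d. dec d e)) (id_diagram n))))"
    using same_parity_trans[OF same_parity_dot[OF v(2)] dot_foldr_act[OF n dplus_funpow_dot[OF n] v(1)]] .
  moreover have "map swap_gen v \<in> lists (gens n)" using v(1) swap_gen_in_gens[OF n] by (auto simp: in_lists_conv_set)
  ultimately show ?case unfolding sum_dec_dot[OF m n1] by (intro bexI[of _ "map swap_gen v"]) simp_all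
next
  case (hook d i)
  then obtain v where v: "v \<in> lists (gens n)" "same_parity d (foldr act v ((dot ^^ (\<Sum>e\<in>edges d. dec d e)) (id_diagram n)))"
    by blast
  have n1: "1 \<le> n" using n by simp
  have m: "matching_diagram n d" using loopless_dplus[OF n1 hook.hyps(1)] dplusD(1) by blast
  have "Gen i \<in> gens n" using hook.hyps(2,3) by (auto simp: gens_def)
  thus ?case unfolding sum_dec_hook[OF m hook.hyps(2-4)]
    using v same_parity_hook[OF v(2), of i] by (intro bexI[of _ "Gen i # v"]) simp_all
qed

lemma same_parity_funpow_dot: "even k \<Longrightarrow> same_parity ((dot ^^ k) d) d"
proof (induction k rule: less_induct)
  case (less k)
  show ?case
  proof (cases "k = 0")
    case False
    then obtain j where j: "k = Suc (Suc j)" using less(2) by (metis even_Suc not0_implies_Suc odd_Suc_minus_one even_zero)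
    have "same_parity ((dot ^^ k) d) ((dot ^^ j) d)" using same_parity_dot_dot unfolding j by simp
    also have "same_parity \<dots> d" using less j by simp
    finally show ?thesis .
  qed simp
qed

lemma admissible_IID:
  assumes "d \<in> admissible_II n"
  shows "dplus n d" "loops d = {#}" "dec d e \<le> 1" "even (\<Sum>e\<in>edges d. dec d e)" "d \<in> diagrams n" "reduce d = d"
    "diagram_value d = Poly_Mapping.single d 1"
proof -
  show a: "dplus n d" "loops d = {#}" "even (\<Sum>e\<in>edges d. dec d e)" "d \<in> diagrams n"
    using assms diagrams_dplus by (auto simp: admissible_II_def)
  have le: "dec d e \<le> 1" for e
  proof (rule ccontr)
    assume "\<not> dec d e \<le> 1"
    hence "dec d e = (dec d e - 2) + 2" by simp
    moreover from this have "e \<in> edges d" using matching_diagramD(2)[OF dplusD(1)[OF a(1)], of e] by auto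
    ultimately have "\<exists>c d'. local_rel d c d'" using local_rel.cancel_edge by blast
    thus False using assms by (simp add: admissible_II_def)
  qed
  thus "dec d e \<le> 1" .
  have "dec d e mod 2 = dec d e" for e using le[of e] by simp
  thus r: "reduce d = d" unfolding reduce_def using a(2) by simp
  show "diagram_value d = Poly_Mapping.single d 1" unfolding diagram_value_def r by (simp add: even_loops_def a(2))
qed

text \<open>By the parity condition an even number of dots has been collected at the identity; they
  cancel and leave a product of generators.\<close>

lemma admissible_word:
  assumes n: "2 \<le> n" and d: "d \<in> admissible_II n"
  obtains v where "v \<in> lists (gens n)" "diagram_value (word_diagram n v) = Poly_Mapping.single d 1"
proof -
  note a = admissible_IID[OF d]
  have n1: "1 \<le> n" using n by simp
  obtain v where v: "v \<in> lists (gens n)" "same_parity d (foldr act v ((dot ^^ (\<Sum>e\<in>edges d. dec d e)) (id_diagram n)))"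
    using loopless_word[OF n dplus_loopless[OF n1 a(1,2)]] by blast
  have "same_parity d (word_diagram n v)"
    unfolding word_diagram_def
    by (rule same_parity_trans[OF v(2) same_parity_foldr_act[OF same_parity_funpow_dot[OF a(4)]]])
  thus ?thesis using that[OF v(1)] diagram_value_same_parity a(7) by metis
qed

lemma word_diagram_in_diagrams:
  assumes n: "2 \<le> n" and xs: "xs \<in> lists (gens n)"
  shows "word_diagram n xs \<in> diagrams n"
proof (cases xs)
  case Nil
  thus ?thesis using id_in_diagrams by simp
next
  case (Cons s ys)
  have dp: "dplus n (word_diagram n xs)" by (rule dplus_word_diagram[OF n xs])
  have "{North (gen_col s), North (Suc (gen_col s))} \<in> edges (word_diagram n xs)"
    using cap_act[OF n _ dplus_word_diagram[OF n]] xs Cons by simp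
  hence "num_caps (word_diagram n xs) \<noteq> 0" using num_caps_eq_0_iff[OF dplusD(1)[OF dp]] by blast
  thus ?thesis using dp by (simp add: diagrams_iff)
qed

lemma good_word_admissible:
  assumes n: "2 \<le> n" and good: "good_word n xs"
  shows "word_diagram n xs \<in> admissible_II n"
proof -
  let ?d = "word_diagram n xs"
  have p: "loops ?d = {#}" "\<forall>e. dec ?d e \<le> 1" "even (\<Sum>e\<in>edges ?d. dec ?d e)"
    using good_profile[OF n good] unfolding profile_def by blast+
  have "\<not> local_rel ?d c d'" for c d'
  proof
    assume "local_rel ?d c d'"
    thus False
    proof cases
      case (cancel_edge e k)
      thus False using p(2)[rule_format, of e] by simp
    qed (use p(1) in auto)
  qed
  thus ?thesis unfolding admissible_II_def using p word_diagram_in_diagrams[OF n good_wordD(1)[OF good]] by blast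
qed

section \<open>The relations of the generators hold for values\<close>

lemma diagram_value_add_loop:
  "diagram_value (add_loops {#0#} d) = Poly_Mapping.map ((*) delta) (diagram_value d)"
proof -
  have "reduce (add_loops {#0#} d) = reduce d" "even_loops (add_loops {#0#} d) = even_loops d"
    by (simp_all add: reduce_def add_loops_def even_loops_def)
  moreover have "size (loops (add_loops {#0#} d)) = Suc (size (loops d))" by (simp add: add_loops_def)
  moreover have "Poly_Mapping.map ((*) delta) (Poly_Mapping.single x c) = Poly_Mapping.single x (delta * c)" for x :: diagram and c
    by (rule poly_mapping_eqI) (simp add: Poly_Mapping.map.rep_eq lookup_single when_def)
  moreover have "Poly_Mapping.map ((*) delta) (0 :: diagram \<Rightarrow>\<^sub>0 int poly) = 0"
    by (rule poly_mapping_eqI) (simp add: Poly_Mapping.map.rep_eq)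
  ultimately show ?thesis unfolding diagram_value_def by simp
qed

lemma hook_hook_same:
  assumes m: "matching_diagram n d" and i: "1 \<le> i" "Suc i \<le> n"
    and c: "{North i, North (Suc i)} \<in> edges d" "dec d {North i, North (Suc i)} = 0"
  shows "hook i d = add_loops {#0#} d"
  unfolding hook_same[OF m c(1)] c(2) add_loops_def
  by (rule diagram.equality) (simp_all add: c(2) fun_upd_idem)

lemma dec_cap_hook:
  assumes "matching_diagram n d" "1 \<le> i" "Suc i \<le> n"
  shows "dec (hook i d) {North i, North (Suc i)} = 0"
proof -
  obtain p where p: "{North i, p} \<in> edges d" using pm_partner[OF matching_diagramD(1)[OF assms(1)], of "North i"] assms by auto
  obtain q where q: "{North (Suc i), q} \<in> edges d"
    using pm_partner[OF matching_diagramD(1)[OF assms(1)], of "North (Suc i)"] assms by auto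
  show ?thesis
    by (cases "p = North (Suc i)") (use hook_same[OF assms(1)] hook_diff(1)[OF assms(1) p q] p in auto)
qed

lemma add_loops_dot: "dot (add_loops L d) = add_loops L (dot d)"
proof -
  have "edge_at (add_loops L d) x = edge_at d x" for x by (rule edge_at_cong) (simp add: add_loops_def)
  thus ?thesis by (simp add: dot_def add_loops_def)
qed

lemma value_square:
  assumes n: "2 \<le> n" and s: "s \<in> gens n"
  shows "diagram_value (word_diagram n [s, s]) = Poly_Mapping.map ((*) delta) (diagram_value (word_diagram n [s]))"
proof -
  have "same_parity (word_diagram n [s, s]) (add_loops {#0#} (word_diagram n [s]))"
  proof (cases s)
    case (Gen i)
    hence i: "1 \<le> i" "Suc i \<le> n" using s by (auto simp: gens_def)
    note m = matching_hook[OF matching_id i]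
    have "hook i (hook i (id_diagram n)) = add_loops {#0#} (hook i (id_diagram n))"
      by (rule hook_hook_same[OF m i cap_hook[OF matching_id i] dec_cap_hook[OF matching_id i]])
    thus ?thesis using Gen by simp
  next
    case Bar1
    have i: "1 \<le> (1::nat)" "Suc 1 \<le> n" and n1: "1 \<le> n" using n by auto
    define y where "y = dot (id_diagram n)"
    have my: "matching_diagram n y" unfolding y_def by (rule matching_dot[OF matching_id n1])
    have "same_parity (dot (hook 1 (dot (dot (hook 1 y))))) (dot (hook 1 (hook 1 y)))"
      by (intro same_parity_dot same_parity_hook same_parity_dot_dot)
    also have "hook 1 (hook 1 y) = add_loops {#0#} (hook 1 y)"
      by (rule hook_hook_same[OF matching_hook[OF my i] i cap_hook[OF my i] dec_cap_hook[OF my i]])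
    finally show ?thesis using Bar1 by (simp add: y_def add_loops_dot)
  qed
  thus ?thesis using diagram_value_same_parity diagram_value_add_loop by metis
qed

text \<open>In both orders there is exactly one \<open>dot\<close> between the two hooks at 1, so
  the loop that they close carries one decoration.\<close>

lemma odd_loop_Gen1_Bar1:
  assumes n: "2 \<le> n"
  shows "\<not> even_loops (word_diagram n [Gen 1, Bar1])" "\<not> even_loops (word_diagram n [Bar1, Gen 1])"
proof -
  have i: "1 \<le> (1::nat)" "Suc 1 \<le> n" and n1: "1 \<le> n" using n by auto
  have *: "\<not> even_loops (hook 1 (dot (hook 1 y)))" if my: "matching_diagram n y" for y
  proof -
    let ?c = "{North 1, North (Suc 1)}"
    have m1: "matching_diagram n (hook 1 y)" by (rule matching_hook[OF my i])
    have c1: "?c \<in> edges (hook 1 y)" by (rule cap_hook[OF my i])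
    have at: "edge_at (hook 1 y) (North 1) = ?c" by (rule edge_at_eq[OF m1 c1]) simp
    have d1: "dec (dot (hook 1 y)) ?c = 1" unfolding dec_dot at dec_cap_hook[OF my i] by simp
    have c2: "?c \<in> edges (dot (hook 1 y))" using c1 by (simp only: dot_def) simp
    have "1 \<in># loops (hook 1 (dot (hook 1 y)))"
      unfolding hook_same[OF matching_dot[OF m1 n1] c2] d1 by simp
    thus ?thesis unfolding even_loops_def by force
  qed
  show "\<not> even_loops (word_diagram n [Gen 1, Bar1])"
    using *[OF matching_dot[OF matching_id n1]] by (simp add: even_loops_def)
  show "\<not> even_loops (word_diagram n [Bar1, Gen 1])"
    using *[OF matching_id] by (simp add: even_loops_def dot_def[of "hook (Suc 0) (dot _)"])
qed

text \<open>For the two letters of column 1 the diagrams differ, but both values are 0.\<close>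

lemma value_commute:
  assumes n: "2 \<le> n" and st: "s \<in> gens n" "t \<in> gens n" "s \<noteq> t" "\<not> connected_gens s t"
  shows "diagram_value (word_diagram n [s, t]) = diagram_value (word_diagram n [t, s])"
proof (cases "gen_col s = gen_col t")
  case True
  hence "s = Gen 1 \<and> t = Bar1 \<or> s = Bar1 \<and> t = Gen 1" using st by (cases s; cases t) (auto simp: gens_def)
  thus ?thesis using odd_loop_Gen1_Bar1[OF n] by (auto simp: diagram_value_def)
next
  case False
  thus ?thesis using act_commute[OF n st(1,2) False st(4) dplus_id] by simp
qed

text \<open>When \<open>Bar1\<close> is involved, the dots move past \<open>hook 2\<close> and
  cancel in pairs; what remains is the zigzag relation for hooks.\<close>

lemma value_braid:
  assumes n: "2 \<le> n" and st: "s \<in> gens n" "t \<in> gens n" "connected_gens s t"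
  shows "diagram_value (word_diagram n [s, t, s]) = diagram_value (word_diagram n [s])"
proof -
  have n1: "1 \<le> n" using n by simp
  have up: "hook i (hook (Suc i) (hook i y)) = hook i y" if "matching_diagram n y" "1 \<le> i" "Suc (Suc i) \<le> n" for i y
    by (rule hook_hook_up[OF matching_hook[OF that(1,2)] that(2,3) cap_hook[OF that(1,2)] dec_cap_hook[OF that(1,2)]]) (use that in simp_all)
  have down: "hook (Suc i) (hook i (hook (Suc i) y)) = hook (Suc i) y" if "matching_diagram n y" "1 \<le> i" "Suc (Suc i) \<le> n" for i y
    by (rule hook_hook_down[OF matching_hook[OF that(1) _ that(3)] that(2,3) cap_hook[OF that(1) _ that(3)] dec_cap_hook[OF that(1) _ that(3)]]) simp_all
  have "same_parity (word_diagram n [s, t, s]) (word_diagram n [s])"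
  proof (cases s; cases t)
    fix i j assume g: "s = Gen i" "t = Gen j"
    hence i: "1 \<le> i" "Suc i \<le> n" "1 \<le> j" "Suc j \<le> n" "j = Suc i \<or> i = Suc j" using st by (auto simp: gens_def)
    from i(5) have "hook i (hook j (hook i (id_diagram n))) = hook i (id_diagram n)"
    proof
      assume "j = Suc i" thus ?thesis using up[OF matching_id i(1)] i by simp
    next
      assume "i = Suc j" thus ?thesis using down[OF matching_id i(3)] i by simp
    qed
    thus ?thesis using g by simp
  next
    fix j assume g: "s = Bar1" "t = Gen j"
    hence j: "j = 2" "3 \<le> n" using st by (auto simp: gens_def)
    have i: "1 \<le> (1::nat)" "Suc 1 \<le> n" "Suc 2 \<le> n" using j by auto
    define y where "y = dot (id_diagram n)"
    have my: "matching_diagram n y" unfolding y_def by (rule matching_dot[OF matching_id n1])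
    define z where "z = dot (hook 1 y)"
    have mz: "matching_diagram n z" unfolding z_def by (rule matching_dot[OF matching_hook[OF my i(1,2)] n1])
    have "dot (hook 2 z) = hook 2 (dot z)" by (rule dot_hook[OF mz _ i(3)]) simp
    hence "same_parity (dot (hook 1 (dot (hook 2 z)))) (dot (hook 1 (hook 2 (hook 1 y))))"
      unfolding z_def by (auto intro!: same_parity_dot same_parity_hook same_parity_dot_dot)
    also have "hook 1 (hook 2 (hook 1 y)) = hook 1 y" using up[OF my, of 1] j by (simp add: numeral_2_eq_2)
    finally show ?thesis using g j by (simp add: y_def z_def)
  next
    fix j assume g: "s = Gen j" "t = Bar1"
    hence j: "j = 2" "3 \<le> n" using st by (auto simp: gens_def)
    have i: "1 \<le> (1::nat)" "Suc 1 \<le> n" "Suc 2 \<le> n" "2 \<le> (2::nat)" "1 \<le> (2::nat)" using j by auto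
    define y where "y = dot (id_diagram n)"
    have my: "matching_diagram n y" unfolding y_def by (rule matching_dot[OF matching_id n1])
    have m2: "matching_diagram n (hook 2 y)" by (rule matching_hook[OF my i(5,3)])
    have m3: "matching_diagram n (hook 1 (hook 2 y))" by (rule matching_hook[OF m2 i(1,2)])
    have "hook 2 (dot (hook 1 (dot (hook 2 (id_diagram n))))) = hook 2 (dot (hook 1 (hook 2 y)))"
      unfolding y_def using dot_hook[OF matching_id i(4,3)] by simp
    also have "\<dots> = dot (hook 2 (hook 1 (hook 2 y)))" using dot_hook[OF m3 i(4,3)] by simp
    also have "hook 2 (hook 1 (hook 2 y)) = hook 2 y" using down[OF my, of 1] j by (simp add: numeral_2_eq_2)
    also have "dot (hook 2 y) = dot (dot (hook 2 (id_diagram n)))" unfolding y_def using dot_hook[OF matching_id i(4,3)] by simp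
    also have "same_parity \<dots> (hook 2 (id_diagram n))" by (rule same_parity_dot_dot)
    finally show ?thesis using g j by simp
  next
    assume "s = Bar1" "t = Bar1" thus ?thesis using st by simp
  qed
  thus ?thesis by (rule diagram_value_same_parity)
qed

section \<open>Algebras over \<open>\<int>[\<delta>]\<close> and their quotients\<close>

text \<open>The record type enforces no laws. The ones collected here carry the arguments about
  quotients and bases, and they pass to homomorphic images by \<open>zd_alg_image\<close>.\<close>

definition zd_alg :: "'a zd_algebra \<Rightarrow> bool" where
  "zd_alg A \<longleftrightarrow> ring A \<and> (\<forall>c. \<forall>x\<in>carrier A. c \<odot>\<^bsub>A\<^esub> x \<in> carrier A) \<and>
     (\<forall>c. \<forall>x\<in>carrier A. \<forall>y\<in>carrier A. c \<odot>\<^bsub>A\<^esub> (x \<oplus>\<^bsub>A\<^esub> y) = (c \<odot>\<^bsub>A\<^esub> x) \<oplus>\<^bsub>A\<^esub> (c \<odot>\<^bsub>A\<^esub> y)) \<and>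
     (\<forall>c. \<forall>x\<in>carrier A. \<forall>y\<in>carrier A. c \<odot>\<^bsub>A\<^esub> (x \<otimes>\<^bsub>A\<^esub> y) = (c \<odot>\<^bsub>A\<^esub> x) \<otimes>\<^bsub>A\<^esub> y) \<and>
     (\<forall>c. \<forall>x\<in>carrier A. \<forall>y\<in>carrier A. c \<odot>\<^bsub>A\<^esub> (x \<otimes>\<^bsub>A\<^esub> y) = x \<otimes>\<^bsub>A\<^esub> (c \<odot>\<^bsub>A\<^esub> y)) \<and>
     (\<forall>c d. \<forall>x\<in>carrier A. (c * d) \<odot>\<^bsub>A\<^esub> x = c \<odot>\<^bsub>A\<^esub> (d \<odot>\<^bsub>A\<^esub> x)) \<and>
     (\<forall>x\<in>carrier A. 1 \<odot>\<^bsub>A\<^esub> x = x)"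

lemma zd_algD:
  assumes "zd_alg A"
  shows "ring A" "x \<in> carrier A \<Longrightarrow> c \<odot>\<^bsub>A\<^esub> x \<in> carrier A"
    "x \<in> carrier A \<Longrightarrow> y \<in> carrier A \<Longrightarrow> c \<odot>\<^bsub>A\<^esub> (x \<oplus>\<^bsub>A\<^esub> y) = (c \<odot>\<^bsub>A\<^esub> x) \<oplus>\<^bsub>A\<^esub> (c \<odot>\<^bsub>A\<^esub> y)"
    "x \<in> carrier A \<Longrightarrow> y \<in> carrier A \<Longrightarrow> c \<odot>\<^bsub>A\<^esub> (x \<otimes>\<^bsub>A\<^esub> y) = (c \<odot>\<^bsub>A\<^esub> x) \<otimes>\<^bsub>A\<^esub> y"
    "x \<in> carrier A \<Longrightarrow> y \<in> carrier A \<Longrightarrow> c \<odot>\<^bsub>A\<^esub> (x \<otimes>\<^bsub>A\<^esub> y) = x \<otimes>\<^bsub>A\<^esub> (c \<odot>\<^bsub>A\<^esub> y)"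
    "x \<in> carrier A \<Longrightarrow> (c * d) \<odot>\<^bsub>A\<^esub> x = c \<odot>\<^bsub>A\<^esub> (d \<odot>\<^bsub>A\<^esub> x)"
    "x \<in> carrier A \<Longrightarrow> 1 \<odot>\<^bsub>A\<^esub> x = x"
  using assms unfolding zd_alg_def by blast+

lemma alg_homD:
  assumes "h \<in> alg_hom A B"
  shows "h \<in> ring_hom A B" "x \<in> carrier A \<Longrightarrow> h x \<in> carrier B"
    "x \<in> carrier A \<Longrightarrow> y \<in> carrier A \<Longrightarrow> h (x \<oplus>\<^bsub>A\<^esub> y) = h x \<oplus>\<^bsub>B\<^esub> h y"
    "x \<in> carrier A \<Longrightarrow> y \<in> carrier A \<Longrightarrow> h (x \<otimes>\<^bsub>A\<^esub> y) = h x \<otimes>\<^bsub>B\<^esub> h y"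
    "h \<one>\<^bsub>A\<^esub> = \<one>\<^bsub>B\<^esub>"
    "x \<in> carrier A \<Longrightarrow> h (c \<odot>\<^bsub>A\<^esub> x) = c \<odot>\<^bsub>B\<^esub> h x"
  using assms unfolding alg_hom_def by (auto simp: ring_hom_def)

lemma alg_homI:
  assumes "\<And>x. x \<in> carrier A \<Longrightarrow> h x \<in> carrier B"
    "\<And>x y. x \<in> carrier A \<Longrightarrow> y \<in> carrier A \<Longrightarrow> h (x \<oplus>\<^bsub>A\<^esub> y) = h x \<oplus>\<^bsub>B\<^esub> h y"
    "\<And>x y. x \<in> carrier A \<Longrightarrow> y \<in> carrier A \<Longrightarrow> h (x \<otimes>\<^bsub>A\<^esub> y) = h x \<otimes>\<^bsub>B\<^esub> h y"
    "h \<one>\<^bsub>A\<^esub> = \<one>\<^bsub>B\<^esub>"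
    "\<And>c x. x \<in> carrier A \<Longrightarrow> h (c \<odot>\<^bsub>A\<^esub> x) = c \<odot>\<^bsub>B\<^esub> h x"
  shows "h \<in> alg_hom A B"
  unfolding alg_hom_def using assms by (auto intro!: ring_hom_memI)

lemma alg_hom_zero: "h \<in> alg_hom A B \<Longrightarrow> ring A \<Longrightarrow> ring B \<Longrightarrow> h \<zero>\<^bsub>A\<^esub> = \<zero>\<^bsub>B\<^esub>"
  using ring_hom_zero alg_homD(1) by blast

lemma alg_hom_minus:
  assumes "h \<in> alg_hom A B" "ring A" "ring B" "x \<in> carrier A" "y \<in> carrier A"
  shows "h (x \<ominus>\<^bsub>A\<^esub> y) = h x \<ominus>\<^bsub>B\<^esub> h y"
proof -
  interpret ring_hom_ring A B h by (rule ring_hom_ringI2[OF assms(2,3) alg_homD(1)[OF assms(1)]])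
  show ?thesis using assms(4,5) by (simp add: a_minus_def R.minus_eq S.minus_eq)
qed

lemma alg_hom_comp: "g \<in> alg_hom A B \<Longrightarrow> h \<in> alg_hom B C \<Longrightarrow> (\<lambda>x. h (g x)) \<in> alg_hom A C"
  by (rule alg_homI) (simp_all add: alg_homD)

lemma zd_alg_image:
  assumes A: "zd_alg A" and Q: "ring B" and h: "h \<in> alg_hom A B" "h ` carrier A = carrier B"
  shows "zd_alg B"
proof -
  note a = zd_algD[OF A] and hh = alg_homD[OF h(1)]
  have 1: "\<exists>a\<in>carrier A. x = h a" if "x \<in> carrier B" for x using that h(2) by blast
  interpret R: ring A by (rule a(1))
  show ?thesis unfolding zd_alg_def
  proof (intro conjI allI ballI)
    show "ring B" by fact
    fix c d x assume "x \<in> carrier B"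
    then obtain u where u: "u \<in> carrier A" "x = h u" using 1 by blast
    show "c \<odot>\<^bsub>B\<^esub> x \<in> carrier B" using u a(2) hh(2,6) by metis
    show "(c * d) \<odot>\<^bsub>B\<^esub> x = c \<odot>\<^bsub>B\<^esub> (d \<odot>\<^bsub>B\<^esub> x)" using u a(2,6) hh(6) by metis
    show "1 \<odot>\<^bsub>B\<^esub> x = x" using u a(7) hh(6) by metis
    fix y assume "y \<in> carrier B"
    then obtain v where v: "v \<in> carrier A" "y = h v" using 1 by blast
    show "c \<odot>\<^bsub>B\<^esub> (x \<oplus>\<^bsub>B\<^esub> y) = (c \<odot>\<^bsub>B\<^esub> x) \<oplus>\<^bsub>B\<^esub> (c \<odot>\<^bsub>B\<^esub> y)"
      using u v a(2,3) hh(3,6) R.a_closed by metis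
    show "c \<odot>\<^bsub>B\<^esub> (x \<otimes>\<^bsub>B\<^esub> y) = (c \<odot>\<^bsub>B\<^esub> x) \<otimes>\<^bsub>B\<^esub> y"
      using u v a(2,4) hh(4,6) R.m_closed by metis
    show "c \<odot>\<^bsub>B\<^esub> (x \<otimes>\<^bsub>B\<^esub> y) = x \<otimes>\<^bsub>B\<^esub> (c \<odot>\<^bsub>B\<^esub> y)"
      using u v a(2,5) hh(4,6) R.m_closed by metis
  qed
qed

lemma quotient_algebra_simps:
  "carrier (quotient_algebra A S) = carrier (A Quot (Idl\<^bsub>A\<^esub> S))"
  "mult (quotient_algebra A S) = mult (A Quot (Idl\<^bsub>A\<^esub> S))"
  "one (quotient_algebra A S) = one (A Quot (Idl\<^bsub>A\<^esub> S))"
  "zero (quotient_algebra A S) = zero (A Quot (Idl\<^bsub>A\<^esub> S))"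
  "add (quotient_algebra A S) = add (A Quot (Idl\<^bsub>A\<^esub> S))"
  "smult (quotient_algebra A S) = (\<lambda>c X. \<Union>x\<in>X. quotient_map A S (c \<odot>\<^bsub>A\<^esub> x))"
  by (simp_all add: quotient_algebra_def ring.defs module.defs)

lemma ring_cong:
  assumes "ring R" "carrier S = carrier R" "mult S = mult R" "one S = one R" "zero S = zero R" "add S = add R"
  shows "ring S"
proof -
  interpret R: ring R by fact
  show ?thesis
  proof (rule ringI)
    show "abelian_group S"
    proof (rule abelian_groupI, unfold assms)
      show "\<exists>y\<in>carrier R. y \<oplus>\<^bsub>R\<^esub> x = \<zero>\<^bsub>R\<^esub>" if "x \<in> carrier R" for x
        using R.l_neg[OF that] R.a_inv_closed[OF that] by blast
    qed (simp_all add: R.a_ac)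
    show "Group.monoid S"
      by (rule monoidI) (auto simp: assms R.m_assoc)
  qed (auto simp: assms R.l_distr R.r_distr)
qed

text \<open>Closure under negatives comes from multiplying by minus one.\<close>

lemma idealI_zd:
  assumes "ring A" "I \<subseteq> carrier A" "\<zero>\<^bsub>A\<^esub> \<in> I" "\<And>x y. x \<in> I \<Longrightarrow> y \<in> I \<Longrightarrow> x \<oplus>\<^bsub>A\<^esub> y \<in> I"
    "\<And>x a. x \<in> I \<Longrightarrow> a \<in> carrier A \<Longrightarrow> a \<otimes>\<^bsub>A\<^esub> x \<in> I" "\<And>x a. x \<in> I \<Longrightarrow> a \<in> carrier A \<Longrightarrow> x \<otimes>\<^bsub>A\<^esub> a \<in> I"
  shows "ideal I A"
proof -
  interpret ring A by fact
  have minus: "\<ominus>\<^bsub>A\<^esub> x \<in> I" if "x \<in> I" for x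
  proof -
    have "x \<in> carrier A" using that assms(2) by blast
    hence "\<ominus>\<^bsub>A\<^esub> x = (\<ominus>\<^bsub>A\<^esub> \<one>\<^bsub>A\<^esub>) \<otimes>\<^bsub>A\<^esub> x" by (simp add: l_minus)
    thus ?thesis using assms(5)[OF that, of "\<ominus>\<^bsub>A\<^esub> \<one>\<^bsub>A\<^esub>"] by simp
  qed
  show ?thesis
  proof (rule idealI[OF assms(1)])
    show "subgroup I (add_monoid A)"
    proof
      show "I \<subseteq> carrier (add_monoid A)" using assms(2) by simp
      show "x \<otimes>\<^bsub>add_monoid A\<^esub> y \<in> I" if "x \<in> I" "y \<in> I" for x y using assms(4) that by simp
      show "\<one>\<^bsub>add_monoid A\<^esub> \<in> I" using assms(3) by simp
      show "inv\<^bsub>add_monoid A\<^esub> x \<in> I" if "x \<in> I" for x using minus[OF that] by (simp add: a_inv_def)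
    qed
  qed (use assms in auto)
qed

lemma ideal_smult:
  assumes A: "zd_alg A" and I: "ideal I A" and x: "x \<in> I"
  shows "c \<odot>\<^bsub>A\<^esub> x \<in> I"
proof -
  interpret ideal I A by fact
  note a = zd_algD[OF A]
  have xc: "x \<in> carrier A" using x Icarr by blast
  have "c \<odot>\<^bsub>A\<^esub> x = c \<odot>\<^bsub>A\<^esub> (\<one>\<^bsub>A\<^esub> \<otimes>\<^bsub>A\<^esub> x)" using xc by simp
  also have "\<dots> = (c \<odot>\<^bsub>A\<^esub> \<one>\<^bsub>A\<^esub>) \<otimes>\<^bsub>A\<^esub> x" using a(4)[of "\<one>\<^bsub>A\<^esub>" x] xc by simp
  finally show ?thesis using I_l_closed[OF x] a(2)[of "\<one>\<^bsub>A\<^esub>"] by simp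
qed

lemma smult_zero:
  assumes A: "zd_alg A"
  shows "c \<odot>\<^bsub>A\<^esub> \<zero>\<^bsub>A\<^esub> = \<zero>\<^bsub>A\<^esub>"
proof -
  note a = zd_algD[OF A]
  interpret ring A by (rule a(1))
  show ?thesis using a(4)[of "\<zero>\<^bsub>A\<^esub>" "\<zero>\<^bsub>A\<^esub>" c] a(2)[of "\<zero>\<^bsub>A\<^esub>" c] by simp
qed

lemma smult_minus:
  assumes A: "zd_alg A" and x: "x \<in> carrier A" "y \<in> carrier A"
  shows "c \<odot>\<^bsub>A\<^esub> (x \<ominus>\<^bsub>A\<^esub> y) = (c \<odot>\<^bsub>A\<^esub> x) \<ominus>\<^bsub>A\<^esub> (c \<odot>\<^bsub>A\<^esub> y)"
proof -
  note a = zd_algD[OF A]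
  interpret ring A by (rule a(1))
  have "(c \<odot>\<^bsub>A\<^esub> (x \<ominus>\<^bsub>A\<^esub> y)) \<oplus>\<^bsub>A\<^esub> (c \<odot>\<^bsub>A\<^esub> y) = c \<odot>\<^bsub>A\<^esub> ((x \<ominus>\<^bsub>A\<^esub> y) \<oplus>\<^bsub>A\<^esub> y)"
    using a(3)[of "x \<ominus>\<^bsub>A\<^esub> y" y] x by simp
  also have "(x \<ominus>\<^bsub>A\<^esub> y) \<oplus>\<^bsub>A\<^esub> y = x" using x by (simp add: a_minus_def a_assoc l_neg)
  finally have "c \<odot>\<^bsub>A\<^esub> x = (c \<odot>\<^bsub>A\<^esub> (x \<ominus>\<^bsub>A\<^esub> y)) \<oplus>\<^bsub>A\<^esub> (c \<odot>\<^bsub>A\<^esub> y)" by simp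
  thus ?thesis using x a(2) by (simp add: a_minus_def a_assoc r_neg)
qed

text \<open>Scalar multiplication on the quotient is defined as a union over the representatives of
  a coset. It is a single coset because the ideal is closed under scalars: a scalar acts as
  multiplication by its multiple of the unit.\<close>

lemma quotient_algebra:
  assumes A: "zd_alg A" and S: "S \<subseteq> carrier A"
  shows "zd_alg (quotient_algebra A S)" "quotient_map A S \<in> alg_hom A (quotient_algebra A S)"
    "quotient_map A S ` carrier A = carrier (quotient_algebra A S)"
    "x \<in> carrier A \<Longrightarrow> quotient_map A S x = \<zero>\<^bsub>quotient_algebra A S\<^esub> \<longleftrightarrow> x \<in> Idl\<^bsub>A\<^esub> S"
proof -
  note a = zd_algD[OF A]
  interpret R: ring A by (rule a(1))
  let ?I = "Idl\<^bsub>A\<^esub> S"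
  interpret I: ideal ?I A by (rule R.genideal_ideal[OF S])
  note q = quotient_algebra_simps[of A S]
  have rQ: "ring (quotient_algebra A S)" by (rule ring_cong[OF I.quotient_is_ring]) (simp_all add: q)
  have "quotient_map A S \<in> ring_hom A (A Quot ?I)" using I.rcos_ring_hom unfolding quotient_map_def .
  hence rh: "quotient_map A S \<in> ring_hom A (quotient_algebra A S)" unfolding ring_hom_def q .
  show surj: "quotient_map A S ` carrier A = carrier (quotient_algebra A S)"
    unfolding q FactRing_def quotient_map_def by (auto simp: A_RCOSETS_def')
  have sm: "quotient_map A S (c \<odot>\<^bsub>A\<^esub> x) = c \<odot>\<^bsub>quotient_algebra A S\<^esub> quotient_map A S x" if x: "x \<in> carrier A" for c x
  proof -
    have "quotient_map A S (c \<odot>\<^bsub>A\<^esub> y) = quotient_map A S (c \<odot>\<^bsub>A\<^esub> x)" if y: "y \<in> quotient_map A S x" for y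
    proof -
      have yc: "y \<in> carrier A" using y x I.a_subset unfolding quotient_map_def by (auto simp: a_r_coset_def')
      have "y \<ominus>\<^bsub>A\<^esub> x \<in> ?I" using I.a_rcos_module_minus[OF R.ring_axioms x yc] y unfolding quotient_map_def by blast
      hence "c \<odot>\<^bsub>A\<^esub> (y \<ominus>\<^bsub>A\<^esub> x) \<in> ?I" by (rule ideal_smult[OF A I.ideal_axioms])
      hence "(c \<odot>\<^bsub>A\<^esub> y) \<ominus>\<^bsub>A\<^esub> (c \<odot>\<^bsub>A\<^esub> x) \<in> ?I" using smult_minus[OF A yc x] by simp
      thus ?thesis using R.quotient_eq_iff_same_a_r_cos[OF I.ideal_axioms a(2)[OF yc] a(2)[OF x]]
        unfolding quotient_map_def by blast
    qed
    moreover have "x \<in> quotient_map A S x" unfolding quotient_map_def by (rule I.a_rcos_self[OF x])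
    ultimately show ?thesis unfolding q by blast
  qed
  show ah: "quotient_map A S \<in> alg_hom A (quotient_algebra A S)" unfolding alg_hom_def using rh sm by blast
  show "zd_alg (quotient_algebra A S)" by (rule zd_alg_image[OF A rQ ah surj])
  show "quotient_map A S x = \<zero>\<^bsub>quotient_algebra A S\<^esub> \<longleftrightarrow> x \<in> ?I" if "x \<in> carrier A"
    using I.rcos_const_imp_mem[OF that] R.a_rcos_zero[OF I.ideal_axioms]
    unfolding q quotient_map_def FactRing_def by auto
qed

lemma eq_iff_minus_zero:
  assumes "ring A" "x \<in> carrier A" "y \<in> carrier A"
  shows "x = y \<longleftrightarrow> x \<ominus>\<^bsub>A\<^esub> y = \<zero>\<^bsub>A\<^esub>"
proof -
  interpret ring A by fact
  show ?thesis using assms r_right_minus_eq by blast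
qed

lemma subalgebra_zd_alg:
  assumes A: "zd_alg A" and X: "subring X A" "\<And>c x. x \<in> X \<Longrightarrow> c \<odot>\<^bsub>A\<^esub> x \<in> X"
  shows "zd_alg (A\<lparr>carrier := X\<rparr>)"
proof -
  note a = zd_algD[OF A]
  interpret ring A by (rule a(1))
  have r: "ring (A\<lparr>carrier := X\<rparr>)" by (rule subring_is_ring[OF X(1)])
  have sub: "X \<subseteq> carrier A" by (rule subringE(1)[OF X(1)])
  show ?thesis unfolding zd_alg_def using r X(2) a sub by (auto simp: subset_iff)
qed

text \<open>The kernel of a quotient of a subalgebra of a quotient is bounded by an ideal
  \<open>K\<close> of the original algebra: the part of the image of \<open>K\<close> that lies in
  \<open>X\<close> is an ideal of the subalgebra and contains \<open>T\<close>, hence also the ideal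
  that \<open>T\<close> generates there.\<close>

lemma quotient_of_subalgebra_kernel:
  assumes A: "zd_alg A" and S: "S \<subseteq> carrier A" and K: "ideal K A" and SK: "S \<subseteq> K"
    and B: "zd_alg ((quotient_algebra A S)\<lparr>carrier := X\<rparr>)" and X: "X \<subseteq> carrier (quotient_algebra A S)"
    and T: "T \<subseteq> X" and TK: "T \<subseteq> quotient_map A S ` K"
    and x: "x \<in> carrier A" "quotient_map A S x \<in> X"
    and z: "quotient_map ((quotient_algebra A S)\<lparr>carrier := X\<rparr>) T (quotient_map A S x)
        = \<zero>\<^bsub>quotient_algebra ((quotient_algebra A S)\<lparr>carrier := X\<rparr>) T\<^esub>"
  shows "x \<in> K"
proof -
  let ?Q = "quotient_algebra A S" and ?h = "quotient_map A S"
  let ?B = "?Q\<lparr>carrier := X\<rparr>"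
  note q = quotient_algebra[OF A S] and h = alg_homD[OF quotient_algebra(2)[OF A S]]
  interpret A: ring A by (rule zd_algD(1)[OF A])
  interpret K: ideal K A by (rule K)
  interpret B: ring ?B by (rule zd_algD(1)[OF B])
  interpret Q: ring ?Q by (rule zd_algD(1)[OF q(1)])
  have TB: "T \<subseteq> carrier ?B" using T by simp
  let ?N = "?h ` K \<inter> X"
  have idN: "ideal ?N ?B"
  proof (rule idealI_zd[OF B.ring_axioms])
    show "?N \<subseteq> carrier ?B" by simp
    have "\<zero>\<^bsub>?Q\<^esub> = ?h \<zero>\<^bsub>A\<^esub>" using alg_hom_zero[OF q(2) A.ring_axioms Q.ring_axioms] by simp
    moreover have "\<zero>\<^bsub>?B\<^esub> \<in> X" using B.zero_closed by simp
    ultimately show "\<zero>\<^bsub>?B\<^esub> \<in> ?N" using K.zero_closed by auto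
  next
    fix u v assume u: "u \<in> ?N" and v: "v \<in> ?N"
    then obtain k l where kl: "k \<in> K" "l \<in> K" "u = ?h k" "v = ?h l" by blast
    have "u \<oplus>\<^bsub>?Q\<^esub> v = ?h (k \<oplus>\<^bsub>A\<^esub> l)" using kl h(3) K.Icarr by simp
    moreover have "k \<oplus>\<^bsub>A\<^esub> l \<in> K" using kl K.a_closed by blast
    moreover have "u \<oplus>\<^bsub>?B\<^esub> v \<in> X" using B.a_closed[of u v] u v by simp
    ultimately show "u \<oplus>\<^bsub>?B\<^esub> v \<in> ?N" by auto
  next
    fix u b assume u: "u \<in> ?N" and b: "b \<in> carrier ?B"
    then obtain k where k: "k \<in> K" "u = ?h k" by blast
    have "b \<in> carrier ?Q" using b X by auto
    then obtain a where a: "a \<in> carrier A" "b = ?h a" using q(3) by blast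
    have "b \<otimes>\<^bsub>?Q\<^esub> u = ?h (a \<otimes>\<^bsub>A\<^esub> k)" "u \<otimes>\<^bsub>?Q\<^esub> b = ?h (k \<otimes>\<^bsub>A\<^esub> a)" using a k h(4) K.Icarr by simp_all
    moreover have "a \<otimes>\<^bsub>A\<^esub> k \<in> K" "k \<otimes>\<^bsub>A\<^esub> a \<in> K" using K.I_l_closed K.I_r_closed a k by blast+
    moreover have "b \<otimes>\<^bsub>?B\<^esub> u \<in> X" "u \<otimes>\<^bsub>?B\<^esub> b \<in> X" using B.m_closed[of b u] B.m_closed[of u b] u b by simp_all
    ultimately show "b \<otimes>\<^bsub>?B\<^esub> u \<in> ?N" "u \<otimes>\<^bsub>?B\<^esub> b \<in> ?N" by auto
  qed
  have "?h x \<in> Idl\<^bsub>?B\<^esub> T" using quotient_algebra(4)[OF B TB, of "?h x"] x(2) z by simp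
  moreover have "Idl\<^bsub>?B\<^esub> T \<subseteq> ?N" by (rule B.genideal_minimal[OF idN]) (use T TK in blast)
  ultimately obtain k where k: "k \<in> K" "?h x = ?h k" by blast
  have kc: "k \<in> carrier A" using k K.Icarr by blast
  have "?h (x \<ominus>\<^bsub>A\<^esub> k) = \<zero>\<^bsub>?Q\<^esub>"
    using alg_hom_minus[OF q(2) A.ring_axioms Q.ring_axioms x(1) kc] k(2) eq_iff_minus_zero[OF Q.ring_axioms h(2)[OF x(1)] h(2)[OF kc]]
    by simp
  hence "x \<ominus>\<^bsub>A\<^esub> k \<in> Idl\<^bsub>A\<^esub> S" using q(4)[of "x \<ominus>\<^bsub>A\<^esub> k"] x(1) kc by simp
  hence "x \<ominus>\<^bsub>A\<^esub> k \<in> K" using A.genideal_minimal[OF K SK] by blast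
  hence "(x \<ominus>\<^bsub>A\<^esub> k) \<oplus>\<^bsub>A\<^esub> k \<in> K" using k(1) K.a_closed by blast
  moreover have "(x \<ominus>\<^bsub>A\<^esub> k) \<oplus>\<^bsub>A\<^esub> k = x" using x(1) kc by (simp add: a_minus_def A.a_assoc A.l_neg)
  ultimately show ?thesis by simp
qed

lemma quotient_of_quotient_kernel:
  assumes A: "zd_alg A" and S: "S \<subseteq> carrier A" and K: "ideal K A" and SK: "S \<subseteq> K"
    and T: "T \<subseteq> quotient_map A S ` K"
    and x: "x \<in> carrier A"
    and z: "quotient_map (quotient_algebra A S) T (quotient_map A S x) = \<zero>\<^bsub>quotient_algebra (quotient_algebra A S) T\<^esub>"
  shows "x \<in> K"
proof -
  note q = quotient_algebra[OF A S]
  have eq: "(quotient_algebra A S)\<lparr>carrier := carrier (quotient_algebra A S)\<rparr> = quotient_algebra A S" by simp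
  have Kc: "K \<subseteq> carrier A" using ideal.Icarr[OF K] by blast
  have TX: "T \<subseteq> carrier (quotient_algebra A S)" using T Kc q(3) by blast
  show ?thesis
    by (rule quotient_of_subalgebra_kernel[OF A S K SK, of "carrier (quotient_algebra A S)" T, unfolded eq])
      (use q TX T x z in \<open>auto\<close>)
qed

lemma kernel_ideal:
  assumes "ring A" "ring B" "h \<in> alg_hom A B"
  shows "ideal {x \<in> carrier A. h x = \<zero>\<^bsub>B\<^esub>} A"
proof -
  interpret A: ring A by fact
  interpret B: ring B by fact
  note hh = alg_homD[OF assms(3)]
  show ?thesis
    by (rule idealI_zd[OF assms(1)]) (use hh alg_hom_zero[OF assms(3,1,2)] in auto)
qed

text \<open>Elements of \<open>A\<close> are lifted to \<open>F\<close>; as the kernels agree, the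
  image in \<open>C\<close> does not depend on the lift.\<close>

lemma alg_iso_of_equal_kernels:
  assumes F: "zd_alg F" and A: "zd_alg A" and C: "zd_alg C"
    and g: "g \<in> alg_hom F A" "g ` carrier F = carrier A"
    and h: "h \<in> alg_hom F C" "h ` carrier F = carrier C"
    and ker: "\<And>f. f \<in> carrier F \<Longrightarrow> g f = \<zero>\<^bsub>A\<^esub> \<longleftrightarrow> h f = \<zero>\<^bsub>C\<^esub>"
  obtains \<phi> where "\<phi> \<in> alg_iso A C" "\<And>f. f \<in> carrier F \<Longrightarrow> \<phi> (g f) = h f"
proof -
  interpret F: ring F by (rule zd_algD(1)[OF F])
  interpret A: ring A by (rule zd_algD(1)[OF A])
  interpret C: ring C by (rule zd_algD(1)[OF C])
  note gg = alg_homD[OF g(1)] and hh = alg_homD[OF h(1)]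
  have same: "g u = g v \<longleftrightarrow> h u = h v" if uv: "u \<in> carrier F" "v \<in> carrier F" for u v
  proof -
    have "g u = g v \<longleftrightarrow> g (u \<ominus>\<^bsub>F\<^esub> v) = \<zero>\<^bsub>A\<^esub>"
      using alg_hom_minus[OF g(1) F.ring_axioms A.ring_axioms uv] eq_iff_minus_zero[OF A.ring_axioms gg(2)[OF uv(1)] gg(2)[OF uv(2)]] by simp
    also have "\<dots> \<longleftrightarrow> h (u \<ominus>\<^bsub>F\<^esub> v) = \<zero>\<^bsub>C\<^esub>" using ker[of "u \<ominus>\<^bsub>F\<^esub> v"] uv by simp
    also have "\<dots> \<longleftrightarrow> h u = h v"
      using alg_hom_minus[OF h(1) F.ring_axioms C.ring_axioms uv] eq_iff_minus_zero[OF C.ring_axioms hh(2)[OF uv(1)] hh(2)[OF uv(2)]] by simp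
    finally show ?thesis .
  qed
  define \<phi> where "\<phi> x = h (SOME f. f \<in> carrier F \<and> g f = x)" for x
  have ph: "\<phi> (g f) = h f" if f: "f \<in> carrier F" for f
  proof -
    let ?f = "SOME k. k \<in> carrier F \<and> g k = g f"
    have "?f \<in> carrier F \<and> g ?f = g f" by (rule someI[of _ f]) (use f in simp)
    thus ?thesis unfolding \<phi>_def using same f by blast
  qed
  have ex: "\<exists>f\<in>carrier F. x = g f" if "x \<in> carrier A" for x using that g(2) by blast
  have "\<phi> \<in> alg_hom A C" unfolding alg_hom_def
  proof (intro CollectI conjI allI ballI ring_hom_memI)
    fix x assume "x \<in> carrier A"
    then obtain f where f: "f \<in> carrier F" "x = g f" using ex by blast
    show "\<phi> x \<in> carrier C" using f ph hh(2) by simp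
    show "\<phi> (c \<odot>\<^bsub>A\<^esub> x) = c \<odot>\<^bsub>C\<^esub> \<phi> x" for c
      using f ph[OF zd_algD(2)[OF F f(1)]] gg(6) hh(6) ph by simp
    fix y assume "y \<in> carrier A"
    then obtain k where k: "k \<in> carrier F" "y = g k" using ex by blast
    show "\<phi> (x \<otimes>\<^bsub>A\<^esub> y) = \<phi> x \<otimes>\<^bsub>C\<^esub> \<phi> y" using f k ph ph[of "f \<otimes>\<^bsub>F\<^esub> k"] gg(4) hh(4) by simp
    show "\<phi> (x \<oplus>\<^bsub>A\<^esub> y) = \<phi> x \<oplus>\<^bsub>C\<^esub> \<phi> y" using f k ph ph[of "f \<oplus>\<^bsub>F\<^esub> k"] gg(3) hh(3) by simp
  next
    show "\<phi> \<one>\<^bsub>A\<^esub> = \<one>\<^bsub>C\<^esub>" using ph[of "\<one>\<^bsub>F\<^esub>"] gg(5) hh(5) by simp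
  qed
  moreover have "bij_betw \<phi> (carrier A) (carrier C)" unfolding bij_betw_def
  proof
    show "inj_on \<phi> (carrier A)"
    proof (rule inj_onI)
      fix x y assume "x \<in> carrier A" "y \<in> carrier A" "\<phi> x = \<phi> y"
      thus "x = y" using ex ph same by metis
    qed
    show "\<phi> ` carrier A = carrier C" unfolding g(2)[symmetric] h(2)[symmetric] image_image using ph by auto
  qed
  ultimately show ?thesis using that ph unfolding alg_iso_def by blast
qed

section \<open>Linear extensions, bases and monoid algebras\<close>

abbreviation scale :: "int poly \<Rightarrow> ('a \<Rightarrow>\<^sub>0 int poly) \<Rightarrow> ('a \<Rightarrow>\<^sub>0 int poly)" where
  "scale c f \<equiv> Poly_Mapping.map ((*) c) f"

lemma lookup_scale [simp]: "Poly_Mapping.lookup (scale c f) x = c * Poly_Mapping.lookup f x"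
  by (simp add: Poly_Mapping.map.rep_eq when_def)

lemma scale_add: "scale c (f + g) = scale c f + scale c g"
  by (rule poly_mapping_eqI) (simp add: lookup_add algebra_simps)

lemma scale_left_add: "scale (c + d) f = scale c f + scale d f"
  by (rule poly_mapping_eqI) (simp add: lookup_add algebra_simps)

lemma scale_scale: "scale c (scale d f) = scale (c * d) f"
  by (rule poly_mapping_eqI) (simp add: mult.assoc)

lemma scale_1 [simp]: "scale 1 f = f"
  by (rule poly_mapping_eqI) simp

lemma scale_0 [simp]: "scale 0 f = 0" "scale c 0 = 0"
  by (rule poly_mapping_eqI; simp)+

lemma map_id_poly_mapping [simp]: "Poly_Mapping.map (\<lambda>a. a) f = (f :: 'a \<Rightarrow>\<^sub>0 int poly)"
  by (rule poly_mapping_eqI) (simp add: Poly_Mapping.map.rep_eq when_def)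

lemma scale_single [simp]: "scale c (Poly_Mapping.single x d) = Poly_Mapping.single x (c * d)"
  by (rule poly_mapping_eqI) (simp add: lookup_single when_def)

lemma scale_sum: "scale c (sum F I) = (\<Sum>i\<in>I. scale c (F i))"
  by (induction I rule: infinite_finite_induct) (simp_all add: scale_add)

text \<open>\<open>R\<close> is a coordinate map sending the elements of \<open>B\<close> to
  different unit vectors; the coefficients of \<open>x\<close> are those of \<open>R x\<close>,
  relabelled along the inverse of \<open>g\<close>.\<close>

lemma basis_transfer:
  fixes A :: "'a zd_algebra" and R :: "'a \<Rightarrow> ('b \<Rightarrow>\<^sub>0 int poly)"
  assumes A: "zd_alg A"
    and add: "\<And>x y. x \<in> carrier A \<Longrightarrow> y \<in> carrier A \<Longrightarrow> R (x \<oplus>\<^bsub>A\<^esub> y) = R x + R y"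
    and smult: "\<And>c x. x \<in> carrier A \<Longrightarrow> R (c \<odot>\<^bsub>A\<^esub> x) = scale c (R x)"
    and inj: "inj_on R (carrier A)"
    and B: "B \<subseteq> carrier A" "\<And>b. b \<in> B \<Longrightarrow> R b = Poly_Mapping.single (g b) 1" "inj_on g B"
    and keys: "\<And>x. x \<in> carrier A \<Longrightarrow> Poly_Mapping.keys (R x) \<subseteq> g ` B"
  shows "is_basis A B"
proof -
  interpret ring A by (rule zd_algD(1)[OF A])
  have R0: "R \<zero>\<^bsub>A\<^esub> = 0" using add[of "\<zero>\<^bsub>A\<^esub>" "\<zero>\<^bsub>A\<^esub>"] by simp
  have fs: "R (\<Oplus>\<^bsub>A\<^esub>b\<in>S. F b) = (\<Sum>b\<in>S. R (F b))" if "finite S" "F \<in> S \<rightarrow> carrier A" for S F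
    using that
  proof (induction S rule: finite_induct)
    case empty thus ?case by (simp add: R0)
  next
    case (insert b S)
    hence "F b \<in> carrier A" "F \<in> S \<rightarrow> carrier A" by auto
    thus ?case using insert by (simp add: finsum_insert add finsum_closed)
  qed
  let ?sum = "\<lambda>c. \<Oplus>\<^bsub>A\<^esub>b\<in>Poly_Mapping.keys c. Poly_Mapping.lookup c b \<odot>\<^bsub>A\<^esub> b"
  have cl: "(\<lambda>b. Poly_Mapping.lookup c b \<odot>\<^bsub>A\<^esub> b) \<in> Poly_Mapping.keys c \<rightarrow> carrier A" if "Poly_Mapping.keys c \<subseteq> B" for c :: "'a \<Rightarrow>\<^sub>0 int poly"
    using that B(1) zd_algD(2)[OF A] by blast
  have Rsum: "R (?sum c) = (\<Sum>b\<in>Poly_Mapping.keys c. Poly_Mapping.single (g b) (Poly_Mapping.lookup c b))"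
    if c: "Poly_Mapping.keys c \<subseteq> B" for c :: "'a \<Rightarrow>\<^sub>0 int poly"
  proof -
    have "R (?sum c) = (\<Sum>b\<in>Poly_Mapping.keys c. R (Poly_Mapping.lookup c b \<odot>\<^bsub>A\<^esub> b))" by (rule fs[OF finite_keys cl[OF c]])
    also have "\<dots> = (\<Sum>b\<in>Poly_Mapping.keys c. Poly_Mapping.single (g b) (Poly_Mapping.lookup c b))"
    proof (rule sum.cong[OF HOL.refl])
      fix b assume "b \<in> Poly_Mapping.keys c"
      hence "b \<in> B" using c by blast
      thus "R (Poly_Mapping.lookup c b \<odot>\<^bsub>A\<^esub> b) = Poly_Mapping.single (g b) (Poly_Mapping.lookup c b)"
        using smult[of b] B by auto
    qed
    finally show ?thesis .
  qed
  have look: "Poly_Mapping.lookup (R (?sum c)) (g b) = Poly_Mapping.lookup c b" if c: "Poly_Mapping.keys c \<subseteq> B" and b: "b \<in> B" for c b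
  proof -
    have "Poly_Mapping.lookup (R (?sum c)) (g b) = (\<Sum>b'\<in>Poly_Mapping.keys c. if b' = b then Poly_Mapping.lookup c b' else 0)"
      unfolding Rsum[OF c] lookup_sum lookup_single
    proof (rule sum.cong[OF HOL.refl])
      fix b' assume "b' \<in> Poly_Mapping.keys c"
      hence "b' \<in> B" using c by blast
      hence "g b' = g b \<longleftrightarrow> b' = b" using b inj_onD[OF B(3)] by metis
      thus "(Poly_Mapping.lookup c b' when g b' = g b) = (if b' = b then Poly_Mapping.lookup c b' else 0)"
        by (simp add: when_def)
    qed
    also have "\<dots> = Poly_Mapping.lookup c b" by (auto simp: not_in_keys_iff_lookup_eq_zero)
    finally show ?thesis .
  qed
  show ?thesis unfolding is_basis_def
  proof (intro conjI ballI B(1))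
    fix x assume x: "x \<in> carrier A"
    define \<beta> where "\<beta> = the_inv_into B g"
    have \<beta>: "\<beta> d \<in> B" "g (\<beta> d) = d" if "d \<in> Poly_Mapping.keys (R x)" for d
      using keys[OF x] that the_inv_into_into[OF B(3)] f_the_inv_into_f[OF B(3)] unfolding \<beta>_def by blast+
    define c where "c = (\<Sum>d\<in>Poly_Mapping.keys (R x). Poly_Mapping.single (\<beta> d) (Poly_Mapping.lookup (R x) d))"
    have kc: "Poly_Mapping.keys c \<subseteq> B"
    proof
      fix b assume "b \<in> Poly_Mapping.keys c"
      moreover have "Poly_Mapping.keys c \<subseteq>
          (\<Union>d\<in>Poly_Mapping.keys (R x). Poly_Mapping.keys (Poly_Mapping.single (\<beta> d) (Poly_Mapping.lookup (R x) d)))"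
        unfolding c_def by (rule keys_sum)
      ultimately obtain d where d: "d \<in> Poly_Mapping.keys (R x)"
        "b \<in> Poly_Mapping.keys (Poly_Mapping.single (\<beta> d) (Poly_Mapping.lookup (R x) d))" by blast
      hence "b = \<beta> d" by (simp split: if_splits)
      thus "b \<in> B" using \<beta>(1)[OF d(1)] by simp
    qed
    have lc: "Poly_Mapping.lookup c b = Poly_Mapping.lookup (R x) (g b)" if b: "b \<in> B" for b
    proof -
      have "Poly_Mapping.lookup c b = (\<Sum>d\<in>Poly_Mapping.keys (R x). if d = g b then Poly_Mapping.lookup (R x) d else 0)"
        unfolding c_def lookup_sum lookup_single
      proof (rule sum.cong[OF HOL.refl])
        fix d assume d: "d \<in> Poly_Mapping.keys (R x)"
        have "\<beta> d = b \<longleftrightarrow> d = g b" using \<beta>[OF d] b inj_onD[OF B(3)] by metis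
        thus "(Poly_Mapping.lookup (R x) d when \<beta> d = b) = (if d = g b then Poly_Mapping.lookup (R x) d else 0)"
          by (simp add: when_def)
      qed
      also have "\<dots> = Poly_Mapping.lookup (R x) (g b)" by (auto simp: not_in_keys_iff_lookup_eq_zero)
      finally show ?thesis .
    qed
    have sc: "?sum c \<in> carrier A" by (rule finsum_closed[OF cl[OF kc]])
    have "R (?sum c) = R x"
    proof (rule poly_mapping_eqI)
      fix d
      show "Poly_Mapping.lookup (R (?sum c)) d = Poly_Mapping.lookup (R x) d"
      proof (cases "d \<in> g ` B")
        case True
        thus ?thesis using look[OF kc] lc by auto
      next
        case False
        hence "d \<notin> Poly_Mapping.keys (R x)" "d \<notin> Poly_Mapping.keys (R (?sum c))" using keys x sc by blast+
        thus ?thesis by (simp add: not_in_keys_iff_lookup_eq_zero)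
      qed
    qed
    hence eq: "x = ?sum c" using inj_onD[OF inj] x sc by metis
    show "\<exists>!c. Poly_Mapping.keys c \<subseteq> B \<and> x = ?sum c"
    proof (rule ex1I[of _ c])
      show "Poly_Mapping.keys c \<subseteq> B \<and> x = ?sum c" using kc eq by blast
      fix c' assume c': "Poly_Mapping.keys c' \<subseteq> B \<and> x = ?sum c'"
      show "c' = c"
      proof (rule poly_mapping_eqI)
        fix b
        show "Poly_Mapping.lookup c' b = Poly_Mapping.lookup c b"
        proof (cases "b \<in> B")
          case True
          thus ?thesis using look[of c' b] look[OF kc True] c' eq by metis
        next
          case False
          hence "b \<notin> Poly_Mapping.keys c'" "b \<notin> Poly_Mapping.keys c" using c' kc by blast+
          thus ?thesis by (simp add: not_in_keys_iff_lookup_eq_zero)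
        qed
      qed
    qed
  qed
qed

text \<open>The linear extension of \<open>F\<close>. A product in a monoid algebra is two nested
  instances of it (\<open>monoid_algebra_simps\<close>), so the ring laws reduce to
  \<open>lin_lin\<close> and the laws of the monoid.\<close>

definition lin :: "('a \<Rightarrow> ('b \<Rightarrow>\<^sub>0 int poly)) \<Rightarrow> ('a \<Rightarrow>\<^sub>0 int poly) \<Rightarrow> ('b \<Rightarrow>\<^sub>0 int poly)" where
  "lin F f = (\<Sum>x\<in>Poly_Mapping.keys f. scale (Poly_Mapping.lookup f x) (F x))"

lemma lin_superset:
  assumes "finite A" "Poly_Mapping.keys f \<subseteq> A"
  shows "lin F f = (\<Sum>x\<in>A. scale (Poly_Mapping.lookup f x) (F x))"
  unfolding lin_def using assms
  by (intro sum.mono_neutral_left) (auto simp: not_in_keys_iff_lookup_eq_zero)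

lemma lin_add: "lin F (f + g) = lin F f + lin F g"
proof -
  let ?A = "Poly_Mapping.keys f \<union> Poly_Mapping.keys g"
  have "lin F h = (\<Sum>x\<in>?A. scale (Poly_Mapping.lookup h x) (F x))" if "Poly_Mapping.keys h \<subseteq> ?A" for h
    by (rule lin_superset) (use that in simp_all)
  thus ?thesis using keys_add[of f g] by (simp add: lookup_add scale_left_add sum.distrib)
qed

lemma lin_0 [simp]: "lin F 0 = 0"
  by (simp add: lin_def)

lemma lin_single [simp]: "lin F (Poly_Mapping.single x c) = scale c (F x)"
  by (cases "c = 0") (simp_all add: lin_def)

lemma lin_minus: "lin F (f - g) = lin F f - lin F g"
  using lin_add[of F "f - g" g] by (simp add: algebra_simps)

lemma lin_scale: "lin F (scale c f) = scale c (lin F f)"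
proof -
  have "lin F (scale c f) = (\<Sum>x\<in>Poly_Mapping.keys f. scale (Poly_Mapping.lookup (scale c f) x) (F x))"
    by (rule lin_superset) (auto simp: in_keys_iff)
  thus ?thesis by (simp add: lin_def scale_sum scale_scale)
qed

lemma lin_sum: "lin F (sum f I) = (\<Sum>i\<in>I. lin F (f i))"
  by (induction I rule: infinite_finite_induct) (simp_all add: lin_add)

lemma lin_lin: "lin F (lin G f) = lin (\<lambda>x. lin F (G x)) f"
proof -
  have "lin F (lin G f) = (\<Sum>x\<in>Poly_Mapping.keys f. lin F (scale (Poly_Mapping.lookup f x) (G x)))"
    unfolding lin_def[of G] by (rule lin_sum)
  thus ?thesis by (simp add: lin_scale lin_def[of "\<lambda>x. lin F (G x)"])
qed

lemma lin_cong: "(\<And>x. x \<in> Poly_Mapping.keys f \<Longrightarrow> F x = G x) \<Longrightarrow> lin F f = lin G f"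
  unfolding lin_def by (rule sum.cong) simp_all

lemma lin_add_fun: "lin (\<lambda>x. F x + G x) f = lin F f + lin G f"
  by (simp add: lin_def scale_add sum.distrib)

lemma lin_scale_fun: "lin (\<lambda>x. scale c (F x)) f = scale c (lin F f)"
  by (simp add: lin_def scale_sum scale_scale mult.commute)

lemma lin_id: "lin (\<lambda>x. Poly_Mapping.single x 1) f = f"
proof (rule poly_mapping_eqI)
  fix x
  show "Poly_Mapping.lookup (lin (\<lambda>x. Poly_Mapping.single x 1) f) x = Poly_Mapping.lookup f x"
  proof -
    have "Poly_Mapping.lookup (lin (\<lambda>x. Poly_Mapping.single x 1) f) x =
        (\<Sum>y\<in>Poly_Mapping.keys f. if y = x then Poly_Mapping.lookup f y else 0)"
      unfolding lin_def lookup_sum by (rule sum.cong) (simp_all add: lookup_single when_def)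
    also have "\<dots> = Poly_Mapping.lookup f x"
      by (simp add: not_in_keys_iff_lookup_eq_zero)
    finally show ?thesis .
  qed
qed

lemma keys_lin: "Poly_Mapping.keys (lin F f) \<subseteq> (\<Union>x\<in>Poly_Mapping.keys f. Poly_Mapping.keys (F x))"
proof -
  have "Poly_Mapping.keys (lin F f) \<subseteq> (\<Union>x\<in>Poly_Mapping.keys f. Poly_Mapping.keys (scale (Poly_Mapping.lookup f x) (F x)))"
    unfolding lin_def by (rule keys_sum)
  also have "\<dots> \<subseteq> (\<Union>x\<in>Poly_Mapping.keys f. Poly_Mapping.keys (F x))"
    by (intro UN_mono subset_refl subsetI) (simp add: in_keys_iff)
  finally show ?thesis .
qed

lemma in_keys_lin: "z \<in> Poly_Mapping.keys (lin F f) \<Longrightarrow> \<exists>x\<in>Poly_Mapping.keys f. z \<in> Poly_Mapping.keys (F x)"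
  using subsetD[OF keys_lin, of z F f] by (simp only: UN_iff)

lemma poly_mapping_induct_single [consumes 1, case_names zero single add]:
  assumes "Poly_Mapping.keys f \<subseteq> X" "P 0" "\<And>x c. x \<in> X \<Longrightarrow> P (Poly_Mapping.single x c)"
    "\<And>f g. Poly_Mapping.keys f \<subseteq> X \<Longrightarrow> Poly_Mapping.keys g \<subseteq> X \<Longrightarrow> P f \<Longrightarrow> P g \<Longrightarrow> P (f + g)"
  shows "P (f :: 'a \<Rightarrow>\<^sub>0 int poly)"
proof -
  have "P (\<Sum>x\<in>A. Poly_Mapping.single x (Poly_Mapping.lookup f x)) \<and>
      Poly_Mapping.keys (\<Sum>x\<in>A. Poly_Mapping.single x (Poly_Mapping.lookup f x)) \<subseteq> X" if "finite A" "A \<subseteq> X" for A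
    using that
  proof (induction A rule: finite_induct)
    case empty
    thus ?case using assms(2) by simp
  next
    case (insert x A)
    have 1: "Poly_Mapping.keys (Poly_Mapping.single x (Poly_Mapping.lookup f x)) \<subseteq> X"
      using insert.prems by (auto split: if_splits)
    have 2: "P (Poly_Mapping.single x (Poly_Mapping.lookup f x))" using assms(3) insert.prems by blast
    show ?case using insert assms(4)[OF 1 _ 2] 1
        keys_add[of "Poly_Mapping.single x (Poly_Mapping.lookup f x)" "\<Sum>x\<in>A. Poly_Mapping.single x (Poly_Mapping.lookup f x)"] by auto
  qed
  moreover have "(\<Sum>x\<in>Poly_Mapping.keys f. Poly_Mapping.single x (Poly_Mapping.lookup f x)) = f"
    using lin_id[of f] by (simp add: lin_def)
  ultimately show ?thesis using assms(1) finite_keys by metis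
qed

lemma monoid_algebra_simps:
  "carrier (monoid_algebra M) = {f. Poly_Mapping.keys f \<subseteq> carrier M}"
  "mult (monoid_algebra M) f g = lin (\<lambda>x. lin (\<lambda>y. Poly_Mapping.single (x \<otimes>\<^bsub>M\<^esub> y) 1) g) f"
  "one (monoid_algebra M) = Poly_Mapping.single \<one>\<^bsub>M\<^esub> 1"
  "zero (monoid_algebra M) = 0" "add (monoid_algebra M) = (+)"
  "smult (monoid_algebra M) c f = scale c f"
  by (simp_all add: monoid_algebra_def lin_def scale_sum)

lemma monoid_algebra_zd_alg:
  assumes "monoid M"
  shows "zd_alg (monoid_algebra M)"
proof -
  interpret monoid M by fact
  note s = monoid_algebra_simps[of M]
  have add_keys: "Poly_Mapping.keys (f + g) \<subseteq> carrier M"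
    if "Poly_Mapping.keys f \<subseteq> carrier M" "Poly_Mapping.keys g \<subseteq> carrier M" for f g :: "'a \<Rightarrow>\<^sub>0 int poly"
    using keys_add[of f g] that by blast
  have closed: "Poly_Mapping.keys (lin (\<lambda>x. lin (\<lambda>y. Poly_Mapping.single (x \<otimes>\<^bsub>M\<^esub> y) 1) g) f) \<subseteq> carrier M"
    if "Poly_Mapping.keys f \<subseteq> carrier M" "Poly_Mapping.keys g \<subseteq> carrier M" for f g :: "'a \<Rightarrow>\<^sub>0 int poly"
  proof
    fix z assume "z \<in> Poly_Mapping.keys (lin (\<lambda>x. lin (\<lambda>y. Poly_Mapping.single (x \<otimes>\<^bsub>M\<^esub> y) (1 :: int poly)) g) f)"
    from in_keys_lin[OF this] obtain x where x: "x \<in> Poly_Mapping.keys f"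
      "z \<in> Poly_Mapping.keys (lin (\<lambda>y. Poly_Mapping.single (x \<otimes>\<^bsub>M\<^esub> y) (1 :: int poly)) g)" by (rule bexE)
    from in_keys_lin[OF x(2)] obtain y where "y \<in> Poly_Mapping.keys g"
      "z \<in> Poly_Mapping.keys (Poly_Mapping.single (x \<otimes>\<^bsub>M\<^esub> y) (1 :: int poly))" by (rule bexE)
    thus "z \<in> carrier M" using x that by (simp add: subset_iff)
  qed
  have ring: "ring (monoid_algebra M)"
  proof (rule ringI)
    show "abelian_group (monoid_algebra M)"
    proof (rule abelian_groupI, unfold s mem_Collect_eq)
      show "\<exists>y\<in>{f. Poly_Mapping.keys f \<subseteq> carrier M}. y + x = 0" if "Poly_Mapping.keys x \<subseteq> carrier M" for x :: "'a \<Rightarrow>\<^sub>0 int poly"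
        by (rule bexI[of _ "- x"]) (use that in simp_all)
    qed (use add_keys in \<open>simp_all add: add_ac\<close>)
    show "Group.monoid (monoid_algebra M)"
    proof (rule monoidI, unfold s mem_Collect_eq)
      show "Poly_Mapping.keys (Poly_Mapping.single \<one>\<^bsub>M\<^esub> (1 :: int poly)) \<subseteq> carrier M" by simp
      show "lin (\<lambda>x. lin (\<lambda>y. Poly_Mapping.single (x \<otimes>\<^bsub>M\<^esub> y) 1) h) (lin (\<lambda>x. lin (\<lambda>y. Poly_Mapping.single (x \<otimes>\<^bsub>M\<^esub> y) 1) g) f)
         = lin (\<lambda>x. lin (\<lambda>y. Poly_Mapping.single (x \<otimes>\<^bsub>M\<^esub> y) 1) (lin (\<lambda>x. lin (\<lambda>y. Poly_Mapping.single (x \<otimes>\<^bsub>M\<^esub> y) 1) h) g)) f"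
        if "Poly_Mapping.keys f \<subseteq> carrier M" "Poly_Mapping.keys g \<subseteq> carrier M" "Poly_Mapping.keys h \<subseteq> carrier M" for f g h :: "'a \<Rightarrow>\<^sub>0 int poly"
        unfolding lin_lin lin_single scale_1
        by (intro lin_cong) (use that m_assoc in \<open>auto simp: subset_iff\<close>)
      show "lin (\<lambda>x. lin (\<lambda>y. Poly_Mapping.single (x \<otimes>\<^bsub>M\<^esub> y) 1) f) (Poly_Mapping.single \<one>\<^bsub>M\<^esub> 1) = f"
        if "Poly_Mapping.keys f \<subseteq> carrier M" for f :: "'a \<Rightarrow>\<^sub>0 int poly"
      proof -
        have "lin (\<lambda>y. Poly_Mapping.single (\<one>\<^bsub>M\<^esub> \<otimes>\<^bsub>M\<^esub> y) 1) f = lin (\<lambda>y. Poly_Mapping.single y 1) f"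
          by (rule lin_cong) (use that in auto)
        thus ?thesis by (simp add: lin_id)
      qed
      show "lin (\<lambda>x. lin (\<lambda>y. Poly_Mapping.single (x \<otimes>\<^bsub>M\<^esub> y) 1) (Poly_Mapping.single \<one>\<^bsub>M\<^esub> 1)) f = f"
        if "Poly_Mapping.keys f \<subseteq> carrier M" for f :: "'a \<Rightarrow>\<^sub>0 int poly"
      proof -
        have "lin (\<lambda>x. lin (\<lambda>y. Poly_Mapping.single (x \<otimes>\<^bsub>M\<^esub> y) 1) (Poly_Mapping.single \<one>\<^bsub>M\<^esub> 1)) f = lin (\<lambda>y. Poly_Mapping.single y 1) f"
          by (rule lin_cong) (use that in auto)
        thus ?thesis by (simp add: lin_id)
      qed
    qed (use closed in blast)
  qed (unfold s, simp_all add: lin_add lin_add_fun)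
  show ?thesis unfolding zd_alg_def
  proof (intro conjI allI ballI ring)
    fix c d :: "int poly" and x assume x: "x \<in> carrier (monoid_algebra M)"
    show "c \<odot>\<^bsub>monoid_algebra M\<^esub> x \<in> carrier (monoid_algebra M)" using x unfolding s by (auto simp: in_keys_iff)
    show "(c * d) \<odot>\<^bsub>monoid_algebra M\<^esub> x = c \<odot>\<^bsub>monoid_algebra M\<^esub> (d \<odot>\<^bsub>monoid_algebra M\<^esub> x)" unfolding s by (simp add: scale_scale)
    show "1 \<odot>\<^bsub>monoid_algebra M\<^esub> x = x" unfolding s by simp
    fix y
    show "c \<odot>\<^bsub>monoid_algebra M\<^esub> (x \<oplus>\<^bsub>monoid_algebra M\<^esub> y) = (c \<odot>\<^bsub>monoid_algebra M\<^esub> x) \<oplus>\<^bsub>monoid_algebra M\<^esub> (c \<odot>\<^bsub>monoid_algebra M\<^esub> y)"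
      unfolding s by (rule scale_add)
    show "c \<odot>\<^bsub>monoid_algebra M\<^esub> (x \<otimes>\<^bsub>monoid_algebra M\<^esub> y) = (c \<odot>\<^bsub>monoid_algebra M\<^esub> x) \<otimes>\<^bsub>monoid_algebra M\<^esub> y"
      unfolding s by (simp add: lin_scale)
    show "c \<odot>\<^bsub>monoid_algebra M\<^esub> (x \<otimes>\<^bsub>monoid_algebra M\<^esub> y) = x \<otimes>\<^bsub>monoid_algebra M\<^esub> (c \<odot>\<^bsub>monoid_algebra M\<^esub> y)"
      unfolding s by (simp add: lin_scale lin_scale_fun)
  qed
qed

lemma monoid_algebra_minus:
  assumes "monoid M" "x \<in> carrier (monoid_algebra M)" "y \<in> carrier (monoid_algebra M)"
  shows "x \<ominus>\<^bsub>monoid_algebra M\<^esub> y = x - y"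
proof -
  interpret ring "monoid_algebra M" by (rule zd_algD(1)[OF monoid_algebra_zd_alg[OF assms(1)]])
  have "- y \<in> carrier (monoid_algebra M)" using assms(3) by (simp add: monoid_algebra_simps)
  hence "\<ominus>\<^bsub>monoid_algebra M\<^esub> y = - y"
    using minus_equality[of "- y" y] assms(3) by (simp add: monoid_algebra_simps)
  thus ?thesis by (simp add: a_minus_def monoid_algebra_simps)
qed

lemma monoid_algebra_hom:
  assumes "\<And>x. x \<in> carrier M \<Longrightarrow> \<phi> x \<in> carrier M'" "\<phi> \<one>\<^bsub>M\<^esub> = \<one>\<^bsub>M'\<^esub>"
    "\<And>x y. x \<in> carrier M \<Longrightarrow> y \<in> carrier M \<Longrightarrow> \<phi> (x \<otimes>\<^bsub>M\<^esub> y) = \<phi> x \<otimes>\<^bsub>M'\<^esub> \<phi> y"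
  shows "lin (\<lambda>x. Poly_Mapping.single (\<phi> x) 1) \<in> alg_hom (monoid_algebra M) (monoid_algebra M')"
proof (rule alg_homI, unfold monoid_algebra_simps mem_Collect_eq)
  fix f g :: "'a \<Rightarrow>\<^sub>0 int poly" and c
  assume f: "Poly_Mapping.keys f \<subseteq> carrier M"
  show "Poly_Mapping.keys (lin (\<lambda>x. Poly_Mapping.single (\<phi> x) 1) f) \<subseteq> carrier M'"
    using keys_lin[of "\<lambda>x. Poly_Mapping.single (\<phi> x) 1" f] f assms(1) by fastforce
  show "lin (\<lambda>x. Poly_Mapping.single (\<phi> x) 1) (scale c f) = scale c (lin (\<lambda>x. Poly_Mapping.single (\<phi> x) 1) f)"
    by (rule lin_scale)
  assume g: "Poly_Mapping.keys g \<subseteq> carrier M"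
  show "lin (\<lambda>x. Poly_Mapping.single (\<phi> x) 1) (f + g) = lin (\<lambda>x. Poly_Mapping.single (\<phi> x) 1) f + lin (\<lambda>x. Poly_Mapping.single (\<phi> x) 1) g"
    by (rule lin_add)
  show "lin (\<lambda>x. Poly_Mapping.single (\<phi> x) 1) (lin (\<lambda>x. lin (\<lambda>y. Poly_Mapping.single (x \<otimes>\<^bsub>M\<^esub> y) 1) g) f) =
    lin (\<lambda>x. lin (\<lambda>y. Poly_Mapping.single (x \<otimes>\<^bsub>M'\<^esub> y) 1) (lin (\<lambda>x. Poly_Mapping.single (\<phi> x) 1) g)) (lin (\<lambda>x. Poly_Mapping.single (\<phi> x) 1) f)"
    unfolding lin_lin lin_single scale_1
    by (intro lin_cong) (use f g assms(3) in \<open>auto simp: subset_iff\<close>)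
qed (simp add: assms(2))

section \<open>Values and stacking\<close>

lemma diagram_value_add_zero_loops:
  "diagram_value (add_loops (replicate_mset k 0) d) = scale (delta ^ k) (diagram_value d)"
proof (induction k)
  case 0
  have "add_loops {#} d = d" by (simp add: add_loops_def)
  thus ?case by (simp only: replicate_mset_0 power_0 scale_1)
next
  case (Suc k)
  have "add_loops (replicate_mset (Suc k) 0) d = add_loops {#0#} (add_loops (replicate_mset k 0) d)"
    by (simp add: add_loops_def)
  thus ?case using Suc by (simp only: diagram_value_add_loop scale_scale power_Suc)
qed

lemma same_parity_reduce:
  assumes "even_loops d"
  shows "same_parity d (add_loops (replicate_mset (size (loops d)) 0) (reduce d))"
proof -
  have "image_mset (\<lambda>k. k mod 2) (loops d) = image_mset (\<lambda>k. 0) (loops d)"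
    by (rule image_mset_cong) (use assms in \<open>auto simp: even_loops_def\<close>)
  thus ?thesis
    by (simp add: same_parity_def add_loops_def reduce_def image_mset_const_eq)
qed

lemma odd_loops_stack:
  "\<not> even_loops a \<or> \<not> even_loops b \<Longrightarrow> \<not> even_loops (stack n a b)"
  unfolding even_loops_def loops_stack by auto

text \<open>A value sees a factor of a stack only through its own value: undecorated loops and pairs
  of decorations may be removed before or after stacking, and an odd loop survives it. This makes
  the kernel of the value a two-sided ideal.\<close>

lemma value_stack_left:
  "lin (\<lambda>x. diagram_value (stack n a x)) (diagram_value d) = diagram_value (stack n a d)"
proof (cases "even_loops d")
  case True
  have "diagram_value (stack n a d) = diagram_value (stack n a (add_loops (replicate_mset (size (loops d)) 0) (reduce d)))"
    by (intro diagram_value_same_parity same_parity_stack same_parity_refl same_parity_reduce True)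
  thus ?thesis using True unfolding stack_add_loops_right diagram_value_add_zero_loops
    by (simp add: diagram_value_def[of d])
next
  case False
  thus ?thesis using odd_loops_stack[of a d] by (simp add: diagram_value_def)
qed

lemma value_stack_right:
  "lin (\<lambda>x. diagram_value (stack n x b)) (diagram_value d) = diagram_value (stack n d b)"
proof (cases "even_loops d")
  case True
  have "diagram_value (stack n d b) = diagram_value (stack n (add_loops (replicate_mset (size (loops d)) 0) (reduce d)) b)"
    by (intro diagram_value_same_parity same_parity_stack same_parity_refl same_parity_reduce True)
  thus ?thesis using True unfolding stack_add_loops_left diagram_value_add_zero_loops
    by (simp add: diagram_value_def[of d])
next
  case False
  thus ?thesis using odd_loops_stack[of d b] by (simp add: diagram_value_def)
qed

section \<open>The diagram algebra and its relations\<close>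

definition value_kernel :: "nat \<Rightarrow> (diagram \<Rightarrow>\<^sub>0 int poly) set" where
  "value_kernel n = {f \<in> carrier (PL n). lin diagram_value f = 0}"

lemma PL_zd_alg: "1 \<le> n \<Longrightarrow> zd_alg (PL n)"
  unfolding PL_def by (rule monoid_algebra_zd_alg[OF monoid_diagrams])

lemma PL_simps:
  "carrier (PL n) = {f. Poly_Mapping.keys f \<subseteq> diagrams n}"
  "mult (PL n) f g = lin (\<lambda>x. lin (\<lambda>y. Poly_Mapping.single (stack n x y) 1) g) f"
  "one (PL n) = Poly_Mapping.single (id_diagram n) 1"
  "zero (PL n) = 0" "add (PL n) = (+)" "smult (PL n) c f = scale c f"
  unfolding PL_def by (simp_all add: monoid_algebra_simps)

lemma PL_minus:
  "1 \<le> n \<Longrightarrow> x \<in> carrier (PL n) \<Longrightarrow> y \<in> carrier (PL n) \<Longrightarrow> x \<ominus>\<^bsub>PL n\<^esub> y = x - y"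
  unfolding PL_def by (rule monoid_algebra_minus[OF monoid_diagrams])

lemma ideal_value_kernel:
  assumes n: "1 \<le> n"
  shows "ideal (value_kernel n) (PL n)"
proof -
  interpret ring "PL n" by (rule zd_algD(1)[OF PL_zd_alg[OF n]])
  show ?thesis
  proof (rule idealI_zd[OF ring_axioms])
    show "value_kernel n \<subseteq> carrier (PL n)" by (auto simp: value_kernel_def)
    show "\<zero>\<^bsub>PL n\<^esub> \<in> value_kernel n" by (simp add: value_kernel_def PL_simps)
    fix f assume f: "f \<in> value_kernel n"
    hence fc: "f \<in> carrier (PL n)" and f0: "lin diagram_value f = 0" by (auto simp: value_kernel_def)
    show "f \<oplus>\<^bsub>PL n\<^esub> g \<in> value_kernel n" if "g \<in> value_kernel n" for g
      using a_closed[of f g] f that by (simp add: value_kernel_def PL_simps(5) lin_add)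
    fix a assume a: "a \<in> carrier (PL n)"
    have "lin diagram_value (a \<otimes>\<^bsub>PL n\<^esub> f) = lin (\<lambda>x. lin (\<lambda>y. diagram_value (stack n x y)) f) a"
      unfolding PL_simps by (simp add: lin_lin)
    also have "\<dots> = lin (\<lambda>x. lin (\<lambda>z. diagram_value (stack n x z)) (lin diagram_value f)) a"
      unfolding lin_lin value_stack_left ..
    also have "\<dots> = 0" unfolding f0 by (simp add: lin_def)
    finally show "a \<otimes>\<^bsub>PL n\<^esub> f \<in> value_kernel n" using m_closed[OF a fc] by (simp add: value_kernel_def)
    have "lin diagram_value (f \<otimes>\<^bsub>PL n\<^esub> a) = lin (\<lambda>x. lin (\<lambda>y. diagram_value (stack n x y)) a) f"
      unfolding PL_simps by (simp add: lin_lin)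
    also have "\<dots> = lin (\<lambda>z. lin (\<lambda>y. diagram_value (stack n z y)) a) (lin diagram_value f)"
      unfolding lin_lin[of _ diagram_value]
    proof (rule lin_cong)
      fix x
      show "lin (\<lambda>y. diagram_value (stack n x y)) a = lin (\<lambda>z. lin (\<lambda>y. diagram_value (stack n z y)) a) (diagram_value x)"
      proof -
        \<comment> \<open>The two linear extensions are exchanged so that
          \<open>value_stack_right\<close> applies to the inner one.\<close>
        have "lin (\<lambda>z. lin (\<lambda>y. diagram_value (stack n z y)) a) (diagram_value x)
            = lin (\<lambda>y. lin (\<lambda>z. diagram_value (stack n z y)) (diagram_value x)) a"
          unfolding lin_def scale_sum scale_scale by (subst sum.swap) (simp add: mult.commute)
        thus ?thesis by (simp only: value_stack_right)
      qed
    qed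
    also have "\<dots> = 0" unfolding f0 by simp
    finally show "f \<otimes>\<^bsub>PL n\<^esub> a \<in> value_kernel n" using m_closed[OF fc a] by (simp add: value_kernel_def)
  qed
qed

lemma local_rel_same_edges: "local_rel d c d' \<Longrightarrow> edges d' = edges d"
  by (induction rule: local_rel.induct) simp_all

lemma local_rel_dec_le: "local_rel d c d' \<Longrightarrow> dec d' e \<le> dec d e"
  by (induction rule: local_rel.induct) simp_all

lemma local_rel_loops_zero: "local_rel d c d' \<Longrightarrow> \<forall>k\<in>#loops d. k = 0 \<Longrightarrow> \<forall>k\<in>#loops d'. k = 0"
  by (induction rule: local_rel.induct) auto

text \<open>The local relations keep the edges and never increase a decoration, so decorated edges
  remain exposed to the wall.\<close>

lemma local_rel_diagrams:
  assumes r: "local_rel d c d'" and d: "d \<in> diagrams n"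
  shows "d' \<in> diagrams n"
proof -
  note E = local_rel_same_edges[OF r] and D = local_rel_dec_le[OF r]
  have D0: "dec d' e = 0" if "dec d e = 0" for e using D[of e] that by simp
  have Dpos: "dec d e > 0" if "dec d' e > 0" for e using D[of e] that by simp
  have dp: "dplus n d" using d diagrams_dplus by blast
  have "dplus n d'"
    unfolding dplus_def matching_diagram_def E
    using dplusD(2-4)[OF dp] matching_diagramD(2)[OF dplusD(1)[OF dp]] D0 Dpos by simp
  moreover have "(\<forall>e\<in>edges d'. dec d' e = 0) \<and> (\<forall>k\<in>#loops d'. k = 0)" if "num_caps d' = 0"
  proof -
    have "num_caps d = 0" using that by (simp add: num_caps_def E)
    hence "(\<forall>e\<in>edges d. dec d e = 0) \<and> (\<forall>k\<in>#loops d. k = 0)" using d unfolding diagrams_iff by blast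
    thus ?thesis unfolding E using local_rel_loops_zero[OF r] D0 by blast
  qed
  ultimately show ?thesis unfolding diagrams_iff by blast
qed

text \<open>Loop removal and cancellation are built into the value. For the two absorbing relations
  both sides contain a loop with one decoration and have value 0.\<close>

lemma local_rel_value:
  assumes r: "local_rel d c d'"
  shows "diagram_value d = scale c (diagram_value d')"
  using r
proof cases
  case (undecorated_loop L)
  have "d = add_loops {#0#} d'" using undecorated_loop by (simp add: add_loops_def)
  thus ?thesis using undecorated_loop(1) diagram_value_add_loop by simp
next
  case (cancel_edge e k)
  hence "same_parity d d'" by (simp add: same_parity_def)
  thus ?thesis using cancel_edge(1) diagram_value_same_parity by simp
next
  case (cancel_loop k L)
  hence "same_parity d d'" by (simp add: same_parity_def)
  thus ?thesis using cancel_loop(1) diagram_value_same_parity by simp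
next
  case (absorb_edge e k)
  hence "1 \<in># loops d" "1 \<in># loops d'" by simp_all
  hence "\<not> even_loops d" "\<not> even_loops d'" unfolding even_loops_def by force+
  thus ?thesis by (simp add: diagram_value_def)
next
  case (absorb_loop k L)
  hence "1 \<in># loops d" "1 \<in># loops d'" by simp_all
  hence "\<not> even_loops d" "\<not> even_loops d'" unfolding even_loops_def by force+
  thus ?thesis by (simp add: diagram_value_def)
qed

lemma single_in_PL: "d \<in> diagrams n \<Longrightarrow> Poly_Mapping.single d c \<in> carrier (PL n)"
  by (simp add: PL_simps)

lemma P_relators_carrier: "1 \<le> n \<Longrightarrow> P_relators n \<subseteq> carrier (PL n)"
proof
  fix r assume n: "1 \<le> n" and "r \<in> P_relators n"
  then obtain d c d' where r: "r = Poly_Mapping.single d 1 - Poly_Mapping.single d' c" "d \<in> diagrams n" "local_rel d c d'"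
    by (auto simp: P_relators_def)
  note s = single_in_PL[OF r(2), of 1] single_in_PL[OF local_rel_diagrams[OF r(3,2)], of c]
  interpret ring "PL n" by (rule zd_algD(1)[OF PL_zd_alg[OF n]])
  show "r \<in> carrier (PL n)" unfolding r(1) PL_minus[OF n s, symmetric] using s by simp
qed

lemma P_relators_value_kernel:
  assumes n: "1 \<le> n"
  shows "P_relators n \<subseteq> value_kernel n"
proof
  fix r assume rP: "r \<in> P_relators n"
  then obtain d c d' where r: "r = Poly_Mapping.single d 1 - Poly_Mapping.single d' c" "local_rel d c d'"
    by (auto simp: P_relators_def)
  have "lin diagram_value r = 0" unfolding r(1) lin_minus using local_rel_value[OF r(2)] by simp
  thus "r \<in> value_kernel n" using rP P_relators_carrier[OF n] by (auto simp: value_kernel_def)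
qed

lemma P_hat_quotient:
  assumes n: "1 \<le> n"
  shows "zd_alg (P_hat n)" "quotient_map (PL n) (P_relators n) \<in> alg_hom (PL n) (P_hat n)"
    "quotient_map (PL n) (P_relators n) ` carrier (PL n) = carrier (P_hat n)"
    "x \<in> carrier (PL n) \<Longrightarrow> quotient_map (PL n) (P_relators n) x = \<zero>\<^bsub>P_hat n\<^esub> \<longleftrightarrow> x \<in> Idl\<^bsub>PL n\<^esub> (P_relators n)"
  unfolding P_hat_def using quotient_algebra[OF PL_zd_alg[OF n] P_relators_carrier[OF n]] by blast+

lemma diag_class_local_rel:
  assumes n: "1 \<le> n" and d: "d \<in> diagrams n" and r: "local_rel d c d'"
  shows "diag_class n d = c \<odot>\<^bsub>P_hat n\<^esub> diag_class n d'"
proof -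
  let ?q = "quotient_map (PL n) (P_relators n)"
  note q = P_hat_quotient[OF n]
  interpret A: ring "PL n" by (rule zd_algD(1)[OF PL_zd_alg[OF n]])
  interpret B: ring "P_hat n" by (rule zd_algD(1)[OF q(1)])
  note s = single_in_PL[OF d, of 1] single_in_PL[OF local_rel_diagrams[OF r d], of c]
  have "Poly_Mapping.single d 1 - Poly_Mapping.single d' c \<in> P_relators n" using d r by (auto simp: P_relators_def)
  hence "Poly_Mapping.single d 1 \<ominus>\<^bsub>PL n\<^esub> Poly_Mapping.single d' c \<in> Idl\<^bsub>PL n\<^esub> (P_relators n)"
    unfolding PL_minus[OF n s] using A.genideal_self[OF P_relators_carrier[OF n]] by blast
  hence "?q (Poly_Mapping.single d 1 \<ominus>\<^bsub>PL n\<^esub> Poly_Mapping.single d' c) = \<zero>\<^bsub>P_hat n\<^esub>"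
    using q(4)[OF A.minus_closed[OF s]] by blast
  hence "?q (Poly_Mapping.single d 1) = ?q (Poly_Mapping.single d' c)"
    using alg_hom_minus[OF q(2) A.ring_axioms B.ring_axioms s] eq_iff_minus_zero[OF B.ring_axioms] alg_homD(2)[OF q(2)] s by metis
  also have "Poly_Mapping.single d' c = c \<odot>\<^bsub>PL n\<^esub> Poly_Mapping.single d' 1" by (simp add: PL_simps)
  also have "?q \<dots> = c \<odot>\<^bsub>P_hat n\<^esub> ?q (Poly_Mapping.single d' 1)"
    by (rule alg_homD(6)[OF q(2) single_in_PL[OF local_rel_diagrams[OF r d]]])
  finally show ?thesis unfolding diag_class_def .
qed

lemma diag_class_carrier: "1 \<le> n \<Longrightarrow> d \<in> diagrams n \<Longrightarrow> diag_class n d \<in> carrier (P_hat n)"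
  unfolding diag_class_def using alg_homD(2)[OF P_hat_quotient(2)] single_in_PL by blast

lemma reduce_in_diagrams:
  assumes d: "d \<in> diagrams n"
  shows "reduce d \<in> diagrams n"
proof -
  have dp: "dplus n d" using d diagrams_dplus by blast
  have "dplus n (reduce d)" unfolding dplus_def matching_diagram_def reduce_def
    using dplusD(2-4)[OF dp] matching_diagramD(2)[OF dplusD(1)[OF dp]] by (auto simp: mod_2_eq_odd dest: odd_pos)
  moreover have "num_caps (reduce d) = num_caps d" by (simp add: num_caps_def reduce_def)
  ultimately show ?thesis using d unfolding diagrams_iff by (auto simp: reduce_def)
qed

text \<open>Each relation used lowers the number of loops plus the number of all decorations; when
  there are no loops and no edge has two decorations, \<open>d\<close> is its own reduction.\<close>

lemma diag_class_reduce:
  assumes n: "1 \<le> n"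
  shows "d \<in> diagrams n \<Longrightarrow> even_loops d \<Longrightarrow>
    diag_class n d = (delta ^ size (loops d)) \<odot>\<^bsub>P_hat n\<^esub> diag_class n (reduce d)"
proof (induction "size (loops d) + sum_mset (loops d) + (\<Sum>e\<in>edges d. dec d e)" arbitrary: d rule: less_induct)
  case less
  note d = less(2) and ev = less(3)
  note m = dplusD(1)[OF diagrams_dplus[OF d]]
  note zq = P_hat_quotient(1)[OF n]
  have IH: "diag_class n d = (c * delta ^ size (loops d')) \<odot>\<^bsub>P_hat n\<^esub> diag_class n (reduce d)"
    if r: "local_rel d c d'" and lt: "size (loops d') + sum_mset (loops d') + (\<Sum>e\<in>edges d'. dec d' e) < size (loops d) + sum_mset (loops d) + (\<Sum>e\<in>edges d. dec d e)"
      and e: "even_loops d'" and red: "reduce d' = reduce d" for c d'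
  proof -
    have "diag_class n d' = (delta ^ size (loops d')) \<odot>\<^bsub>P_hat n\<^esub> diag_class n (reduce d)"
      using less(1)[OF lt local_rel_diagrams[OF r d] e] red by simp
    thus ?thesis using diag_class_local_rel[OF n d r]
      zd_algD(6)[OF zq diag_class_carrier[OF n reduce_in_diagrams[OF d]]] by simp
  qed
  show ?case
  proof (cases "loops d = {#}")
    case False
    then obtain k L where kL: "loops d = add_mset k L" by (meson multiset_cases)
    have ek: "even k" "\<forall>j\<in>#L. even j" using ev unfolding even_loops_def kL by auto
    show ?thesis
    proof (cases "k = 0")
      case True
      hence r: "local_rel d delta (d\<lparr>loops := L\<rparr>)" using local_rel.undecorated_loop[of d L] kL by simp
      show ?thesis using IH[OF r] ek kL by (simp add: even_loops_def reduce_def)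
    next
      case False
      then obtain j where j: "k = j + 2" using ek(1) by (metis add_2_eq_Suc' even_Suc not0_implies_Suc odd_Suc_minus_one even_zero)
      hence r: "local_rel d 1 (d\<lparr>loops := add_mset j L\<rparr>)" using local_rel.cancel_loop[of d j L] kL by simp
      show ?thesis using IH[OF r] ek kL j by (simp add: even_loops_def reduce_def)
    qed
  next
    case True
    show ?thesis
    proof (cases "\<exists>e\<in>edges d. 2 \<le> dec d e")
      case True
      then obtain e where e: "e \<in> edges d" "2 \<le> dec d e" by blast
      define k where "k = dec d e - 2"
      have k: "dec d e = k + 2" using e(2) by (simp add: k_def)
      have r: "local_rel d 1 (d\<lparr>dec := (dec d)(e := k)\<rparr>)" using local_rel.cancel_edge[OF e(1) k] .
      have fin: "finite (edges d)" using finite_matching[OF matching_diagramD(1)[OF m]] .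
      have "(\<Sum>f\<in>edges d. ((dec d)(e := k)) f) < (\<Sum>f\<in>edges d. dec d f)"
        by (rule sum_strict_mono_ex1[OF fin]) (use e k in auto)
      moreover have "reduce (d\<lparr>dec := (dec d)(e := k)\<rparr>) = reduce d" using k by (auto simp: reduce_def fun_eq_iff)
      ultimately show ?thesis using IH[OF r] ev by (simp add: even_loops_def)
    next
      case False
      have "dec d e mod 2 = dec d e" for e
      proof (cases "e \<in> edges d")
        case True
        hence "dec d e < 2" using False by (meson not_less)
        thus ?thesis by simp
      next
        case False
        thus ?thesis using matching_diagramD(2)[OF m False] by simp
      qed
      hence "reduce d = d" using True by (simp add: reduce_def)
      thus ?thesis using True zd_algD(7)[OF zq diag_class_carrier[OF n d]] by simp
    qed
  qed
qed

text \<open>Cancelling pairs brings an odd loop down to exactly one decoration, the form in which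
  \<open>decorated_loop_classes\<close> lists its generators.\<close>

lemma diag_class_odd:
  assumes n: "1 \<le> n" and d: "d \<in> diagrams n" and odd: "\<not> even_loops d"
  obtains d' where "d' \<in> diagrams n" "1 \<in># loops d'" "diag_class n d = diag_class n d'"
proof -
  have *: "\<exists>d'\<in>diagrams n. 1 \<in># loops d' \<and> diag_class n d = diag_class n d'"
    if "d \<in> diagrams n" "odd k" "k \<in># loops d" for d k
    using that
  proof (induction k arbitrary: d rule: less_induct)
    case (less k)
    show ?case
    proof (cases "k = 1")
      case True
      thus ?thesis using less by blast
    next
      case False
      then obtain j where j: "k = j + 2" "odd j" using less(3) by (metis One_nat_def add_2_eq_Suc' even_Suc oddE not0_implies_Suc even_zero)
      obtain L where L: "loops d = add_mset k L" using less(4) by (meson multi_member_split)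
      have r: "local_rel d 1 (d\<lparr>loops := add_mset j L\<rparr>)" using local_rel.cancel_loop[of d j L] L j by simp
      have d': "d\<lparr>loops := add_mset j L\<rparr> \<in> diagrams n" by (rule local_rel_diagrams[OF r less(2)])
      have "diag_class n d = diag_class n (d\<lparr>loops := add_mset j L\<rparr>)"
        using diag_class_local_rel[OF n less(2) r] zd_algD(7)[OF P_hat_quotient(1)[OF n] diag_class_carrier[OF n d']] by simp
      thus ?thesis using less(1)[OF _ d' j(2)] j by simp
    qed
  qed
  obtain k where "k \<in># loops d" "odd k" using odd unfolding even_loops_def by blast
  thus ?thesis using *[OF d] that by blast
qed

text \<open>A nonzero value is a single term, so it determines the reduced diagram and the
  coefficient, and by \<open>diag_class_reduce\<close> these determine the class.\<close>

lemma diag_class_of_value: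
  assumes n: "1 \<le> n" and d: "d \<in> diagrams n" "d' \<in> diagrams n"
    and v: "diagram_value d = scale c (diagram_value d')" and ev: "even_loops d'" and c: "c \<noteq> 0"
  shows "diag_class n d = c \<odot>\<^bsub>P_hat n\<^esub> diag_class n d'"
proof -
  have nz: "c * delta ^ size (loops d') \<noteq> 0" using c by simp
  have v': "scale c (diagram_value d') = Poly_Mapping.single (reduce d') (c * delta ^ size (loops d'))"
    using ev by (simp add: diagram_value_def)
  have ed: "even_loops d"
  proof (rule ccontr)
    assume "\<not> even_loops d"
    hence "Poly_Mapping.single (reduce d') (c * delta ^ size (loops d')) = 0" using v v' by (simp add: diagram_value_def)
    thus False using nz by (metis lookup_single_eq lookup_zero)
  qed
  have s: "Poly_Mapping.single (reduce d) (delta ^ size (loops d)) = Poly_Mapping.single (reduce d') (c * delta ^ size (loops d'))"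
    using v v' ed by (simp add: diagram_value_def)
  have red: "reduce d = reduce d'"
  proof (rule ccontr)
    assume "reduce d \<noteq> reduce d'"
    hence "Poly_Mapping.lookup (Poly_Mapping.single (reduce d) (delta ^ size (loops d))) (reduce d') = 0" by (simp add: lookup_single_not_eq)
    thus False using nz unfolding s by simp
  qed
  have "delta ^ size (loops d) = c * delta ^ size (loops d')"
    using s unfolding red by (metis lookup_single_eq)
  thus ?thesis
    using diag_class_reduce[OF n d(1) ed] diag_class_reduce[OF n d(2) ev] red
      zd_algD(6)[OF P_hat_quotient(1)[OF n] diag_class_carrier[OF n reduce_in_diagrams[OF d(2)]]] by simp
qed

section \<open>The Temperley--Lieb quotient\<close>

lemma free_monoid: "monoid (free_monoid n)"
  by (rule monoidI) (auto simp: free_monoid_def)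

lemma free_algebra_zd_alg: "zd_alg (free_algebra n)"
  by (rule monoid_algebra_zd_alg[OF free_monoid])

lemma free_algebra_simps:
  "carrier (free_algebra n) = {f. Poly_Mapping.keys f \<subseteq> lists (gens n)}"
  "mult (free_algebra n) f g = lin (\<lambda>x. lin (\<lambda>y. Poly_Mapping.single (x @ y) 1) g) f"
  "one (free_algebra n) = Poly_Mapping.single [] 1"
  "zero (free_algebra n) = 0" "add (free_algebra n) = (+)" "smult (free_algebra n) c f = scale c f"
  by (simp_all add: monoid_algebra_simps free_monoid_def)

lemma free_algebra_minus:
  "x \<in> carrier (free_algebra n) \<Longrightarrow> y \<in> carrier (free_algebra n) \<Longrightarrow> x \<ominus>\<^bsub>free_algebra n\<^esub> y = x - y"
  by (rule monoid_algebra_minus[OF free_monoid])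

lemma single_in_free_algebra: "w \<in> lists (gens n) \<Longrightarrow> Poly_Mapping.single w c \<in> carrier (free_algebra n)"
  by (simp add: free_algebra_simps)

lemma minus_in_free_algebra:
  assumes "x \<in> carrier (free_algebra n)" "y \<in> carrier (free_algebra n)"
  shows "x - y \<in> carrier (free_algebra n)"
proof -
  interpret ring "free_algebra n" by (rule zd_algD(1)[OF free_algebra_zd_alg])
  show ?thesis using minus_closed[OF assms] unfolding free_algebra_minus[OF assms] .
qed

definition to_PL :: "nat \<Rightarrow> (gen list \<Rightarrow>\<^sub>0 int poly) \<Rightarrow> (diagram \<Rightarrow>\<^sub>0 int poly)" where
  "to_PL n = lin (\<lambda>w. Poly_Mapping.single (word_diagram n w) 1)"

definition word_value :: "nat \<Rightarrow> (gen list \<Rightarrow>\<^sub>0 int poly) \<Rightarrow> (diagram \<Rightarrow>\<^sub>0 int poly)" where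
  "word_value n = lin (\<lambda>w. diagram_value (word_diagram n w))"

lemma to_PL_hom: "2 \<le> n \<Longrightarrow> to_PL n \<in> alg_hom (free_algebra n) (PL n)"
  unfolding to_PL_def PL_def
  by (rule monoid_algebra_hom)
    (simp_all add: free_monoid_def word_diagram_in_diagrams word_diagram_append)

lemma word_value_eq: "word_value n f = lin diagram_value (to_PL n f)"
  unfolding word_value_def to_PL_def lin_lin by simp

lemma word_value_single: "word_value n (Poly_Mapping.single w c) = scale c (diagram_value (word_diagram n w))"
  by (simp add: word_value_def)

text \<open>This set is the preimage of the ideal \<open>value_kernel n\<close> under the
  homomorphism \<open>to_PL n\<close>.\<close>

lemma ideal_word_value_kernel:
  assumes n: "2 \<le> n"
  shows "ideal {f \<in> carrier (free_algebra n). word_value n f = 0} (free_algebra n)"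
proof -
  have n1: "1 \<le> n" using n by simp
  note h = alg_homD[OF to_PL_hom[OF n]]
  interpret F: ring "free_algebra n" by (rule zd_algD(1)[OF free_algebra_zd_alg])
  interpret N: ideal "value_kernel n" "PL n" by (rule ideal_value_kernel[OF n1])
  define K where "K = {f \<in> carrier (free_algebra n). word_value n f = 0}"
  have Kc: "f \<in> carrier (free_algebra n)" and KN: "to_PL n f \<in> value_kernel n" if "f \<in> K" for f
  proof -
    have f: "f \<in> carrier (free_algebra n)" "word_value n f = 0" using that unfolding K_def by blast+
    show "f \<in> carrier (free_algebra n)" by (rule f(1))
    show "to_PL n f \<in> value_kernel n"
      using h(2)[OF f(1)] f(2) unfolding word_value_eq value_kernel_def by blast
  qed
  have KI: "f \<in> K" if "f \<in> carrier (free_algebra n)" "to_PL n f \<in> value_kernel n" for f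
    using that unfolding K_def word_value_eq value_kernel_def by blast
  have "ideal K (free_algebra n)"
  proof (rule idealI_zd[OF F.ring_axioms])
    show "K \<subseteq> carrier (free_algebra n)" using Kc by (rule subsetI)
    show "\<zero>\<^bsub>free_algebra n\<^esub> \<in> K" using F.zero_closed unfolding K_def free_algebra_simps(4) word_value_def mem_Collect_eq lin_0 by (intro conjI HOL.refl)
    fix f assume f: "f \<in> K"
    note fc = Kc[OF f] KN[OF f]
    show "f \<oplus>\<^bsub>free_algebra n\<^esub> g \<in> K" if g: "g \<in> K" for g
      by (rule KI[OF F.a_closed[OF fc(1) Kc[OF g]]], unfold h(3)[OF fc(1) Kc[OF g]]) (rule additive_subgroup.a_closed[OF N.is_additive_subgroup fc(2) KN[OF g]])
    fix a assume a: "a \<in> carrier (free_algebra n)"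
    show "a \<otimes>\<^bsub>free_algebra n\<^esub> f \<in> K"
      by (rule KI[OF F.m_closed[OF a fc(1)]], unfold h(4)[OF a fc(1)]) (rule N.I_l_closed[OF fc(2) h(2)[OF a]])
    show "f \<otimes>\<^bsub>free_algebra n\<^esub> a \<in> K"
      by (rule KI[OF F.m_closed[OF fc(1) a]], unfold h(4)[OF fc(1) a]) (rule N.I_r_closed[OF fc(2) h(2)[OF a]])
  qed
  thus ?thesis unfolding K_def .
qed

lemma TL_relatorsI:
  "s \<in> gens n \<Longrightarrow> monom_word 1 [s, s] - monom_word delta [s] \<in> TL_relators n"
  "s \<in> gens n \<Longrightarrow> t \<in> gens n \<Longrightarrow> s \<noteq> t \<Longrightarrow> \<not> connected_gens s t \<Longrightarrow>
    monom_word 1 [s, t] - monom_word 1 [t, s] \<in> TL_relators n"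
  "s \<in> gens n \<Longrightarrow> t \<in> gens n \<Longrightarrow> connected_gens s t \<Longrightarrow>
    monom_word 1 [s, t, s] - monom_word 1 [s] \<in> TL_relators n"
  unfolding TL_relators_def Un_iff mem_Collect_eq by metis+

lemma TL_relators_cases:
  assumes "r \<in> TL_relators n"
  obtains (square) s where "s \<in> gens n" "r = monom_word 1 [s, s] - monom_word delta [s]"
  | (commute) s t where "s \<in> gens n" "t \<in> gens n" "s \<noteq> t" "\<not> connected_gens s t" "r = monom_word 1 [s, t] - monom_word 1 [t, s]"
  | (braid) s t where "s \<in> gens n" "t \<in> gens n" "connected_gens s t" "r = monom_word 1 [s, t, s] - monom_word 1 [s]"
  using assms unfolding TL_relators_def by auto

lemma TL_relators_carrier: "TL_relators n \<subseteq> carrier (free_algebra n)"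
proof
  fix r assume "r \<in> TL_relators n"
  thus "r \<in> carrier (free_algebra n)"
    by (cases rule: TL_relators_cases) (auto intro!: minus_in_free_algebra single_in_free_algebra)
qed

lemma TL_relators_value:
  assumes n: "2 \<le> n" and r: "r \<in> TL_relators n"
  shows "word_value n r = 0"
  using r
proof (cases rule: TL_relators_cases)
  case (square s)
  thus ?thesis using value_square[OF n square(1)] unfolding word_value_def by (simp only: lin_minus lin_single scale_1) simp
next
  case (commute s t)
  thus ?thesis using value_commute[OF n commute(1-4)] unfolding word_value_def by (simp only: lin_minus lin_single scale_1) simp
next
  case (braid s t)
  thus ?thesis using value_braid[OF n braid(1-3)] unfolding word_value_def by (simp only: lin_minus lin_single scale_1) simp
qed

lemma TL_quotient:
  "zd_alg (TL n)" "quotient_map (free_algebra n) (TL_relators n) \<in> alg_hom (free_algebra n) (TL n)"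
  "quotient_map (free_algebra n) (TL_relators n) ` carrier (free_algebra n) = carrier (TL n)"
  "x \<in> carrier (free_algebra n) \<Longrightarrow> quotient_map (free_algebra n) (TL_relators n) x = \<zero>\<^bsub>TL n\<^esub> \<longleftrightarrow> x \<in> Idl\<^bsub>free_algebra n\<^esub> (TL_relators n)"
  unfolding TL_def using quotient_algebra[OF free_algebra_zd_alg TL_relators_carrier] by blast+

lemma mult_single_free_algebra:
  "Poly_Mapping.single u 1 \<otimes>\<^bsub>free_algebra n\<^esub> Poly_Mapping.single v 1 = Poly_Mapping.single (u @ v) 1"
  unfolding free_algebra_simps by simp

lemma Gen1_Bar1_in_gens: "2 \<le> n \<Longrightarrow> [Gen 1, Bar1] \<in> lists (gens n)"
  by (auto simp: gens_def)

lemma b_gen_mult: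
  assumes "s \<in> gens n" "t \<in> gens n"
  shows "b_gen n s \<otimes>\<^bsub>TL n\<^esub> b_gen n t = quotient_map (free_algebra n) (TL_relators n) (monom_word 1 [s, t])"
proof -
  have "monom_word 1 [s] \<in> carrier (free_algebra n)" "monom_word 1 [t] \<in> carrier (free_algebra n)"
    using assms by (auto intro!: single_in_free_algebra)
  thus ?thesis unfolding b_gen_def using alg_homD(4)[OF TL_quotient(2), of "monom_word 1 [s]" n "monom_word 1 [t]"] mult_single_free_algebra[of n "[s]" "[t]"] by simp
qed

definition TL_hat_map :: "nat \<Rightarrow> (gen list \<Rightarrow>\<^sub>0 int poly) \<Rightarrow> (gen list \<Rightarrow>\<^sub>0 int poly) set set" where
  "TL_hat_map n f = TL_proj n (quotient_map (free_algebra n) (TL_relators n) f)"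

lemma TL_hat_quotient:
  assumes n: "2 \<le> n"
  shows "zd_alg (TL_hat n)" "TL_proj n \<in> alg_hom (TL n) (TL_hat n)" "TL_proj n ` carrier (TL n) = carrier (TL_hat n)"
    "x \<in> carrier (TL n) \<Longrightarrow> TL_proj n x = \<zero>\<^bsub>TL_hat n\<^esub> \<longleftrightarrow> x \<in> Idl\<^bsub>TL n\<^esub> {b_gen n (Gen 1) \<otimes>\<^bsub>TL n\<^esub> b_gen n Bar1}"
proof -
  have g: "Gen 1 \<in> gens n" "Bar1 \<in> gens n" using n by (auto simp: gens_def)
  have "{b_gen n (Gen 1) \<otimes>\<^bsub>TL n\<^esub> b_gen n Bar1} \<subseteq> carrier (TL n)"
    unfolding b_gen_mult[OF g] using alg_homD(2)[OF TL_quotient(2)] single_in_free_algebra[OF Gen1_Bar1_in_gens[OF n]] by blast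
  note q = quotient_algebra[OF TL_quotient(1) this]
  show "zd_alg (TL_hat n)" "TL_proj n \<in> alg_hom (TL n) (TL_hat n)" "TL_proj n ` carrier (TL n) = carrier (TL_hat n)"
    "x \<in> carrier (TL n) \<Longrightarrow> TL_proj n x = \<zero>\<^bsub>TL_hat n\<^esub> \<longleftrightarrow> x \<in> Idl\<^bsub>TL n\<^esub> {b_gen n (Gen 1) \<otimes>\<^bsub>TL n\<^esub> b_gen n Bar1}"
    unfolding TL_hat_def TL_proj_def using q by blast+
qed

lemma TL_hat_map_hom:
  assumes n: "2 \<le> n"
  shows "TL_hat_map n \<in> alg_hom (free_algebra n) (TL_hat n)"
  using alg_hom_comp[OF TL_quotient(2) TL_hat_quotient(2)[OF n]] unfolding TL_hat_map_def[abs_def] .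

lemma TL_hat_map_surj:
  assumes n: "2 \<le> n"
  shows "TL_hat_map n ` carrier (free_algebra n) = carrier (TL_hat n)"
  unfolding TL_hat_map_def[abs_def] TL_hat_quotient(3)[OF n, symmetric] TL_quotient(3)[symmetric] image_image ..

text \<open>The universal property of the double quotient, in the form of a bound on the kernel. It
  is applied to the kernel of the value and to the kernel of the map onto the diagram
  quotient.\<close>

lemma TL_hat_map_zero_in_ideal:
  assumes n: "2 \<le> n" and K: "ideal K (free_algebra n)" "TL_relators n \<subseteq> K" "monom_word 1 [Gen 1, Bar1] \<in> K"
    and f: "f \<in> carrier (free_algebra n)" "TL_hat_map n f = \<zero>\<^bsub>TL_hat n\<^esub>"
  shows "f \<in> K"
proof (rule quotient_of_quotient_kernel[OF free_algebra_zd_alg TL_relators_carrier K(1,2) _ f(1)])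
  have g: "Gen 1 \<in> gens n" "Bar1 \<in> gens n" using n by (auto simp: gens_def)
  let ?T = "{b_gen n (Gen 1) \<otimes>\<^bsub>TL n\<^esub> b_gen n Bar1}"
  show "?T \<subseteq> quotient_map (free_algebra n) (TL_relators n) ` K"
    unfolding b_gen_mult[OF g] using K(3) by blast
  show "quotient_map (quotient_algebra (free_algebra n) (TL_relators n)) ?T (quotient_map (free_algebra n) (TL_relators n) f)
    = \<zero>\<^bsub>quotient_algebra (quotient_algebra (free_algebra n) (TL_relators n)) ?T\<^esub>"
    using f(2) unfolding TL_hat_map_def TL_proj_def TL_hat_def TL_def .
qed

lemma TL_hat_map_relator:
  assumes n: "2 \<le> n" and r: "r \<in> TL_relators n"
  shows "TL_hat_map n r = \<zero>\<^bsub>TL_hat n\<^esub>"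
proof -
  interpret F: ring "free_algebra n" by (rule zd_algD(1)[OF free_algebra_zd_alg])
  have "quotient_map (free_algebra n) (TL_relators n) r = \<zero>\<^bsub>TL n\<^esub>"
    using TL_quotient(4) r TL_relators_carrier F.genideal_self[OF TL_relators_carrier] by blast
  thus ?thesis unfolding TL_hat_map_def
    using alg_hom_zero[OF TL_hat_quotient(2)[OF n] zd_algD(1)[OF TL_quotient(1)] zd_algD(1)[OF TL_hat_quotient(1)[OF n]]] by simp
qed

lemma TL_hat_map_Gen1_Bar1:
  assumes n: "2 \<le> n"
  shows "TL_hat_map n (monom_word 1 [Gen 1, Bar1]) = \<zero>\<^bsub>TL_hat n\<^esub>"
proof -
  have g: "Gen 1 \<in> gens n" "Bar1 \<in> gens n" using n by (auto simp: gens_def)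
  interpret T: ring "TL n" by (rule zd_algD(1)[OF TL_quotient(1)])
  have c: "quotient_map (free_algebra n) (TL_relators n) (monom_word 1 [Gen 1, Bar1]) \<in> carrier (TL n)"
    using alg_homD(2)[OF TL_quotient(2)] single_in_free_algebra[OF Gen1_Bar1_in_gens[OF n]] by blast
  show ?thesis unfolding TL_hat_map_def
    using TL_hat_quotient(4)[OF n c] T.genideal_self'[OF c] unfolding b_gen_mult[OF g] by blast
qed

abbreviation b_word :: "nat \<Rightarrow> gen list \<Rightarrow> (gen list \<Rightarrow>\<^sub>0 int poly) set set" where
  "b_word n w \<equiv> TL_hat_map n (monom_word 1 w)"

lemma b_word_carrier: "2 \<le> n \<Longrightarrow> w \<in> lists (gens n) \<Longrightarrow> b_word n w \<in> carrier (TL_hat n)"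
  using alg_homD(2)[OF TL_hat_map_hom] single_in_free_algebra by blast

lemma b_word_append:
  assumes "2 \<le> n" "u \<in> lists (gens n)" "v \<in> lists (gens n)"
  shows "b_word n (u @ v) = b_word n u \<otimes>\<^bsub>TL_hat n\<^esub> b_word n v"
  using alg_homD(4)[OF TL_hat_map_hom[OF assms(1)] single_in_free_algebra[OF assms(2), of 1] single_in_free_algebra[OF assms(3), of 1]]
  unfolding mult_single_free_algebra .

lemma b_word_relator:
  assumes n: "2 \<le> n" and r: "monom_word 1 u - monom_word c v \<in> TL_relators n"
    and uv: "u \<in> lists (gens n)" "v \<in> lists (gens n)"
  shows "b_word n u = c \<odot>\<^bsub>TL_hat n\<^esub> b_word n v"
proof -
  note h = TL_hat_map_hom[OF n]
  interpret A: ring "free_algebra n" by (rule zd_algD(1)[OF free_algebra_zd_alg])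
  interpret B: ring "TL_hat n" by (rule zd_algD(1)[OF TL_hat_quotient(1)[OF n]])
  note s = single_in_free_algebra[OF uv(1), of 1] single_in_free_algebra[OF uv(2), of c]
  have "TL_hat_map n (monom_word 1 u) = TL_hat_map n (monom_word c v)"
    using TL_hat_map_relator[OF n r] alg_hom_minus[OF h A.ring_axioms B.ring_axioms s] eq_iff_minus_zero[OF B.ring_axioms]
      alg_homD(2)[OF h] s unfolding free_algebra_minus[OF s] by metis
  also have "monom_word c v = c \<odot>\<^bsub>free_algebra n\<^esub> monom_word 1 v" by (simp add: free_algebra_simps)
  also have "TL_hat_map n \<dots> = c \<odot>\<^bsub>TL_hat n\<^esub> b_word n v"
    by (rule alg_homD(6)[OF h single_in_free_algebra[OF uv(2)]])
  finally show ?thesis .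
qed

lemma b_word_context:
  assumes n: "2 \<le> n" and w: "u \<in> lists (gens n)" "v \<in> lists (gens n)" "x \<in> lists (gens n)" "y \<in> lists (gens n)"
    and eq: "b_word n x = c \<odot>\<^bsub>TL_hat n\<^esub> b_word n y"
  shows "b_word n (u @ x @ v) = c \<odot>\<^bsub>TL_hat n\<^esub> b_word n (u @ y @ v)"
proof -
  interpret B: ring "TL_hat n" by (rule zd_algD(1)[OF TL_hat_quotient(1)[OF n]])
  note z = zd_algD[OF TL_hat_quotient(1)[OF n]]
  note c = b_word_carrier[OF n w(1)] b_word_carrier[OF n w(2)] b_word_carrier[OF n w(3)] b_word_carrier[OF n w(4)]
  have xv: "x @ v \<in> lists (gens n)" "y @ v \<in> lists (gens n)" using w by auto
  show ?thesis
    unfolding b_word_append[OF n w(1) xv(1)] b_word_append[OF n w(3,2)] b_word_append[OF n w(1) xv(2)] b_word_append[OF n w(4,2)] eq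
    using c z(4)[OF c(4) c(2), of c] z(5)[OF c(1) B.m_closed[OF c(4) c(2)], of c] by simp
qed

lemma b_word_context_zero:
  assumes n: "2 \<le> n" and w: "u \<in> lists (gens n)" "v \<in> lists (gens n)" "x \<in> lists (gens n)"
    and eq: "b_word n x = \<zero>\<^bsub>TL_hat n\<^esub>"
  shows "b_word n (u @ x @ v) = \<zero>\<^bsub>TL_hat n\<^esub>"
proof -
  interpret B: ring "TL_hat n" by (rule zd_algD(1)[OF TL_hat_quotient(1)[OF n]])
  have xv: "x @ v \<in> lists (gens n)" using w by auto
  show ?thesis
    unfolding b_word_append[OF n w(1) xv] b_word_append[OF n w(3,2)] eq
    using b_word_carrier[OF n w(1)] b_word_carrier[OF n w(2)] by simp
qed

lemma b_word_commutation:
  assumes n: "2 \<le> n" and xs: "xs \<in> lists (gens n)" and c: "commutation xs ys"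
  shows "b_word n xs = b_word n ys"
  using c
proof cases
  case (1 s t us vs)
  have g: "us \<in> lists (gens n)" "vs \<in> lists (gens n)" "[s, t] \<in> lists (gens n)" "[t, s] \<in> lists (gens n)" using xs 1(1) by auto
  have "monom_word 1 [s, t] - monom_word 1 [t, s] \<in> TL_relators n"
    using TL_relatorsI(2)[of s n t] g(3) 1(3,4) by simp
  from b_word_context[OF n g b_word_relator[OF n this g(3,4)]]
  have "b_word n xs = 1 \<odot>\<^bsub>TL_hat n\<^esub> b_word n ys" unfolding 1(1,2) .
  moreover have "ys \<in> lists (gens n)" using g unfolding 1(2) by auto
  ultimately show ?thesis using zd_algD(7)[OF TL_hat_quotient(1)[OF n]] b_word_carrier[OF n] by simp
qed

lemma commutations_lists: "commutation\<^sup>*\<^sup>* xs ys \<Longrightarrow> xs \<in> lists X \<Longrightarrow> ys \<in> lists X"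
  using commutations_set[of xs ys] by (simp add: lists_eq_set)

lemma b_word_commutations:
  assumes n: "2 \<le> n" and xs: "xs \<in> lists (gens n)" and c: "commutation\<^sup>*\<^sup>* xs ys"
  shows "b_word n xs = b_word n ys"
  using c
proof (induction rule: rtranclp_induct)
  case (step y z)
  thus ?case using b_word_commutation[OF n commutations_lists[OF step(1) xs] step(2)] by simp
qed simp

text \<open>The factors \<open>ss\<close> and \<open>sts\<close> are left sides of length-reducing
  relations; the pair of column 1 vanishes in the quotient, after one commutation if
  \<open>Bar1\<close> comes first.\<close>

lemma bad_factor_shortens:
  assumes n: "2 \<le> n" and ys: "ys \<in> lists (gens n)" and bad: "bad_factor ys"
  shows "b_word n ys = \<zero>\<^bsub>TL_hat n\<^esub> \<or>
    (\<exists>zs c. zs \<in> lists (gens n) \<and> length zs < length ys \<and> c \<in> {1, delta} \<and> b_word n ys = c \<odot>\<^bsub>TL_hat n\<^esub> b_word n zs)"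
proof -
  from bad obtain us vs where b: "(\<exists>s. ys = us @ [s, s] @ vs) \<or> (\<exists>s t. connected_gens s t \<and> ys = us @ [s, t, s] @ vs) \<or>
     ys = us @ [Gen 1, Bar1] @ vs \<or> ys = us @ [Bar1, Gen 1] @ vs" unfolding bad_factor_def by blast
  have g: "us \<in> lists (gens n)" "vs \<in> lists (gens n)" using b ys by auto
  have zero: "b_word n (us @ [Gen 1, Bar1] @ vs) = \<zero>\<^bsub>TL_hat n\<^esub>"
    by (rule b_word_context_zero[OF n g Gen1_Bar1_in_gens[OF n] TL_hat_map_Gen1_Bar1[OF n]])
  from b show ?thesis
  proof (elim disjE exE conjE)
    fix s assume y: "ys = us @ [s, s] @ vs"
    have s: "[s, s] \<in> lists (gens n)" "[s] \<in> lists (gens n)" using ys y by auto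
    have "monom_word 1 [s, s] - monom_word delta [s] \<in> TL_relators n" using TL_relatorsI(1)[of s n] s by simp
    from b_word_context[OF n g s b_word_relator[OF n this s]]
    have "b_word n ys = delta \<odot>\<^bsub>TL_hat n\<^esub> b_word n (us @ [s] @ vs)" unfolding y .
    moreover have "us @ [s] @ vs \<in> lists (gens n)" "length (us @ [s] @ vs) < length ys" using g s y by auto
    ultimately show ?thesis by (intro disjI2 exI[of _ "us @ [s] @ vs"] exI[of _ delta]) simp
  next
    fix s t assume st: "connected_gens s t" and y: "ys = us @ [s, t, s] @ vs"
    have s: "[s, t, s] \<in> lists (gens n)" "[s] \<in> lists (gens n)" "t \<in> gens n" using ys y by auto
    have "monom_word 1 [s, t, s] - monom_word 1 [s] \<in> TL_relators n" using TL_relatorsI(3)[of s n t] s st by simp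
    from b_word_context[OF n g s(1,2) b_word_relator[OF n this s(1,2)]]
    have "b_word n ys = 1 \<odot>\<^bsub>TL_hat n\<^esub> b_word n (us @ [s] @ vs)" unfolding y .
    moreover have "us @ [s] @ vs \<in> lists (gens n)" "length (us @ [s] @ vs) < length ys" using g s y by auto
    ultimately show ?thesis by (intro disjI2 exI[of _ "us @ [s] @ vs"] exI[of _ 1]) simp
  next
    assume "ys = us @ [Gen 1, Bar1] @ vs"
    thus ?thesis using zero by simp
  next
    assume y: "ys = us @ [Bar1, Gen 1] @ vs"
    have "commutation (us @ [Bar1, Gen 1] @ vs) (us @ [Gen 1, Bar1] @ vs)"
      by (rule commutation.intros) simp_all
    thus ?thesis using b_word_commutation[OF n ys] zero y by simp
  qed
qed

text \<open>That \<open>v\<close> is \<open>w\<close> itself or strictly shorter is recorded for the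
  comparison of lengths in the Coxeter group.\<close>

lemma b_word_reduces:
  assumes n: "2 \<le> n"
  shows "w \<in> lists (gens n) \<Longrightarrow> b_word n w = \<zero>\<^bsub>TL_hat n\<^esub> \<or>
    (\<exists>v k. good_word n v \<and> (v = w \<or> length v < length w) \<and> b_word n w = (delta ^ k) \<odot>\<^bsub>TL_hat n\<^esub> b_word n v)"
proof (induction "length w" arbitrary: w rule: less_induct)
  case less
  note z = zd_algD[OF TL_hat_quotient(1)[OF n]]
  show ?case
  proof (cases "good_word n w")
    case True
    have "b_word n w = (delta ^ 0) \<odot>\<^bsub>TL_hat n\<^esub> b_word n w" using z(7)[OF b_word_carrier[OF n less(2)]] by simp
    thus ?thesis using True by blast
  next
    case False
    then obtain ys where ys: "commutation\<^sup>*\<^sup>* w ys" "bad_factor ys" using less(2) unfolding good_word_def by blast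
    have yl: "ys \<in> lists (gens n)" by (rule commutations_lists[OF ys(1) less(2)])
    have eq: "b_word n w = b_word n ys" by (rule b_word_commutations[OF n less(2) ys(1)])
    have len: "length ys = length w" by (rule commutations_length[OF ys(1)])
    from bad_factor_shortens[OF n yl ys(2)] show ?thesis
    proof (elim disjE exE conjE)
      assume "b_word n ys = \<zero>\<^bsub>TL_hat n\<^esub>" thus ?thesis using eq by simp
    next
      fix zs c assume zs: "zs \<in> lists (gens n)" "length zs < length ys" and c: "c \<in> {1, delta}"
        and e: "b_word n ys = c \<odot>\<^bsub>TL_hat n\<^esub> b_word n zs"
      obtain j where j: "c = delta ^ j"
      proof (cases "c = 1")
        case True thus ?thesis using that[of 0] by simp
      next
        case False thus ?thesis using that[of 1] c by simp
      qed
      have "length zs < length w" using zs(2) len by simp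
      from less(1)[OF this zs(1)] consider (zero) "b_word n zs = \<zero>\<^bsub>TL_hat n\<^esub>"
        | (good) v k where "good_word n v" "v = zs \<or> length v < length zs" "b_word n zs = (delta ^ k) \<odot>\<^bsub>TL_hat n\<^esub> b_word n v"
        by blast
      thus ?thesis
      proof cases
        case zero
        thus ?thesis using e eq smult_zero[OF TL_hat_quotient(1)[OF n]] by simp
      next
        case (good v k)
        note v = good(1,3)
        have "length v < length w" using good(2) zs(2) len by auto
        moreover have "b_word n w = (delta ^ (j + k)) \<odot>\<^bsub>TL_hat n\<^esub> b_word n v"
          unfolding eq e v(2) j power_add using z(6)[OF b_word_carrier[OF n good_wordD(1)[OF v(1)]]] by simp
        ultimately show ?thesis using v(1) by blast
      qed
    qed
  qed
qed

section \<open>The value as a complete invariant of the Temperley--Lieb quotient\<close>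

lemma word_value_zero:
  assumes n: "2 \<le> n" and f: "f \<in> carrier (free_algebra n)" "TL_hat_map n f = \<zero>\<^bsub>TL_hat n\<^esub>"
  shows "word_value n f = 0"
proof -
  let ?K = "{f \<in> carrier (free_algebra n). word_value n f = 0}"
  have "diagram_value (word_diagram n [Gen 1, Bar1]) = 0" using odd_loop_Gen1_Bar1[OF n] unfolding diagram_value_def by simp
  hence "word_value n (monom_word 1 [Gen 1, Bar1]) = 0" unfolding word_value_single by simp
  hence 1: "monom_word 1 [Gen 1, Bar1] \<in> ?K" using single_in_free_algebra[OF Gen1_Bar1_in_gens[OF n]] by blast
  have 2: "TL_relators n \<subseteq> ?K" using TL_relators_carrier TL_relators_value[OF n] by blast
  show ?thesis using TL_hat_map_zero_in_ideal[OF n ideal_word_value_kernel[OF n] 2 1 f] by blast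
qed

lemma word_value_eq_of_map_eq:
  assumes n: "2 \<le> n" and f: "f \<in> carrier (free_algebra n)" "g \<in> carrier (free_algebra n)" "TL_hat_map n f = TL_hat_map n g"
  shows "word_value n f = word_value n g"
proof -
  note h = TL_hat_map_hom[OF n]
  interpret A: ring "free_algebra n" by (rule zd_algD(1)[OF free_algebra_zd_alg])
  interpret B: ring "TL_hat n" by (rule zd_algD(1)[OF TL_hat_quotient(1)[OF n]])
  have "TL_hat_map n (f - g) = \<zero>\<^bsub>TL_hat n\<^esub>"
    using alg_hom_minus[OF h A.ring_axioms B.ring_axioms f(1,2)] f(3) eq_iff_minus_zero[OF B.ring_axioms] alg_homD(2)[OF h] f
    unfolding free_algebra_minus[OF f(1,2)] by metis
  hence "word_value n (f - g) = 0" by (rule word_value_zero[OF n minus_in_free_algebra[OF f(1,2)]])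
  thus ?thesis unfolding word_value_def lin_minus by simp
qed

lemma good_word_value:
  assumes "2 \<le> n" "good_word n v"
  shows "diagram_value (word_diagram n v) = Poly_Mapping.single (word_diagram n v) 1"
  using admissible_IID(7)[OF good_word_admissible[OF assms]] .

lemma word_value_of_reduced:
  assumes n: "2 \<le> n" and w: "w \<in> lists (gens n)" and v: "good_word n v"
    and eq: "b_word n w = (delta ^ k) \<odot>\<^bsub>TL_hat n\<^esub> b_word n v"
  shows "diagram_value (word_diagram n w) = Poly_Mapping.single (word_diagram n v) (delta ^ k)"
proof -
  have vl: "v \<in> lists (gens n)" by (rule good_wordD(1)[OF v])
  have s: "monom_word (delta ^ k) v = (delta ^ k) \<odot>\<^bsub>free_algebra n\<^esub> monom_word 1 v" by (simp add: free_algebra_simps)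
  have "TL_hat_map n (monom_word 1 w) = TL_hat_map n (monom_word (delta ^ k) v)"
    unfolding eq s by (rule alg_homD(6)[OF TL_hat_map_hom[OF n] single_in_free_algebra[OF vl], symmetric])
  hence "word_value n (monom_word 1 w) = word_value n (monom_word (delta ^ k) v)"
    by (rule word_value_eq_of_map_eq[OF n single_in_free_algebra[OF w] single_in_free_algebra[OF vl]])
  thus ?thesis unfolding word_value_single good_word_value[OF n v] by (simp only: scale_1 scale_single mult_1_right)
qed

text \<open>Any choice gives the same class in the quotient, because good words with the same
  diagram are related by commutations.\<close>

definition pick_word :: "nat \<Rightarrow> diagram \<Rightarrow> gen list" where
  "pick_word n d = (SOME v. good_word n v \<and> word_diagram n v = d)"

lemma pick_word:
  assumes n: "2 \<le> n" and v: "good_word n v"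
  shows "good_word n (pick_word n (word_diagram n v))" "b_word n (pick_word n (word_diagram n v)) = b_word n v"
proof -
  let ?p = "pick_word n (word_diagram n v)"
  have p: "good_word n ?p \<and> word_diagram n ?p = word_diagram n v"
    unfolding pick_word_def by (rule someI[of _ v]) (use v in simp)
  thus "good_word n ?p" by blast
  have "commutation\<^sup>*\<^sup>* ?p v" by (rule word_diagram_inj[OF n _ v]) (use p in simp_all)
  thus "b_word n ?p = b_word n v" using b_word_commutations[OF n good_wordD(1)] p by simp
qed

text \<open>Replacing each diagram in the value by a good word for it recovers the class of
  \<open>f\<close>. Hence equal values force equal classes, the converse of
  \<open>word_value_eq_of_map_eq\<close>.\<close>

lemma TL_hat_map_rebuild:
  assumes n: "2 \<le> n" and f: "f \<in> carrier (free_algebra n)"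
  shows "TL_hat_map n f = TL_hat_map n (lin (\<lambda>d. monom_word 1 (pick_word n d)) (word_value n f)) \<and>
    lin (\<lambda>d. monom_word 1 (pick_word n d)) (word_value n f) \<in> carrier (free_algebra n) \<and>
    Poly_Mapping.keys (word_value n f) \<subseteq> word_diagram n ` {v. good_word n v}"
proof -
  note h = alg_homD[OF TL_hat_map_hom[OF n]]
  interpret A: ring "free_algebra n" by (rule zd_algD(1)[OF free_algebra_zd_alg])
  interpret B: ring "TL_hat n" by (rule zd_algD(1)[OF TL_hat_quotient(1)[OF n]])
  have "Poly_Mapping.keys f \<subseteq> lists (gens n)" using f by (simp add: free_algebra_simps)
  thus ?thesis
  proof (induction f rule: poly_mapping_induct_single)
    case zero
    show ?case using A.zero_closed by (simp add: word_value_def free_algebra_simps)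
  next
    case (single w c)
    let ?G = "lin (\<lambda>d. monom_word 1 (pick_word n d))"
    have wc: "monom_word c w = c \<odot>\<^bsub>free_algebra n\<^esub> monom_word 1 w" by (simp add: free_algebra_simps)
    have mw: "TL_hat_map n (monom_word c w) = c \<odot>\<^bsub>TL_hat n\<^esub> b_word n w"
      unfolding wc by (rule h(6)[OF single_in_free_algebra[OF single]])
    from b_word_reduces[OF n single] consider (zero) "b_word n w = \<zero>\<^bsub>TL_hat n\<^esub>"
      | (good) v k where "good_word n v" "b_word n w = (delta ^ k) \<odot>\<^bsub>TL_hat n\<^esub> b_word n v" by blast
    thus ?case
    proof cases
      case zero
      note b0 = zero
      have "word_value n (monom_word 1 w) = 0" by (rule word_value_zero[OF n single_in_free_algebra[OF single] b0])
      hence v0: "word_value n (monom_word c w) = 0" unfolding word_value_single by (simp only: scale_1 scale_0)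
      have "TL_hat_map n (monom_word c w) = \<zero>\<^bsub>TL_hat n\<^esub>"
        unfolding mw b0 by (rule smult_zero[OF TL_hat_quotient(1)[OF n]])
      moreover have "TL_hat_map n 0 = \<zero>\<^bsub>TL_hat n\<^esub>"
        using alg_hom_zero[OF TL_hat_map_hom[OF n] A.ring_axioms B.ring_axioms] by (simp add: free_algebra_simps)
      ultimately show ?thesis unfolding v0 using A.zero_closed by (simp add: free_algebra_simps)
    next
      case (good v k)
      note v = good(1) and e = good(2)
      have val: "word_value n (monom_word c w) = Poly_Mapping.single (word_diagram n v) (c * delta ^ k)"
        unfolding word_value_single word_value_of_reduced[OF n single v e] by (rule scale_single)
      let ?p = "pick_word n (word_diagram n v)"
      note pl = good_wordD(1)[OF pick_word(1)[OF n v]]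
      have G: "?G (word_value n (monom_word c w)) = monom_word (c * delta ^ k) ?p"
        unfolding val by simp
      have s: "monom_word (c * delta ^ k) ?p = (c * delta ^ k) \<odot>\<^bsub>free_algebra n\<^esub> monom_word 1 ?p" by (simp add: free_algebra_simps)
      have "TL_hat_map n (monom_word (c * delta ^ k) ?p) = (c * delta ^ k) \<odot>\<^bsub>TL_hat n\<^esub> b_word n v"
        unfolding s h(6)[OF single_in_free_algebra[OF pl]] pick_word(2)[OF n v] ..
      moreover have "TL_hat_map n (monom_word c w) = (c * delta ^ k) \<odot>\<^bsub>TL_hat n\<^esub> b_word n v"
        unfolding mw e using zd_algD(6)[OF TL_hat_quotient(1)[OF n] b_word_carrier[OF n good_wordD(1)[OF v]]] by simp
      moreover have "Poly_Mapping.keys (word_value n (monom_word c w)) \<subseteq> word_diagram n ` {v. good_word n v}"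
        unfolding val using v by simp
      ultimately show ?thesis unfolding G using single_in_free_algebra[OF pl] by simp
    qed
  next
    case (add f g)
    let ?G = "lin (\<lambda>d. monom_word 1 (pick_word n d))"
    have fg: "f \<in> carrier (free_algebra n)" "g \<in> carrier (free_algebra n)" using add(1,2) by (simp_all add: free_algebra_simps)
    have 1: "TL_hat_map n (f + g) = TL_hat_map n f \<oplus>\<^bsub>TL_hat n\<^esub> TL_hat_map n g"
      using h(3)[OF fg] by (simp only: free_algebra_simps)
    have 2: "?G (word_value n (f + g)) = ?G (word_value n f) + ?G (word_value n g)"
      unfolding word_value_def lin_add ..
    have 3: "TL_hat_map n (?G (word_value n f) + ?G (word_value n g)) = TL_hat_map n (?G (word_value n f)) \<oplus>\<^bsub>TL_hat n\<^esub> TL_hat_map n (?G (word_value n g))"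
      using h(3)[of "?G (word_value n f)" "?G (word_value n g)"] add(3,4) by (simp only: free_algebra_simps(5))
    have 4: "?G (word_value n f) + ?G (word_value n g) \<in> carrier (free_algebra n)"
      using A.a_closed[of "?G (word_value n f)" "?G (word_value n g)"] add(3,4) by (simp only: free_algebra_simps(5))
    have "word_value n (f + g) = word_value n f + word_value n g" unfolding word_value_def lin_add ..
    hence 5: "Poly_Mapping.keys (word_value n (f + g)) \<subseteq> word_diagram n ` {v. good_word n v}"
      using keys_add[of "word_value n f" "word_value n g"] add(3,4) by (simp only:) blast
    have "TL_hat_map n (f + g) = TL_hat_map n (?G (word_value n (f + g)))" unfolding 1 2 3 using add(3,4) by metis
    thus ?case using 4 5 unfolding 2 by blast
  qed
qed

lemma TL_hat_map_eq_iff: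
  assumes n: "2 \<le> n" and f: "f \<in> carrier (free_algebra n)" "g \<in> carrier (free_algebra n)"
  shows "TL_hat_map n f = TL_hat_map n g \<longleftrightarrow> word_value n f = word_value n g"
  using TL_hat_map_rebuild[OF n f(1)] TL_hat_map_rebuild[OF n f(2)] word_value_eq_of_map_eq[OF n f] by metis

lemma TL_hat_map_zero_iff:
  assumes n: "2 \<le> n" and f: "f \<in> carrier (free_algebra n)"
  shows "TL_hat_map n f = \<zero>\<^bsub>TL_hat n\<^esub> \<longleftrightarrow> word_value n f = 0"
proof -
  interpret A: ring "free_algebra n" by (rule zd_algD(1)[OF free_algebra_zd_alg])
  have "TL_hat_map n 0 = \<zero>\<^bsub>TL_hat n\<^esub>"
    using alg_hom_zero[OF TL_hat_map_hom[OF n] A.ring_axioms zd_algD(1)[OF TL_hat_quotient(1)[OF n]]] by (simp add: free_algebra_simps)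
  moreover have "0 \<in> carrier (free_algebra n)" using A.zero_closed by (simp add: free_algebra_simps)
  ultimately show ?thesis using TL_hat_map_eq_iff[OF n f, of 0] by (simp add: word_value_def)
qed

text \<open>The value serves as coordinates: it is a unit vector on each good word, distinguishes
  all classes, and involves only diagrams of good words.\<close>

lemma TL_hat_basis:
  assumes n: "2 \<le> n"
  shows "is_basis (TL_hat n) (b_word n ` {v. good_word n v})"
proof -
  note h = alg_homD[OF TL_hat_map_hom[OF n]]
  interpret A: ring "free_algebra n" by (rule zd_algD(1)[OF free_algebra_zd_alg])
  \<comment> \<open>The chosen preimage does not matter, since the value depends only on the class
    (\<open>word_value_eq_of_map_eq\<close>).\<close>
  define R where "R x = word_value n (SOME f. f \<in> carrier (free_algebra n) \<and> TL_hat_map n f = x)" for x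
  have R: "R (TL_hat_map n f) = word_value n f" if f: "f \<in> carrier (free_algebra n)" for f
  proof -
    let ?g = "SOME g. g \<in> carrier (free_algebra n) \<and> TL_hat_map n g = TL_hat_map n f"
    have "?g \<in> carrier (free_algebra n) \<and> TL_hat_map n ?g = TL_hat_map n f" by (rule someI[of _ f]) (use f in simp)
    thus ?thesis unfolding R_def using word_value_eq_of_map_eq[OF n _ f] by blast
  qed
  have ex: "\<exists>f\<in>carrier (free_algebra n). x = TL_hat_map n f" if "x \<in> carrier (TL_hat n)" for x
    using that unfolding TL_hat_map_surj[OF n, symmetric] by blast
  \<comment> \<open>Defined from \<open>R\<close> rather than from a word, so that it does not
    depend on which good word represents \<open>b\<close>.\<close>
  define g where "g b = (SOME d. R b = Poly_Mapping.single d 1)" for b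
  have g: "g b = d" if "R b = Poly_Mapping.single d 1" for b d
  proof -
    have "R b = Poly_Mapping.single (g b) 1" unfolding g_def by (rule someI[of _ d]) (rule that)
    hence "Poly_Mapping.keys (Poly_Mapping.single (g b) (1 :: int poly)) = Poly_Mapping.keys (Poly_Mapping.single d (1 :: int poly))"
      using that by simp
    thus ?thesis by simp
  qed
  have Rb: "R (b_word n v) = Poly_Mapping.single (word_diagram n v) 1" if v: "good_word n v" for v
    using R[OF single_in_free_algebra[OF good_wordD(1)[OF v], of 1]] unfolding word_value_single good_word_value[OF n v] scale_1 .
  have gb: "g (b_word n v) = word_diagram n v" if v: "good_word n v" for v by (rule g[OF Rb[OF v]])
  show ?thesis
  proof (rule basis_transfer[OF TL_hat_quotient(1)[OF n], where R = R and g = g])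
    show "R (x \<oplus>\<^bsub>TL_hat n\<^esub> y) = R x + R y" if xy: "x \<in> carrier (TL_hat n)" "y \<in> carrier (TL_hat n)" for x y
    proof -
      obtain u v where uv: "u \<in> carrier (free_algebra n)" "x = TL_hat_map n u" "v \<in> carrier (free_algebra n)" "y = TL_hat_map n v"
        using ex[OF xy(1)] ex[OF xy(2)] by blast
      have "R (x \<oplus>\<^bsub>TL_hat n\<^esub> y) = word_value n (u \<oplus>\<^bsub>free_algebra n\<^esub> v)"
        unfolding uv(2,4) h(3)[OF uv(1,3), symmetric] by (rule R[OF A.a_closed[OF uv(1,3)]])
      thus ?thesis unfolding uv(2,4) R[OF uv(1)] R[OF uv(3)] by (simp only: free_algebra_simps(5) word_value_def lin_add)
    qed
    show "R (c \<odot>\<^bsub>TL_hat n\<^esub> x) = scale c (R x)" if x: "x \<in> carrier (TL_hat n)" for c x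
    proof -
      obtain u where u: "u \<in> carrier (free_algebra n)" "x = TL_hat_map n u" using ex[OF x] by blast
      have "R (c \<odot>\<^bsub>TL_hat n\<^esub> x) = word_value n (c \<odot>\<^bsub>free_algebra n\<^esub> u)"
        unfolding u(2) h(6)[OF u(1), symmetric] by (rule R[OF zd_algD(2)[OF free_algebra_zd_alg u(1)]])
      thus ?thesis unfolding u(2) R[OF u(1)] by (simp only: free_algebra_simps(6) word_value_def lin_scale)
    qed
    show "inj_on R (carrier (TL_hat n))"
    proof (rule inj_onI)
      fix x y assume xy: "x \<in> carrier (TL_hat n)" "y \<in> carrier (TL_hat n)" "R x = R y"
      obtain u v where uv: "u \<in> carrier (free_algebra n)" "x = TL_hat_map n u" "v \<in> carrier (free_algebra n)" "y = TL_hat_map n v"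
        using ex[OF xy(1)] ex[OF xy(2)] by blast
      show "x = y" using xy(3) unfolding uv(2,4) R[OF uv(1)] R[OF uv(3)] using TL_hat_map_eq_iff[OF n uv(1,3)] by blast
    qed
    show "b_word n ` {v. good_word n v} \<subseteq> carrier (TL_hat n)" using b_word_carrier[OF n good_wordD(1)] by blast
    show "R b = Poly_Mapping.single (g b) 1" if "b \<in> b_word n ` {v. good_word n v}" for b
      using that Rb gb by auto
    show "inj_on g (b_word n ` {v. good_word n v})"
    proof (rule inj_onI)
      fix x y assume xy: "x \<in> b_word n ` {v. good_word n v}" "y \<in> b_word n ` {v. good_word n v}" "g x = g y"
      then obtain u v where uv: "good_word n u" "x = b_word n u" "good_word n v" "y = b_word n v" by blast
      hence "word_diagram n u = word_diagram n v" using xy(3) gb by simp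
      hence "commutation\<^sup>*\<^sup>* u v" by (rule word_diagram_inj[OF n uv(1,3)])
      thus "x = y" using b_word_commutations[OF n good_wordD(1)[OF uv(1)]] uv(2,4) by simp
    qed
    show "Poly_Mapping.keys (R x) \<subseteq> g ` b_word n ` {v. good_word n v}" if x: "x \<in> carrier (TL_hat n)" for x
    proof -
      obtain u where u: "u \<in> carrier (free_algebra n)" "x = TL_hat_map n u" using ex[OF x] by blast
      have "Poly_Mapping.keys (R x) \<subseteq> word_diagram n ` {v. good_word n v}"
        unfolding u(2) R[OF u(1)] using TL_hat_map_rebuild[OF n u(1)] by blast
      also have "\<dots> = g ` b_word n ` {v. good_word n v}" unfolding image_image using gb by (intro image_cong) auto
      finally show ?thesis .
    qed
  qed
qed

section \<open>The diagram quotient\<close>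

definition diag_map :: "nat \<Rightarrow> (gen list \<Rightarrow>\<^sub>0 int poly) \<Rightarrow> (diagram \<Rightarrow>\<^sub>0 int poly) set" where
  "diag_map n f = quotient_map (PL n) (P_relators n) (to_PL n f)"

lemma diag_map_hom:
  assumes n: "2 \<le> n"
  shows "diag_map n \<in> alg_hom (free_algebra n) (P_hat n)"
proof -
  have n1: "1 \<le> n" using n by simp
  show ?thesis using alg_hom_comp[OF to_PL_hom[OF n] P_hat_quotient(2)[OF n1]] unfolding diag_map_def[abs_def] .
qed

lemma diag_map_single: "diag_map n (monom_word 1 w) = diag_class n (word_diagram n w)"
  unfolding diag_map_def diag_class_def to_PL_def lin_single scale_1 ..

lemma word_diagram_letter: "2 \<le> n \<Longrightarrow> s \<in> gens n \<Longrightarrow> word_diagram n [s] = simple_diagram n s"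
  by (simp add: simple_diagram_eq_act)

text \<open>The generated subalgebra is an intersection; the image of the free algebra is one of the
  subalgebras intersected and is contained in each of them.\<close>

lemma DTL_carrier:
  assumes n: "2 \<le> n"
  shows "carrier (DTL n) = diag_map n ` carrier (free_algebra n)"
proof -
  have n1: "1 \<le> n" using n by simp
  note h = alg_homD[OF diag_map_hom[OF n]]
  interpret A: ring "free_algebra n" by (rule zd_algD(1)[OF free_algebra_zd_alg])
  interpret B: ring "P_hat n" by (rule zd_algD(1)[OF P_hat_quotient(1)[OF n1]])
  interpret H: ring_hom_ring "free_algebra n" "P_hat n" "diag_map n"
    by (rule ring_hom_ringI2[OF A.ring_axioms B.ring_axioms h(1)])
  let ?S = "(\<lambda>s. diag_class n (simple_diagram n s)) ` gens n"
  let ?F = "{X. subring X (P_hat n) \<and> (\<forall>c. \<forall>x\<in>X. c \<odot>\<^bsub>P_hat n\<^esub> x \<in> X) \<and> ?S \<subseteq> X}"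
  have C: "carrier (DTL n) = \<Inter> ?F" unfolding DTL_def generated_subalgebra_def by simp
  show ?thesis
  proof (rule equalityI)
    have "subring (diag_map n ` carrier (free_algebra n)) (P_hat n)"
      by (rule H.img_is_subring[OF A.carrier_is_subring])
    moreover have "c \<odot>\<^bsub>P_hat n\<^esub> x \<in> diag_map n ` carrier (free_algebra n)"
      if x: "x \<in> diag_map n ` carrier (free_algebra n)" for c x
    proof -
      obtain f where f: "f \<in> carrier (free_algebra n)" "x = diag_map n f" using x by blast
      show ?thesis unfolding f(2) h(6)[OF f(1), symmetric]
        by (rule imageI[OF zd_algD(2)[OF free_algebra_zd_alg f(1)]])
    qed
    moreover have "?S \<subseteq> diag_map n ` carrier (free_algebra n)"
    proof (rule image_subsetI)
      fix s assume s: "s \<in> gens n"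
      have "diag_map n (monom_word 1 [s]) \<in> diag_map n ` carrier (free_algebra n)"
        by (rule imageI[OF single_in_free_algebra]) (use s in simp)
      thus "diag_class n (simple_diagram n s) \<in> diag_map n ` carrier (free_algebra n)"
        unfolding diag_map_single word_diagram_letter[OF n s] .
    qed
    ultimately have "diag_map n ` carrier (free_algebra n) \<in> ?F" by simp
    thus "carrier (DTL n) \<subseteq> diag_map n ` carrier (free_algebra n)" unfolding C by (rule Inter_lower)
    show "diag_map n ` carrier (free_algebra n) \<subseteq> carrier (DTL n)"
      unfolding C
    proof (rule Inter_greatest)
      fix X assume "X \<in> ?F"
      hence X: "subring X (P_hat n)" "\<And>c x. x \<in> X \<Longrightarrow> c \<odot>\<^bsub>P_hat n\<^esub> x \<in> X"
        and S: "\<And>s. s \<in> gens n \<Longrightarrow> diag_class n (simple_diagram n s) \<in> X" by auto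
      note X1 = subringE[OF X(1)]
      have word: "diag_map n (monom_word 1 w) \<in> X" if "w \<in> lists (gens n)" for w
        using that
      proof (induction w)
        case Nil
        show ?case using h(5) X1(3) by (simp add: free_algebra_simps)
      next
        case (Cons s w)
        have "diag_map n (monom_word 1 [s]) \<in> X"
          using S[OF Cons(1)] unfolding diag_map_single word_diagram_letter[OF n Cons(1)] .
        hence "diag_map n (monom_word 1 [s]) \<otimes>\<^bsub>P_hat n\<^esub> diag_map n (monom_word 1 w) \<in> X"
          using X1(6) Cons(3) by blast
        moreover have "[s] \<in> lists (gens n)" using Cons(1) by simp
        ultimately show ?case
          using h(4)[OF single_in_free_algebra[of "[s]" n 1] single_in_free_algebra[OF Cons(2), of 1]]
          unfolding mult_single_free_algebra by simp
      qed
      show "diag_map n ` carrier (free_algebra n) \<subseteq> X"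
      proof (rule image_subsetI)
        fix f assume "f \<in> carrier (free_algebra n)"
        hence "Poly_Mapping.keys f \<subseteq> lists (gens n)" by (simp add: free_algebra_simps)
        thus "diag_map n f \<in> X"
        proof (induction f rule: poly_mapping_induct_single)
          case zero
          show ?case using H.hom_zero X1(2) by (simp add: free_algebra_simps)
        next
          case (single w c)
          have "diag_map n (c \<odot>\<^bsub>free_algebra n\<^esub> monom_word 1 w) \<in> X"
            unfolding h(6)[OF single_in_free_algebra[OF single]] by (rule X(2)[OF word[OF single]])
          thus ?case unfolding free_algebra_simps scale_single by simp
        next
          case (add f g)
          have "diag_map n (f \<oplus>\<^bsub>free_algebra n\<^esub> g) = diag_map n f \<oplus>\<^bsub>P_hat n\<^esub> diag_map n g"
            by (rule h(3)) (use add(1,2) in \<open>simp_all add: free_algebra_simps\<close>)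
          thus ?case using X1(7)[OF add(3,4)] by (simp add: free_algebra_simps)
        qed
      qed
    qed
  qed
qed

lemma DTL_eq: "DTL n = (P_hat n)\<lparr>carrier := carrier (DTL n)\<rparr>"
  unfolding DTL_def generated_subalgebra_def by simp

lemma DTL_simps:
  "mult (DTL n) = mult (P_hat n)" "one (DTL n) = one (P_hat n)" "zero (DTL n) = zero (P_hat n)"
  "add (DTL n) = add (P_hat n)" "smult (DTL n) = smult (P_hat n)"
  unfolding DTL_def generated_subalgebra_def by simp_all

lemma DTL_zd_alg:
  assumes n: "2 \<le> n"
  shows "zd_alg (DTL n)"
proof -
  have n1: "1 \<le> n" using n by simp
  note h = alg_homD[OF diag_map_hom[OF n]]
  interpret A: ring "free_algebra n" by (rule zd_algD(1)[OF free_algebra_zd_alg])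
  interpret H: ring_hom_ring "free_algebra n" "P_hat n" "diag_map n"
    by (rule ring_hom_ringI2[OF A.ring_axioms zd_algD(1)[OF P_hat_quotient(1)[OF n1]] h(1)])
  have "zd_alg ((P_hat n)\<lparr>carrier := carrier (DTL n)\<rparr>)"
  proof (rule subalgebra_zd_alg[OF P_hat_quotient(1)[OF n1]])
    show "subring (carrier (DTL n)) (P_hat n)"
      unfolding DTL_carrier[OF n] by (rule H.img_is_subring[OF A.carrier_is_subring])
    show "c \<odot>\<^bsub>P_hat n\<^esub> x \<in> carrier (DTL n)" if x: "x \<in> carrier (DTL n)" for c x
    proof -
      obtain f where f: "f \<in> carrier (free_algebra n)" "x = diag_map n f"
        using x unfolding DTL_carrier[OF n] by blast
      show ?thesis unfolding f(2) h(6)[OF f(1), symmetric] DTL_carrier[OF n]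
        by (rule imageI[OF zd_algD(2)[OF free_algebra_zd_alg f(1)]])
    qed
  qed
  thus ?thesis unfolding DTL_eq[symmetric] .
qed

lemma diag_map_DTL_hom:
  assumes n: "2 \<le> n"
  shows "diag_map n \<in> alg_hom (free_algebra n) (DTL n)"
proof -
  note h = alg_homD[OF diag_map_hom[OF n]]
  show ?thesis
    by (rule alg_homI, unfold DTL_simps) (simp_all only: h(3-6) DTL_carrier[OF n] imageI)
qed

lemma DTL_hat_quotient:
  assumes n: "2 \<le> n"
  shows "zd_alg (DTL_hat n)" "quotient_map (DTL n) (decorated_loop_classes n) \<in> alg_hom (DTL n) (DTL_hat n)"
    "quotient_map (DTL n) (decorated_loop_classes n) ` carrier (DTL n) = carrier (DTL_hat n)"
    "x \<in> carrier (DTL n) \<Longrightarrow>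
      quotient_map (DTL n) (decorated_loop_classes n) x = \<zero>\<^bsub>DTL_hat n\<^esub> \<longleftrightarrow> x \<in> Idl\<^bsub>DTL n\<^esub> (decorated_loop_classes n)"
proof -
  have "decorated_loop_classes n \<subseteq> carrier (DTL n)" unfolding decorated_loop_classes_def by auto
  note q = quotient_algebra[OF DTL_zd_alg[OF n] this]
  show "zd_alg (DTL_hat n)" "quotient_map (DTL n) (decorated_loop_classes n) \<in> alg_hom (DTL n) (DTL_hat n)"
    "quotient_map (DTL n) (decorated_loop_classes n) ` carrier (DTL n) = carrier (DTL_hat n)"
    "x \<in> carrier (DTL n) \<Longrightarrow>
      quotient_map (DTL n) (decorated_loop_classes n) x = \<zero>\<^bsub>DTL_hat n\<^esub> \<longleftrightarrow> x \<in> Idl\<^bsub>DTL n\<^esub> (decorated_loop_classes n)"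
    unfolding DTL_hat_def using q by blast+
qed

definition DTL_hat_map :: "nat \<Rightarrow> (gen list \<Rightarrow>\<^sub>0 int poly) \<Rightarrow> (diagram \<Rightarrow>\<^sub>0 int poly) set set" where
  "DTL_hat_map n f = quotient_map (DTL n) (decorated_loop_classes n) (diag_map n f)"

lemma DTL_hat_map_hom:
  assumes n: "2 \<le> n"
  shows "DTL_hat_map n \<in> alg_hom (free_algebra n) (DTL_hat n)"
  using alg_hom_comp[OF diag_map_DTL_hom[OF n] DTL_hat_quotient(2)[OF n]] unfolding DTL_hat_map_def[abs_def] .

lemma DTL_hat_map_surj:
  assumes n: "2 \<le> n"
  shows "DTL_hat_map n ` carrier (free_algebra n) = carrier (DTL_hat n)"
  unfolding DTL_hat_map_def[abs_def] DTL_hat_quotient(3)[OF n, symmetric] DTL_carrier[OF n] image_image ..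

lemma DTL_hat_map_word: "DTL_hat_map n (monom_word 1 w) = diag_hat n (word_diagram n w)"
  unfolding DTL_hat_map_def diag_hat_def diag_map_single ..

text \<open>Diagrams with a decorated loop have value 0, so the ideal that they generate inside the
  subalgebra stays within the image of \<open>value_kernel n\<close>.\<close>

lemma word_value_zero_of_DTL_hat_map:
  assumes n: "2 \<le> n" and f: "f \<in> carrier (free_algebra n)" and z: "DTL_hat_map n f = \<zero>\<^bsub>DTL_hat n\<^esub>"
  shows "word_value n f = 0"
proof -
  have n1: "1 \<le> n" using n by simp
  let ?Q = "quotient_algebra (PL n) (P_relators n)" and ?X = "carrier (DTL n)" and ?T = "decorated_loop_classes n"
  have D: "DTL n = ?Q\<lparr>carrier := ?X\<rparr>" unfolding P_hat_def[symmetric] by (rule DTL_eq)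
  have X: "?X \<subseteq> carrier ?Q"
    unfolding DTL_carrier[OF n] P_hat_def[symmetric] using alg_homD(2)[OF diag_map_hom[OF n]] by (rule image_subsetI)
  have T: "?T \<subseteq> ?X" unfolding decorated_loop_classes_def by auto
  have TK: "?T \<subseteq> quotient_map (PL n) (P_relators n) ` value_kernel n"
  proof
    fix x assume "x \<in> ?T"
    then obtain d where d: "x = diag_class n d" "d \<in> diagrams n" "1 \<in># loops d"
      unfolding decorated_loop_classes_def by auto
    have "\<not> even_loops d" using d(3) unfolding even_loops_def by force
    hence "Poly_Mapping.single d 1 \<in> value_kernel n"
      using single_in_PL[OF d(2)] by (simp add: value_kernel_def diagram_value_def)
    thus "x \<in> quotient_map (PL n) (P_relators n) ` value_kernel n" unfolding d(1) diag_class_def by (rule imageI)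
  qed
  have "to_PL n f \<in> value_kernel n"
  proof (rule quotient_of_subalgebra_kernel[OF PL_zd_alg[OF n1] P_relators_carrier[OF n1] ideal_value_kernel[OF n1]
        P_relators_value_kernel[OF n1] _ X T TK alg_homD(2)[OF to_PL_hom[OF n] f]])
    show "zd_alg (?Q\<lparr>carrier := ?X\<rparr>)" unfolding D[symmetric] by (rule DTL_zd_alg[OF n])
    show "quotient_map (PL n) (P_relators n) (to_PL n f) \<in> ?X"
      unfolding diag_map_def[symmetric] DTL_carrier[OF n] by (rule imageI[OF f])
    show "quotient_map (?Q\<lparr>carrier := ?X\<rparr>) ?T (quotient_map (PL n) (P_relators n) (to_PL n f))
      = \<zero>\<^bsub>quotient_algebra (?Q\<lparr>carrier := ?X\<rparr>) ?T\<^esub>"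
      using z unfolding D[symmetric] DTL_hat_map_def diag_map_def DTL_hat_def .
  qed
  thus ?thesis unfolding value_kernel_def word_value_eq by blast
qed

text \<open>The generators of the ideal are required to lie in \<open>DTL n\<close>; the class
  considered does so because it is the class of a word.\<close>

lemma DTL_hat_map_odd:
  assumes n: "2 \<le> n" and w: "w \<in> lists (gens n)" and odd: "\<not> even_loops (word_diagram n w)"
  shows "DTL_hat_map n (monom_word 1 w) = \<zero>\<^bsub>DTL_hat n\<^esub>"
proof -
  have n1: "1 \<le> n" using n by simp
  obtain d where d: "d \<in> diagrams n" "1 \<in># loops d" "diag_class n (word_diagram n w) = diag_class n d"
    by (rule diag_class_odd[OF n1 word_diagram_in_diagrams[OF n w] odd])
  have c: "diag_map n (monom_word 1 w) \<in> carrier (DTL n)"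
    using alg_homD(2)[OF diag_map_DTL_hom[OF n] single_in_free_algebra[OF w]] .
  have T: "decorated_loop_classes n \<subseteq> carrier (DTL n)" unfolding decorated_loop_classes_def by auto
  have "diag_map n (monom_word 1 w) \<in> decorated_loop_classes n"
    unfolding decorated_loop_classes_def mem_Collect_eq
    by (rule exI[of _ d]) (use c d in \<open>simp add: diag_map_single\<close>)
  hence "diag_map n (monom_word 1 w) \<in> Idl\<^bsub>DTL n\<^esub> (decorated_loop_classes n)"
    using ring.genideal_self[OF zd_algD(1)[OF DTL_zd_alg[OF n]] T] by blast
  thus ?thesis unfolding DTL_hat_map_def using DTL_hat_quotient(4)[OF n c] by blast
qed

text \<open>With even loops the equation holds already in \<open>DTL n\<close>; with odd loops both
  sides are 0.\<close>

lemma DTL_hat_map_of_value: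
  assumes n: "2 \<le> n" and uv: "u \<in> lists (gens n)" "v \<in> lists (gens n)"
    and val: "diagram_value (word_diagram n u) = scale c (diagram_value (word_diagram n v))" and c: "c \<noteq> 0"
  shows "DTL_hat_map n (monom_word 1 u) = c \<odot>\<^bsub>DTL_hat n\<^esub> DTL_hat_map n (monom_word 1 v)"
proof (cases "even_loops (word_diagram n v)")
  case True
  have n1: "1 \<le> n" using n by simp
  have "diag_map n (monom_word 1 u) = c \<odot>\<^bsub>DTL n\<^esub> diag_map n (monom_word 1 v)"
    unfolding diag_map_single DTL_simps
    by (rule diag_class_of_value[OF n1 word_diagram_in_diagrams[OF n uv(1)] word_diagram_in_diagrams[OF n uv(2)] val True c])
  thus ?thesis unfolding DTL_hat_map_def
    using alg_homD(6)[OF DTL_hat_quotient(2)[OF n] alg_homD(2)[OF diag_map_DTL_hom[OF n] single_in_free_algebra[OF uv(2)]]]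
    by simp
next
  case False
  have "\<not> even_loops (word_diagram n u)"
  proof
    assume e: "even_loops (word_diagram n u)"
    have "diagram_value (word_diagram n v) = 0" using False by (simp add: diagram_value_def)
    hence "diagram_value (word_diagram n u) = 0" unfolding val by simp
    hence "Poly_Mapping.lookup (diagram_value (word_diagram n u)) (reduce (word_diagram n u)) = 0" by simp
    thus False using e by (simp add: diagram_value_def)
  qed
  thus ?thesis using DTL_hat_map_odd[OF n] uv False smult_zero[OF DTL_hat_quotient(1)[OF n]] by simp
qed

lemma DTL_hat_map_relator:
  assumes n: "2 \<le> n" and uv: "u \<in> lists (gens n)" "v \<in> lists (gens n)"
    and val: "diagram_value (word_diagram n u) = scale c (diagram_value (word_diagram n v))" and c: "c \<noteq> 0"
  shows "DTL_hat_map n (monom_word 1 u - monom_word c v) = \<zero>\<^bsub>DTL_hat n\<^esub>"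
proof -
  note h = DTL_hat_map_hom[OF n]
  interpret A: ring "free_algebra n" by (rule zd_algD(1)[OF free_algebra_zd_alg])
  interpret B: ring "DTL_hat n" by (rule zd_algD(1)[OF DTL_hat_quotient(1)[OF n]])
  note s = single_in_free_algebra[OF uv(1), of 1] single_in_free_algebra[OF uv(2), of c]
  have "monom_word c v = c \<odot>\<^bsub>free_algebra n\<^esub> monom_word 1 v" by (simp add: free_algebra_simps)
  hence "DTL_hat_map n (monom_word c v) = c \<odot>\<^bsub>DTL_hat n\<^esub> DTL_hat_map n (monom_word 1 v)"
    using alg_homD(6)[OF h single_in_free_algebra[OF uv(2)]] by simp
  hence "DTL_hat_map n (monom_word 1 u) = DTL_hat_map n (monom_word c v)"
    using DTL_hat_map_of_value[OF n uv val c] by simp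
  thus ?thesis
    using alg_hom_minus[OF h A.ring_axioms B.ring_axioms s] eq_iff_minus_zero[OF B.ring_axioms]
      alg_homD(2)[OF h] s unfolding free_algebra_minus[OF s] by metis
qed

text \<open>The two sides of each relator have equal values up to the scalar of the relator, and the
  product for column 1 has an odd loop; so all defining relations hold in the diagram
  quotient.\<close>

lemma DTL_hat_map_zero_of_TL_hat_map:
  assumes n: "2 \<le> n" and f: "f \<in> carrier (free_algebra n)" and z: "TL_hat_map n f = \<zero>\<^bsub>TL_hat n\<^esub>"
  shows "DTL_hat_map n f = \<zero>\<^bsub>DTL_hat n\<^esub>"
proof -
  let ?K = "{f \<in> carrier (free_algebra n). DTL_hat_map n f = \<zero>\<^bsub>DTL_hat n\<^esub>}"
  have K: "ideal ?K (free_algebra n)"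
    by (rule kernel_ideal[OF zd_algD(1)[OF free_algebra_zd_alg] zd_algD(1)[OF DTL_hat_quotient(1)[OF n]] DTL_hat_map_hom[OF n]])
  have "DTL_hat_map n r = \<zero>\<^bsub>DTL_hat n\<^esub>" if "r \<in> TL_relators n" for r
    using that
  proof (cases rule: TL_relators_cases)
    case (square s)
    show ?thesis unfolding square(2)
      by (rule DTL_hat_map_relator[OF n _ _ value_square[OF n square(1)]]) (use square(1) in simp_all)
  next
    case (commute s t)
    show ?thesis unfolding commute(5)
      by (rule DTL_hat_map_relator[OF n], unfold scale_1 value_commute[OF n commute(1-4)]) (use commute(1,2) in simp_all)
  next
    case (braid s t)
    show ?thesis unfolding braid(4)
      by (rule DTL_hat_map_relator[OF n], unfold scale_1 value_braid[OF n braid(1-3)]) (use braid(1,2) in simp_all)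
  qed
  hence 1: "TL_relators n \<subseteq> ?K" using TL_relators_carrier by blast
  have 2: "monom_word 1 [Gen 1, Bar1] \<in> ?K"
    using DTL_hat_map_odd[OF n Gen1_Bar1_in_gens[OF n] odd_loop_Gen1_Bar1(1)[OF n]]
      single_in_free_algebra[OF Gen1_Bar1_in_gens[OF n]] by blast
  show ?thesis using TL_hat_map_zero_in_ideal[OF n K 1 2 f z] by blast
qed

lemma TL_hat_map_zero_iff_DTL_hat_map:
  assumes n: "2 \<le> n" and f: "f \<in> carrier (free_algebra n)"
  shows "TL_hat_map n f = \<zero>\<^bsub>TL_hat n\<^esub> \<longleftrightarrow> DTL_hat_map n f = \<zero>\<^bsub>DTL_hat n\<^esub>"
  using DTL_hat_map_zero_of_TL_hat_map[OF n f] word_value_zero_of_DTL_hat_map[OF n f] TL_hat_map_zero_iff[OF n f] by blast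

section \<open>Reduced words of fully commutative elements\<close>

lemma cox_eq_lists: "cox_eq n xs ys \<Longrightarrow> xs \<in> lists (gens n) \<and> ys \<in> lists (gens n)"
proof (induction rule: cox_eq.induct)
  case (relator s t us vs)
  have "set (concat (replicate (cox_m s t) [s, t])) \<subseteq> {s, t}" by auto
  thus ?case using relator by (auto simp: lists_eq_set)
qed auto

lemma cox_eq_square:
  assumes "s \<in> gens n" "us \<in> lists (gens n)" "vs \<in> lists (gens n)"
  shows "cox_eq n (us @ s # s # vs) (us @ vs)"
  using cox_eq.relator[OF assms(1,1,2,3)] by (simp add: cox_m_def)

text \<open>\<open>(s t)^2\<close> is inserted in front of \<open>t s\<close> and squares are
  cancelled; \<open>cox_eq_braid\<close> does the same with \<open>(s t)^3\<close> in front of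
  \<open>t s t\<close>.\<close>

lemma cox_eq_commute:
  assumes st: "s \<in> gens n" "t \<in> gens n" "s \<noteq> t" "\<not> connected_gens s t"
    and g: "us \<in> lists (gens n)" "vs \<in> lists (gens n)"
  shows "cox_eq n (us @ s # t # vs) (us @ t # s # vs)"
proof -
  have "cox_eq n (us @ s # t # s # t # t # s # vs) (us @ t # s # vs)"
    using cox_eq.relator[OF st(1,2) g(1), of "t # s # vs"] st g by (simp add: cox_m_def numeral_2_eq_2)
  moreover have "cox_eq n (us @ s # t # s # t # t # s # vs) (us @ s # t # s # s # vs)"
    using cox_eq_square[OF st(2), of "us @ [s, t, s]" "s # vs"] st g by simp
  moreover have "cox_eq n (us @ s # t # s # s # vs) (us @ s # t # vs)"
    using cox_eq_square[OF st(1), of "us @ [s, t]" vs] st g by simp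
  ultimately show ?thesis by (meson cox_eq.sym cox_eq.trans)
qed

lemma connected_gens_neq: "connected_gens s t \<Longrightarrow> s \<noteq> t"
  by (cases s; cases t) auto

lemma cox_eq_braid:
  assumes st: "s \<in> gens n" "t \<in> gens n" "connected_gens s t"
    and g: "us \<in> lists (gens n)" "vs \<in> lists (gens n)"
  shows "cox_eq n (us @ s # t # s # vs) (us @ t # s # t # vs)"
proof -
  have "cox_eq n (us @ s # t # s # t # s # t # t # s # t # vs) (us @ t # s # t # vs)"
    using cox_eq.relator[OF st(1,2) g(1), of "t # s # t # vs"] connected_gens_neq[OF st(3)] st g
    by (simp add: cox_m_def numeral_3_eq_3)
  moreover have "cox_eq n (us @ s # t # s # t # s # t # t # s # t # vs) (us @ s # t # s # t # s # s # t # vs)"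
    using cox_eq_square[OF st(2), of "us @ [s, t, s, t, s]" "s # t # vs"] st g by simp
  moreover have "cox_eq n (us @ s # t # s # t # s # s # t # vs) (us @ s # t # s # t # t # vs)"
    using cox_eq_square[OF st(1), of "us @ [s, t, s, t]" "t # vs"] st g by simp
  moreover have "cox_eq n (us @ s # t # s # t # t # vs) (us @ s # t # s # vs)"
    using cox_eq_square[OF st(2), of "us @ [s, t, s]" vs] st g by simp
  ultimately show ?thesis by (meson cox_eq.sym cox_eq.trans)
qed

text \<open>For a map compatible with contexts it suffices to check squares and the commutation and
  braid forms of the relations, which are what can be computed for products of the elements b_s -
  1.\<close>

lemma cox_eq_invariant:
  fixes \<rho> :: "gen list \<Rightarrow> 'a"
  assumes ctx: "\<And>us x y vs. us \<in> lists (gens n) \<Longrightarrow> vs \<in> lists (gens n) \<Longrightarrow> x \<in> lists (gens n) \<Longrightarrow>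
      y \<in> lists (gens n) \<Longrightarrow> \<rho> x = \<rho> y \<Longrightarrow> \<rho> (us @ x @ vs) = \<rho> (us @ y @ vs)"
    and square: "\<And>s. s \<in> gens n \<Longrightarrow> \<rho> [s, s] = \<rho> []"
    and commute: "\<And>s t. s \<in> gens n \<Longrightarrow> t \<in> gens n \<Longrightarrow> s \<noteq> t \<Longrightarrow> \<not> connected_gens s t \<Longrightarrow> \<rho> [s, t] = \<rho> [t, s]"
    and braid: "\<And>s t. s \<in> gens n \<Longrightarrow> t \<in> gens n \<Longrightarrow> connected_gens s t \<Longrightarrow> \<rho> [s, t, s] = \<rho> [t, s, t]"
  shows "cox_eq n xs ys \<Longrightarrow> \<rho> xs = \<rho> ys"
proof (induction rule: cox_eq.induct)
  case (relator s t us vs)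
  note st = relator(1,2)
  have sq: "\<rho> (as @ [r, r] @ bs) = \<rho> (as @ bs)" if "r \<in> gens n" "as \<in> lists (gens n)" "bs \<in> lists (gens n)" for r as bs
    using ctx[OF that(2,3) _ _ square[OF that(1)]] that(1) by simp
  have "\<rho> (concat (replicate (cox_m s t) [s, t])) = \<rho> []"
  proof -
    consider (eq) "s = t" | (con) "s \<noteq> t" "connected_gens s t" | (non) "s \<noteq> t" "\<not> connected_gens s t" by blast
    thus ?thesis
    proof cases
      case eq
      thus ?thesis using square[OF st(1)] by (simp add: cox_m_def)
    next
      case non
      have "\<rho> ([s, t] @ [s, t] @ []) = \<rho> ([s, t] @ [t, s] @ [])"
        by (rule ctx) (use st commute[OF st non] in simp_all)
      also have "\<dots> = \<rho> ([s] @ [t, t] @ [s])" by simp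
      also have "\<dots> = \<rho> ([s] @ [s])" by (rule sq) (use st in simp_all)
      finally show ?thesis using non square[OF st(1)] by (simp add: cox_m_def numeral_2_eq_2)
    next
      case con
      have "\<rho> ([] @ [s, t, s] @ [t, s, t]) = \<rho> ([] @ [t, s, t] @ [t, s, t])"
        by (rule ctx) (use st braid[OF st con(2)] in simp_all)
      also have "\<dots> = \<rho> ([t, s] @ [t, t] @ [s, t])" by simp
      also have "\<dots> = \<rho> ([t, s] @ [s, t])" by (rule sq) (use st in simp_all)
      also have "\<dots> = \<rho> ([t] @ [s, s] @ [t])" by simp
      also have "\<dots> = \<rho> ([t] @ [t])" by (rule sq) (use st in simp_all)
      finally show ?thesis using con square[OF st(2)] by (simp add: cox_m_def numeral_3_eq_3)
    qed
  qed
  moreover have "concat (replicate (cox_m s t) [s, t]) \<in> lists (gens n)" using st by (auto simp: lists_eq_set)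
  ultimately show ?case using ctx[OF relator(3,4), of "concat (replicate (cox_m s t) [s, t])" "[]"] by simp
qed auto

lemma cox_eq_commutation:
  assumes xs: "xs \<in> lists (gens n)" and c: "commutation xs ys"
  shows "cox_eq n xs ys"
  using c
proof cases
  case (1 s t us vs)
  thus ?thesis using cox_eq_commute[of s n t us vs] xs by simp
qed

lemma cox_eq_commutations:
  assumes xs: "xs \<in> lists (gens n)" and c: "commutation\<^sup>*\<^sup>* xs ys"
  shows "cox_eq n xs ys"
  using c
proof (induction rule: rtranclp_induct)
  case base
  show ?case by (rule cox_eq.refl[OF xs])
next
  case (step y z)
  show ?case using cox_eq.trans[OF step(3) cox_eq_commutation[OF commutations_lists[OF step(1) xs] step(2)]] .
qed

lemma W_D_cases:
  assumes w: "w \<in> W_D n" and x: "x \<in> w"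
  shows "x \<in> lists (gens n)" "y \<in> w \<longleftrightarrow> cox_eq n x y"
proof -
  obtain z where z: "w = {(xs, ys). cox_eq n xs ys} `` {z}" using w unfolding W_D_def by (rule quotientE) blast
  have wz: "y \<in> w \<longleftrightarrow> cox_eq n z y" for y unfolding z by simp
  show "x \<in> lists (gens n)" using x cox_eq_lists unfolding wz by blast
  show "y \<in> w \<longleftrightarrow> cox_eq n x y" using x unfolding wz by (meson cox_eq.sym cox_eq.trans)
qed

lemma W_D_class: "xs \<in> lists (gens n) \<Longrightarrow> {ys. cox_eq n xs ys} \<in> W_D n"
  unfolding W_D_def using quotientI[of xs "lists (gens n)" "{(xs, ys). cox_eq n xs ys}"] by (simp add: Image_def)

lemma reduced_expr_exists:
  assumes "w \<in> W_D n"
  shows "\<exists>xs. reduced_expr w xs"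
proof -
  obtain z where z: "z \<in> lists (gens n)" "w = {(xs, ys). cox_eq n xs ys} `` {z}" using assms unfolding W_D_def by (rule quotientE) blast
  have "z \<in> w" unfolding z(2) using cox_eq.refl[OF z(1)] by simp
  thus ?thesis unfolding reduced_expr_def using ex_has_least_nat[of "\<lambda>x. x \<in> w" z length] by blast
qed

lemma reduced_expr_cox_eq:
  assumes w: "w \<in> W_D n" and r: "reduced_expr w xs" and c: "cox_eq n xs ys" and l: "length ys = length xs"
  shows "reduced_expr w ys"
  using r W_D_cases(2)[OF w, of xs ys] c l unfolding reduced_expr_def by simp

text \<open>A factor \<open>ss\<close> contradicts reducedness. A factor \<open>sts\<close> gives,
  by the braid relation, another reduced word with a different multiset of letters, which
  commutations cannot produce. The pair of column 1 makes the heap of type I.\<close>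

lemma reduced_FC_good:
  assumes w: "w \<in> FC n" "heap_type_II w" and r: "reduced_expr w xs"
  shows "good_word n xs"
proof -
  have W: "w \<in> W_D n" using w(1) by (simp add: FC_def)
  have xw: "xs \<in> w" using r by (simp add: reduced_expr_def)
  have xl: "xs \<in> lists (gens n)" by (rule W_D_cases(1)[OF W xw])
  have fc: "commutation\<^sup>*\<^sup>* as bs" if "reduced_expr w as" "reduced_expr w bs" for as bs
    using w(1) that unfolding FC_def by blast
  have "\<not> bad_factor ys" if ys: "commutation\<^sup>*\<^sup>* xs ys" for ys
  proof
    assume bad: "bad_factor ys"
    have ry: "reduced_expr w ys"
      by (rule reduced_expr_cox_eq[OF W r cox_eq_commutations[OF xl ys] commutations_length[OF ys]])
    have yw: "ys \<in> w" using ry by (simp add: reduced_expr_def)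
    have yl: "ys \<in> lists (gens n)" by (rule W_D_cases(1)[OF W yw])
    have t1: False if "reduced_expr w (us @ [Bar1, Gen 1] @ vs)" for us vs
      using w(2) that unfolding heap_type_I_def by (metis sublist_appendI)
    from bad obtain us vs where b: "(\<exists>s. ys = us @ [s, s] @ vs) \<or> (\<exists>s t. connected_gens s t \<and> ys = us @ [s, t, s] @ vs) \<or>
      ys = us @ [Gen 1, Bar1] @ vs \<or> ys = us @ [Bar1, Gen 1] @ vs" unfolding bad_factor_def by blast
    have g: "us \<in> lists (gens n)" "vs \<in> lists (gens n)" using b yl by auto
    from b show False
    proof (elim disjE exE conjE)
      fix s assume y: "ys = us @ [s, s] @ vs"
      have "cox_eq n ys (us @ vs)" unfolding y using cox_eq_square[of s n us vs] yl y g by simp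
      hence "us @ vs \<in> w" using W_D_cases(2)[OF W yw] by blast
      hence "length ys \<le> length (us @ vs)" using ry unfolding reduced_expr_def by blast
      thus False unfolding y by simp
    next
      fix s t assume st: "connected_gens s t" and y: "ys = us @ [s, t, s] @ vs"
      have "cox_eq n ys (us @ t # s # t # vs)" unfolding y using cox_eq_braid[of s n t us vs] yl y g st by simp
      hence "reduced_expr w (us @ t # s # t # vs)" by (rule reduced_expr_cox_eq[OF W ry]) (simp add: y)
      from commutations_mset[OF fc[OF ry this]] have "{#t, s, t#} = {#s, t, s#}" unfolding y by simp
      hence "count {#t, s, t#} s = count {#s, t, s#} s" by simp
      thus False using connected_gens_neq[OF st] by simp
    next
      assume y: "ys = us @ [Gen 1, Bar1] @ vs"
      have "commutation ys (us @ [Bar1, Gen 1] @ vs)" unfolding y by (rule commutation.intros) simp_all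
      from reduced_expr_cox_eq[OF W ry cox_eq_commutation[OF yl this]] show False using t1 y by simp
    next
      assume "ys = us @ [Bar1, Gen 1] @ vs"
      thus False using t1 ry by simp
    qed
  qed
  thus ?thesis unfolding good_word_def using xl by blast
qed

section \<open>The Coxeter group at \<delta> = 2\<close>

primrec chi :: "gen list \<Rightarrow> (gen list \<Rightarrow>\<^sub>0 int poly)" where
  "chi [] = monom_word 1 []"
| "chi (s # xs) = lin (\<lambda>w. monom_word 1 (s # w)) (chi xs) - chi xs"

lemma chi_append: "chi (xs @ ys) = chi xs \<otimes>\<^bsub>free_algebra n\<^esub> chi ys"
proof (induction xs)
  case Nil
  show ?case unfolding free_algebra_simps chi.simps lin_single scale_1 append_Nil lin_id ..
next
  case (Cons s xs)
  show ?case unfolding append_Cons chi.simps Cons unfolding free_algebra_simps lin_minus lin_lin lin_single scale_1 append_Cons ..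
qed

text \<open>\<open>chi xs\<close> is the product of the elements s - 1 over the letters s of
  \<open>xs\<close>, expanded in the free algebra; apart from its leading term \<open>xs\<close>,
  every term drops at least one letter.\<close>

lemma chi_keys:
  "xs \<in> lists X \<Longrightarrow> Poly_Mapping.keys (chi xs - monom_word 1 xs) \<subseteq> {zs \<in> lists X. length zs < length xs}"
proof (induction xs)
  case (Cons s xs)
  let ?r = "chi xs - monom_word 1 xs"
  have r: "Poly_Mapping.keys ?r \<subseteq> {zs \<in> lists X. length zs < length xs}" using Cons by simp
  have eq: "chi (s # xs) - monom_word 1 (s # xs) = lin (\<lambda>w. monom_word 1 (s # w)) ?r - (?r + monom_word 1 xs)"
    unfolding chi.simps lin_minus lin_single scale_1 by simp
  have "z \<in> {zs \<in> lists X. length zs < length (s # xs)}" if z: "z \<in> Poly_Mapping.keys (chi (s # xs) - monom_word 1 (s # xs))" for z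
  proof -
    have "z \<in> Poly_Mapping.keys (lin (\<lambda>w. monom_word 1 (s # w)) ?r) \<or> z \<in> Poly_Mapping.keys (?r + monom_word 1 xs)"
      using subsetD[OF keys_diff z[unfolded eq]] by (rule UnE) simp_all
    moreover have "z \<in> Poly_Mapping.keys ?r \<or> z = xs" if "z \<in> Poly_Mapping.keys (?r + monom_word 1 xs)"
      using subsetD[OF keys_add that] by auto
    ultimately consider "z \<in> Poly_Mapping.keys (lin (\<lambda>w. monom_word 1 (s # w)) ?r)" | "z \<in> Poly_Mapping.keys ?r" | "z = xs"
      by blast
    thus ?thesis
    proof cases
      case 1
      from in_keys_lin[OF this] obtain w where w: "w \<in> Poly_Mapping.keys ?r" "z \<in> Poly_Mapping.keys (monom_word (1 :: int poly) (s # w))"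
        by (rule bexE)
      have "z = s # w" using w(2) by simp
      with w(1) show ?thesis using r Cons(2) by auto
    qed (use r Cons(2) in auto)
  qed
  thus ?case by blast
qed simp

lemma chi_keys':
  assumes "xs \<in> lists X" "zs \<in> Poly_Mapping.keys (chi xs)"
  shows "zs \<in> lists X" "zs = xs \<or> length zs < length xs"
proof -
  have "chi xs = (chi xs - monom_word 1 xs) + monom_word 1 xs" by simp
  hence "zs \<in> Poly_Mapping.keys (chi xs - monom_word 1 xs) \<union> Poly_Mapping.keys (monom_word (1 :: int poly) xs)"
    using keys_add assms(2) by (metis subsetD)
  hence "zs \<in> Poly_Mapping.keys (chi xs - monom_word 1 xs) \<or> zs = xs" by auto
  thus "zs \<in> lists X" "zs = xs \<or> length zs < length xs" using chi_keys[OF assms(1)] assms(1) by auto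
qed

lemma chi_in_free_algebra: "xs \<in> lists (gens n) \<Longrightarrow> chi xs \<in> carrier (free_algebra n)"
  unfolding free_algebra_simps using chi_keys'(1) by blast

text \<open>For \<open>c = delta - 2\<close> the quotient by this ideal is the specialisation
  \<delta> = 2.\<close>

lemma ideal_smult_image:
  assumes A: "zd_alg A"
  shows "ideal {c \<odot>\<^bsub>A\<^esub> x | x. x \<in> carrier A} A"
proof (rule idealI_zd[OF zd_algD(1)[OF A]])
  note a = zd_algD[OF A]
  interpret ring A by (rule a(1))
  have I: "c \<odot>\<^bsub>A\<^esub> x \<in> {c \<odot>\<^bsub>A\<^esub> x | x. x \<in> carrier A}" if "x \<in> carrier A" for x using that by blast
  show "{c \<odot>\<^bsub>A\<^esub> x | x. x \<in> carrier A} \<subseteq> carrier A" using a(2) by blast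
  show "\<zero>\<^bsub>A\<^esub> \<in> {c \<odot>\<^bsub>A\<^esub> x | x. x \<in> carrier A}" using I[OF zero_closed] unfolding smult_zero[OF A] .
  fix x assume "x \<in> {c \<odot>\<^bsub>A\<^esub> x | x. x \<in> carrier A}"
  then obtain u where u: "u \<in> carrier A" "x = c \<odot>\<^bsub>A\<^esub> u" by blast
  show "x \<oplus>\<^bsub>A\<^esub> y \<in> {c \<odot>\<^bsub>A\<^esub> x | x. x \<in> carrier A}" if y: "y \<in> {c \<odot>\<^bsub>A\<^esub> x | x. x \<in> carrier A}" for y
  proof -
    obtain v where v: "v \<in> carrier A" "y = c \<odot>\<^bsub>A\<^esub> v" using y by blast
    show ?thesis unfolding u(2) v(2) a(3)[OF u(1) v(1), symmetric] by (rule I[OF a_closed[OF u(1) v(1)]])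
  qed
  fix y assume y: "y \<in> carrier A"
  show "y \<otimes>\<^bsub>A\<^esub> x \<in> {c \<odot>\<^bsub>A\<^esub> x | x. x \<in> carrier A}"
    unfolding u(2) a(5)[OF y u(1), symmetric] by (rule I[OF m_closed[OF y u(1)]])
  show "x \<otimes>\<^bsub>A\<^esub> y \<in> {c \<odot>\<^bsub>A\<^esub> x | x. x \<in> carrier A}"
    unfolding u(2) a(4)[OF u(1) y, symmetric] by (rule I[OF m_closed[OF u(1) y]])
qed

text \<open>At \<open>\<delta> = 2\<close> the elements \<open>b\<^sub>s - 1\<close> satisfy the relations of the Coxeter group.\<close>

lemma chi_cox_eq:
  assumes n: "2 \<le> n" and c: "cox_eq n xs ys"
  shows "\<exists>h. word_value n (chi xs) - word_value n (chi ys) = scale (delta - 2) (word_value n h)"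
proof -
  let ?F = "free_algebra n" and ?A = "TL_hat n"
  define I where "I = {(delta - 2) \<odot>\<^bsub>?A\<^esub> x | x. x \<in> carrier ?A}"
  note A = TL_hat_quotient(1)[OF n]
  note h = TL_hat_map_hom[OF n]
  note hD = alg_homD[OF h]
  interpret F: ring ?F by (rule zd_algD(1)[OF free_algebra_zd_alg])
  interpret A: ring ?A by (rule zd_algD(1)[OF A])
  interpret I: ideal I ?A unfolding I_def by (rule ideal_smult_image[OF A])
  define q where "q f = I +>\<^bsub>?A\<^esub> TL_hat_map n f" for f
  have q_mult: "q (f \<otimes>\<^bsub>?F\<^esub> g) = q f \<otimes>\<^bsub>?A Quot I\<^esub> q g" if "f \<in> carrier ?F" "g \<in> carrier ?F" for f g
    unfolding q_def hD(4)[OF that] using ring_hom_mult[OF I.rcos_ring_hom hD(2)[OF that(1)] hD(2)[OF that(2)]] .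
  \<comment> \<open>Congruence modulo \<delta> - 2 is translated into a statement on values, where
    it can be tested coefficient by coefficient.\<close>
  have q_eq: "q f = q g \<longleftrightarrow> (\<exists>k\<in>carrier ?F. word_value n f - word_value n g = scale (delta - 2) (word_value n k))"
    if fg: "f \<in> carrier ?F" "g \<in> carrier ?F" for f g
  proof -
    have d: "f - g \<in> carrier ?F" by (rule minus_in_free_algebra[OF fg])
    have "q f = q g \<longleftrightarrow> TL_hat_map n f \<ominus>\<^bsub>?A\<^esub> TL_hat_map n g \<in> I"
      unfolding q_def using A.quotient_eq_iff_same_a_r_cos[OF I.ideal_axioms hD(2)[OF fg(1)] hD(2)[OF fg(2)]] by blast
    also have "\<dots> \<longleftrightarrow> TL_hat_map n (f - g) \<in> I"
      using alg_hom_minus[OF h F.ring_axioms A.ring_axioms fg] unfolding free_algebra_minus[OF fg] by simp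
    also have "\<dots> \<longleftrightarrow> (\<exists>k\<in>carrier ?F. TL_hat_map n (f - g) = (delta - 2) \<odot>\<^bsub>?A\<^esub> TL_hat_map n k)"
      unfolding I_def TL_hat_map_surj[OF n, symmetric] by blast
    also have "\<dots> \<longleftrightarrow> (\<exists>k\<in>carrier ?F. word_value n (f - g) = scale (delta - 2) (word_value n k))"
    proof (rule bex_cong[OF HOL.refl])
      fix k assume k: "k \<in> carrier ?F"
      have "TL_hat_map n (f - g) = (delta - 2) \<odot>\<^bsub>?A\<^esub> TL_hat_map n k \<longleftrightarrow> TL_hat_map n (f - g) = TL_hat_map n ((delta - 2) \<odot>\<^bsub>?F\<^esub> k)"
        unfolding hD(6)[OF k] ..
      also have "\<dots> \<longleftrightarrow> word_value n (f - g) = word_value n ((delta - 2) \<odot>\<^bsub>?F\<^esub> k)"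
        by (rule TL_hat_map_eq_iff[OF n d zd_algD(2)[OF free_algebra_zd_alg k]])
      also have "word_value n ((delta - 2) \<odot>\<^bsub>?F\<^esub> k) = scale (delta - 2) (word_value n k)"
        unfolding free_algebra_simps word_value_def lin_scale ..
      finally show "TL_hat_map n (f - g) = (delta - 2) \<odot>\<^bsub>?A\<^esub> TL_hat_map n k \<longleftrightarrow> word_value n (f - g) = scale (delta - 2) (word_value n k)" .
    qed
    finally show ?thesis unfolding word_value_def lin_minus .
  qed
  have q_eqI: "q (chi x) = q (chi y)"
    if "word_value n (chi x) - word_value n (chi y) = scale (delta - 2) (word_value n k)" "k \<in> carrier ?F"
      "x \<in> lists (gens n)" "y \<in> lists (gens n)" for x y k
    using q_eq[OF chi_in_free_algebra[OF that(3)] chi_in_free_algebra[OF that(4)]] that(1,2) by blast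
  let ?v = "\<lambda>w. diagram_value (word_diagram n w)"
  have expand: "word_value n (chi []) = ?v []" "word_value n (chi [s, t]) = ?v [s, t] - ?v [s] - (?v [t] - ?v [])"
    "word_value n (chi [s, t, s]) = ?v [s, t, s] - ?v [s, t] - (?v [s, s] - ?v [s]) - (?v [t, s] - ?v [t] - (?v [s] - ?v []))" for s t
    unfolding word_value_def by (simp_all only: chi.simps lin_minus lin_single scale_1)
  have "q (chi xs) = q (chi ys)"
    using c
  proof (rule cox_eq_invariant[where \<rho> = "\<lambda>w. q (chi w)", rotated -1])
    fix us x y vs assume l: "us \<in> lists (gens n)" "vs \<in> lists (gens n)" "x \<in> lists (gens n)" "y \<in> lists (gens n)"
      and eq: "q (chi x) = q (chi y)"
    note f = chi_in_free_algebra[OF l(1)] chi_in_free_algebra[OF l(2)] chi_in_free_algebra[OF l(3)] chi_in_free_algebra[OF l(4)]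
    show "q (chi (us @ x @ vs)) = q (chi (us @ y @ vs))"
      unfolding chi_append[of _ _ n] q_mult[OF f(1) F.m_closed[OF f(3,2)]] q_mult[OF f(1) F.m_closed[OF f(4,2)]]
        q_mult[OF f(3,2)] q_mult[OF f(4,2)] eq ..
  next
    fix s assume s: "s \<in> gens n"
    have "word_value n (chi [s, s]) - word_value n (chi []) = scale (delta - 2) (word_value n (monom_word 1 [s]))"
    proof -
      have "scale delta (?v [s]) - ?v [s] - (?v [s] - ?v []) - ?v [] = scale (delta - 2) (?v [s])"
        by (rule poly_mapping_eqI) (simp add: lookup_minus lookup_add algebra_simps)
      thus ?thesis unfolding expand value_square[OF n s] word_value_single scale_1 .
    qed
    thus "q (chi [s, s]) = q (chi [])"
      by (rule q_eqI) (use s in \<open>simp_all add: single_in_free_algebra\<close>)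
  next
    fix s t assume st: "s \<in> gens n" "t \<in> gens n" "s \<noteq> t" "\<not> connected_gens s t"
    have "word_value n (chi [s, t]) - word_value n (chi [t, s]) = scale (delta - 2) (word_value n 0)"
      unfolding expand value_commute[OF n st] by (simp add: word_value_def algebra_simps)
    thus "q (chi [s, t]) = q (chi [t, s])"
      by (rule q_eqI) (use F.zero_closed st in \<open>simp_all add: free_algebra_simps\<close>)
  next
    fix s t assume st: "s \<in> gens n" "t \<in> gens n" "connected_gens s t"
    have ts: "connected_gens t s" using st(3) connected_gens_sym by simp
    have "word_value n (chi [s, t, s]) - word_value n (chi [t, s, t]) = scale (delta - 2) (word_value n (monom_word 1 [t] - monom_word 1 [s]))"
    proof -
      have "?v [s] - ?v [s, t] - (scale delta (?v [s]) - ?v [s]) - (?v [t, s] - ?v [t] - (?v [s] - ?v [])) -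
          (?v [t] - ?v [t, s] - (scale delta (?v [t]) - ?v [t]) - (?v [s, t] - ?v [s] - (?v [t] - ?v []))) =
          scale (delta - 2) (?v [t] - ?v [s])"
        by (rule poly_mapping_eqI) (simp add: lookup_minus lookup_add algebra_simps)
      thus ?thesis
        unfolding expand value_square[OF n st(1)] value_square[OF n st(2)] value_braid[OF n st] value_braid[OF n st(2,1) ts]
        unfolding word_value_def lin_minus lin_single scale_1 .
    qed
    thus "q (chi [s, t, s]) = q (chi [t, s, t])"
      by (rule q_eqI) (use st in \<open>simp_all add: minus_in_free_algebra single_in_free_algebra\<close>)
  qed
  thus ?thesis using q_eq[OF chi_in_free_algebra chi_in_free_algebra] cox_eq_lists[OF c] by blast
qed

lemma key_reduces:
  assumes n: "2 \<le> n" and w: "w \<in> lists (gens n)" and D: "D \<in> Poly_Mapping.keys (diagram_value (word_diagram n w))"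
  obtains v where "good_word n v" "v = w \<or> length v < length w" "word_diagram n v = D"
proof -
  have "b_word n w \<noteq> \<zero>\<^bsub>TL_hat n\<^esub>"
  proof
    assume "b_word n w = \<zero>\<^bsub>TL_hat n\<^esub>"
    from word_value_zero[OF n single_in_free_algebra[OF w] this] have "diagram_value (word_diagram n w) = 0"
      unfolding word_value_single scale_1 .
    thus False using D by simp
  qed
  then obtain v k where v: "good_word n v" "v = w \<or> length v < length w" "b_word n w = (delta ^ k) \<odot>\<^bsub>TL_hat n\<^esub> b_word n v"
    using b_word_reduces[OF n w] by blast
  have "D = word_diagram n v" using D unfolding word_value_of_reduced[OF n w v(1,3)] by simp
  thus ?thesis using that v by blast
qed

text \<open>Modulo \<delta> - 2 the values of \<open>chi xs\<close> and \<open>chi ys\<close> agree.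
  The diagram of \<open>xs\<close> has coefficient 1 in the first, hence occurs in the second, where
  it can only come from a good word that is \<open>ys\<close> or shorter than \<open>ys\<close>; the
  bound on the lengths leaves \<open>ys\<close>.\<close>

lemma good_word_cox_eq:
  assumes n: "2 \<le> n" and good: "good_word n xs" and c: "cox_eq n xs ys" and len: "length ys \<le> length xs"
  shows "commutation\<^sup>*\<^sup>* xs ys"
proof -
  let ?D = "word_diagram n xs"
  have l: "xs \<in> lists (gens n)" "ys \<in> lists (gens n)" using cox_eq_lists[OF c] by blast+
  obtain h where h: "word_value n (chi xs) - word_value n (chi ys) = scale (delta - 2) (word_value n h)"
    using chi_cox_eq[OF n c] by blast
  have coeff: "Poly_Mapping.lookup (word_value n (chi xs)) ?D = 1"
  proof -
    \<comment> \<open>All good words with the diagram \<open>?D\<close> have the length of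
      \<open>xs\<close>, so the shorter terms of \<open>chi xs\<close> cannot produce it.\<close>
    have "?D \<notin> Poly_Mapping.keys (word_value n (chi xs - monom_word 1 xs))"
    proof
      assume "?D \<in> Poly_Mapping.keys (word_value n (chi xs - monom_word 1 xs))"
      then obtain zs where zs: "zs \<in> Poly_Mapping.keys (chi xs - monom_word 1 xs)"
        "?D \<in> Poly_Mapping.keys (diagram_value (word_diagram n zs))"
        unfolding word_value_def using in_keys_lin by (metis (no_types, lifting))
      have z: "zs \<in> lists (gens n)" "length zs < length xs" using subsetD[OF chi_keys[OF l(1)] zs(1)] by simp_all
      obtain v where v: "good_word n v" "v = zs \<or> length v < length zs" "word_diagram n v = ?D"
        by (rule key_reduces[OF n z(1) zs(2)])
      have "length v = length xs" using commutations_length[OF word_diagram_inj[OF n v(1) good v(3)]] by simp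
      thus False using v(2) z(2) by auto
    qed
    moreover have "word_value n (chi xs) = word_value n (chi xs - monom_word 1 xs) + Poly_Mapping.single ?D 1"
      unfolding word_value_def lin_minus lin_single scale_1 good_word_value[OF n good] by simp
    ultimately show ?thesis by (simp add: lookup_add in_keys_iff)
  qed
  have "?D \<in> Poly_Mapping.keys (word_value n (chi ys))"
  proof (rule ccontr)
    assume "\<not> ?thesis"
    hence "Poly_Mapping.lookup (word_value n (chi ys)) ?D = 0" by (simp add: in_keys_iff)
    hence "1 = (delta - 2) * Poly_Mapping.lookup (word_value n h) ?D"
      using arg_cong[OF h, of "\<lambda>f. Poly_Mapping.lookup f ?D"] coeff by (simp add: lookup_minus)
    \<comment> \<open>At \<delta> = 2 the right side vanishes while the left side is 1.\<close>
    hence "poly 1 2 = poly ((delta - 2) * Poly_Mapping.lookup (word_value n h) ?D) 2" by (rule arg_cong)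
    thus False by simp
  qed
  then obtain zs where zs: "zs \<in> Poly_Mapping.keys (chi ys)" "?D \<in> Poly_Mapping.keys (diagram_value (word_diagram n zs))"
    unfolding word_value_def using in_keys_lin by (metis (no_types, lifting))
  have z: "zs \<in> lists (gens n)" "zs = ys \<or> length zs < length ys" by (rule chi_keys'[OF l(2) zs(1)])+
  obtain v where v: "good_word n v" "v = zs \<or> length v < length zs" "word_diagram n v = ?D"
    by (rule key_reduces[OF n z(1) zs(2)])
  have vx: "commutation\<^sup>*\<^sup>* v xs" by (rule word_diagram_inj[OF n v(1) good v(3)])
  have "length v = length xs" using commutations_length[OF vx] by simp
  hence "v = ys" using v(2) z(2) len by auto
  thus ?thesis using commutations_sym[OF vx] by simp
qed

text \<open>By \<open>good_word_cox_eq\<close>, every reduced word of the class is obtained from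
  \<open>xs\<close> by commutations and is therefore good; in particular none of them has the factor
  \<open>[Bar1, Gen 1]\<close>.\<close>

lemma good_word_class:
  assumes n: "2 \<le> n" and good: "good_word n xs"
  shows "{ys. cox_eq n xs ys} \<in> FC n" "heap_type_II {ys. cox_eq n xs ys}" "reduced_expr {ys. cox_eq n xs ys} zs \<Longrightarrow> commutation\<^sup>*\<^sup>* xs zs"
proof -
  let ?w = "{ys. cox_eq n xs ys}"
  have xl: "xs \<in> lists (gens n)" by (rule good_wordD(1)[OF good])
  have com: "commutation\<^sup>*\<^sup>* xs zs" if r: "reduced_expr ?w zs" for zs
  proof (rule good_word_cox_eq[OF n good])
    show "cox_eq n xs zs" "length zs \<le> length xs" using r cox_eq.refl[OF xl] unfolding reduced_expr_def by blast+
  qed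
  show "?w \<in> FC n" unfolding FC_def
    using W_D_class[OF xl] com commutations_sym by (auto intro: rtranclp_trans)
  show "heap_type_II ?w"
  proof
    assume "heap_type_I ?w"
    then obtain zs where zs: "reduced_expr ?w zs" "sublist [Bar1, Gen 1] zs" unfolding heap_type_I_def by blast
    have "bad_factor zs" using zs(2) unfolding sublist_def bad_factor_def by blast
    thus False using good_wordD(2)[OF good com[OF zs(1)]] by blast
  qed
  show "reduced_expr ?w zs \<Longrightarrow> commutation\<^sup>*\<^sup>* xs zs" by (rule com)
qed

section \<open>The monomial basis and the isomorphism\<close>

lemma b_elem_eq:
  assumes w: "w \<in> W_D n"
  shows "b_elem n w = quotient_map (free_algebra n) (TL_relators n) (monom_word 1 (SOME xs. reduced_expr w xs))"
proof -
  note h = alg_homD[OF TL_quotient(2)[of n]]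
  have *: "foldr (\<lambda>s x. b_gen n s \<otimes>\<^bsub>TL n\<^esub> x) xs \<one>\<^bsub>TL n\<^esub> = quotient_map (free_algebra n) (TL_relators n) (monom_word 1 xs)"
    if "xs \<in> lists (gens n)" for xs
    using that
  proof (induction xs)
    case Nil
    show ?case using h(5) by (simp add: free_algebra_simps)
  next
    case (Cons s xs)
    have s: "[s] \<in> lists (gens n)" using Cons(1) by simp
    show ?case using h(4)[OF single_in_free_algebra[OF s, of 1] single_in_free_algebra[OF Cons(2), of 1]] Cons(3)
      unfolding mult_single_free_algebra b_gen_def by simp
  qed
  have "reduced_expr w (SOME xs. reduced_expr w xs)" by (rule someI_ex[OF reduced_expr_exists[OF w]])
  hence "(SOME xs. reduced_expr w xs) \<in> lists (gens n)" using W_D_cases(1)[OF w] unfolding reduced_expr_def by blast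
  thus ?thesis unfolding b_elem_def by (rule *)
qed

lemma b_hat_elem_eq: "w \<in> W_D n \<Longrightarrow> b_hat_elem n w = b_word n (SOME xs. reduced_expr w xs)"
  unfolding b_hat_elem_def b_elem_eq TL_hat_map_def ..

lemma monomial_basis_II_eq:
  assumes n: "2 \<le> n"
  shows "monomial_basis_II n = b_word n ` {v. good_word n v}"
proof (rule equalityI; rule subsetI)
  fix x assume "x \<in> monomial_basis_II n"
  then obtain w where w: "x = b_hat_elem n w" "w \<in> FC n" "heap_type_II w" unfolding monomial_basis_II_def by blast
  have W: "w \<in> W_D n" using w(2) by (simp add: FC_def)
  have "reduced_expr w (SOME xs. reduced_expr w xs)" by (rule someI_ex[OF reduced_expr_exists[OF W]])
  from reduced_FC_good[OF w(2,3) this] show "x \<in> b_word n ` {v. good_word n v}"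
    unfolding w(1) b_hat_elem_eq[OF W] by blast
next
  fix x assume "x \<in> b_word n ` {v. good_word n v}"
  then obtain v where v: "x = b_word n v" "good_word n v" by blast
  let ?w = "{ys. cox_eq n v ys}"
  note c = good_word_class[OF n v(2)]
  have W: "?w \<in> W_D n" using c(1) by (simp add: FC_def)
  have "commutation\<^sup>*\<^sup>* v (SOME xs. reduced_expr ?w xs)" by (rule c(3)[OF someI_ex[OF reduced_expr_exists[OF W]]])
  hence "x = b_hat_elem n ?w" unfolding v(1) b_hat_elem_eq[OF W] by (rule b_word_commutations[OF n good_wordD(1)[OF v(2)]])
  thus "x \<in> monomial_basis_II n" unfolding monomial_basis_II_def using c(1,2) by blast
qed

text \<open>An admissible diagram is, as a unit vector, the value of some word, and reducing that
  word leads to a good word with this diagram.\<close>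

lemma word_diagram_good_words:
  assumes n: "2 \<le> n"
  shows "word_diagram n ` {v. good_word n v} = admissible_II n"
proof (rule equalityI; rule subsetI)
  fix d assume "d \<in> word_diagram n ` {v. good_word n v}"
  thus "d \<in> admissible_II n" using good_word_admissible[OF n] by blast
next
  fix d assume "d \<in> admissible_II n"
  then obtain w where w: "w \<in> lists (gens n)" "diagram_value (word_diagram n w) = Poly_Mapping.single d 1"
    by (rule admissible_word[OF n])
  have "d \<in> Poly_Mapping.keys (diagram_value (word_diagram n w))" unfolding w(2) by simp
  then obtain v where "good_word n v" "word_diagram n v = d" by (rule key_reduces[OF n w(1)])
  thus "d \<in> word_diagram n ` {v. good_word n v}" by blast
qed

text \<open>This yields the uniqueness of the homomorphism in the theorem, after pulling back along
  the surjection \<open>TL_hat_map n\<close>.\<close>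

lemma free_algebra_hom_eqI:
  assumes C: "ring C" and g: "g \<in> alg_hom (free_algebra n) C" and h: "h \<in> alg_hom (free_algebra n) C"
    and eq: "\<And>s. s \<in> gens n \<Longrightarrow> g (monom_word 1 [s]) = h (monom_word 1 [s])" and f: "f \<in> carrier (free_algebra n)"
  shows "g f = h f"
proof -
  note gD = alg_homD[OF g] and hD = alg_homD[OF h]
  interpret F: ring "free_algebra n" by (rule zd_algD(1)[OF free_algebra_zd_alg])
  have word: "g (monom_word 1 w) = h (monom_word 1 w)" if "w \<in> lists (gens n)" for w
    using that
  proof (induction w)
    case Nil
    show ?case using gD(5) hD(5) by (simp add: free_algebra_simps)
  next
    case (Cons s w)
    have s: "[s] \<in> lists (gens n)" using Cons(1) by simp
    note m = single_in_free_algebra[OF s, of 1] single_in_free_algebra[OF Cons(2), of 1]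
    show ?case using gD(4)[OF m] hD(4)[OF m] eq[OF Cons(1)] Cons(3) unfolding mult_single_free_algebra by simp
  qed
  have "Poly_Mapping.keys f \<subseteq> lists (gens n)" using f by (simp add: free_algebra_simps)
  thus ?thesis
  proof (induction f rule: poly_mapping_induct_single)
    case zero
    show ?case using alg_hom_zero[OF g F.ring_axioms C] alg_hom_zero[OF h F.ring_axioms C] by (simp add: free_algebra_simps)
  next
    case (single w c)
    have "monom_word c w = c \<odot>\<^bsub>free_algebra n\<^esub> monom_word 1 w" by (simp add: free_algebra_simps)
    thus ?case using gD(6)[OF single_in_free_algebra[OF single]] hD(6)[OF single_in_free_algebra[OF single]] word[OF single] by simp
  next
    case (add f f')
    have c: "f \<in> carrier (free_algebra n)" "f' \<in> carrier (free_algebra n)" using add(1,2) by (simp_all add: free_algebra_simps)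
    show ?case using gD(3)[OF c] hD(3)[OF c] add(3,4) by (simp add: free_algebra_simps)
  qed
qed

theorem theorem3p2p8:
  fixes n :: nat
  assumes "n \<ge> 4"
  shows "\<exists>\<phi>. \<phi> \<in> alg_hom (TL_hat n) (DTL_hat n) \<and>
             (\<forall>s\<in>gens n. \<phi> (b_hat n s) = d_hat n s) \<and>
             (\<forall>\<psi>\<in>alg_hom (TL_hat n) (DTL_hat n).
                (\<forall>s\<in>gens n. \<psi> (b_hat n s) = d_hat n s) \<longrightarrow>
                (\<forall>x\<in>carrier (TL_hat n). \<psi> x = \<phi> x)) \<and>
             \<phi> \<in> alg_iso (TL_hat n) (DTL_hat n) \<and>
             is_basis (TL_hat n) (monomial_basis_II n) \<and>
             bij_betw \<phi> (monomial_basis_II n) (diag_hat n ` admissible_II n)"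
proof -
  have n: "2 \<le> n" using assms by simp
  obtain \<phi> where iso: "\<phi> \<in> alg_iso (TL_hat n) (DTL_hat n)"
    and \<phi>: "\<And>f. f \<in> carrier (free_algebra n) \<Longrightarrow> \<phi> (TL_hat_map n f) = DTL_hat_map n f"
    using alg_iso_of_equal_kernels[OF free_algebra_zd_alg TL_hat_quotient(1)[OF n] DTL_hat_quotient(1)[OF n]
      TL_hat_map_hom[OF n] TL_hat_map_surj[OF n] DTL_hat_map_hom[OF n] DTL_hat_map_surj[OF n]
      TL_hat_map_zero_iff_DTL_hat_map[OF n]] by blast
  have hom: "\<phi> \<in> alg_hom (TL_hat n) (DTL_hat n)" and bij: "bij_betw \<phi> (carrier (TL_hat n)) (carrier (DTL_hat n))"
    using iso unfolding alg_iso_def by blast+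
  have letter: "\<phi> (b_hat n s) = d_hat n s" if s: "s \<in> gens n" for s
  proof -
    have "b_hat n s = b_word n [s]" unfolding b_hat_def b_gen_def TL_hat_map_def ..
    moreover have "[s] \<in> lists (gens n)" using s by simp
    ultimately have "\<phi> (b_hat n s) = DTL_hat_map n (monom_word 1 [s])" using \<phi>[OF single_in_free_algebra] by simp
    thus ?thesis unfolding DTL_hat_map_word word_diagram_letter[OF n s] d_hat_def .
  qed
  have unique: "\<psi> x = \<phi> x"
    if \<psi>: "\<psi> \<in> alg_hom (TL_hat n) (DTL_hat n)" "\<forall>s\<in>gens n. \<psi> (b_hat n s) = d_hat n s" and x: "x \<in> carrier (TL_hat n)" for \<psi> x
  proof -
    obtain f where f: "f \<in> carrier (free_algebra n)" "x = TL_hat_map n f" using x unfolding TL_hat_map_surj[OF n, symmetric] by blast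
    have "\<psi> (TL_hat_map n f) = \<phi> (TL_hat_map n f)"
    proof (rule free_algebra_hom_eqI[OF zd_algD(1)[OF DTL_hat_quotient(1)[OF n]]
          alg_hom_comp[OF TL_hat_map_hom[OF n] \<psi>(1)] alg_hom_comp[OF TL_hat_map_hom[OF n] hom] _ f(1)])
      fix s assume s: "s \<in> gens n"
      have "b_hat n s = b_word n [s]" unfolding b_hat_def b_gen_def TL_hat_map_def ..
      thus "\<psi> (b_word n [s]) = \<phi> (b_word n [s])" using \<psi>(2) letter s by metis
    qed
    thus ?thesis unfolding f(2) .
  qed
  have basis: "is_basis (TL_hat n) (monomial_basis_II n)"
    unfolding monomial_basis_II_eq[OF n] by (rule TL_hat_basis[OF n])
  have "\<phi> ` monomial_basis_II n = diag_hat n ` admissible_II n"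
  proof -
    have "\<phi> ` monomial_basis_II n = (\<lambda>v. diag_hat n (word_diagram n v)) ` {v. good_word n v}"
      unfolding monomial_basis_II_eq[OF n] image_image
    proof (rule image_cong[OF HOL.refl])
      fix v assume "v \<in> {v. good_word n v}"
      hence "v \<in> lists (gens n)" using good_wordD(1) by blast
      thus "\<phi> (b_word n v) = diag_hat n (word_diagram n v)" using \<phi>[OF single_in_free_algebra[of v n 1]] unfolding DTL_hat_map_word by blast
    qed
    thus ?thesis unfolding word_diagram_good_words[OF n, symmetric] image_image .
  qed
  moreover have "inj_on \<phi> (monomial_basis_II n)"
  proof (rule inj_on_subset)
    show "inj_on \<phi> (carrier (TL_hat n))" using bij by (rule bij_betw_imp_inj_on)
    show "monomial_basis_II n \<subseteq> carrier (TL_hat n)" using basis unfolding is_basis_def by blast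
  qed
  ultimately have "bij_betw \<phi> (monomial_basis_II n) (diag_hat n ` admissible_II n)" unfolding bij_betw_def by blast
  thus ?thesis using hom letter unique iso basis by blast
qed

end
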